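(* Let the data satisfy $u^0\in D(A^2)$, $v^0\in D(A^{3/2})$, $f(0)\in D(A)$, $f_t(0)\in D(A^{1/2})$, $f_{tt}(0)\in L^2(\Omega)$, $f,f_t,f_{tt},f_{ttt}\in L^2(0,T;L^2(\Omega))$, so that the weak solution $u$ of the biharmonic wave problem has $u,u_t,u_{tt}\in L^\infty(0,T;H^{2+\gamma_0}(\Omega))$ and $u_{tt},u_{ttt},u_{tttt}\in L^\infty(0,T;L^2(\Omega))$. Let $u_h:[0,T]\to V_h$ solve the semidiscrete problem $$(u_{htt},v_h)+a_h(u_h,v_h)=(f,v_h)\ \text{ for all }v_h\in V_h,\qquad u_h(0)=\mathcal R_hu^0,\quad u_{ht}(0)=\mathcal R_hv^0 .$$ Then there is a constant $C>0$, depending on $\alpha,\beta,T,C_1,C_2$ but independent of the mesh-size $h$, such that for every $t\in(0,T]$ $$\|u(t)-u_h(t)\|\le C\,h^{2\gamma_0}L_{(f,u)},$$ where $$L_{(f,u)}=\|f\|_{L^\infty(L^2)}+\|f_t\|_{L^2(L^2)}+\|u\|_{L^\infty(H^{2+\gamma_0})}+\|u_t\|_{L^\infty(H^{2+\gamma_0})}+\|u_{tt}\|_{L^\infty(L^2)}+\|u_{tt}\|_{L^2(H^{2+\gamma_0})}+\|u_{ttt}\|_{L^2(L^2)} .$$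
   Context: $\Omega\subset\mathbb R^2$ is a bounded polygonal Lipschitz domain, $T>0$; $(\cdot,\cdot)$ and $\|\cdot\|$ are the $L^2(\Omega)$ inner product and norm; $a(w,v)=\int_\Omega D^2w:D^2v\,dx$; $L^p(X)$ abbreviates $L^p(0,T;X)$ with $X=L^2(\Omega)$ or $H^{2+\gamma_0}(\Omega)$. The weak solution $u\in C^0([0,T];H^2_0(\Omega))\cap C^1([0,T];L^2(\Omega))$ satisfies $(u_{tt},v)+a(u,v)=(f,v)$ for all $v\in H^2_0(\Omega)$, $u(0)=u^0$, $u_t(0)=v^0$. $A\psi=\Delta^2\psi$ with $D(A)=\{\psi\in H^2_0(\Omega):\Delta^2\psi\in L^2(\Omega)\}$, and $D(A^r)=\{w\in L^2(\Omega):\sum_n\lambda_n^{2r}|(w,\psi_n)|^2<\infty\}$, where $(\lambda_n,\psi_n)$ are the eigenpairs of $A$, with $\{\psi_n\}$ an orthonormal basis of $L^2(\Omega)$. $\gamma_0\in(1/2,1]$ is the elliptic regularity index of the clamped biharmonic operator; $D(A)\subset H^{2+\gamma_0}(\Omega)$ continuously. Mesh: $\mathcal T$ is a shape-regular triangulation of $\overline\Omega$ with mesh-size $h=\max_{K\in\mathcal T}\mathrm{diam}(K)$, edges $\mathcal E$, vertices $\mathcal V$; $\mathcal V(e)$ is the set of endpoints of edge $e$ and $h_e$ its length; $[\![\cdot]\!]$ is the jump across an interior edge and the trace on a boundary edge; $\{\!\{\cdot\}\!\}$ is the average across an interior edge; $H^m(\mathcal T)$ is the space of piecewise $H^m$ functions;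 $P_r(\mathcal T)$ is the space of piecewise polynomials of degree at most $r$. Discrete space and form: $\mathrm M(\mathcal T)\subset P_2(\mathcal T)$ is the Morley space: piecewise quadratics continuous at interior vertices, with normal derivatives continuous at midpoints of interior edges, vanishing at boundary vertices and with normal derivatives vanishing at midpoints of boundary edges. $V_h\subset H^2(\mathcal T)$ is a finite-dimensional subspace; on $H^2_0(\Omega)+V_h$ one uses $$\|v\|_h^2=\sum_{K\in\mathcal T}|v|_{H^2(K)}^2+\sum_{e\in\mathcal E}\sum_{z\in\mathcal V(e)}h_e^{-2}\big|[\![v]\!](z)\big|^2+\sum_{e\in\mathcal E}\Big|\frac1{h_e}\int_e\Big[\!\Big[\frac{\partial v}{\partial n}\Big]\!\Big]ds\Big|^2 ,$$ and $a_h$ is a symmetric bilinear form on $V_h+\mathrm M(\mathcal T)$ such that, for all $w_h,v_h\in V_h$, $\alpha\|w_h\|_h^2\le a_h(w_h,w_h)$ and $a_h(w_h,v_h)\le\beta\|w_h\|_h\|v_h\|_h$ with constants $\alpha,\beta>0$ independent of $h$. (The Morley, quadratic discontinuous Galerkin and quadratic $C^0$ interior penalty methods are instances.) Smoother: $I_{\mathrm M}:H^2(\mathcal T)\to\mathrm M(\mathcal T)$ is the extended Morley interpolation: at each interior vertex $z$, $(I_{\mathrm M}v)(z)$ is the average of the values $(v|_K)(z)$ over the triangles $K$ containing $z$, and on each interior edge $\int_e\partial_n(I_{\mathrm M}v)\,ds=\int_e\{\!\{\partial_nv\}\!\}\,ds$ (boundary degrees of freedom vanish). $J:\mathrm M(\mathcal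 T)\to H^2_0(\Omega)$ is a fixed linear companion operator, with values in the sum of the Hsieh–Clough–Tocher space and $P_8(\mathcal T)$, such that for $w\in\mathrm M(\mathcal T)$: $Jw=w$ at all vertices, $\nabla(Jw)(z)$ is the average of $(\nabla w|_K)(z)$ over the triangles $K$ containing $z$ at every interior vertex $z$, and $\int_e\partial_n(Jw)\,ds=\int_e\partial_nw\,ds$ for every edge $e$. $Q:=J I_{\mathrm M}:V_h\to H^2_0(\Omega)$ satisfies, with $C_1>0$ independent of $h$, $$\|v_h-Qv_h\|_{H^s(\mathcal T)}\le C_1h^{2-s}\min_{v\in H^2_0(\Omega)}\|v-v_h\|_h,\qquad v_h\in V_h,\ 0\le s\le2 .$$ Modified Ritz projection $\mathcal R_h:H^2_0(\Omega)\to V_h$: $a_h(\mathcal R_hw,v_h)=a(w,Qv_h)$ for all $v_h\in V_h$. It satisfies, with $C_2>0$ independent of $h$, $\|v-\mathcal R_hv\|+h^{\gamma_0}\|v-\mathcal R_hv\|_h\le C_2h^{2\gamma_0}\|v\|_{H^{2+\gamma_0}(\Omega)}$ for all $v\in H^2_0(\Omega)\cap H^{2+\gamma_0}(\Omega)$. *)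

theory Defs
  imports "HOL-Analysis.Analysis"
begin

section \<open>Lebesgue and Sobolev spaces\<close>

text \<open>
  Elements of function spaces are represented by functions on the whole space; only their values
  on the set in question matter, and only up to null sets. All notions below are invariant under
  modification on null sets.
\<close>

definition ae_eq :: "'a::euclidean_space set \<Rightarrow> ('a \<Rightarrow> real) \<Rightarrow> ('a \<Rightarrow> real) \<Rightarrow> bool" where
  "ae_eq U v w \<longleftrightarrow> (AE x in lebesgue_on U. v x = w x)"

definition L2_space :: "'a::euclidean_space set \<Rightarrow> ('a \<Rightarrow> real) set" where
  "L2_space U = {v. v \<in> borel_measurable (lebesgue_on U) \<and> integrable (lebesgue_on U) (\<lambda>x. (v x)\<^sup>2)}"

definition L2_inner :: "'a::euclidean_space set \<Rightarrow> ('a \<Rightarrow> real) \<Rightarrow> ('a \<Rightarrow> real) \<Rightarrow> real" where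
  "L2_inner U v w = (LINT x|lebesgue_on U. v x * w x)"

definition L2_norm :: "'a::euclidean_space set \<Rightarrow> ('a \<Rightarrow> real) \<Rightarrow> real" where
  "L2_norm U v = sqrt (L2_inner U v v)"

definition partial_deriv :: "'a::euclidean_space \<Rightarrow> ('a \<Rightarrow> real) \<Rightarrow> 'a \<Rightarrow> real" where
  "partial_deriv b \<phi> = (\<lambda>x. frechet_derivative \<phi> (at x) b)"

definition multi_deriv :: "'a::euclidean_space list \<Rightarrow> ('a \<Rightarrow> real) \<Rightarrow> 'a \<Rightarrow> real" where
  "multi_deriv bs \<phi> = foldr partial_deriv bs \<phi>"

definition smooth_fun :: "('a::euclidean_space \<Rightarrow> real) \<Rightarrow> bool" where
  "smooth_fun \<phi> \<longleftrightarrow> (\<forall>bs. set bs \<subseteq> Basis \<longrightarrow> multi_deriv bs \<phi> differentiable_on UNIV)"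

definition test_funs :: "'a::euclidean_space set \<Rightarrow> ('a \<Rightarrow> real) set" where
  "test_funs U = {\<phi>. smooth_fun \<phi> \<and> compact (closure {x. \<phi> x \<noteq> 0}) \<and> closure {x. \<phi> x \<noteq> 0} \<subseteq> U}"

definition has_weak_deriv ::
  "'a::euclidean_space set \<Rightarrow> 'a list \<Rightarrow> ('a \<Rightarrow> real) \<Rightarrow> ('a \<Rightarrow> real) \<Rightarrow> bool" where
  "has_weak_deriv U bs v g \<longleftrightarrow>
     (\<forall>\<phi>\<in>test_funs U. L2_inner U v (multi_deriv bs \<phi>) = (- 1) ^ length bs * L2_inner U g \<phi>)"

definition weak_deriv :: "'a::euclidean_space set \<Rightarrow> 'a list \<Rightarrow> ('a \<Rightarrow> real) \<Rightarrow> 'a \<Rightarrow> real" where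
  "weak_deriv U bs v = (SOME g. g \<in> L2_space U \<and> has_weak_deriv U bs v g)"

text \<open>Lists of basis vectors of length \<open>k\<close> index the entries of the full derivative tensor of order \<open>k\<close>.\<close>

definition deriv_idx :: "nat \<Rightarrow> 'a::euclidean_space list set" where
  "deriv_idx k = {bs. set bs \<subseteq> Basis \<and> length bs = k}"

definition gagliardo :: "'a::euclidean_space set \<Rightarrow> real \<Rightarrow> ('a \<Rightarrow> real) \<Rightarrow> ennreal" where
  "gagliardo U \<sigma> g =
     (\<integral>\<^sup>+x. (\<integral>\<^sup>+y. ennreal ((g x - g y)\<^sup>2 / norm (x - y) powr (real DIM('a) + 2 * \<sigma>))
        \<partial>lebesgue_on U) \<partial>lebesgue_on U)"

definition sobolev_space :: "'a::euclidean_space set \<Rightarrow> real \<Rightarrow> ('a \<Rightarrow> real) set" where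
  "sobolev_space U s = {v. v \<in> L2_space U \<and>
     (\<forall>k\<le>nat \<lfloor>s\<rfloor>. \<forall>bs\<in>deriv_idx k. \<exists>g\<in>L2_space U. has_weak_deriv U bs v g) \<and>
     (frac s > 0 \<longrightarrow>
        (\<forall>bs\<in>deriv_idx (nat \<lfloor>s\<rfloor>). gagliardo U (frac s) (weak_deriv U bs v) < \<infinity>))}"

text \<open>
  Sobolev--Slobodeckij norm of order \<open>s \<ge> 0\<close>. The factor \<open>1 - frac s\<close> only changes the norm to an
  equivalent one for each fixed \<open>s\<close>. It compensates the blow-up of the double integral as \<open>s\<close>
  increases to an integer, so that estimates can hold with one constant for a whole range of \<open>s\<close>.
\<close>

definition sobolev_norm :: "'a::euclidean_space set \<Rightarrow> real \<Rightarrow> ('a \<Rightarrow> real) \<Rightarrow> real" where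
  "sobolev_norm U s v = sqrt (
     (\<Sum>k\<le>nat \<lfloor>s\<rfloor>. \<Sum>bs\<in>deriv_idx k. (L2_norm U (weak_deriv U bs v))\<^sup>2) +
     (if frac s = 0 then 0
      else (1 - frac s) *
        (\<Sum>bs\<in>deriv_idx (nat \<lfloor>s\<rfloor>). enn2real (gagliardo U (frac s) (weak_deriv U bs v)))))"

definition sobolev_seminorm2 :: "'a::euclidean_space set \<Rightarrow> ('a \<Rightarrow> real) \<Rightarrow> real" where
  "sobolev_seminorm2 U v = sqrt (\<Sum>bs\<in>deriv_idx 2. (L2_norm U (weak_deriv U bs v))\<^sup>2)"

definition H20 :: "'a::euclidean_space set \<Rightarrow> ('a \<Rightarrow> real) set" where
  "H20 U = {v \<in> sobolev_space U 2.
     \<exists>\<phi>. (\<forall>n::nat. \<phi> n \<in> test_funs U) \<and> (\<lambda>n. sobolev_norm U 2 (\<lambda>x. v x - \<phi> n x)) \<longlonglongrightarrow> 0}"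

definition plate_form :: "'a::euclidean_space set \<Rightarrow> ('a \<Rightarrow> real) \<Rightarrow> ('a \<Rightarrow> real) \<Rightarrow> real" where
  "plate_form U w v = (\<Sum>bs\<in>deriv_idx 2. L2_inner U (weak_deriv U bs w) (weak_deriv U bs v))"


section \<open>The domain and the clamped biharmonic operator\<close>

type_synonym plane = "real^2"

definition lipschitz_boundary :: "plane set \<Rightarrow> bool" where
  "lipschitz_boundary \<Omega> \<longleftrightarrow>
     (\<forall>p\<in>frontier \<Omega>. \<exists>r>0. \<exists>L g d e. norm d = 1 \<and> norm e = 1 \<and> d \<bullet> e = 0 \<and>
        L-lipschitz_on UNIV g \<and>
        (\<forall>x\<in>ball p r. x \<in> \<Omega> \<longleftrightarrow> (g :: real \<Rightarrow> real) ((x - p) \<bullet> d) < (x - p) \<bullet> e))"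

definition polygonal_lipschitz_domain :: "plane set \<Rightarrow> bool" where
  "polygonal_lipschitz_domain \<Omega> \<longleftrightarrow>
     open \<Omega> \<and> connected \<Omega> \<and> bounded \<Omega> \<and> \<Omega> \<noteq> {} \<and> lipschitz_boundary \<Omega> \<and>
     (\<exists>S. finite S \<and> frontier \<Omega> = (\<Union>(a, b)\<in>S. closed_segment a b))"

definition laplacian :: "('a::euclidean_space \<Rightarrow> real) \<Rightarrow> 'a \<Rightarrow> real" where
  "laplacian \<phi> x = (\<Sum>b\<in>Basis. multi_deriv [b, b] \<phi> x)"

definition has_weak_bilaplacian ::
  "'a::euclidean_space set \<Rightarrow> ('a \<Rightarrow> real) \<Rightarrow> ('a \<Rightarrow> real) \<Rightarrow> bool" where
  "has_weak_bilaplacian U w g \<longleftrightarrow>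
     (\<forall>\<phi>\<in>test_funs U. L2_inner U w (laplacian (laplacian \<phi>)) = L2_inner U g \<phi>)"

definition dom_A :: "plane set \<Rightarrow> (plane \<Rightarrow> real) set" where
  "dom_A \<Omega> = {w \<in> H20 \<Omega>. \<exists>g\<in>L2_space \<Omega>. has_weak_bilaplacian \<Omega> w g}"

definition op_A :: "plane set \<Rightarrow> (plane \<Rightarrow> real) \<Rightarrow> plane \<Rightarrow> real" where
  "op_A \<Omega> w = (SOME g. g \<in> L2_space \<Omega> \<and> has_weak_bilaplacian \<Omega> w g)"

definition elliptic_regularity :: "plane set \<Rightarrow> real \<Rightarrow> bool" where
  "elliptic_regularity \<Omega> \<gamma> \<longleftrightarrow> dom_A \<Omega> \<subseteq> sobolev_space \<Omega> (2 + \<gamma>) \<and>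
     (\<exists>c. \<forall>w\<in>dom_A \<Omega>. sobolev_norm \<Omega> (2 + \<gamma>) w \<le> c * (L2_norm \<Omega> w + L2_norm \<Omega> (op_A \<Omega> w)))"

definition eigenbasis_A :: "plane set \<Rightarrow> (nat \<Rightarrow> real) \<Rightarrow> (nat \<Rightarrow> plane \<Rightarrow> real) \<Rightarrow> bool" where
  "eigenbasis_A \<Omega> ev \<psi> \<longleftrightarrow>
     (\<forall>n. \<psi> n \<in> dom_A \<Omega> \<and> ae_eq \<Omega> (op_A \<Omega> (\<psi> n)) (\<lambda>x. ev n * \<psi> n x)) \<and>
     (\<forall>m n. L2_inner \<Omega> (\<psi> m) (\<psi> n) = (if m = n then 1 else 0)) \<and>
     (\<forall>w\<in>L2_space \<Omega>.
        (\<lambda>N. L2_norm \<Omega> (\<lambda>x. w x - (\<Sum>n<N. L2_inner \<Omega> w (\<psi> n) * \<psi> n x))) \<longlonglongrightarrow> 0)"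

definition dom_A_pow ::
  "plane set \<Rightarrow> (nat \<Rightarrow> real) \<Rightarrow> (nat \<Rightarrow> plane \<Rightarrow> real) \<Rightarrow> real \<Rightarrow> (plane \<Rightarrow> real) set" where
  "dom_A_pow \<Omega> ev \<psi> r =
     {w \<in> L2_space \<Omega>. summable (\<lambda>n. ev n powr (2 * r) * \<bar>L2_inner \<Omega> w (\<psi> n)\<bar>\<^sup>2)}"


section \<open>Functions of time with values in a function space\<close>

text \<open>A function space is passed as a carrier \<open>X\<close> together with its norm \<open>N\<close>.\<close>

definition bochner_measurable ::
  "(plane \<Rightarrow> real) set \<Rightarrow> ((plane \<Rightarrow> real) \<Rightarrow> real) \<Rightarrow> real \<Rightarrow> (real \<Rightarrow> plane \<Rightarrow> real) \<Rightarrow> bool" where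
  "bochner_measurable X N T w \<longleftrightarrow>
     (\<exists>s :: nat \<Rightarrow> real \<Rightarrow> plane \<Rightarrow> real.
        (\<forall>n. finite (s n ` {0<..<T}) \<and> s n ` {0<..<T} \<subseteq> X \<and>
             (\<forall>y. {t \<in> {0<..<T}. s n t = y} \<in> sets lebesgue)) \<and>
        (AE t in lebesgue_on {0<..<T}. w t \<in> X \<and> (\<lambda>n. N (\<lambda>x. s n t x - w t x)) \<longlonglongrightarrow> 0))"

definition time_L2 ::
  "(plane \<Rightarrow> real) set \<Rightarrow> ((plane \<Rightarrow> real) \<Rightarrow> real) \<Rightarrow> real \<Rightarrow> (real \<Rightarrow> plane \<Rightarrow> real) set" where
  "time_L2 X N T = {w. bochner_measurable X N T w \<and>
     (\<integral>\<^sup>+t. ennreal ((N (w t))\<^sup>2) \<partial>lebesgue_on {0<..<T}) < \<infinity>}"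

definition time_L2_norm ::
  "((plane \<Rightarrow> real) \<Rightarrow> real) \<Rightarrow> real \<Rightarrow> (real \<Rightarrow> plane \<Rightarrow> real) \<Rightarrow> real" where
  "time_L2_norm N T w = sqrt (enn2real (\<integral>\<^sup>+t. ennreal ((N (w t))\<^sup>2) \<partial>lebesgue_on {0<..<T}))"

definition time_Linf ::
  "(plane \<Rightarrow> real) set \<Rightarrow> ((plane \<Rightarrow> real) \<Rightarrow> real) \<Rightarrow> real \<Rightarrow> (real \<Rightarrow> plane \<Rightarrow> real) set" where
  "time_Linf X N T = {w. bochner_measurable X N T w \<and>
     (\<exists>c. AE t in lebesgue_on {0<..<T}. N (w t) \<le> c)}"

definition time_Linf_norm ::
  "((plane \<Rightarrow> real) \<Rightarrow> real) \<Rightarrow> real \<Rightarrow> (real \<Rightarrow> plane \<Rightarrow> real) \<Rightarrow> real" where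
  "time_Linf_norm N T w = Inf {c. 0 \<le> c \<and> (AE t in lebesgue_on {0<..<T}. N (w t) \<le> c)}"

definition time_C0 ::
  "(plane \<Rightarrow> real) set \<Rightarrow> ((plane \<Rightarrow> real) \<Rightarrow> real) \<Rightarrow> real \<Rightarrow> (real \<Rightarrow> plane \<Rightarrow> real) set" where
  "time_C0 X N T = {w. \<forall>t\<in>{0..T}. w t \<in> X \<and>
     ((\<lambda>s. N (\<lambda>x. w s x - w t x)) \<longlongrightarrow> 0) (at t within {0..T})}"

definition has_time_deriv ::
  "plane set \<Rightarrow> real \<Rightarrow> (real \<Rightarrow> plane \<Rightarrow> real) \<Rightarrow> (real \<Rightarrow> plane \<Rightarrow> real) \<Rightarrow> bool" where
  "has_time_deriv \<Omega> T w w' \<longleftrightarrow> (\<forall>t\<in>{0..T}.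
     ((\<lambda>s. L2_norm \<Omega> (\<lambda>x. (w s x - w t x) / (s - t) - w' t x)) \<longlongrightarrow> 0) (at t within {0..T}))"

text \<open>
  Distributional derivative on \<open>(0,T)\<close> of a scalar function, and of an \<open>L\<^sup>2(\<Omega>)\<close>-valued one; the
  latter tests the identity between \<open>L\<^sup>2(\<Omega>)\<close>-valued integrals against the elements of \<open>L\<^sup>2(\<Omega>)\<close>.
\<close>

definition has_scalar_weak_time_deriv :: "real \<Rightarrow> (real \<Rightarrow> real) \<Rightarrow> (real \<Rightarrow> real) \<Rightarrow> bool" where
  "has_scalar_weak_time_deriv T g g' \<longleftrightarrow>
     integrable (lebesgue_on {0<..<T}) g \<and> integrable (lebesgue_on {0<..<T}) g' \<and>
     has_weak_deriv {0<..<T} [1] g g'"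

definition has_weak_time_deriv ::
  "plane set \<Rightarrow> real \<Rightarrow> (real \<Rightarrow> plane \<Rightarrow> real) \<Rightarrow> (real \<Rightarrow> plane \<Rightarrow> real) \<Rightarrow> bool" where
  "has_weak_time_deriv \<Omega> T w w' \<longleftrightarrow> (\<forall>v\<in>L2_space \<Omega>.
     has_scalar_weak_time_deriv T (\<lambda>t. L2_inner \<Omega> (w t) v) (\<lambda>t. L2_inner \<Omega> (w' t) v))"

text \<open>For a solution of this low regularity \<open>(u\<^sub>t\<^sub>t, v)\<close> is the weak derivative of \<open>(u\<^sub>t, v)\<close>.\<close>

definition weak_solution ::
  "plane set \<Rightarrow> real \<Rightarrow> (real \<Rightarrow> plane \<Rightarrow> real) \<Rightarrow> (plane \<Rightarrow> real) \<Rightarrow> (plane \<Rightarrow> real) \<Rightarrow>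
   (real \<Rightarrow> plane \<Rightarrow> real) \<Rightarrow> (real \<Rightarrow> plane \<Rightarrow> real) \<Rightarrow> bool" where
  "weak_solution \<Omega> T f u0 v0 u u_t \<longleftrightarrow>
     u \<in> time_C0 (H20 \<Omega>) (sobolev_norm \<Omega> 2) T \<and>
     u_t \<in> time_C0 (L2_space \<Omega>) (L2_norm \<Omega>) T \<and> has_time_deriv \<Omega> T u u_t \<and>
     (\<forall>v\<in>H20 \<Omega>. has_scalar_weak_time_deriv T (\<lambda>t. L2_inner \<Omega> (u_t t) v)
        (\<lambda>t. L2_inner \<Omega> (f t) v - plate_form \<Omega> (u t) v)) \<and>
     ae_eq \<Omega> (u 0) u0 \<and> ae_eq \<Omega> (u_t 0) v0"


section \<open>Triangulations, traces, jumps\<close>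

text \<open>
  A triangle is represented by the set \<open>t\<close> of its three vertices, an edge by the set of its two
  endpoints, so that \<open>\<V>(e) = e\<close>; the closed triangle is \<open>convex hull t\<close>.
\<close>

type_synonym triangle = "plane set"

definition conforming_triangulation :: "plane set \<Rightarrow> triangle set \<Rightarrow> bool" where
  "conforming_triangulation \<Omega> \<T> \<longleftrightarrow> finite \<T> \<and> (\<forall>t\<in>\<T>. card t = 3 \<and> \<not> collinear t) \<and>
     (\<Union>t\<in>\<T>. convex hull t) = closure \<Omega> \<and>
     (\<forall>s\<in>\<T>. \<forall>t\<in>\<T>. convex hull s \<inter> convex hull t = convex hull (s \<inter> t))"

definition shape_regular :: "real \<Rightarrow> triangle set \<Rightarrow> bool" where
  "shape_regular \<kappa> \<T> \<longleftrightarrow>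
     (\<forall>t\<in>\<T>. \<exists>x. \<exists>\<rho>>0. cball x \<rho> \<subseteq> convex hull t \<and> diameter (convex hull t) \<le> \<kappa> * \<rho>)"

definition mesh_size :: "triangle set \<Rightarrow> real" where
  "mesh_size \<T> = Max ((\<lambda>t. diameter (convex hull t)) ` \<T>)"

definition tri_int :: "triangle \<Rightarrow> plane set" where
  "tri_int t = interior (convex hull t)"

definition mesh_vertices :: "triangle set \<Rightarrow> plane set" where
  "mesh_vertices \<T> = \<Union>\<T>"

definition mesh_edges :: "triangle set \<Rightarrow> plane set set" where
  "mesh_edges \<T> = {e. card e = 2 \<and> (\<exists>t\<in>\<T>. e \<subseteq> t)}"

definition boundary_edge :: "plane set \<Rightarrow> plane set \<Rightarrow> bool" where
  "boundary_edge \<Omega> e \<longleftrightarrow> convex hull e \<subseteq> frontier \<Omega>"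

text \<open>
  An arbitrary but fixed orientation of each edge; it determines the parametrisation of the edge
  over \<open>[0,1]\<close> and its unit normal.
\<close>

definition edge_ends :: "plane set \<Rightarrow> plane \<times> plane" where
  "edge_ends e = (SOME p. e = {fst p, snd p})"

definition edge_point :: "plane set \<Rightarrow> real \<Rightarrow> plane" where
  "edge_point e s = (1 - s) *\<^sub>R fst (edge_ends e) + s *\<^sub>R snd (edge_ends e)"

definition edge_length :: "plane set \<Rightarrow> real" where
  "edge_length e = dist (fst (edge_ends e)) (snd (edge_ends e))"

definition edge_normal :: "plane set \<Rightarrow> plane" where
  "edge_normal e = (let d = snd (edge_ends e) - fst (edge_ends e)
     in (1 / edge_length e) *\<^sub>R vector [d $ 2, - d $ 1])"

definition tris_at :: "triangle set \<Rightarrow> plane \<Rightarrow> triangle set" where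
  "tris_at \<T> z = {t \<in> \<T>. z \<in> t}"

definition tris_on :: "triangle set \<Rightarrow> plane set \<Rightarrow> triangle set" where
  "tris_on \<T> e = {t \<in> \<T>. e \<subseteq> t}"

text \<open>Value at a point \<open>z\<close> of the closed triangle of the continuous representative of \<open>v|\<^sub>K\<close>.\<close>

definition point_trace :: "triangle \<Rightarrow> (plane \<Rightarrow> real) \<Rightarrow> plane \<Rightarrow> real" where
  "point_trace t v z =
     (THE y. \<exists>w. continuous_on (convex hull t) w \<and> ae_eq (convex hull t) w v \<and> w z = y)"

text \<open>
  Trace on the edge \<open>e\<close>, parametrised over \<open>[0,1]\<close>, of an \<open>H\<^sup>1\<close> function on the triangle: the
  \<open>L\<^sup>2\<close> limit of the restrictions of smooth functions that converge to it in \<open>H\<^sup>1\<close>.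
\<close>

definition edge_trace :: "triangle \<Rightarrow> plane set \<Rightarrow> (plane \<Rightarrow> real) \<Rightarrow> real \<Rightarrow> real" where
  "edge_trace t e g = (SOME \<tau>. \<tau> \<in> L2_space {0..1} \<and>
     (\<exists>\<phi>. (\<forall>n::nat. smooth_fun (\<phi> n)) \<and>
        (\<lambda>n. sobolev_norm (tri_int t) 1 (\<lambda>x. \<phi> n x - g x)) \<longlonglongrightarrow> 0 \<and>
        (\<lambda>n. L2_norm {0..1} (\<lambda>s. \<phi> n (edge_point e s) - \<tau> s)) \<longlonglongrightarrow> 0))"

text \<open>\<open>\<integral>\<^sub>e \<partial>\<^sub>n(v|\<^sub>K) ds\<close>\<close>

definition normal_deriv_int :: "triangle \<Rightarrow> plane set \<Rightarrow> (plane \<Rightarrow> real) \<Rightarrow> real" where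
  "normal_deriv_int t e v = edge_length e *
     (LINT s|lebesgue_on {0..1}.
        (\<Sum>b\<in>Basis. (edge_normal e \<bullet> b) * edge_trace t e (weak_deriv (tri_int t) [b] v) s))"

text \<open>\<open>\<partial>\<^sub>n(v|\<^sub>K)\<close> at the midpoint of \<open>e\<close>\<close>

definition normal_deriv_mid :: "triangle \<Rightarrow> plane set \<Rightarrow> (plane \<Rightarrow> real) \<Rightarrow> real" where
  "normal_deriv_mid t e v =
     (\<Sum>b\<in>Basis. (edge_normal e \<bullet> b) *
        point_trace t (weak_deriv (tri_int t) [b] v) (edge_point e (1 / 2)))"

text \<open>
  Jump across \<open>e\<close> of a quantity \<open>F\<close> given from the side of each triangle: difference of the two
  values for an interior edge, the single value for a boundary edge. Only its modulus is used, so
  the choice of the side \<open>K\<^sub>+\<close> is immaterial.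
\<close>

definition edge_jump :: "triangle set \<Rightarrow> plane set \<Rightarrow> (triangle \<Rightarrow> real) \<Rightarrow> real" where
  "edge_jump \<T> e F = (let t = (SOME t. t \<in> tris_on \<T> e)
     in F t - (\<Sum>s\<in>tris_on \<T> e - {t}. F s))"

definition pw_sobolev_space :: "triangle set \<Rightarrow> real \<Rightarrow> (plane \<Rightarrow> real) set" where
  "pw_sobolev_space \<T> s = {v. \<forall>t\<in>\<T>. v \<in> sobolev_space (tri_int t) s}"

definition pw_sobolev_norm :: "triangle set \<Rightarrow> real \<Rightarrow> (plane \<Rightarrow> real) \<Rightarrow> real" where
  "pw_sobolev_norm \<T> s v = sqrt (\<Sum>t\<in>\<T>. (sobolev_norm (tri_int t) s v)\<^sup>2)"

definition h_norm :: "triangle set \<Rightarrow> (plane \<Rightarrow> real) \<Rightarrow> real" where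
  "h_norm \<T> v = sqrt (
     (\<Sum>t\<in>\<T>. (sobolev_seminorm2 (tri_int t) v)\<^sup>2) +
     (\<Sum>e\<in>mesh_edges \<T>. \<Sum>z\<in>e.
        (1 / edge_length e)\<^sup>2 * \<bar>edge_jump \<T> e (\<lambda>t. point_trace t v z)\<bar>\<^sup>2) +
     (\<Sum>e\<in>mesh_edges \<T>.
        \<bar>1 / edge_length e * edge_jump \<T> e (\<lambda>t. normal_deriv_int t e v)\<bar>\<^sup>2))"

definition pw_poly :: "nat \<Rightarrow> triangle set \<Rightarrow> (plane \<Rightarrow> real) set" where
  "pw_poly r \<T> = {v. \<forall>t\<in>\<T>. \<exists>c :: nat \<Rightarrow> nat \<Rightarrow> real.
     ae_eq (convex hull t) v (\<lambda>x. \<Sum>(i, j)\<in>{(i, j). i + j \<le> r}. c i j * (x $ 1) ^ i * (x $ 2) ^ j)}"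


section \<open>Discrete spaces and operators\<close>

definition morley_space :: "plane set \<Rightarrow> triangle set \<Rightarrow> (plane \<Rightarrow> real) set" where
  "morley_space \<Omega> \<T> = {v \<in> pw_poly 2 \<T>.
     (\<forall>z\<in>mesh_vertices \<T>.
        if z \<in> frontier \<Omega> then \<forall>t\<in>tris_at \<T> z. point_trace t v z = 0
        else \<forall>s\<in>tris_at \<T> z. \<forall>t\<in>tris_at \<T> z. point_trace s v z = point_trace t v z) \<and>
     (\<forall>e\<in>mesh_edges \<T>.
        if boundary_edge \<Omega> e then \<forall>t\<in>tris_on \<T> e. normal_deriv_mid t e v = 0
        else \<forall>s\<in>tris_on \<T> e. \<forall>t\<in>tris_on \<T> e. normal_deriv_mid s e v = normal_deriv_mid t e v)}"

definition fin_dim_space :: "(plane \<Rightarrow> real) set \<Rightarrow> bool" where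
  "fin_dim_space V \<longleftrightarrow> (\<exists>B. finite B \<and> V = {\<lambda>x. \<Sum>b\<in>B. c b * b x |c. True})"

definition sum_space :: "(plane \<Rightarrow> real) set \<Rightarrow> (plane \<Rightarrow> real) set \<Rightarrow> (plane \<Rightarrow> real) set" where
  "sum_space V W = {\<lambda>x. v x + w x |v w. v \<in> V \<and> w \<in> W}"

definition symmetric_bilinear_on ::
  "(plane \<Rightarrow> real) set \<Rightarrow> ((plane \<Rightarrow> real) \<Rightarrow> (plane \<Rightarrow> real) \<Rightarrow> real) \<Rightarrow> bool" where
  "symmetric_bilinear_on S a \<longleftrightarrow>
     (\<forall>v\<in>S. \<forall>w\<in>S. a v w = a w v) \<and>
     (\<forall>v\<in>S. \<forall>w\<in>S. \<forall>z\<in>S. \<forall>p q. a (\<lambda>x. p * v x + q * w x) z = p * a v z + q * a w z)"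

definition discrete_form ::
  "plane set \<Rightarrow> triangle set \<Rightarrow> real \<Rightarrow> real \<Rightarrow> (plane \<Rightarrow> real) set \<Rightarrow>
   ((plane \<Rightarrow> real) \<Rightarrow> (plane \<Rightarrow> real) \<Rightarrow> real) \<Rightarrow> bool" where
  "discrete_form \<Omega> \<T> \<alpha> \<beta> V a \<longleftrightarrow> symmetric_bilinear_on (sum_space V (morley_space \<Omega> \<T>)) a \<and>
     (\<forall>w\<in>V. \<alpha> * (h_norm \<T> w)\<^sup>2 \<le> a w w) \<and>
     (\<forall>w\<in>V. \<forall>v\<in>V. a w v \<le> \<beta> * h_norm \<T> w * h_norm \<T> v)"

text \<open>The boundary degrees of freedom of the interpolant vanish by membership in the Morley space.\<close>

definition morley_interpolation ::
  "plane set \<Rightarrow> triangle set \<Rightarrow> ((plane \<Rightarrow> real) \<Rightarrow> plane \<Rightarrow> real) \<Rightarrow> bool" where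
  "morley_interpolation \<Omega> \<T> I \<longleftrightarrow> (\<forall>v\<in>pw_sobolev_space \<T> 2. I v \<in> morley_space \<Omega> \<T> \<and>
     (\<forall>z\<in>mesh_vertices \<T> - frontier \<Omega>. \<forall>t\<in>tris_at \<T> z.
        point_trace t (I v) z = (\<Sum>s\<in>tris_at \<T> z. point_trace s v z) / real (card (tris_at \<T> z))) \<and>
     (\<forall>e\<in>mesh_edges \<T>. \<not> boundary_edge \<Omega> e \<longrightarrow> (\<forall>t\<in>tris_on \<T> e.
        normal_deriv_int t e (I v) = (\<Sum>s\<in>tris_on \<T> e. normal_deriv_int s e v) / 2)))"

definition hct_space :: "plane set \<Rightarrow> triangle set \<Rightarrow> (plane \<Rightarrow> real) set" where
  "hct_space \<Omega> \<T> =
     sobolev_space \<Omega> 2 \<inter> pw_poly 3 {insert ((1 / 3) *\<^sub>R (\<Sum>y\<in>t. y)) (t - {z}) |t z. t \<in> \<T> \<and> z \<in> t}"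

definition companion ::
  "plane set \<Rightarrow> triangle set \<Rightarrow> ((plane \<Rightarrow> real) \<Rightarrow> plane \<Rightarrow> real) \<Rightarrow> bool" where
  "companion \<Omega> \<T> J \<longleftrightarrow>
     (\<forall>w1\<in>morley_space \<Omega> \<T>. \<forall>w2\<in>morley_space \<Omega> \<T>. \<forall>w\<in>morley_space \<Omega> \<T>. \<forall>p q.
        ae_eq \<Omega> w (\<lambda>x. p * w1 x + q * w2 x) \<longrightarrow> ae_eq \<Omega> (J w) (\<lambda>x. p * J w1 x + q * J w2 x)) \<and>
     (\<forall>w\<in>morley_space \<Omega> \<T>.
        J w \<in> H20 \<Omega> \<and>
        (\<exists>y\<in>hct_space \<Omega> \<T>. \<exists>p\<in>pw_poly 8 \<T>. ae_eq \<Omega> (J w) (\<lambda>x. y x + p x)) \<and>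
        (\<forall>z\<in>mesh_vertices \<T>. \<forall>t\<in>tris_at \<T> z. point_trace t (J w) z = point_trace t w z) \<and>
        (\<forall>z\<in>mesh_vertices \<T> - frontier \<Omega>. \<forall>t\<in>tris_at \<T> z. \<forall>b\<in>Basis.
           point_trace t (weak_deriv (tri_int t) [b] (J w)) z =
             (\<Sum>s\<in>tris_at \<T> z. point_trace s (weak_deriv (tri_int s) [b] w) z)
               / real (card (tris_at \<T> z))) \<and>
        (\<forall>e\<in>mesh_edges \<T>. \<forall>t\<in>tris_on \<T> e. normal_deriv_int t e (J w) = normal_deriv_int t e w))"

definition smoother_estimate ::
  "plane set \<Rightarrow> triangle set \<Rightarrow> real \<Rightarrow> (plane \<Rightarrow> real) set \<Rightarrow>
   ((plane \<Rightarrow> real) \<Rightarrow> plane \<Rightarrow> real) \<Rightarrow> bool" where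
  "smoother_estimate \<Omega> \<T> C1 V Q \<longleftrightarrow> (\<forall>v\<^sub>h\<in>V. \<forall>s. 0 \<le> s \<and> s \<le> 2 \<longrightarrow>
     pw_sobolev_norm \<T> s (\<lambda>x. v\<^sub>h x - Q v\<^sub>h x)
       \<le> C1 * mesh_size \<T> powr (2 - s) * (INF v\<in>H20 \<Omega>. h_norm \<T> (\<lambda>x. v x - v\<^sub>h x)))"

definition ritz_projection ::
  "plane set \<Rightarrow> (plane \<Rightarrow> real) set \<Rightarrow> ((plane \<Rightarrow> real) \<Rightarrow> (plane \<Rightarrow> real) \<Rightarrow> real) \<Rightarrow>
   ((plane \<Rightarrow> real) \<Rightarrow> plane \<Rightarrow> real) \<Rightarrow> ((plane \<Rightarrow> real) \<Rightarrow> plane \<Rightarrow> real) \<Rightarrow> bool" where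
  "ritz_projection \<Omega> V a Q R \<longleftrightarrow>
     (\<forall>w\<in>H20 \<Omega>. R w \<in> V \<and> (\<forall>v\<^sub>h\<in>V. a (R w) v\<^sub>h = plate_form \<Omega> w (Q v\<^sub>h)))"

definition ritz_estimate ::
  "plane set \<Rightarrow> triangle set \<Rightarrow> real \<Rightarrow> real \<Rightarrow> ((plane \<Rightarrow> real) \<Rightarrow> plane \<Rightarrow> real) \<Rightarrow> bool" where
  "ritz_estimate \<Omega> \<T> \<gamma> C2 R \<longleftrightarrow> (\<forall>v\<in>H20 \<Omega> \<inter> sobolev_space \<Omega> (2 + \<gamma>).
     L2_norm \<Omega> (\<lambda>x. v x - R v x) + mesh_size \<T> powr \<gamma> * h_norm \<T> (\<lambda>x. v x - R v x)
       \<le> C2 * mesh_size \<T> powr (2 * \<gamma>) * sobolev_norm \<Omega> (2 + \<gamma>) v)"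

definition semidiscrete_solution ::
  "plane set \<Rightarrow> real \<Rightarrow> (plane \<Rightarrow> real) set \<Rightarrow> ((plane \<Rightarrow> real) \<Rightarrow> (plane \<Rightarrow> real) \<Rightarrow> real) \<Rightarrow>
   (real \<Rightarrow> plane \<Rightarrow> real) \<Rightarrow> (plane \<Rightarrow> real) \<Rightarrow> (plane \<Rightarrow> real) \<Rightarrow> (real \<Rightarrow> plane \<Rightarrow> real) \<Rightarrow> bool" where
  "semidiscrete_solution \<Omega> T V a f w0 w1 u\<^sub>h \<longleftrightarrow>
     (\<exists>u\<^sub>h_t u\<^sub>h_tt.
        (\<forall>t\<in>{0..T}. u\<^sub>h t \<in> V \<and> u\<^sub>h_t t \<in> V \<and> u\<^sub>h_tt t \<in> V) \<and>
        has_time_deriv \<Omega> T u\<^sub>h u\<^sub>h_t \<and> has_time_deriv \<Omega> T u\<^sub>h_t u\<^sub>h_tt \<and>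
        (\<forall>t\<in>{0..T}. \<forall>v\<^sub>h\<in>V.
           L2_inner \<Omega> (u\<^sub>h_tt t) v\<^sub>h + a (u\<^sub>h t) v\<^sub>h = L2_inner \<Omega> (f t) v\<^sub>h) \<and>
        ae_eq \<Omega> (u\<^sub>h 0) w0 \<and> ae_eq \<Omega> (u\<^sub>h_t 0) w1)"

text \<open>
  \<open>f\<close>, \<open>f_t\<close>, \<open>f_tt\<close> are the continuous \<open>L\<^sup>2(\<Omega>)\<close>-valued representatives, which exist because each
  has a weak derivative in \<open>L\<^sup>2(0,T;L\<^sup>2(\<Omega>))\<close>; this gives the values at time \<open>0\<close> their meaning.
\<close>

definition smooth_data ::
  "plane set \<Rightarrow> real \<Rightarrow> (nat \<Rightarrow> real) \<Rightarrow> (nat \<Rightarrow> plane \<Rightarrow> real) \<Rightarrow> (plane \<Rightarrow> real) \<Rightarrow> (plane \<Rightarrow> real) \<Rightarrow>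
   (real \<Rightarrow> plane \<Rightarrow> real) \<Rightarrow> (real \<Rightarrow> plane \<Rightarrow> real) \<Rightarrow> (real \<Rightarrow> plane \<Rightarrow> real) \<Rightarrow>
   (real \<Rightarrow> plane \<Rightarrow> real) \<Rightarrow> bool" where
  "smooth_data \<Omega> T ev \<psi> u0 v0 f f_t f_tt f_ttt \<longleftrightarrow>
     {f, f_t, f_tt} \<subseteq> time_C0 (L2_space \<Omega>) (L2_norm \<Omega>) T \<and>
     {f, f_t, f_tt, f_ttt} \<subseteq> time_L2 (L2_space \<Omega>) (L2_norm \<Omega>) T \<and>
     has_weak_time_deriv \<Omega> T f f_t \<and> has_weak_time_deriv \<Omega> T f_t f_tt \<and>
     has_weak_time_deriv \<Omega> T f_tt f_ttt \<and>
     u0 \<in> dom_A_pow \<Omega> ev \<psi> 2 \<and> v0 \<in> dom_A_pow \<Omega> ev \<psi> (3 / 2) \<and>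
     f 0 \<in> dom_A \<Omega> \<and> f_t 0 \<in> dom_A_pow \<Omega> ev \<psi> (1 / 2) \<and> f_tt 0 \<in> L2_space \<Omega>"

definition L_fu ::
  "plane set \<Rightarrow> real \<Rightarrow> real \<Rightarrow> (real \<Rightarrow> plane \<Rightarrow> real) \<Rightarrow> (real \<Rightarrow> plane \<Rightarrow> real) \<Rightarrow>
   (real \<Rightarrow> plane \<Rightarrow> real) \<Rightarrow> (real \<Rightarrow> plane \<Rightarrow> real) \<Rightarrow> (real \<Rightarrow> plane \<Rightarrow> real) \<Rightarrow>
   (real \<Rightarrow> plane \<Rightarrow> real) \<Rightarrow> real" where
  "L_fu \<Omega> T \<gamma> f f_t u u_t u_tt u_ttt =
     time_Linf_norm (L2_norm \<Omega>) T f + time_L2_norm (L2_norm \<Omega>) T f_t +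
     time_Linf_norm (sobolev_norm \<Omega> (2 + \<gamma>)) T u +
     time_Linf_norm (sobolev_norm \<Omega> (2 + \<gamma>)) T u_t +
     time_Linf_norm (L2_norm \<Omega>) T u_tt +
     time_L2_norm (sobolev_norm \<Omega> (2 + \<gamma>)) T u_tt +
     time_L2_norm (L2_norm \<Omega>) T u_ttt"

end

theory Submission
  imports Defs
begin

text \<open>
  Expanding in the eigenbasis of \<open>A\<close> turns the wave equation into the scalar oscillators
  \<open>c'' + \<lambda> c = F\<close>. Differentiating each of them twice and bounding its energy by the data gives
  square-summable bounds uniform in time, hence the derivatives of \<open>u\<close> up to order four as series
  that are continuous in time, with \<open>A u = f - u\<^sub>t\<^sub>t\<close> and its time derivatives.

  For \<open>\<theta> = R\<^sub>h u - u\<^sub>h\<close> the definition of the Ritz projection yields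
  \<open>(\<theta>\<^sub>t\<^sub>t, v) + a\<^sub>h(\<theta>, v) = (R\<^sub>h u\<^sub>t\<^sub>t - u\<^sub>t\<^sub>t, v) + (f - u\<^sub>t\<^sub>t, Q v - v)\<close> for all \<open>v\<close> in \<open>V\<^sub>h\<close>.
  Testing with \<open>v = \<theta>\<^sub>t\<close>, integrating the last term by parts in time and using
  \<open>\<parallel>Q v - v\<parallel> \<le> C h\<^sup>2 a\<^sub>h(v, v)\<^sup>1\<^sup>/\<^sup>2\<close> bounds the energy of \<open>\<theta>\<close>, whose initial value vanishes.
  The error is then at most \<open>\<parallel>u - R\<^sub>h u\<parallel> + \<parallel>\<theta>\<parallel>\<close>, where \<open>h\<^sup>2\<close> is absorbed into a multiple of
  \<open>h\<^sup>2\<^sup>\<gamma>\<close> because \<open>h\<close> is at most the diameter of \<open>\<Omega>\<close>.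
\<close>

section \<open>Semi-inner product spaces of functions\<close>

text \<open>Nothing directly says that \<open>R u\<close> is differentiable in time. It is
  differentiated through its coordinates in an L2-orthonormal basis of \<open>V\<close>: they equal
  \<open>plate_form (u t) (Q (d i))\<close> with a fixed \<open>d i\<close>, and
  \<open>A u = f - u_tt\<close> turns these into L2 products. Two time derivatives of
  \<open>R u\<close> thus cost four of \<open>u\<close>, although the final bound shows only three;
  the regularity of the data at time 0 pays for the fourth. Elements of \<open>V\<close> are
  functions, not classes, so both the L2 product and \<open>a\<close> are only semidefinite there.
  They have the same null functions: \<open>a\<close> ignores functions that vanish almost
  everywhere because it is bounded by a norm that cannot see them, and \<open>a v v = 0\<close>
  makes \<open>v\<close> vanish almost everywhere because \<open>Q v\<close> then agrees with
  \<open>v\<close> and has zero plate energy. Linear algebra in \<open>V\<close> is done modulo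
  these functions. The energy is estimated at its maximum in time instead of by an exponential
  (Gronwall) argument, which makes the final constant polynomial in \<open>sqrt T\<close>.\<close>

definition lin_span :: "('a \<Rightarrow> real) set \<Rightarrow> ('a \<Rightarrow> real) set" where
  "lin_span B = {\<lambda>x. \<Sum>b\<in>B. c b * b x |c. True}"

lemma lin_spanI: "(\<lambda>x. \<Sum>b\<in>B. c b * b x) \<in> lin_span B"
  unfolding lin_span_def by blast

lemma lin_spanE:
  assumes "v \<in> lin_span B"
  obtains c where "v = (\<lambda>x. \<Sum>b\<in>B. c b * b x)"
  using assms unfolding lin_span_def by blast

lemma lin_span_lin:
  assumes "v \<in> lin_span B" "w \<in> lin_span B"
  shows "(\<lambda>x. p * v x + q * w x) \<in> lin_span B"
proof -
  obtain c where c: "v = (\<lambda>x. \<Sum>b\<in>B. c b * b x)" using assms(1) by (rule lin_spanE)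
  obtain d where "w = (\<lambda>x. \<Sum>b\<in>B. d b * b x)" using assms(2) by (rule lin_spanE)
  with c have "(\<lambda>x. p * v x + q * w x) = (\<lambda>x. \<Sum>a\<in>B. (p * c a + q * d a) * a x)"
    by (simp add: fun_eq_iff sum.distrib sum_distrib_left algebra_simps)
  then show ?thesis using lin_spanI by simp
qed

lemma lin_span_0: "(\<lambda>x. 0) \<in> lin_span B"
  using lin_spanI[of "\<lambda>_. 0" B] by simp

lemma lin_span_sum:
  fixes k :: nat
  assumes "\<And>i. i < k \<Longrightarrow> g i \<in> lin_span B"
  shows "(\<lambda>x. \<Sum>i<k. c i * g i x) \<in> lin_span B"
  using assms
proof (induction k)
  case (Suc k)
  then show ?case using lin_span_lin[of "\<lambda>x. \<Sum>i<k. c i * g i x" B "g k" 1 "c k"] by auto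
qed (simp add: lin_span_0)

lemma lin_span_insert:
  assumes "finite B" "b \<notin> B" "v \<in> lin_span B"
  shows "v \<in> lin_span (insert b B)"
proof -
  obtain c where "v = (\<lambda>x. \<Sum>b\<in>B. c b * b x)" using assms(3) by (rule lin_spanE)
  then have *: "v = (\<lambda>x. \<Sum>a\<in>insert b B. (if a = b then 0 else c a) * a x)"
    using assms(1,2) by (auto intro!: sum.cong)
  show ?thesis unfolding * by (rule lin_spanI)
qed

lemma lin_span_superset:
  assumes "finite B" "b \<in> B"
  shows "b \<in> lin_span B"
proof -
  have "(\<Sum>a\<in>B. (if a = b then 1 else 0) * a x) = b x" for x
  proof -
    have "(\<Sum>a\<in>B. (if a = b then 1 else 0) * a x) = (\<Sum>a\<in>B. if a = b then a x else 0)"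
      by (rule sum.cong) auto
    then show ?thesis using assms by simp
  qed
  then show ?thesis using lin_spanI[of "\<lambda>a. if a = b then 1 else 0" B] by simp
qed

text \<open>Carrier and form are parameters because four pairs are used: L2 functions and the
  discrete space with the L2 product, clamped functions with the plate form, and the discrete space
  with \<open>a\<close>. The form is only semidefinite, since functions that agree almost everywhere
  are distinct elements at distance zero.\<close>

locale semi_ip =
  fixes X :: "('a \<Rightarrow> real) set" and ip :: "('a \<Rightarrow> real) \<Rightarrow> ('a \<Rightarrow> real) \<Rightarrow> real"
  assumes zero_mem: "(\<lambda>x. 0) \<in> X"
    and lin_mem: "v \<in> X \<Longrightarrow> w \<in> X \<Longrightarrow> (\<lambda>x. p * v x + q * w x) \<in> X"
    and sym: "v \<in> X \<Longrightarrow> w \<in> X \<Longrightarrow> ip v w = ip w v"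
    and lin_left: "v \<in> X \<Longrightarrow> w \<in> X \<Longrightarrow> z \<in> X \<Longrightarrow>
      ip (\<lambda>x. p * v x + q * w x) z = p * ip v z + q * ip w z"
    and nonneg: "v \<in> X \<Longrightarrow> 0 \<le> ip v v"
begin

lemma add_mem: "v \<in> X \<Longrightarrow> w \<in> X \<Longrightarrow> (\<lambda>x. v x + w x) \<in> X"
  using lin_mem[of v w 1 1] by simp

lemma diff_mem: "v \<in> X \<Longrightarrow> w \<in> X \<Longrightarrow> (\<lambda>x. v x - w x) \<in> X"
  using lin_mem[of v w 1 "-1"] by simp

lemma scale_mem: "v \<in> X \<Longrightarrow> (\<lambda>x. c * v x) \<in> X"
  using lin_mem[of v v c 0] by simp

lemma sum_mem: "(\<And>i. i \<in> I \<Longrightarrow> e i \<in> X) \<Longrightarrow> (\<lambda>x. \<Sum>i\<in>I. c i * e i x) \<in> X"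
proof (induction I rule: infinite_finite_induct)
  case (insert i F)
  then show ?case using lin_mem[of "e i" "\<lambda>x. \<Sum>i\<in>F. c i * e i x" "c i" 1] by simp
qed (simp_all add: zero_mem)

lemma lin_right: "v \<in> X \<Longrightarrow> w \<in> X \<Longrightarrow> z \<in> X \<Longrightarrow>
    ip z (\<lambda>x. p * v x + q * w x) = p * ip z v + q * ip z w"
  by (simp add: sym[of z] lin_mem lin_left)

lemma add_left: "v \<in> X \<Longrightarrow> w \<in> X \<Longrightarrow> z \<in> X \<Longrightarrow> ip (\<lambda>x. v x + w x) z = ip v z + ip w z"
  using lin_left[of v w z 1 1] by simp

lemma diff_left: "v \<in> X \<Longrightarrow> w \<in> X \<Longrightarrow> z \<in> X \<Longrightarrow> ip (\<lambda>x. v x - w x) z = ip v z - ip w z"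
  using lin_left[of v w z 1 "-1"] by simp

lemma scale_left: "v \<in> X \<Longrightarrow> z \<in> X \<Longrightarrow> ip (\<lambda>x. c * v x) z = c * ip v z"
  using lin_left[of v v z c 0] by simp

lemma add_right: "v \<in> X \<Longrightarrow> w \<in> X \<Longrightarrow> z \<in> X \<Longrightarrow> ip z (\<lambda>x. v x + w x) = ip z v + ip z w"
  using lin_right[of v w z 1 1] by simp

lemma diff_right: "v \<in> X \<Longrightarrow> w \<in> X \<Longrightarrow> z \<in> X \<Longrightarrow> ip z (\<lambda>x. v x - w x) = ip z v - ip z w"
  using lin_right[of v w z 1 "-1"] by simp

lemma scale_right: "v \<in> X \<Longrightarrow> z \<in> X \<Longrightarrow> ip z (\<lambda>x. c * v x) = c * ip z v"
  using lin_right[of v v z c 0] by simp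

lemma zero_left: "z \<in> X \<Longrightarrow> ip (\<lambda>x. 0) z = 0"
  using scale_left[of z z 0] by simp

lemma sum_left:
  assumes "\<And>i. i \<in> I \<Longrightarrow> e i \<in> X" "z \<in> X"
  shows "ip (\<lambda>x. \<Sum>i\<in>I. c i * e i x) z = (\<Sum>i\<in>I. c i * ip (e i) z)"
  using assms(1)
proof (induction I rule: infinite_finite_induct)
  case (insert i F)
  then show ?case
    using lin_left[of "e i" "\<lambda>x. \<Sum>i\<in>F. c i * e i x" z "c i" 1] assms(2) by (simp add: sum_mem)
qed (simp_all add: zero_left assms(2))

lemma sum_right:
  assumes "\<And>i. i \<in> I \<Longrightarrow> e i \<in> X" "z \<in> X"
  shows "ip z (\<lambda>x. \<Sum>i\<in>I. c i * e i x) = (\<Sum>i\<in>I. c i * ip z (e i))"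
  by (simp add: sym[of z] sum_mem sum_left assms)

lemma diff_diff: "v \<in> X \<Longrightarrow> w \<in> X \<Longrightarrow>
    ip (\<lambda>x. v x - w x) (\<lambda>x. v x - w x) = ip v v - 2 * ip v w + ip w w"
  by (simp add: diff_left diff_right diff_mem sym)

lemma add_add: "v \<in> X \<Longrightarrow> w \<in> X \<Longrightarrow>
    ip (\<lambda>x. v x + w x) (\<lambda>x. v x + w x) = ip v v + 2 * ip v w + ip w w"
  by (simp add: add_left add_right add_mem sym)

lemma scale_scale: "v \<in> X \<Longrightarrow> ip (\<lambda>x. c * v x) (\<lambda>x. c * v x) = c\<^sup>2 * ip v v"
  by (simp add: scale_left scale_right scale_mem power2_eq_square)

text \<open>The usual quadratic in \<open>c\<close>. For a semidefinite form its leading coefficient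
  \<open>ip w w\<close> may vanish; the quadratic is then affine and bounded below, which forces its
  slope to be zero.\<close>

lemma cauchy_schwarz_sq:
  assumes v: "v \<in> X" and w: "w \<in> X"
  shows "(ip v w)\<^sup>2 \<le> ip v v * ip w w"
proof -
  have *: "0 \<le> ip v v + 2 * c * ip v w + c\<^sup>2 * ip w w" for c
  proof -
    have "0 \<le> ip (\<lambda>x. v x + c * w x) (\<lambda>x. v x + c * w x)"
      by (intro nonneg add_mem scale_mem v w)
    then show ?thesis
      using v w by (simp add: add_add scale_mem scale_scale scale_right)
  qed
  show ?thesis
  proof (cases "ip w w = 0")
    case True
    have "ip v w = 0"
    proof (rule ccontr)
      assume "ip v w \<noteq> 0"
      \<comment> \<open>With this \<open>c\<close> the affine expression has the value -1.\<close>
      then show False using *[of "- (ip v v + 1) / (2 * ip v w)"] True by (simp add: field_simps)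
    qed
    then show ?thesis using True by simp
  next
    case False
    then have "0 < ip w w" using nonneg[OF w] by simp
    \<comment> \<open>The chosen \<open>c\<close> is the minimiser of the quadratic.\<close>
    then show ?thesis
      using *[of "- ip v w / ip w w"]
      by (simp add: field_simps power2_eq_square)
  qed
qed

definition nm where "nm v = sqrt (ip v v)"

lemma nm_nonneg: "v \<in> X \<Longrightarrow> 0 \<le> nm v" by (simp add: nm_def nonneg)

lemma nm_sq: "v \<in> X \<Longrightarrow> (nm v)\<^sup>2 = ip v v" by (simp add: nm_def nonneg)

lemma cauchy_schwarz: "v \<in> X \<Longrightarrow> w \<in> X \<Longrightarrow> \<bar>ip v w\<bar> \<le> nm v * nm w"
  using real_sqrt_le_mono[OF cauchy_schwarz_sq[of v w]] by (simp add: nm_def real_sqrt_mult)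

lemma null_left: "v \<in> X \<Longrightarrow> w \<in> X \<Longrightarrow> ip v v = 0 \<Longrightarrow> ip v w = 0"
  using cauchy_schwarz_sq[of v w] by simp

lemma nm_triangle:
  assumes v: "v \<in> X" and w: "w \<in> X"
  shows "nm (\<lambda>x. v x + w x) \<le> nm v + nm w"
proof (rule power2_le_imp_le)
  show "(nm (\<lambda>x. v x + w x))\<^sup>2 \<le> (nm v + nm w)\<^sup>2"
    using cauchy_schwarz[OF v w]
    by (simp add: power2_sum nm_sq v w add_mem add_add)
qed (simp add: nm_nonneg v w)

lemma nm_uminus: "v \<in> X \<Longrightarrow> nm (\<lambda>x. - v x) = nm v"
  using scale_scale[of v "-1"] by (simp add: nm_def)

lemma nm_diff_triangle:
  assumes "v \<in> X" "w \<in> X"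
  shows "nm (\<lambda>x. v x - w x) \<le> nm v + nm w"
  using nm_triangle[of v "\<lambda>x. - w x"] scale_mem[of w "-1"] assms by (simp add: nm_uminus)

lemma nm_diff_le:
  assumes "v \<in> X" "w \<in> X"
  shows "\<bar>nm v - nm w\<bar> \<le> nm (\<lambda>x. v x - w x)"
  using nm_triangle[of "\<lambda>x. v x - w x" w] nm_triangle[of "\<lambda>x. w x - v x" v]
    nm_uminus[of "\<lambda>x. v x - w x"] assms by (simp add: diff_mem)

lemma nm_tendsto:
  assumes "eventually (\<lambda>n. v n \<in> X) F" "w \<in> X" "((\<lambda>n. nm (\<lambda>x. v n x - w x)) \<longlongrightarrow> 0) F"
  shows "((\<lambda>n. nm (v n)) \<longlongrightarrow> nm w) F"
proof (rule LIM_zero_cancel, rule Lim_null_comparison[OF _ assms(3)])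
  show "eventually (\<lambda>n. norm (nm (v n) - nm w) \<le> nm (\<lambda>x. v n x - w x)) F"
    using assms(1) by eventually_elim (use nm_diff_le[OF _ assms(2)] in auto)
qed

lemma ip_tendsto:
  assumes "eventually (\<lambda>n. v n \<in> X) F" "w \<in> X" "z \<in> X" "((\<lambda>n. nm (\<lambda>x. v n x - w x)) \<longlongrightarrow> 0) F"
  shows "((\<lambda>n. ip (v n) z) \<longlongrightarrow> ip w z) F"
proof (rule LIM_zero_cancel, rule Lim_null_comparison)
  show "((\<lambda>n. nm (\<lambda>x. v n x - w x) * nm z) \<longlongrightarrow> 0) F"
    using tendsto_mult_right[OF assms(4), of "nm z"] by simp
  show "eventually (\<lambda>n. norm (ip (v n) z - ip w z) \<le> nm (\<lambda>x. v n x - w x) * nm z) F"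
    using assms(1)
  proof eventually_elim
    case (elim n)
    then show ?case
      using cauchy_schwarz[of "\<lambda>x. v n x - w x" z] assms(2,3) by (simp add: diff_left diff_mem)
  qed
qed

lemma lin_span_mem: "B \<subseteq> X \<Longrightarrow> v \<in> lin_span B \<Longrightarrow> v \<in> X"
  by (elim lin_spanE) (auto intro!: sum_mem)

text \<open>The vectors may be dependent or null. The part \<open>r\<close> of the new vector
  orthogonal to the system either is null and changes nothing, or is normalised and appended.
  Accordingly the expansion holds up to a null residual, not as an equation between
  functions.\<close>

lemma gram_schmidt:
  assumes "finite B" "B \<subseteq> X"
  shows "\<exists>m e. (\<forall>i<m::nat. e i \<in> lin_span B) \<and>
    (\<forall>i<m. \<forall>j<m. ip (e i) (e j) = (if i = j then 1 else 0)) \<and>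
    (\<forall>v\<in>lin_span B.
       ip (\<lambda>x. v x - (\<Sum>i<m. ip v (e i) * e i x)) (\<lambda>x. v x - (\<Sum>i<m. ip v (e i) * e i x)) = 0)"
  using assms
proof (induction B rule: finite_induct)
  case empty
  have "ip v v = 0" if "v \<in> lin_span {}" for v
    using that zero_left[OF zero_mem] by (elim lin_spanE) simp
  then show ?case by (intro exI[of _ 0]) simp
next
  case (insert b B)
  have BX: "B \<subseteq> X" "b \<in> X" using insert.prems by auto
  obtain m :: nat and e where e: "\<forall>i<m. e i \<in> lin_span B"
    and on: "\<forall>i<m. \<forall>j<m. ip (e i) (e j) = (if i = j then 1 else 0)"
    and ex: "\<forall>v\<in>lin_span B. ip (\<lambda>x. v x - (\<Sum>i<m. ip v (e i) * e i x)) (\<lambda>x. v x - (\<Sum>i<m. ip v (e i) * e i x)) = 0"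
    using insert.IH[OF BX(1)] by (elim exE conjE) (erule (2) that)
  note e = e[rule_format] and on = on[rule_format] and ex = ex[rule_format]
  have SX: "v \<in> X" if "v \<in> lin_span B" for v
    using that BX lin_span_mem by blast
  have eX: "e i \<in> X" if "i < m" for i using SX e that by blast
  note sub = lin_span_insert[OF insert.hyps]
  note Slin = lin_span_lin[of _ "insert b B"]
  note Ssum = lin_span_sum[of _ _ "insert b B"]
  have bS: "b \<in> lin_span (insert b B)" using lin_span_superset insert.hyps by blast
  define r where "r = (\<lambda>x. b x - (\<Sum>i<m. ip b (e i) * e i x))"
  have rX: "r \<in> X" unfolding r_def by (intro diff_mem sum_mem BX eX) auto
  have rS: "r \<in> lin_span (insert b B)"
    using Slin[OF bS Ssum[of m e "\<lambda>i. ip b (e i)"], of 1 "-1"] e sub by (simp add: r_def)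
  have re: "ip r (e j) = 0" if j: "j < m" for j
  proof -
    have "ip r (e j) = ip b (e j) - (\<Sum>i<m. ip b (e i) * ip (e i) (e j))"
      unfolding r_def using j by (subst diff_left) (auto intro!: BX eX sum_mem sum_left)
    also have "(\<Sum>i<m. ip b (e i) * ip (e i) (e j)) = (\<Sum>i<m. if i = j then ip b (e i) else 0)"
      by (rule sum.cong) (auto simp: on j)
    finally show ?thesis using j by simp
  qed
  have dec: "\<exists>k w. w \<in> lin_span B \<and> v = (\<lambda>x. w x + k * b x)" if v: "v \<in> lin_span (insert b B)" for v
  proof -
    obtain c where "v = (\<lambda>x. \<Sum>a\<in>insert b B. c a * a x)" using v by (rule lin_spanE)
    then show ?thesis using insert.hyps
      by (intro exI[of _ "c b"] exI[of _ "\<lambda>x. \<Sum>a\<in>B. c a * a x"]) (auto simp: lin_spanI)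
  qed
  \<comment> \<open>The residual after projection to the old system. On the enlarged span it is the
    null residual of the component in the old span plus a multiple of \<open>r\<close>.\<close>
  define P where "P = (\<lambda>v x. v x - (\<Sum>i<m. ip v (e i) * e i x))"
  have PX: "P v \<in> X" if "v \<in> X" for v
    unfolding P_def by (intro diff_mem sum_mem eX that) auto
  have Pdec: "P v = (\<lambda>x. P w x + k * r x)" if "w \<in> lin_span B" "v = (\<lambda>x. w x + k * b x)" for v w k
  proof -
    have "ip v (e i) = ip w (e i) + k * ip b (e i)" if "i < m" for i
      using that \<open>v = _\<close> SX[OF \<open>w \<in> lin_span B\<close>] BX eX[of i] by (simp add: add_left scale_left scale_mem)
    then have "(\<Sum>i<m. ip v (e i) * e i x) = (\<Sum>i<m. ip w (e i) * e i x) + k * (\<Sum>i<m. ip b (e i) * e i x)" for x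
      by (auto simp: algebra_simps sum_distrib_left sum.distrib[symmetric] intro!: sum.cong)
    moreover have "v x = w x + k * b x" for x using that by simp
    ultimately show ?thesis
      by (simp add: P_def r_def fun_eq_iff right_diff_distrib)
  qed
  have null: "ip (P w) z = 0" if "w \<in> lin_span B" "z \<in> X" for w z
    using null_left[OF PX[OF SX[OF that(1)]] that(2)] ex[OF that(1)] by (simp add: P_def)
  show ?case
  proof (cases "ip r r = 0")
    case True
    have "ip (P v) (P v) = 0" if v: "v \<in> lin_span (insert b B)" for v
    proof -
      obtain k w where w: "w \<in> lin_span B" "v = (\<lambda>x. w x + k * b x)" using dec[OF v] by blast
      have "P w \<in> X" using PX SX w by blast
      then show ?thesis using null[OF w(1)] True rX
        by (simp add: Pdec[OF w] add_add scale_mem scale_scale)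
    qed
    then show ?thesis using sub[OF e] on unfolding P_def
      by (intro exI[of _ m] exI[of _ e] conjI allI impI ballI)
  next
    case False
    define s where "s = 1 / sqrt (ip r r)"
    have rpos: "ip r r > 0" using False nonneg[OF rX] by simp
    then have s: "s\<^sup>2 * ip r r = 1" "s \<noteq> 0" by (auto simp: s_def power_divide)
    define e' where "e' = e(m := (\<lambda>x. s * r x))"
    have e'S: "e' i \<in> lin_span (insert b B)" if "i < Suc m" for i
      using that e sub Slin[OF rS rS, of s 0] by (cases "i = m") (auto simp: e'_def)
    have e'on: "ip (e' i) (e' j) = (if i = j then 1 else 0)" if ij: "i < Suc m" "j < Suc m" for i j
    proof -
      consider "i < m" "j < m" | "i = m" "j = m" | "i = m" "j < m" | "i < m" "j = m" using ij by linarith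
      then show ?thesis
      proof cases
        case 1 then show ?thesis using on by (simp add: e'_def)
      next
        case 2 then show ?thesis using s rX by (simp add: e'_def scale_scale)
      next
        case 3 then show ?thesis using re rX eX by (simp add: e'_def scale_left)
      next
        case 4 then show ?thesis using re[of i] rX eX[of i] sym[of "e i" r] by (simp add: e'_def scale_right)
      qed
    qed
    have "ip (\<lambda>x. v x - (\<Sum>i<Suc m. ip v (e' i) * e' i x)) (\<lambda>x. v x - (\<Sum>i<Suc m. ip v (e' i) * e' i x)) = 0"
      if v: "v \<in> lin_span (insert b B)" for v
    proof -
      obtain k w where w: "w \<in> lin_span B" "v = (\<lambda>x. w x + k * b x)" using dec[OF v] by blast
      have wX: "w \<in> X" using SX w by blast
      have vX: "v \<in> X" using w wX BX by (auto intro: add_mem scale_mem)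
      \<comment> \<open>\<open>r\<close> is orthogonal to the old system and to the null residual
        \<open>P w\<close>, so \<open>ip v r\<close> sees only the multiple \<open>k\<close> of
        \<open>r\<close>.\<close>
      have "ip v r = ip (P v) r + (\<Sum>i<m. ip v (e i) * ip (e i) r)"
        unfolding P_def using vX rX eX by (subst diff_left) (auto intro!: sum_mem sum_left[symmetric])
      also have "(\<Sum>i<m. ip v (e i) * ip (e i) r) = 0"
        using re sym rX eX by (intro sum.neutral) auto
      also have "ip (P v) r = k * ip r r"
        using PX[OF wX] rX null[OF w(1) rX] by (simp add: Pdec[OF w] add_left scale_left scale_mem)
      finally have em: "ip v (e' m) * e' m x = k * r x" for x
        using s vX rX by (simp add: e'_def scale_right power2_eq_square algebra_simps)
      have "(\<Sum>i<Suc m. ip v (e' i) * e' i x) = (\<Sum>i<m. ip v (e i) * e i x) + k * r x" for x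
        unfolding sum.lessThan_Suc em
        by (simp add: e'_def)
      then have "(\<lambda>x. v x - (\<Sum>i<Suc m. ip v (e' i) * e' i x)) = P w"
        using fun_cong[OF Pdec[OF w]] by (auto simp: P_def fun_eq_iff diff_diff_eq[symmetric])
      then show ?thesis using null[OF w(1) PX[OF wX]] by simp
    qed
    then show ?thesis using e'S e'on
      by (intro exI[of _ "Suc m"] exI[of _ e'] conjI allI impI ballI)
  qed
qed

end

section \<open>Square integrable functions as a semi-inner product space\<close>

lemma L2_mult_integrable:
  assumes "v \<in> L2_space U" "w \<in> L2_space U"
  shows "integrable (lebesgue_on U) (\<lambda>x. v x * w x)"
proof (rule Bochner_Integration.integrable_bound)
  show "integrable (lebesgue_on U) (\<lambda>x. (v x)\<^sup>2 + (w x)\<^sup>2)"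
    using assms by (auto simp: L2_space_def)
  show "(\<lambda>x. v x * w x) \<in> borel_measurable (lebesgue_on U)"
    using assms by (auto simp: L2_space_def)
  have "\<bar>a * b\<bar> \<le> a\<^sup>2 + b\<^sup>2" for a b :: real
    using sum_squares_bound[of "\<bar>a\<bar>" "\<bar>b\<bar>"] zero_le_power2[of a] zero_le_power2[of b]
    unfolding abs_mult power2_abs by linarith
  then show "AE x in lebesgue_on U. norm (v x * w x) \<le> norm ((v x)\<^sup>2 + (w x)\<^sup>2)"
    by (intro AE_I2) (metis abs_of_nonneg real_norm_def sum_power2_ge_zero)
qed

lemma L2_space_lin:
  assumes "v \<in> L2_space U" "w \<in> L2_space U"
  shows "(\<lambda>x. p * v x + q * w x) \<in> L2_space U"
proof -
  have "integrable (lebesgue_on U) (\<lambda>x. p\<^sup>2 * (v x)\<^sup>2 + (2 * p * q) * (v x * w x) + q\<^sup>2 * (w x)\<^sup>2)"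
    using assms L2_mult_integrable[OF assms] by (auto simp: L2_space_def)
  also have "(\<lambda>x. p\<^sup>2 * (v x)\<^sup>2 + (2 * p * q) * (v x * w x) + q\<^sup>2 * (w x)\<^sup>2) = (\<lambda>x. (p * v x + q * w x)\<^sup>2)"
    by (auto simp: power2_eq_square algebra_simps)
  finally show ?thesis using assms by (auto simp: L2_space_def)
qed

lemma L2_semi_ip: "semi_ip (L2_space U) (L2_inner U)"
proof
  show "(\<lambda>x. 0) \<in> L2_space U" by (simp add: L2_space_def)
  fix v w z assume v: "v \<in> L2_space U" and w: "w \<in> L2_space U"
  show "L2_inner U v w = L2_inner U w v" by (simp add: L2_inner_def mult.commute)
  show "0 \<le> L2_inner U v v" by (simp add: L2_inner_def)
  fix p q
  show "(\<lambda>x. p * v x + q * w x) \<in> L2_space U" by (rule L2_space_lin[OF v w])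
  assume z: "z \<in> L2_space U"
  have "L2_inner U (\<lambda>x. p * v x + q * w x) z
      = (LINT x|lebesgue_on U. p * (v x * z x) + q * (w x * z x))"
    by (simp add: L2_inner_def algebra_simps)
  then show "L2_inner U (\<lambda>x. p * v x + q * w x) z = p * L2_inner U v z + q * L2_inner U w z"
    using L2_mult_integrable[OF v z] L2_mult_integrable[OF w z] by (simp add: L2_inner_def)
qed

interpretation L2: semi_ip "L2_space U" "L2_inner U"
  rewrites "semi_ip.nm (L2_inner U) = L2_norm U" for U
  by (rule L2_semi_ip) (simp add: fun_eq_iff semi_ip.nm_def[OF L2_semi_ip] L2_norm_def)

lemma L2_null_iff: "v \<in> L2_space U \<Longrightarrow> L2_inner U v v = 0 \<longleftrightarrow> ae_eq U v (\<lambda>x. 0)"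
  using integral_nonneg_eq_0_iff_AE[of "lebesgue_on U" "\<lambda>x. v x * v x"] L2_mult_integrable[of v U v]
  by (simp add: L2_inner_def ae_eq_def)

lemma ae_eq_sym: "ae_eq U v w \<Longrightarrow> ae_eq U w v"
  unfolding ae_eq_def by (erule eventually_mono) simp

lemma ae_eq_refl [simp]: "ae_eq U v v"
  unfolding ae_eq_def by simp

lemma ae_eq_trans: "ae_eq U v w \<Longrightarrow> ae_eq U w z \<Longrightarrow> ae_eq U v z"
  unfolding ae_eq_def by (erule (1) eventually_elim2) simp

lemma ae_eq_lin: "ae_eq U v v' \<Longrightarrow> ae_eq U w w' \<Longrightarrow>
    ae_eq U (\<lambda>x. p * v x + q * w x) (\<lambda>x. p * v' x + q * w' x)"
  unfolding ae_eq_def by (erule (1) eventually_elim2) simp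

lemma ae_eq_diff: "ae_eq U v v' \<Longrightarrow> ae_eq U w w' \<Longrightarrow> ae_eq U (\<lambda>x. v x - w x) (\<lambda>x. v' x - w' x)"
  unfolding ae_eq_def by (erule (1) eventually_elim2) simp

lemma ae_eq_diff0_iff: "ae_eq U (\<lambda>x. v x - w x) (\<lambda>x. 0) \<longleftrightarrow> ae_eq U v w"
  by (simp add: ae_eq_def)

text \<open>Lebesgue measure is complete, so measurability survives a change on a null set.
  Multiplying with the indicator of \<open>U\<close> moves the question from the restricted measure
  to the whole space.\<close>

lemma lebesgue_on_measurable_AE:
  fixes v w :: "'a::euclidean_space \<Rightarrow> real"
  assumes "U \<in> sets lebesgue" "AE x in lebesgue_on U. v x = w x" "v \<in> borel_measurable (lebesgue_on U)"
  shows "w \<in> borel_measurable (lebesgue_on U)"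
proof -
  have sp: "U \<inter> space lebesgue \<in> sets lebesgue" using assms(1) by simp
  have "AE x in lebesgue. v x * indicat_real U x = w x * indicat_real U x"
    using assms(1,2) by (subst (asm) AE_restrict_space_iff) (auto simp: indicator_def elim: eventually_mono)
  moreover have "(\<lambda>x. v x * indicat_real U x) \<in> borel_measurable lebesgue"
    using assms(3) borel_measurable_restrict_space_iff[OF sp, of v] by (simp add: mult.commute)
  ultimately have "(\<lambda>x. w x * indicat_real U x) \<in> borel_measurable lebesgue"
    by (rule borel_measurable_AE[rotated])
  then show ?thesis
    using borel_measurable_restrict_space_iff[OF sp, of w] by (simp add: mult.commute)
qed

section \<open>Bump functions\<close>

lemma inv_Suc_tendsto: "(\<lambda>n. 1 / real (Suc n)) \<longlonglongrightarrow> 0"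
  using LIMSEQ_inverse_real_of_nat by (simp add: inverse_eq_divide)

text \<open>The flat function \<open>exp (- c / x)\<close> divided by a power of \<open>x\<close>.
  The powers are included because differentiation produces them: the family is closed under
  derivatives up to linear combinations, so smoothness needs no separate argument for each
  order.\<close>

definition gexp :: "nat \<Rightarrow> real \<Rightarrow> real \<Rightarrow> real" where
  "gexp k c x = (if x > 0 then exp (- c / x) / x ^ k else 0)"

text \<open>In the variable \<open>y = c / x\<close> the function is \<open>y ^ k / exp y\<close> up
  to a constant, and the exponential beats every power.\<close>

lemma gexp_tendsto_0:
  assumes "c > 0"
  shows "(gexp k c \<longlongrightarrow> 0) (at 0)"
proof -
  have "filterlim (\<lambda>x. c / x) at_top (at_right 0)"
    using filterlim_tendsto_pos_mult_at_top[OF tendsto_const assms filterlim_inverse_at_top_right]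
    by (simp add: divide_inverse)
  then have "((\<lambda>x. (c / x) ^ k / exp (c / x) / c ^ k) \<longlongrightarrow> 0 / c ^ k) (at_right 0)"
    using assms by (intro tendsto_divide tendsto_const filterlim_compose[OF tendsto_power_div_exp_0]) auto
  moreover have "eventually (\<lambda>x. (c / x) ^ k / exp (c / x) / c ^ k = gexp k c x) (at_right 0)"
    using eventually_at_right_less[of 0]
    by eventually_elim (use assms in \<open>simp add: gexp_def exp_minus field_simps\<close>)
  ultimately have R: "(gexp k c \<longlongrightarrow> 0) (at_right 0)"
    using Lim_transform_eventually by fastforce
  have "eventually (\<lambda>x. gexp k c x = 0) (at_left 0)"
    by (auto simp: gexp_def eventually_at_left_field intro: exI[of _ "-1"])
  then have "(gexp k c \<longlongrightarrow> 0) (at_left 0)"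
    by (simp cong: tendsto_cong)
  with R show ?thesis by (simp add: filterlim_at_split)
qed

lemma gexp_deriv:
  assumes c: "c > 0"
  shows "(gexp k c has_real_derivative c * gexp (k + 2) c x - real k * gexp (k + 1) c x) (at x)"
proof -
  consider "x < 0" | "x = 0" | "x > 0" by linarith
  then show ?thesis
  proof cases
    case 1
    have "eventually (\<lambda>y. 0 = gexp k c y) (nhds x)"
      using 1 eventually_nhds_in_open[of "{..<0}" x] by (auto simp: gexp_def elim: eventually_mono)
    from DERIV_cong_ev[OF refl this refl, THEN iffD1, OF DERIV_const]
    have "(gexp k c has_real_derivative 0) (at x)" .
    then show ?thesis using 1 by (simp add: gexp_def)
  next
    case 2
    \<comment> \<open>The difference quotient of \<open>gexp k\<close> at 0 is
      \<open>gexp (k + 1)\<close>, whose limit is already known to be 0.\<close>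
    have "(\<lambda>h. (gexp k c (0 + h) - gexp k c 0) / h) = gexp (k + 1) c"
      by (auto simp: gexp_def fun_eq_iff)
    then have "(gexp k c has_real_derivative 0) (at 0)"
      using gexp_tendsto_0[OF c, of "k + 1"] by (simp add: DERIV_def)
    then show ?thesis using 2 by (simp add: gexp_def)
  next
    case 3
    have "((\<lambda>x. exp (- c / x) * inverse (x ^ k)) has_real_derivative
        exp (- c / x) * (c / x\<^sup>2) * inverse (x ^ k) + exp (- c / x) * (- (real k * x ^ (k - 1)) * inverse (x ^ k * x ^ k))) (at x)"
      using 3 by (auto intro!: derivative_eq_intros simp: power2_eq_square field_simps)
    moreover have "exp (- c / x) * (c / x\<^sup>2) * inverse (x ^ k) + exp (- c / x) * (- (real k * x ^ (k - 1)) * inverse (x ^ k * x ^ k))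
        = c * gexp (k + 2) c x - real k * gexp (k + 1) c x"
      using 3 by (cases k) (auto simp: gexp_def field_simps power2_eq_square)
    ultimately have D: "((\<lambda>x. exp (- c / x) * inverse (x ^ k)) has_real_derivative
        c * gexp (k + 2) c x - real k * gexp (k + 1) c x) (at x)" by simp
    have "eventually (\<lambda>y. exp (- c / y) * inverse (y ^ k) = gexp k c y) (nhds x)"
      using 3 eventually_nhds_in_open[of "{0<..}" x] by (auto simp: gexp_def divide_inverse elim: eventually_mono)
    from DERIV_cong_ev[OF refl this refl] D show ?thesis by simp
  qed
qed

text \<open>A family that contains the bump functions and is closed under partial differentiation; hence its members are smooth.\<close>

inductive_set gen_funs :: "('a::euclidean_space \<Rightarrow> real) set" where
  gen: "c > 0 \<Longrightarrow> (\<lambda>x. gexp k c (x \<bullet> v + d)) \<in> gen_funs"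
| const: "(\<lambda>x. r) \<in> gen_funs"
| add: "\<phi> \<in> gen_funs \<Longrightarrow> \<eta> \<in> gen_funs \<Longrightarrow> (\<lambda>x. \<phi> x + \<eta> x) \<in> gen_funs"
| mult: "\<phi> \<in> gen_funs \<Longrightarrow> \<eta> \<in> gen_funs \<Longrightarrow> (\<lambda>x. \<phi> x * \<eta> x) \<in> gen_funs"

lemma gen_funs_deriv:
  "\<phi> \<in> gen_funs \<Longrightarrow> \<exists>D. (\<forall>x. (\<phi> has_derivative D x) (at x)) \<and> (\<forall>b. (\<lambda>x. D x b) \<in> gen_funs)"
proof (induction rule: gen_funs.induct)
  case (gen c k v d)
  let ?g = "\<lambda>x. c * gexp (k + 2) c (x \<bullet> v + d) - real k * gexp (k + 1) c (x \<bullet> v + d)"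
  have "((\<lambda>x. gexp k c (x \<bullet> v + d)) has_derivative (\<lambda>b. (b \<bullet> v) * ?g x)) (at x)" for x
  proof -
    have "((\<lambda>x. x \<bullet> v + d) has_derivative (\<lambda>b. b \<bullet> v)) (at x)"
      by (auto intro!: derivative_eq_intros)
    from has_derivative_compose[OF this gexp_deriv[OF gen, unfolded has_field_derivative_def, of k]]
    show ?thesis by (simp add: mult.commute)
  qed
  moreover have "(\<lambda>x. (b \<bullet> v) * ?g x) \<in> gen_funs" for b
  proof -
    have "(\<lambda>x. (b \<bullet> v) * (c * gexp (k + 2) c (x \<bullet> v + d) + (- real k) * gexp (k + 1) c (x \<bullet> v + d))) \<in> gen_funs"
      by (intro gen_funs.mult gen_funs.const gen_funs.add gen_funs.gen gen)
    then show ?thesis by simp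
  qed
  ultimately show ?case by (intro exI[of _ "\<lambda>x b. (b \<bullet> v) * ?g x"]) auto
next
  case (const r)
  then show ?case by (intro exI[of _ "\<lambda>x b. 0"]) (auto intro: gen_funs.const)
next
  case (add \<phi> \<eta>)
  then obtain D E where "\<forall>x. (\<phi> has_derivative D x) (at x)" "\<forall>b. (\<lambda>x. D x b) \<in> gen_funs"
    "\<forall>x. (\<eta> has_derivative E x) (at x)" "\<forall>b. (\<lambda>x. E x b) \<in> gen_funs" by blast
  then show ?case
    by (intro exI[of _ "\<lambda>x b. D x b + E x b"]) (auto intro: gen_funs.add has_derivative_add)
next
  case (mult \<phi> \<eta>)
  then obtain D E where *: "\<forall>x. (\<phi> has_derivative D x) (at x)" "\<forall>b. (\<lambda>x. D x b) \<in> gen_funs"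
    "\<forall>x. (\<eta> has_derivative E x) (at x)" "\<forall>b. (\<lambda>x. E x b) \<in> gen_funs" by blast
  have "(\<lambda>x. \<phi> x * E x b + D x b * \<eta> x) \<in> gen_funs" for b
    using * mult by (intro gen_funs.add gen_funs.mult) auto
  then show ?case
    using * by (intro exI[of _ "\<lambda>x b. \<phi> x * E x b + D x b * \<eta> x"]) (auto intro: has_derivative_mult)
qed

lemma multi_deriv_Nil [simp]: "multi_deriv [] \<phi> = \<phi>"
  by (simp add: multi_deriv_def)

lemma multi_deriv_Cons: "multi_deriv (b # bs) \<phi> = partial_deriv b (multi_deriv bs \<phi>)"
  by (simp add: multi_deriv_def)

lemma multi_deriv_append: "multi_deriv (bs @ cs) \<phi> = multi_deriv bs (multi_deriv cs \<phi>)"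
  by (simp add: multi_deriv_def)

lemma partial_deriv_eq: "(\<And>x. (\<phi> has_derivative D x) (at x)) \<Longrightarrow> partial_deriv b \<phi> = (\<lambda>x. D x b)"
  unfolding partial_deriv_def by (metis frechet_derivative_at)

lemma gen_funs_smooth:
  assumes "\<phi> \<in> gen_funs"
  shows "smooth_fun \<phi>"
proof -
  have "multi_deriv bs \<phi> \<in> gen_funs" for bs
  proof (induction bs)
    case (Cons b bs)
    then obtain D where D: "\<forall>x. (multi_deriv bs \<phi> has_derivative D x) (at x)" "\<forall>b. (\<lambda>x. D x b) \<in> gen_funs"
      using gen_funs_deriv by blast
    then show ?case using partial_deriv_eq[of "multi_deriv bs \<phi>" D b] by (simp add: multi_deriv_Cons)
  qed (simp add: assms)
  then have "multi_deriv bs \<phi> differentiable (at x)" for bs x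
    using gen_funs_deriv differentiableI by blast
  then show ?thesis by (simp add: smooth_fun_def differentiable_on_def)
qed

text \<open>In each coordinate one factor is flat at the left face of the box and one at the right
  face. The arguments are written as \<open>x \<bullet> v + d\<close> to match the generators of
  \<open>gen_funs\<close>. As the parameter \<open>1 / Suc n\<close> tends to 0, each factor tends
  to 1 wherever it is positive, so the bumps converge to the indicator of the open box.\<close>

definition bump :: "'a::euclidean_space \<Rightarrow> 'a \<Rightarrow> nat \<Rightarrow> 'a \<Rightarrow> real" where
  "bump a b n x = (\<Prod>i\<in>Basis. gexp 0 (1 / Suc n) (x \<bullet> i + - (a \<bullet> i)) * gexp 0 (1 / Suc n) (x \<bullet> - i + b \<bullet> i))"

lemma gen_funs_prod:
  "finite I \<Longrightarrow> (\<And>i. i \<in> I \<Longrightarrow> g i \<in> gen_funs) \<Longrightarrow> (\<lambda>x. \<Prod>i\<in>I. g i x) \<in> gen_funs"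
  by (induction I rule: finite_induct) (auto intro: gen_funs.const gen_funs.mult)

lemma bump_smooth: "smooth_fun (bump a b n)"
proof -
  have "bump a b n \<in> gen_funs"
    unfolding bump_def by (intro gen_funs_prod gen_funs.mult gen_funs.gen) auto
  then show ?thesis by (rule gen_funs_smooth)
qed

lemma gexp_0_bounds: "c > 0 \<Longrightarrow> 0 \<le> gexp 0 c x \<and> gexp 0 c x \<le> 1"
  by (auto simp: gexp_def)

lemma gexp_0_nz: "c > 0 \<Longrightarrow> gexp 0 c x \<noteq> 0 \<longleftrightarrow> x > 0"
  by (auto simp: gexp_def)

lemma bump_bounds: "0 \<le> bump a b n x" "bump a b n x \<le> 1"
  unfolding bump_def using gexp_0_bounds[of "1 / Suc n"]
  by (auto intro!: prod_nonneg prod_le_1 mult_le_one mult_nonneg_nonneg)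

lemma bump_nz: "bump a b n x \<noteq> 0 \<longleftrightarrow> x \<in> box a b"
  unfolding bump_def using gexp_0_nz[of "1 / Suc n"] by (auto simp: mem_box)

lemma bump_test:
  assumes "cbox a b \<subseteq> U"
  shows "bump a b n \<in> test_funs U"
proof -
  have "closure {x. bump a b n x \<noteq> 0} \<subseteq> cbox a b"
    by (rule closure_minimal) (auto simp: bump_nz mem_box less_imp_le)
  moreover from this have "compact (closure {x. bump a b n x \<noteq> 0})"
    using bounded_subset[OF bounded_cbox] by (auto simp: compact_eq_bounded_closed)
  ultimately show ?thesis using bump_smooth assms by (auto simp: test_funs_def)
qed

lemma bump_tendsto: "(\<lambda>n. bump a b n x) \<longlonglongrightarrow> indicat_real (box a b) x"
proof (cases "x \<in> box a b")
  case True
  have *: "(\<lambda>n. gexp 0 (1 / Suc n) y) \<longlonglongrightarrow> 1" if "y > 0" for y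
  proof -
    have "(\<lambda>n. exp (- (1 / Suc n) / y)) \<longlonglongrightarrow> exp (- 0 / y)"
      by (intro tendsto_exp tendsto_divide tendsto_minus inv_Suc_tendsto tendsto_const) (use that in auto)
    then show ?thesis using that by (simp add: gexp_def)
  qed
  have "(\<lambda>n. bump a b n x) \<longlonglongrightarrow> (\<Prod>i\<in>(Basis::'a set). 1 * 1)"
    unfolding bump_def using True by (intro tendsto_prod tendsto_mult *) (auto simp: mem_box)
  then show ?thesis using True by simp
next
  case False
  then have "bump a b n x = 0" for n using bump_nz by blast
  then show ?thesis using False by simp
qed

lemma has_derivative_outside_support:
  fixes \<eta> :: "'a::real_normed_vector \<Rightarrow> real"
  assumes "closed K" "\<And>y. y \<notin> K \<Longrightarrow> \<eta> y = 0" "(\<eta> has_derivative D) (at x)" "x \<notin> K"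
  shows "D b = 0"
proof -
  have "((\<lambda>_. 0) has_derivative D) (at x)"
    by (rule has_derivative_transform_within_open[OF assms(3), of "- K"])
      (use assms(1,2,4) in \<open>simp_all add: open_Compl\<close>)
  then have "D = (\<lambda>_. 0)"
    by (rule has_derivative_unique[OF _ has_derivative_const])
  then show ?thesis by simp
qed

lemma line_deriv:
  assumes "\<And>x. (\<eta> has_derivative D x) (at x)"
  shows "((\<lambda>s. \<eta> (x + s *\<^sub>R b)) has_real_derivative D (x + s *\<^sub>R b) b) (at s)"
proof -
  have "((\<lambda>s. x + s *\<^sub>R b) has_derivative (\<lambda>s. s *\<^sub>R b)) (at s)"
    by (auto intro!: derivative_eq_intros)
  from has_derivative_compose[OF this assms]
  have "((\<lambda>s. \<eta> (x + s *\<^sub>R b)) has_derivative (\<lambda>h. D (x + s *\<^sub>R b) (h *\<^sub>R b))) (at s)" .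
  moreover have "D (x + s *\<^sub>R b) (h *\<^sub>R b) = D (x + s *\<^sub>R b) b * h" for h
    using linear_cmul[OF has_derivative_linear[OF assms]] by (simp add: mult.commute)
  ultimately show ?thesis by (simp add: has_field_derivative_def fun_eq_iff)
qed

text \<open>The difference quotients of \<open>\<eta>\<close> in direction \<open>b\<close> have integral zero by translation invariance
  and converge boundedly to the derivative.\<close>

lemma integral_directional_deriv_0:
  fixes \<eta> :: "'a::euclidean_space \<Rightarrow> real"
  assumes D: "\<And>x. (\<eta> has_derivative D x) (at x)" and c: "continuous_on UNIV (\<lambda>x. D x b)"
    and K: "compact K" "\<And>x. x \<notin> K \<Longrightarrow> \<eta> x = 0"
  shows "(LINT x|lebesgue. D x b) = 0"
proof -
  have contc: "continuous_on UNIV \<eta>"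
    using D has_derivative_continuous continuous_at_imp_continuous_on by blast
  then have mchi [measurable]: "\<eta> \<in> borel_measurable borel"
    by (rule borel_measurable_continuous_onI)
  have mD [measurable]: "(\<lambda>x. D x b) \<in> borel_measurable borel"
    by (rule borel_measurable_continuous_onI[OF c])
  have D0: "D x b = 0" if "x \<notin> K" for x
    using has_derivative_outside_support[OF compact_imp_closed[OF K(1)] K(2) D that] .
  obtain M where M: "\<And>x. x \<in> K \<Longrightarrow> \<bar>D x b\<bar> \<le> M"
    using compact_imp_bounded[OF compact_continuous_image[OF continuous_on_subset[OF c] K(1)]]
    by (auto simp: bounded_iff)
  define M' where "M' = max M 0"
  have M': "\<bar>D x b\<bar> \<le> M'" for x using M D0 unfolding M'_def by (cases "x \<in> K") (auto intro: max.coboundedI1)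
  \<comment> \<open>The points from which a step of length at most 1 times \<open>b\<close> can
    reach \<open>K\<close>; it contains the supports of all difference quotients
    \<open>f n\<close>.\<close>
  define K' where "K' = (\<lambda>(k, s). k - s *\<^sub>R b) ` (K \<times> {0..1})"
  have "compact K'" unfolding K'_def
    by (intro compact_continuous_image compact_Times K) (auto intro!: continuous_intros simp: case_prod_beta)
  define f where "f = (\<lambda>n x. (\<eta> (x + (1 / Suc n) *\<^sub>R b) - \<eta> x) * Suc n)"
  have int_chi: "integrable lborel \<eta>"
  proof -
    have "integrable lborel (\<lambda>x. indicat_real K x *\<^sub>R \<eta> x)"
      using borel_integrable_compact[OF K(1) continuous_on_subset[OF contc]] by simp
    moreover have "(\<lambda>x. indicat_real K x *\<^sub>R \<eta> x) = \<eta>" using K(2) by (auto simp: indicator_def fun_eq_iff)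
    ultimately show ?thesis by simp
  qed
  have shift: "integrable lborel (\<lambda>x. \<eta> (x + d)) \<and> (LINT x|lborel. \<eta> (x + d)) = (LINT x|lborel. \<eta> x)" for d
  proof -
    have "integrable (distr lborel borel (\<lambda>x. d + x)) \<eta>" "(LINT x|distr lborel borel (\<lambda>x. d + x). \<eta> x) = (LINT x|lborel. \<eta> x)"
      using int_chi by (simp_all add: lborel_distr_plus)
    then show ?thesis by (simp add: integrable_distr_eq integral_distr add.commute)
  qed
  have If: "(LINT x|lborel. f n x) = 0" for n
    using shift int_chi by (simp add: f_def)
  have bound: "\<bar>f n x\<bar> \<le> M' * indicat_real K' x" for n x
  proof (cases "x \<in> K'")
    case True
    have "\<exists>z>0. z < 1 / Suc n \<and> \<eta> (x + (1 / Suc n) *\<^sub>R b) - \<eta> (x + 0 *\<^sub>R b) = (1 / Suc n - 0) * D (x + z *\<^sub>R b) b"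
      by (rule MVT2[where f = "\<lambda>s. \<eta> (x + s *\<^sub>R b)"]) (auto intro!: line_deriv D)
    then obtain z where "\<eta> (x + (1 / Suc n) *\<^sub>R b) - \<eta> x = (1 / Suc n) * D (x + z *\<^sub>R b) b" by auto
    then have "f n x = D (x + z *\<^sub>R b) b" by (simp add: f_def)
    then show ?thesis using True M' by simp
  next
    case False
    have "x \<notin> K" using False by (force simp: K'_def)
    moreover have "x + (1 / Suc n) *\<^sub>R b \<notin> K"
    proof
      assume "x + (1 / Suc n) *\<^sub>R b \<in> K"
      then have "x \<in> K'" unfolding K'_def
        by (intro image_eqI[of _ _ "(x + (1 / Suc n) *\<^sub>R b, 1 / Suc n)"]) auto
      then show False using False by simp
    qed
    ultimately show ?thesis using K(2) M'[of x] by (simp add: f_def)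
  qed
  have lim: "(\<lambda>n. f n x) \<longlonglongrightarrow> D x b" for x
  proof -
    have "((\<lambda>h. (\<eta> (x + (0 + h) *\<^sub>R b) - \<eta> (x + 0 *\<^sub>R b)) / h) \<longlongrightarrow> D (x + 0 *\<^sub>R b) b) (at 0)"
      using line_deriv[OF D, of x b 0] unfolding DERIV_def .
    moreover have "filterlim (\<lambda>n. 1 / real (Suc n)) (at 0) sequentially"
      unfolding filterlim_at using inv_Suc_tendsto by auto
    ultimately have "(\<lambda>n. (\<eta> (x + (0 + 1 / real (Suc n)) *\<^sub>R b) - \<eta> (x + 0 *\<^sub>R b)) / (1 / real (Suc n))) \<longlonglongrightarrow> D (x + 0 *\<^sub>R b) b"
      by (rule filterlim_compose)
    then show ?thesis by (simp add: f_def)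
  qed
  have K'b: "K' \<in> sets borel" using \<open>compact K'\<close> by (simp add: borel_compact)
  have "(\<lambda>n. LINT x|lborel. f n x) \<longlonglongrightarrow> (LINT x|lborel. D x b)"
  proof (rule integral_dominated_convergence[where w = "\<lambda>x. M' * indicat_real K' x"])
    show "integrable lborel (\<lambda>x. M' * indicat_real K' x)"
      using \<open>compact K'\<close> emeasure_compact_finite[of K'] K'b by (auto intro!: integrable_mult_right integrable_real_indicator)
    show "f n \<in> borel_measurable lborel" for n unfolding f_def by measurable
    show "AE x in lborel. (\<lambda>n. f n x) \<longlonglongrightarrow> D x b" using lim by simp
    show "AE x in lborel. norm (f n x) \<le> M' * indicat_real K' x" for n using bound by simp
  qed simp
  then have "(LINT x|lborel. D x b) = 0" using LIMSEQ_unique[OF _ tendsto_const[of 0]] by (simp add: If)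
  then show ?thesis by (simp add: integral_completion)
qed

lemma smooth_fun_has_derivative:
  assumes "smooth_fun \<phi>" "set bs \<subseteq> Basis"
  shows "(multi_deriv bs \<phi> has_derivative frechet_derivative (multi_deriv bs \<phi>) (at x)) (at x)"
  using assms by (auto simp: smooth_fun_def differentiable_on_def frechet_derivative_works[symmetric])

lemma smooth_fun_multi_deriv: "smooth_fun \<phi> \<Longrightarrow> set bs \<subseteq> Basis \<Longrightarrow> smooth_fun (multi_deriv bs \<phi>)"
  unfolding smooth_fun_def by (metis multi_deriv_append set_append Un_least)

lemma smooth_fun_continuous: "smooth_fun \<phi> \<Longrightarrow> set bs \<subseteq> Basis \<Longrightarrow> continuous_on S (multi_deriv bs \<phi>)"
  using differentiable_imp_continuous_on continuous_on_subset unfolding smooth_fun_def by blast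

lemma smooth_fun_line_deriv:
  assumes "smooth_fun \<phi>" "set bs \<subseteq> Basis"
  shows "((\<lambda>s. multi_deriv bs \<phi> (x + s *\<^sub>R b)) has_real_derivative partial_deriv b (multi_deriv bs \<phi>) (x + s *\<^sub>R b)) (at s)"
  unfolding partial_deriv_def by (rule line_deriv[OF smooth_fun_has_derivative[OF assms]])

text \<open>The mean value theorem is applied first in direction \<open>i\<close> to the increment
  in direction \<open>j\<close>, then in direction \<open>j\<close> to the derivative in direction
  \<open>i\<close>. The left-hand side is symmetric in \<open>i\<close> and \<open>j\<close>, which
  is the point of the lemma.\<close>

lemma second_difference:
  assumes \<phi>: "smooth_fun \<phi>" and i: "i \<in> Basis" and j: "j \<in> Basis" and h: "h > 0"
  shows "\<exists>s t. 0 < s \<and> s < h \<and> 0 < t \<and> t < h \<and>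
    \<phi> (x + h *\<^sub>R i + h *\<^sub>R j) - \<phi> (x + h *\<^sub>R i) - \<phi> (x + h *\<^sub>R j) + \<phi> x
      = h * (h * multi_deriv [j, i] \<phi> (x + s *\<^sub>R i + t *\<^sub>R j))"
proof -
  note d0 = smooth_fun_line_deriv[OF \<phi>, of "[]", simplified]
  note d1 = smooth_fun_line_deriv[OF \<phi>, of "[i]", simplified]
  have "\<exists>s>0. s < h \<and> (\<phi> ((x + h *\<^sub>R j) + h *\<^sub>R i) - \<phi> (x + h *\<^sub>R i)) - (\<phi> ((x + h *\<^sub>R j) + 0 *\<^sub>R i) - \<phi> (x + 0 *\<^sub>R i))
     = (h - 0) * (partial_deriv i \<phi> ((x + h *\<^sub>R j) + s *\<^sub>R i) - partial_deriv i \<phi> (x + s *\<^sub>R i))"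
    by (rule MVT2[where f = "\<lambda>s. \<phi> ((x + h *\<^sub>R j) + s *\<^sub>R i) - \<phi> (x + s *\<^sub>R i)"])
      (auto intro!: DERIV_diff d0 simp: h)
  then obtain s where s: "0 < s" "s < h" "(\<phi> ((x + h *\<^sub>R j) + h *\<^sub>R i) - \<phi> (x + h *\<^sub>R i)) - (\<phi> (x + h *\<^sub>R j) - \<phi> x)
     = h * (partial_deriv i \<phi> ((x + h *\<^sub>R j) + s *\<^sub>R i) - partial_deriv i \<phi> (x + s *\<^sub>R i))" by auto
  have "\<exists>t>0. t < h \<and> multi_deriv [i] \<phi> ((x + s *\<^sub>R i) + h *\<^sub>R j) - multi_deriv [i] \<phi> ((x + s *\<^sub>R i) + 0 *\<^sub>R j)
     = (h - 0) * (partial_deriv j (multi_deriv [i] \<phi>) ((x + s *\<^sub>R i) + t *\<^sub>R j))"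
    by (rule MVT2[where f = "\<lambda>t. multi_deriv [i] \<phi> ((x + s *\<^sub>R i) + t *\<^sub>R j)"]) (auto intro!: d1 simp: h i)
  then obtain t where "0 < t" "t < h" "partial_deriv i \<phi> ((x + s *\<^sub>R i) + h *\<^sub>R j) - partial_deriv i \<phi> (x + s *\<^sub>R i)
     = h * multi_deriv [j, i] \<phi> ((x + s *\<^sub>R i) + t *\<^sub>R j)" by (auto simp: multi_deriv_Cons)
  then show ?thesis using s by (intro exI[of _ s] exI[of _ t]) (simp add: algebra_simps)
qed

text \<open>The same second difference equals either mixed derivative at some intermediate point;
  both kinds of intermediate points tend to \<open>x\<close> as the step \<open>1 / Suc n\<close>
  shrinks, and the mixed derivatives are continuous.\<close>

lemma multi_deriv_swap:
  assumes \<phi>: "smooth_fun \<phi>" and i: "i \<in> Basis" and j: "j \<in> Basis"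
  shows "multi_deriv [i, j] \<phi> = multi_deriv [j, i] \<phi>"
proof
  fix x
  have cont: "isCont (multi_deriv [k, l] \<phi>) x" if "k \<in> Basis" "l \<in> Basis" for k l
    using smooth_fun_continuous[OF \<phi>, of "[k, l]" UNIV] that by (simp add: continuous_on_eq_continuous_at)
  have lim: "(\<lambda>n. multi_deriv [k, l] \<phi> (x + s n *\<^sub>R i + t n *\<^sub>R j)) \<longlonglongrightarrow> multi_deriv [k, l] \<phi> x"
    if "k \<in> Basis" "l \<in> Basis" "\<And>n. 0 < s n \<and> s n < 1 / Suc n" "\<And>n. 0 < t n \<and> t n < 1 / Suc n" for k l s t
  proof -
    have "s \<longlonglongrightarrow> 0" "t \<longlonglongrightarrow> 0" 
      by (rule tendsto_sandwich[OF _ _ tendsto_const inv_Suc_tendsto]; use that in \<open>auto intro!: eventuallyI less_imp_le\<close>)+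
    then have "(\<lambda>n. x + s n *\<^sub>R i + t n *\<^sub>R j) \<longlonglongrightarrow> x + 0 *\<^sub>R i + 0 *\<^sub>R j" by (intro tendsto_intros)
    then show ?thesis using cont[OF that(1,2)] isCont_tendsto_compose by simp blast
  qed
  have "\<forall>n. \<exists>s t. 0 < s \<and> s < 1 / Suc n \<and> 0 < t \<and> t < 1 / Suc n \<and>
    \<phi> (x + (1 / Suc n) *\<^sub>R i + (1 / Suc n) *\<^sub>R j) - \<phi> (x + (1 / Suc n) *\<^sub>R i) - \<phi> (x + (1 / Suc n) *\<^sub>R j) + \<phi> x
      = (1 / Suc n) * ((1 / Suc n) * multi_deriv [j, i] \<phi> (x + s *\<^sub>R i + t *\<^sub>R j))"
    by (intro allI second_difference[OF \<phi> i j]) simp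
  then obtain s t where st: "\<And>n. 0 < s n \<and> s n < 1 / Suc n" "\<And>n. 0 < t n \<and> t n < 1 / Suc n"
    "\<And>n. \<phi> (x + (1 / Suc n) *\<^sub>R i + (1 / Suc n) *\<^sub>R j) - \<phi> (x + (1 / Suc n) *\<^sub>R i) - \<phi> (x + (1 / Suc n) *\<^sub>R j) + \<phi> x
      = (1 / Suc n) * ((1 / Suc n) * multi_deriv [j, i] \<phi> (x + s n *\<^sub>R i + t n *\<^sub>R j))"
    unfolding choice_iff by blast
  have "\<forall>n. \<exists>s t. 0 < s \<and> s < 1 / Suc n \<and> 0 < t \<and> t < 1 / Suc n \<and>
    \<phi> (x + (1 / Suc n) *\<^sub>R j + (1 / Suc n) *\<^sub>R i) - \<phi> (x + (1 / Suc n) *\<^sub>R j) - \<phi> (x + (1 / Suc n) *\<^sub>R i) + \<phi> x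
      = (1 / Suc n) * ((1 / Suc n) * multi_deriv [i, j] \<phi> (x + s *\<^sub>R j + t *\<^sub>R i))"
    by (intro allI second_difference[OF \<phi> j i]) simp
  then obtain s' t' where st': "\<And>n. 0 < s' n \<and> s' n < 1 / Suc n" "\<And>n. 0 < t' n \<and> t' n < 1 / Suc n"
    "\<And>n. \<phi> (x + (1 / Suc n) *\<^sub>R j + (1 / Suc n) *\<^sub>R i) - \<phi> (x + (1 / Suc n) *\<^sub>R j) - \<phi> (x + (1 / Suc n) *\<^sub>R i) + \<phi> x
      = (1 / Suc n) * ((1 / Suc n) * multi_deriv [i, j] \<phi> (x + s' n *\<^sub>R j + t' n *\<^sub>R i))"
    unfolding choice_iff by blast
  have "multi_deriv [j, i] \<phi> (x + s n *\<^sub>R i + t n *\<^sub>R j) = multi_deriv [i, j] \<phi> (x + t' n *\<^sub>R i + s' n *\<^sub>R j)" for n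
  proof -
    have "(1 / Suc n) * ((1 / Suc n) * multi_deriv [j, i] \<phi> (x + s n *\<^sub>R i + t n *\<^sub>R j))
        = (1 / Suc n) * ((1 / Suc n) * multi_deriv [i, j] \<phi> (x + s' n *\<^sub>R j + t' n *\<^sub>R i))"
      unfolding st(3)[symmetric] st'(3)[symmetric] by (simp add: algebra_simps)
    then have "multi_deriv [j, i] \<phi> (x + s n *\<^sub>R i + t n *\<^sub>R j) = multi_deriv [i, j] \<phi> (x + s' n *\<^sub>R j + t' n *\<^sub>R i)"
      by simp
    then show ?thesis by (simp add: add.assoc add.commute add.left_commute)
  qed
  then have "(\<lambda>n. multi_deriv [j, i] \<phi> (x + s n *\<^sub>R i + t n *\<^sub>R j)) \<longlonglongrightarrow> multi_deriv [i, j] \<phi> x"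
    using lim[OF i j st'(2,1)] by simp
  from LIMSEQ_unique[OF this lim[OF j i st(1,2)]]
  show "multi_deriv [i, j] \<phi> x = multi_deriv [j, i] \<phi> x" .
qed

section \<open>Test functions and weak derivatives\<close>

lemma open_sets_lebesgue: "open U \<Longrightarrow> U \<in> sets lebesgue"
  by (intro sets_completionI_sets) simp

lemma multi_deriv_outside_support:
  assumes \<phi>: "smooth_fun \<phi>" and K: "closed K" "\<And>x. x \<notin> K \<Longrightarrow> \<phi> x = 0" and bs: "set bs \<subseteq> Basis" and x: "x \<notin> K"
  shows "multi_deriv bs \<phi> x = 0"
  using bs x
proof (induction bs arbitrary: x)
  case (Cons b bs)
  have "frechet_derivative (multi_deriv bs \<phi>) (at x) b = 0"
    by (rule has_derivative_outside_support[OF K(1) _ smooth_fun_has_derivative[OF \<phi>]])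
      (use Cons in auto)
  then show ?case by (simp add: multi_deriv_Cons partial_deriv_def)
qed (use K in simp)

lemma test_funs_support:
  assumes "\<phi> \<in> test_funs U"
  shows "\<exists>K. compact K \<and> K \<subseteq> U \<and> (\<forall>x. x \<notin> K \<longrightarrow> \<phi> x = 0)"
  using assms closure_subset[of "{x. \<phi> x \<noteq> 0}"]
  by (intro exI[of _ "closure {x. \<phi> x \<noteq> 0}"]) (auto simp: test_funs_def)

lemma test_funs_smooth: "\<phi> \<in> test_funs U \<Longrightarrow> smooth_fun \<phi>"
  by (simp add: test_funs_def)

lemma test_funsI:
  assumes "smooth_fun \<phi>" "compact K" "K \<subseteq> U" "\<And>x. x \<notin> K \<Longrightarrow> \<phi> x = 0"
  shows "\<phi> \<in> test_funs U"
proof -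
  have c: "closure {x. \<phi> x \<noteq> 0} \<subseteq> K"
    using assms by (intro closure_minimal compact_imp_closed) auto
  then have "bounded (closure {x. \<phi> x \<noteq> 0})"
    using bounded_subset[OF compact_imp_bounded[OF assms(2)]] by blast
  then have "compact (closure {x. \<phi> x \<noteq> 0})"
    by (simp add: compact_eq_bounded_closed)
  with c show ?thesis using assms by (auto simp: test_funs_def)
qed

lemma test_funs_multi_deriv:
  assumes "\<phi> \<in> test_funs U" "set bs \<subseteq> Basis"
  shows "multi_deriv bs \<phi> \<in> test_funs U"
proof -
  obtain K where K: "compact K" "K \<subseteq> U" "\<And>x. x \<notin> K \<Longrightarrow> \<phi> x = 0"
    using test_funs_support[OF assms(1)] by blast
  have sm: "smooth_fun \<phi>" using assms(1) by (rule test_funs_smooth)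
  show ?thesis
    by (rule test_funsI[OF smooth_fun_multi_deriv[OF sm assms(2)] K(1,2)])
      (rule multi_deriv_outside_support[OF sm compact_imp_closed[OF K(1)] K(3) assms(2)])
qed

lemma test_funs_mono: "U \<subseteq> W \<Longrightarrow> test_funs U \<subseteq> test_funs W"
  by (auto simp: test_funs_def)

lemma multi_deriv_lin:
  assumes "smooth_fun \<phi>" "smooth_fun \<eta>" "set bs \<subseteq> Basis"
  shows "multi_deriv bs (\<lambda>x. p * \<phi> x + q * \<eta> x) = (\<lambda>x. p * multi_deriv bs \<phi> x + q * multi_deriv bs \<eta> x)"
  using assms(3)
proof (induction bs)
  case (Cons b bs)
  have bs: "set bs \<subseteq> Basis" using Cons.prems by simp
  have IH: "multi_deriv bs (\<lambda>x. p * \<phi> x + q * \<eta> x) = (\<lambda>x. p * multi_deriv bs \<phi> x + q * multi_deriv bs \<eta> x)"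
    by (rule Cons.IH[OF bs])
  have D: "((\<lambda>x. p * multi_deriv bs \<phi> x + q * multi_deriv bs \<eta> x) has_derivative
      (\<lambda>h. p * frechet_derivative (multi_deriv bs \<phi>) (at x) h + q * frechet_derivative (multi_deriv bs \<eta>) (at x) h)) (at x)" for x
    by (intro has_derivative_add has_derivative_mult_right smooth_fun_has_derivative assms(1,2) bs)
  show ?case
    unfolding multi_deriv_Cons IH partial_deriv_eq[OF D] by (simp add: partial_deriv_def)
qed simp

lemma smooth_fun_lin:
  assumes "smooth_fun \<phi>" "smooth_fun \<eta>"
  shows "smooth_fun (\<lambda>x. p * \<phi> x + q * \<eta> x)"
  unfolding smooth_fun_def
proof (intro allI impI)
  fix bs :: "'a list" assume bs: "set bs \<subseteq> Basis"
  show "multi_deriv bs (\<lambda>x. p * \<phi> x + q * \<eta> x) differentiable_on UNIV"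
    unfolding multi_deriv_lin[OF assms bs]
    using assms bs by (auto simp: smooth_fun_def intro!: differentiable_on_add differentiable_on_mult differentiable_on_const)
qed

lemma test_funs_lin:
  assumes "\<phi> \<in> test_funs U" "\<eta> \<in> test_funs U"
  shows "(\<lambda>x. p * \<phi> x + q * \<eta> x) \<in> test_funs U"
proof -
  obtain K where K: "compact K" "K \<subseteq> U" "\<And>x. x \<notin> K \<Longrightarrow> \<phi> x = 0"
    using test_funs_support[OF assms(1)] by blast
  obtain L where L: "compact L" "L \<subseteq> U" "\<And>x. x \<notin> L \<Longrightarrow> \<eta> x = 0"
    using test_funs_support[OF assms(2)] by blast
  show ?thesis
    by (rule test_funsI[of _ "K \<union> L"])
      (use K L assms in \<open>auto intro!: smooth_fun_lin simp: test_funs_smooth\<close>)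
qed

lemma test_funs_zero: "(\<lambda>x. 0) \<in> test_funs U"
proof (rule test_funsI[of _ "{}"])
  show "smooth_fun (\<lambda>x::'a. 0)" by (rule gen_funs_smooth[OF gen_funs.const])
qed auto

lemma test_funs_continuous: "\<phi> \<in> test_funs U \<Longrightarrow> continuous_on S \<phi>"
  using smooth_fun_continuous[of \<phi> "[]"] by (simp add: test_funs_def)

lemma test_funs_integrable:
  assumes "\<phi> \<in> test_funs U" "continuous_on UNIV w"
  shows "integrable lebesgue (\<lambda>x. w x * \<phi> x)"
proof -
  obtain K where K: "compact K" "\<And>x. x \<notin> K \<Longrightarrow> \<phi> x = 0"
    using test_funs_support[OF assms(1)] by blast
  have "continuous_on K (\<lambda>x. w x * \<phi> x)"
    by (intro continuous_on_mult continuous_on_subset[OF assms(2)] test_funs_continuous[OF assms(1)]) auto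
  from borel_integrable_compact[OF K(1) this]
  have "integrable lborel (\<lambda>x. indicator K x *\<^sub>R (w x * \<phi> x))" .
  moreover have "(\<lambda>x. indicator K x *\<^sub>R (w x * \<phi> x)) = (\<lambda>x. w x * \<phi> x)"
    using K(2) by (auto simp: fun_eq_iff indicator_def)
  ultimately show ?thesis by (simp add: integrable_completion)
qed

lemma continuous_lebesgue_on_measurable:
  fixes w :: "'a::euclidean_space \<Rightarrow> real"
  assumes "continuous_on UNIV w"
  shows "w \<in> borel_measurable (lebesgue_on U)"
  using borel_measurable_continuous_onI[OF assms]
  by (intro measurable_restrict_space1) (auto simp: measurable_completion)

lemma test_funs_L2:
  assumes "\<phi> \<in> test_funs U" "W \<in> sets lebesgue"
  shows "\<phi> \<in> L2_space W"
proof -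
  have "integrable lebesgue (\<lambda>x. indicator W x *\<^sub>R (\<phi> x * \<phi> x))"
    using test_funs_integrable[OF assms(1) test_funs_continuous[OF assms(1)]]
    by (rule integrable_mult_indicator[OF assms(2)])
  then show ?thesis
    using continuous_lebesgue_on_measurable[OF test_funs_continuous[OF assms(1)]] assms(2)
    by (simp add: L2_space_def power2_eq_square integrable_restrict_space)
qed

lemma L2_inner_lebesgue:
  assumes "U \<in> sets lebesgue" "\<And>x. x \<notin> U \<Longrightarrow> v x * w x = 0"
  shows "L2_inner U v w = (LINT x|lebesgue. v x * w x)"
proof -
  have "L2_inner U v w = (LINT x|lebesgue. indicator U x *\<^sub>R (v x * w x))"
    unfolding L2_inner_def using assms(1) by (simp add: integral_restrict_space)
  also have "(\<lambda>x. indicator U x *\<^sub>R (v x * w x)) = (\<lambda>x. v x * w x)"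
    using assms(2) by (auto simp: fun_eq_iff indicator_def)
  finally show ?thesis .
qed

lemma test_funs_outside: "\<phi> \<in> test_funs U \<Longrightarrow> x \<notin> U \<Longrightarrow> \<phi> x = 0"
  using test_funs_support[of \<phi> U] by blast

text \<open>There is no boundary term: the product has compact support, so its directional
  derivative has integral zero over the whole space.\<close>

lemma test_funs_by_parts:
  fixes U :: "'a::euclidean_space set"
  assumes U: "U \<in> sets lebesgue" and b: "b \<in> Basis"
    and \<phi>: "\<phi> \<in> test_funs U" and \<eta>: "\<eta> \<in> test_funs U"
  shows "L2_inner U \<phi> (partial_deriv b \<eta>) = - L2_inner U (partial_deriv b \<phi>) \<eta>"
proof -
  have d\<phi>: "multi_deriv [b] \<phi> \<in> test_funs U" and d\<eta>: "multi_deriv [b] \<eta> \<in> test_funs U"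
    using test_funs_multi_deriv[OF \<phi>, of "[b]"] test_funs_multi_deriv[OF \<eta>, of "[b]"] b by simp_all
  obtain K where K: "compact K" "\<And>x. x \<notin> K \<Longrightarrow> \<eta> x = 0"
    using test_funs_support[OF \<eta>] by blast
  have D: "((\<lambda>x. \<phi> x * \<eta> x) has_derivative (\<lambda>h. \<phi> x * frechet_derivative \<eta> (at x) h + frechet_derivative \<phi> (at x) h * \<eta> x)) (at x)" for x
    using smooth_fun_has_derivative[OF test_funs_smooth[OF \<phi>], of "[]"] smooth_fun_has_derivative[OF test_funs_smooth[OF \<eta>], of "[]"]
    by (intro has_derivative_mult) auto
  have c: "continuous_on UNIV (\<lambda>x. \<phi> x * partial_deriv b \<eta> x + partial_deriv b \<phi> x * \<eta> x)"
    using test_funs_continuous[OF d\<phi>] test_funs_continuous[OF d\<eta>] test_funs_continuous[OF \<phi>] test_funs_continuous[OF \<eta>]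
    by (intro continuous_intros) (auto simp: multi_deriv_Cons)
  have "(LINT x|lebesgue. \<phi> x * partial_deriv b \<eta> x + partial_deriv b \<phi> x * \<eta> x) = 0"
    using integral_directional_deriv_0[OF D c[unfolded partial_deriv_def] K(1)] K(2) by (simp add: partial_deriv_def)
  moreover have "integrable lebesgue (\<lambda>x. \<phi> x * partial_deriv b \<eta> x)"
    using test_funs_integrable[OF d\<eta> test_funs_continuous[OF \<phi>]] by (simp add: multi_deriv_Cons)
  moreover have "integrable lebesgue (\<lambda>x. partial_deriv b \<phi> x * \<eta> x)"
    using test_funs_integrable[OF \<eta> test_funs_continuous[OF d\<phi>]] by (simp add: multi_deriv_Cons)
  ultimately have "(LINT x|lebesgue. \<phi> x * partial_deriv b \<eta> x) + (LINT x|lebesgue. partial_deriv b \<phi> x * \<eta> x) = 0"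
    by simp
  moreover have "L2_inner U \<phi> (partial_deriv b \<eta>) = (LINT x|lebesgue. \<phi> x * partial_deriv b \<eta> x)"
    by (rule L2_inner_lebesgue[OF U]) (simp add: test_funs_outside[OF \<phi>])
  moreover have "L2_inner U (partial_deriv b \<phi>) \<eta> = (LINT x|lebesgue. partial_deriv b \<phi> x * \<eta> x)"
    by (rule L2_inner_lebesgue[OF U]) (simp add: test_funs_outside[OF \<eta>])
  ultimately show ?thesis by simp
qed

text \<open>The derivatives are moved across one at a time, starting with the outermost, so they
  arrive in reversed order. This is the origin of every \<open>rev bs\<close> below.\<close>

lemma has_weak_deriv_test:
  fixes U :: "'a::euclidean_space set"
  assumes U: "U \<in> sets lebesgue" and "\<phi> \<in> test_funs U" "set bs \<subseteq> Basis"
  shows "has_weak_deriv U bs \<phi> (multi_deriv (rev bs) \<phi>)"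
  using assms(2,3)
proof (induction bs arbitrary: \<phi>)
  case Nil
  then show ?case by (simp add: has_weak_deriv_def)
next
  case (Cons b bs)
  show ?case unfolding has_weak_deriv_def
  proof
    fix \<eta> assume \<eta>: "\<eta> \<in> test_funs U"
    have bs: "b \<in> Basis" "set bs \<subseteq> Basis" using Cons.prems by auto
    have d\<eta>: "multi_deriv bs \<eta> \<in> test_funs U" by (rule test_funs_multi_deriv[OF \<eta> bs(2)])
    have d\<phi>: "multi_deriv [b] \<phi> \<in> test_funs U" using test_funs_multi_deriv[OF Cons.prems(1), of "[b]"] bs by simp
    have "L2_inner U \<phi> (multi_deriv (b # bs) \<eta>) = - L2_inner U (multi_deriv [b] \<phi>) (multi_deriv bs \<eta>)"
      using test_funs_by_parts[OF U bs(1) Cons.prems(1) d\<eta>] by (simp add: multi_deriv_Cons)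
    also have "L2_inner U (multi_deriv [b] \<phi>) (multi_deriv bs \<eta>) = (- 1) ^ length bs * L2_inner U (multi_deriv (rev bs) (multi_deriv [b] \<phi>)) \<eta>"
      using Cons.IH[OF d\<phi> bs(2)] \<eta> unfolding has_weak_deriv_def by blast
    finally show "L2_inner U \<phi> (multi_deriv (b # bs) \<eta>) = (- 1) ^ length (b # bs) * L2_inner U (multi_deriv (rev (b # bs)) \<phi>) \<eta>"
      by (simp add: multi_deriv_append)
  qed
qed

text \<open>Open boxes form an intersection-stable generator of the Borel sets, so vanishing
  integrals spread to all Borel sets; \<open>tot\<close> serves the complements. Lebesgue sets
  differ from Borel sets by null sets, and a density is determined by its integrals.\<close>

lemma integral_zero_boxes_imp_AE:
  fixes G :: "'a::euclidean_space \<Rightarrow> real"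
  assumes G: "integrable lebesgue G"
    and 0: "\<And>a b. (LINT x|lebesgue. indicat_real (box a b) x * G x) = 0" and tot: "(LINT x|lebesgue. G x) = 0"
  shows "AE x in lebesgue. G x = 0"
proof -
  have I: "set_integrable lebesgue A G" if "A \<in> sets lebesgue" for A
    unfolding set_integrable_def using integrable_mult_indicator[OF that G] .
  have bor: "(LINT x:A|lebesgue. G x) = 0" if A: "A \<in> sets borel" for A
  proof -
    let ?B = "range (\<lambda>(a, b). box a b) :: 'a set set"
    have "Int_stable ?B" by (auto simp: Int_stable_def box_Int_box)
    have leb: "X \<in> sets lebesgue" if "X \<in> sigma_sets UNIV ?B" for X
    proof -
      have "X \<in> sets borel" using that by (subst borel_eq_box) simp
      then show ?thesis by (intro sets_completionI_sets) simp
    qed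
    note \<open>Int_stable ?B\<close>
    moreover have "?B \<subseteq> Pow UNIV" by simp
    moreover have "A \<in> sigma_sets UNIV ?B" using A by (subst (asm) borel_eq_box) simp
    ultimately show ?thesis
    proof (induction rule: sigma_sets_induct_disjoint)
      case (basic X)
      then show ?case using 0 by (auto simp: set_lebesgue_integral_def)
    next
      case (compl X)
      have "(LINT x:(X \<union> (UNIV - X))|lebesgue. G x) = (LINT x:X|lebesgue. G x) + (LINT x:(UNIV - X)|lebesgue. G x)"
        using leb[OF compl(1)] by (intro set_integral_Un I) auto
      then show ?case using compl tot by (simp add: set_lebesgue_integral_def)
    next
      case (union X)
      have "X i \<in> sets lebesgue" for i using union(2) by (intro leb) blast
      then have "(LINT x:(\<Union>i. X i)|lebesgue. G x) = (\<Sum>i. (LINT x:(X i)|lebesgue. G x))"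
        using union(1) by (intro lebesgue_integral_countable_add I) (auto simp: disjoint_family_on_def)
      then show ?case using union by simp
    qed (auto simp: set_lebesgue_integral_def)
  qed
  have "(LINT x:A|lebesgue. G x) = (LINT x:A|lebesgue. 0)" if A: "A \<in> sets lebesgue" for A
  proof -
    obtain S N N' where *: "A = S \<union> N" "N \<subseteq> N'" "N' \<in> null_sets lborel" "S \<in> sets lborel"
      using A by (rule sets_completionE)
    then have "AE x in lebesgue. x \<notin> N'"
      by (intro AE_not_in) (auto simp: null_sets_completionI)
    then have ae: "AE x in lebesgue. indicat_real A x *\<^sub>R G x = indicat_real S x *\<^sub>R G x"
      by (rule eventually_mono) (use * in \<open>auto simp: indicator_def\<close>)
    have "S \<in> sets lebesgue" using * by (intro sets_completionI_sets)
    then have "(LINT x:A|lebesgue. G x) = (LINT x:S|lebesgue. G x)"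
      unfolding set_lebesgue_integral_def
      using I[OF A] I[of S] by (intro integral_cong_AE ae) (auto simp: set_integrable_def)
    then show ?thesis using bor[of S] * by (simp add: set_lebesgue_integral_def)
  qed
  with density_unique_real[OF G, of "\<lambda>_. 0"] show ?thesis by simp
qed

text \<open>On a set of finite measure \<open>\<bar>y\<bar> \<le> y^2 + 1\<close> gives a majorant.
  The indicator appears in the integrand because \<open>g\<close> is unrestricted outside
  \<open>U\<close>.\<close>

lemma L2_integrable_bounded:
  assumes g: "g \<in> L2_space U" and U: "U \<in> sets lebesgue" and W: "W \<subseteq> U" "W \<in> lmeasurable"
  shows "integrable lebesgue (\<lambda>x. indicat_real W x * g x)"
proof -
  have gi: "integrable lebesgue (\<lambda>x. indicat_real U x *\<^sub>R (g x)\<^sup>2)" and m: "(\<lambda>x. indicat_real U x *\<^sub>R g x) \<in> borel_measurable lebesgue"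
    using g U by (auto simp: L2_space_def integrable_restrict_space borel_measurable_restrict_space_iff)
  have "integrable lebesgue (indicat_real W)" using W by (intro integrable_real_indicator) (auto simp: fmeasurable_def)
  with gi have "integrable lebesgue (\<lambda>x. indicat_real U x *\<^sub>R (g x)\<^sup>2 + indicat_real W x)"
    by (rule Bochner_Integration.integrable_add)
  then show ?thesis
  proof (rule Bochner_Integration.integrable_bound)
    have "(\<lambda>x. indicat_real W x * (indicat_real U x *\<^sub>R g x)) \<in> borel_measurable lebesgue"
      using m W by (intro borel_measurable_times borel_measurable_indicator) (auto simp: fmeasurableD)
    moreover have "(\<lambda>x. indicat_real W x * (indicat_real U x *\<^sub>R g x)) = (\<lambda>x. indicat_real W x * g x)"
      using W by (auto simp: fun_eq_iff indicator_def)
    ultimately show "(\<lambda>x. indicat_real W x * g x) \<in> borel_measurable lebesgue" by simp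
    have "\<bar>y\<bar> \<le> y\<^sup>2 + 1" for y :: real
      using zero_le_power2[of "\<bar>y\<bar> - 1"] by (simp add: power2_diff)
    then show "AE x in lebesgue. norm (indicat_real W x * g x) \<le> norm (indicat_real U x *\<^sub>R (g x)\<^sup>2 + indicat_real W x)"
      using W by (intro AE_I2) (auto simp: indicator_def)
  qed
qed

lemma ex_cbox_cover:
  fixes U :: "'a::euclidean_space set"
  shows "open U \<Longrightarrow> \<exists>\<D>. countable \<D> \<and> \<D> \<subseteq> Pow U \<and> (\<forall>X\<in>\<D>. \<exists>a b. X = cbox a b) \<and> \<Union>\<D> = U"
  by (erule open_countable_Union_open_cbox, rule exI, intro conjI ballI)

text \<open>Bump functions converge boundedly to indicators of boxes, so \<open>g\<close> has
  integral zero over every box whose closed box lies in \<open>U\<close>. Inside one fixed closed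
  box this suffices for \<open>g\<close> to vanish almost everywhere, and \<open>U\<close> is a
  countable union of closed boxes.\<close>

theorem fundamental_lemma:
  fixes U :: "'a::euclidean_space set"
  assumes U: "open U" and g: "g \<in> L2_space U" and 0: "\<And>\<phi>. \<phi> \<in> test_funs U \<Longrightarrow> L2_inner U g \<phi> = 0"
  shows "ae_eq U g (\<lambda>x. 0)"
proof -
  have Us: "U \<in> sets lebesgue" by (rule open_sets_lebesgue[OF U])
  have box0: "(LINT x|lebesgue. indicat_real (box a b) x * g x) = 0" if ab: "cbox a b \<subseteq> U" for a b
  proof -
    have "(\<lambda>n. LINT x|lebesgue_on U. g x * bump a b n x) \<longlonglongrightarrow> (LINT x|lebesgue_on U. g x * indicat_real (box a b) x)"
    proof (rule integral_dominated_convergence[where w = "\<lambda>x. \<bar>indicat_real (box a b) x * g x\<bar>"])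
      have bU: "box a b \<subseteq> U" using ab box_subset_cbox by blast
      have I: "integrable lebesgue (\<lambda>x. indicat_real (box a b) x * g x)"
        by (rule L2_integrable_bounded[OF g Us bU]) simp
      moreover have "(\<lambda>x. indicat_real U x *\<^sub>R \<bar>indicat_real (box a b) x * g x\<bar>) = (\<lambda>x. \<bar>indicat_real (box a b) x * g x\<bar>)"
        using bU by (auto simp: fun_eq_iff indicator_def)
      ultimately show "integrable (lebesgue_on U) (\<lambda>x. \<bar>indicat_real (box a b) x * g x\<bar>)"
        using Us by (simp add: integrable_restrict_space)
      show "AE x in lebesgue_on U. (\<lambda>n. g x * bump a b n x) \<longlonglongrightarrow> g x * indicat_real (box a b) x"
        by (intro AE_I2 tendsto_mult tendsto_const bump_tendsto)
      show "AE x in lebesgue_on U. norm (g x * bump a b n x) \<le> \<bar>indicat_real (box a b) x * g x\<bar>" for n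
      proof (intro AE_I2)
        fix x show "norm (g x * bump a b n x) \<le> \<bar>indicat_real (box a b) x * g x\<bar>"
          using bump_bounds[of a b n x] bump_nz[of a b n x]
          by (cases "x \<in> box a b") (auto simp: abs_mult mult_left_le)
      qed
      show gm: "(\<lambda>x. g x * bump a b n x) \<in> borel_measurable (lebesgue_on U)" for n
        using g test_funs_L2[OF bump_test[OF ab] Us, of n] by (intro borel_measurable_times) (auto simp: L2_space_def)
      have "indicat_real (box a b) \<in> borel_measurable lebesgue"
        by (intro borel_measurable_indicator open_sets_lebesgue open_box)
      then have "indicat_real (box a b) \<in> borel_measurable (lebesgue_on U)"
        by (rule measurable_restrict_space1)
      then show "(\<lambda>x. g x * indicat_real (box a b) x) \<in> borel_measurable (lebesgue_on U)"
        using g by (intro borel_measurable_times) (auto simp: L2_space_def)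
    qed
    moreover have "(LINT x|lebesgue_on U. g x * bump a b n x) = 0" for n
      using 0[OF bump_test[OF ab]] by (simp add: L2_inner_def)
    ultimately have "(LINT x|lebesgue_on U. g x * indicat_real (box a b) x) = 0"
      by (simp add: LIMSEQ_const_iff)
    moreover have "(LINT x|lebesgue_on U. g x * indicat_real (box a b) x) = (LINT x|lebesgue. indicat_real (box a b) x * g x)"
    proof -
      have "(\<lambda>x. indicat_real U x *\<^sub>R (g x * indicat_real (box a b) x)) = (\<lambda>x. indicat_real (box a b) x * g x)"
        using ab box_subset_cbox[of a b] by (auto simp: fun_eq_iff indicator_def)
      then show ?thesis using Us by (simp add: integral_restrict_space)
    qed
    ultimately show ?thesis by simp
  qed
  have cb: "AE x in lebesgue. x \<in> cbox p q \<longrightarrow> g x = 0" if pq: "cbox p q \<subseteq> U" for p q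
  proof -
    have bU: "box p q \<subseteq> U" using pq box_subset_cbox by blast
    have "AE x in lebesgue. indicat_real (box p q) x * g x = 0"
    proof (rule integral_zero_boxes_imp_AE)
      show "integrable lebesgue (\<lambda>x. indicat_real (box p q) x * g x)"
        by (rule L2_integrable_bounded[OF g Us bU]) simp
      show "(LINT x|lebesgue. indicat_real (box p q) x * g x) = 0" by (rule box0[OF pq])
      fix a b
      \<comment> \<open>An arbitrary box is first cut down to \<open>box p q\<close>. The
        intersection is again a box, and its closure stays inside \<open>U\<close>, where
        \<open>box0\<close> applies.\<close>
      obtain a' b' where ab: "box a b \<inter> box p q = box a' b'" using box_Int_box[of a b p q] by blast
      have "(\<lambda>x. indicat_real (box a b) x * (indicat_real (box p q) x * g x)) = (\<lambda>x. indicat_real (box a' b') x * g x)"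
        using ab by (auto simp: fun_eq_iff indicator_def)
      moreover have "(LINT x|lebesgue. indicat_real (box a' b') x * g x) = 0"
      proof (cases "box a' b' = {}")
        case False
        have "cbox a' b' = closure (box a' b')" using closure_box[OF False] by simp
        also have "\<dots> \<subseteq> cbox p q"
          using ab box_subset_cbox[of p q] by (intro closure_minimal) auto
        finally show ?thesis using box0 pq by blast
      qed simp
      ultimately show "(LINT x|lebesgue. indicat_real (box a b) x * (indicat_real (box p q) x * g x)) = 0" by simp
    qed
    moreover have "AE x in lebesgue. x \<notin> cbox p q - box p q"
      using negligible_frontier_interval[of p q] by (intro AE_not_in) (simp add: negligible_iff_null_sets)
    ultimately show ?thesis
      by eventually_elim (auto simp: indicator_def)
  qed
  obtain \<D> where D: "countable \<D>" "\<D> \<subseteq> Pow U" "\<forall>X\<in>\<D>. \<exists>a b. X = cbox a b" "\<Union>\<D> = U"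
    using ex_cbox_cover[OF U] by blast
  have "AE x in lebesgue. \<forall>X\<in>\<D>. x \<in> X \<longrightarrow> g x = 0"
    unfolding AE_ball_countable[OF D(1)]
  proof
    fix X assume X: "X \<in> \<D>"
    then obtain a b where "X = cbox a b" using D(3) by blast
    then show "AE x in lebesgue. x \<in> X \<longrightarrow> g x = 0" using cb[of a b] D(2) X by auto
  qed
  then have "AE x in lebesgue. x \<in> U \<longrightarrow> g x = 0"
    by (rule eventually_mono) (use D(4) in auto)
  then show ?thesis using Us by (simp add: ae_eq_def AE_restrict_space_iff)
qed

lemma ae_eq_mult_right: "ae_eq U v w \<Longrightarrow> ae_eq U (\<lambda>x. v x * z x) (\<lambda>x. w x * z x)"
  unfolding ae_eq_def by (erule eventually_mono) simp

text \<open>Integrability is transferred in both directions, so the equality of integrals also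
  covers nonintegrable functions, whose integral is 0 by convention.\<close>

lemma integral_cong_ae_eq:
  fixes U :: "'a::euclidean_space set"
  assumes U: "U \<in> sets lebesgue" and ae: "ae_eq U v w"
  shows "integrable (lebesgue_on U) v \<longleftrightarrow> integrable (lebesgue_on U) w"
    and "integral\<^sup>L (lebesgue_on U) v = integral\<^sup>L (lebesgue_on U) w"
proof -
  have m: "v \<in> borel_measurable (lebesgue_on U) \<longleftrightarrow> w \<in> borel_measurable (lebesgue_on U)"
    using lebesgue_on_measurable_AE[OF U] ae ae_eq_sym[OF ae] unfolding ae_eq_def by blast
  show i: "integrable (lebesgue_on U) v \<longleftrightarrow> integrable (lebesgue_on U) w"
    using m ae integrable_cong_AE[of v "lebesgue_on U" w] borel_measurable_integrable[of "lebesgue_on U" v]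
      borel_measurable_integrable[of "lebesgue_on U" w] unfolding ae_eq_def by blast
  show "integral\<^sup>L (lebesgue_on U) v = integral\<^sup>L (lebesgue_on U) w"
  proof (cases "integrable (lebesgue_on U) v")
    case True
    then show ?thesis using i ae unfolding ae_eq_def
      by (intro integral_cong_AE) (auto dest: borel_measurable_integrable)
  next
    case False
    then show ?thesis using i by (simp add: not_integrable_integral_eq)
  qed
qed

lemma L2_inner_ae: "U \<in> sets lebesgue \<Longrightarrow> ae_eq U v w \<Longrightarrow> L2_inner U v z = L2_inner U w z"
  unfolding L2_inner_def by (intro integral_cong_ae_eq ae_eq_mult_right)

lemma L2_inner_ae2: "U \<in> sets lebesgue \<Longrightarrow> ae_eq U v w \<Longrightarrow> L2_inner U z v = L2_inner U z w"
  using L2_inner_ae[of U v w z] by (simp add: L2_inner_def mult.commute)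

lemma L2_norm_ae: "U \<in> sets lebesgue \<Longrightarrow> ae_eq U v w \<Longrightarrow> L2_norm U v = L2_norm U w"
  unfolding L2_norm_def by (simp add: L2_inner_ae[of U v w] L2_inner_ae2[of U v w])

lemma L2_space_ae:
  assumes "U \<in> sets lebesgue" "ae_eq U v w" "v \<in> L2_space U"
  shows "w \<in> L2_space U"
proof -
  have "ae_eq U (\<lambda>x. (v x)\<^sup>2) (\<lambda>x. (w x)\<^sup>2)"
    using assms(2) unfolding ae_eq_def by (rule eventually_mono) simp
  then show ?thesis
    using lebesgue_on_measurable_AE[OF assms(1) assms(2)[unfolded ae_eq_def]]
      integral_cong_ae_eq(1)[OF assms(1)] assms(3) by (auto simp: L2_space_def)
qed

lemma has_weak_deriv_ae: "U \<in> sets lebesgue \<Longrightarrow> ae_eq U v w \<Longrightarrow> has_weak_deriv U bs v = has_weak_deriv U bs w"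
  unfolding has_weak_deriv_def fun_eq_iff by (simp add: L2_inner_ae[of U v w])

lemma weak_deriv_ae: "U \<in> sets lebesgue \<Longrightarrow> ae_eq U v w \<Longrightarrow> weak_deriv U bs v = weak_deriv U bs w"
  unfolding weak_deriv_def by (simp add: has_weak_deriv_ae[of U v w])

lemma weak_deriv_some:
  assumes "\<exists>g\<in>L2_space U. has_weak_deriv U bs v g"
  shows "weak_deriv U bs v \<in> L2_space U" "has_weak_deriv U bs v (weak_deriv U bs v)"
proof -
  have "\<exists>g. g \<in> L2_space U \<and> has_weak_deriv U bs v g" using assms by blast
  from someI_ex[OF this] show "weak_deriv U bs v \<in> L2_space U" "has_weak_deriv U bs v (weak_deriv U bs v)"
    unfolding weak_deriv_def by auto
qed

lemma weak_deriv_unique: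
  assumes U: "open U" and g: "g \<in> L2_space U" "h \<in> L2_space U" "has_weak_deriv U bs v g" "has_weak_deriv U bs v h"
  shows "ae_eq U g h"
proof -
  have "L2_inner U (\<lambda>x. g x - h x) \<phi> = 0" if \<phi>: "\<phi> \<in> test_funs U" for \<phi>
  proof -
    have "(- 1) ^ length bs * L2_inner U g \<phi> = (- 1) ^ length bs * L2_inner U h \<phi>"
      using g(3,4) \<phi> unfolding has_weak_deriv_def by metis
    then show ?thesis
      using test_funs_L2[OF \<phi> open_sets_lebesgue[OF U]] g by (simp add: L2.diff_left)
  qed
  from fundamental_lemma[OF U L2.diff_mem[OF g(1,2)] this] show ?thesis by (simp add: ae_eq_diff0_iff)
qed

lemma weak_deriv_eq:
  assumes "open U" "g \<in> L2_space U" "has_weak_deriv U bs v g"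
  shows "ae_eq U (weak_deriv U bs v) g"
  using weak_deriv_unique[OF assms(1) weak_deriv_some(1) assms(2) weak_deriv_some(2) assms(3)] assms by blast

lemma has_weak_deriv_lin:
  assumes U: "open U" and L: "v \<in> L2_space U" "w \<in> L2_space U" "g \<in> L2_space U" "h \<in> L2_space U"
    and bs: "set bs \<subseteq> Basis" and "has_weak_deriv U bs v g" "has_weak_deriv U bs w h"
  shows "has_weak_deriv U bs (\<lambda>x. p * v x + q * w x) (\<lambda>x. p * g x + q * h x)"
  unfolding has_weak_deriv_def
proof
  fix \<phi> assume \<phi>: "\<phi> \<in> test_funs U"
  note Us = open_sets_lebesgue[OF U]
  have d\<phi>: "multi_deriv bs \<phi> \<in> L2_space U" "\<phi> \<in> L2_space U"
    using test_funs_L2[OF test_funs_multi_deriv[OF \<phi> bs] Us] test_funs_L2[OF \<phi> Us] by auto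
  have "L2_inner U v (multi_deriv bs \<phi>) = (- 1) ^ length bs * L2_inner U g \<phi>"
    "L2_inner U w (multi_deriv bs \<phi>) = (- 1) ^ length bs * L2_inner U h \<phi>"
    using assms(7,8) \<phi> unfolding has_weak_deriv_def by auto
  then show "L2_inner U (\<lambda>x. p * v x + q * w x) (multi_deriv bs \<phi>) = (- 1) ^ length bs * L2_inner U (\<lambda>x. p * g x + q * h x) \<phi>"
    using L d\<phi> by (simp add: L2.lin_left algebra_simps)
qed

section \<open>The space of clamped functions\<close>

lemma finite_deriv_idx: "finite (deriv_idx k)"
  unfolding deriv_idx_def using finite_lists_length_eq[of Basis k] by simp

lemma deriv_idx_0: "deriv_idx 0 = {[]}"
  by (auto simp: deriv_idx_def)

lemma deriv_idx_Basis: "bs \<in> deriv_idx k \<Longrightarrow> set bs \<subseteq> Basis"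
  by (simp add: deriv_idx_def)

lemma sobolev_space_2_iff:
  "v \<in> sobolev_space U 2 \<longleftrightarrow> v \<in> L2_space U \<and> (\<forall>k\<le>2. \<forall>bs\<in>deriv_idx k. \<exists>g\<in>L2_space U. has_weak_deriv U bs v g)"
  by (simp add: sobolev_space_def)

lemma sobolev_norm_2:
  "sobolev_norm U 2 v = sqrt (\<Sum>k\<le>2. \<Sum>bs\<in>deriv_idx k. (L2_norm U (weak_deriv U bs v))\<^sup>2)"
  by (simp add: sobolev_norm_def)

lemma sobolev_norm_0: "sobolev_norm U 0 v = \<bar>L2_norm U (weak_deriv U [] v)\<bar>"
  by (simp add: sobolev_norm_def deriv_idx_0)

lemma sobolev_space_ae:
  assumes "U \<in> sets lebesgue" "ae_eq U v w" "v \<in> sobolev_space U s"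
  shows "w \<in> sobolev_space U s"
  using assms(3) L2_space_ae[OF assms(1,2)] unfolding sobolev_space_def
  by (simp add: has_weak_deriv_ae[OF assms(1,2)] weak_deriv_ae[OF assms(1,2)])

lemma sobolev_norm_ae:
  assumes "U \<in> sets lebesgue" "ae_eq U v w"
  shows "sobolev_norm U s v = sobolev_norm U s w"
  unfolding sobolev_norm_def by (simp add: weak_deriv_ae[OF assms])

lemma H20_ae:
  assumes "U \<in> sets lebesgue" "ae_eq U v w" "v \<in> H20 U"
  shows "w \<in> H20 U"
proof -
  have "sobolev_norm U 2 (\<lambda>x. v x - \<phi> x) = sobolev_norm U 2 (\<lambda>x. w x - \<phi> x)" for \<phi>
    by (intro sobolev_norm_ae assms(1) ae_eq_diff assms(2) ae_eq_refl)
  then show ?thesis using assms(3) sobolev_space_ae[OF assms(1,2)] by (simp add: H20_def)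
qed

lemma sobolev2_weak_deriv:
  assumes "v \<in> sobolev_space U 2" "k \<le> 2" "bs \<in> deriv_idx k"
  shows "weak_deriv U bs v \<in> L2_space U" "has_weak_deriv U bs v (weak_deriv U bs v)"
proof -
  have "\<exists>g\<in>L2_space U. has_weak_deriv U bs v g" using assms by (simp add: sobolev_space_2_iff)
  then show "weak_deriv U bs v \<in> L2_space U" "has_weak_deriv U bs v (weak_deriv U bs v)"
    using weak_deriv_some by blast+
qed

lemma sobolev2_lin:
  assumes U: "open U" and v: "v \<in> sobolev_space U 2" and w: "w \<in> sobolev_space U 2"
  shows "(\<lambda>x. p * v x + q * w x) \<in> sobolev_space U 2"
    and "k \<le> 2 \<Longrightarrow> bs \<in> deriv_idx k \<Longrightarrow>
      ae_eq U (weak_deriv U bs (\<lambda>x. p * v x + q * w x)) (\<lambda>x. p * weak_deriv U bs v x + q * weak_deriv U bs w x)"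
proof -
  have L: "v \<in> L2_space U" "w \<in> L2_space U" using v w by (auto simp: sobolev_space_2_iff)
  have *: "(\<lambda>x. p * weak_deriv U bs v x + q * weak_deriv U bs w x) \<in> L2_space U \<and>
     has_weak_deriv U bs (\<lambda>x. p * v x + q * w x) (\<lambda>x. p * weak_deriv U bs v x + q * weak_deriv U bs w x)"
    if "k \<le> 2" "bs \<in> deriv_idx k" for k bs
    using sobolev2_weak_deriv[OF v that] sobolev2_weak_deriv[OF w that] L
    by (intro conjI L2.lin_mem has_weak_deriv_lin[OF U]) (auto simp: deriv_idx_Basis[OF that(2)])
  then show "(\<lambda>x. p * v x + q * w x) \<in> sobolev_space U 2"
    using L by (auto simp: sobolev_space_2_iff L2.lin_mem)
  show "k \<le> 2 \<Longrightarrow> bs \<in> deriv_idx k \<Longrightarrow>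
      ae_eq U (weak_deriv U bs (\<lambda>x. p * v x + q * w x)) (\<lambda>x. p * weak_deriv U bs v x + q * weak_deriv U bs w x)"
    using * by (intro weak_deriv_eq[OF U]) auto
qed

lemma weak_deriv_test:
  assumes U: "open U" and \<phi>: "\<phi> \<in> test_funs U" and bs: "set bs \<subseteq> Basis"
  shows "ae_eq U (weak_deriv U bs \<phi>) (multi_deriv (rev bs) \<phi>)"
  using bs by (intro weak_deriv_eq[OF U] has_weak_deriv_test test_funs_L2[OF test_funs_multi_deriv[OF \<phi>]] \<phi> open_sets_lebesgue[OF U]) auto

lemma test_sobolev2:
  fixes U :: "'a::euclidean_space set"
  assumes U: "open U" and \<phi>: "\<phi> \<in> test_funs U"
  shows "\<phi> \<in> sobolev_space U 2"
  unfolding sobolev_space_2_iff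
proof (intro conjI allI impI ballI)
  note Us = open_sets_lebesgue[OF U]
  show "\<phi> \<in> L2_space U" by (rule test_funs_L2[OF \<phi> Us])
  fix k and bs :: "'a list" assume "bs \<in> deriv_idx k"
  then have "set bs \<subseteq> Basis" by (rule deriv_idx_Basis)
  then show "\<exists>g\<in>L2_space U. has_weak_deriv U bs \<phi> g"
    using has_weak_deriv_test[OF Us \<phi>] test_funs_L2[OF test_funs_multi_deriv[OF \<phi>] Us, of "rev bs"] by auto
qed

lemma weak_deriv_diff_test:
  assumes U: "open U" and v: "v \<in> sobolev_space U 2" and \<phi>: "\<phi> \<in> test_funs U" and k: "k \<le> 2" "bs \<in> deriv_idx k"
  shows "ae_eq U (weak_deriv U bs (\<lambda>x. v x - \<phi> x)) (\<lambda>x. weak_deriv U bs v x - multi_deriv (rev bs) \<phi> x)"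
  using ae_eq_trans[OF sobolev2_lin(2)[OF U v test_sobolev2[OF U \<phi>] k, of 1 "-1"]
    ae_eq_lin[OF ae_eq_refl weak_deriv_test[OF U \<phi> deriv_idx_Basis[OF k(2)]], of 1 _ "-1"]] by simp

lemma sobolev_norm_2_tendsto_0_iff:
  fixes U :: "'a::euclidean_space set"
  shows "((\<lambda>n. sobolev_norm U 2 (z n)) \<longlongrightarrow> 0) F \<longleftrightarrow> (\<forall>k\<le>2. \<forall>bs\<in>deriv_idx k. ((\<lambda>n. L2_norm U (weak_deriv U bs (z n))) \<longlongrightarrow> 0) F)"
proof (intro iffI allI impI ballI)
  fix k and bs :: "'a list" assume lim: "((\<lambda>n. sobolev_norm U 2 (z n)) \<longlongrightarrow> 0) F" and k: "k \<le> 2" "bs \<in> deriv_idx k"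
  have "\<bar>L2_norm U (weak_deriv U bs (z n))\<bar> \<le> sobolev_norm U 2 (z n)" for n
  proof -
    have "(L2_norm U (weak_deriv U bs (z n)))\<^sup>2 \<le> (\<Sum>bs\<in>deriv_idx k. (L2_norm U (weak_deriv U bs (z n)))\<^sup>2)"
      using k finite_deriv_idx by (intro member_le_sum) auto
    also have "\<dots> \<le> (\<Sum>k\<le>2. \<Sum>bs\<in>deriv_idx k. (L2_norm U (weak_deriv U bs (z n)))\<^sup>2)"
      using k by (intro member_le_sum sum_nonneg) auto
    finally show ?thesis unfolding sobolev_norm_2 by (rule real_le_rsqrt[of "\<bar>_\<bar>", simplified power2_abs])
  qed
  then show "((\<lambda>n. L2_norm U (weak_deriv U bs (z n))) \<longlongrightarrow> 0) F"
    by (intro Lim_null_comparison[OF _ lim]) auto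
next
  assume *: "\<forall>k\<le>2. \<forall>bs\<in>deriv_idx k. ((\<lambda>n. L2_norm U (weak_deriv U bs (z n))) \<longlongrightarrow> 0) F"
  have "((\<lambda>n. sobolev_norm U 2 (z n)) \<longlongrightarrow> sqrt (\<Sum>k\<le>2. \<Sum>bs\<in>(deriv_idx k :: 'a list set). 0\<^sup>2)) F"
    unfolding sobolev_norm_2 using * by (intro tendsto_intros) auto
  then show "((\<lambda>n. sobolev_norm U 2 (z n)) \<longlongrightarrow> 0) F" by simp
qed

text \<open>Convergence in the Sobolev norm is unfolded into L2 convergence of each derivative, with
  the weak derivatives of the approximants replaced by classical ones. All later limits in
  \<open>H20\<close> are taken in this form.\<close>

lemma H20_iff:
  assumes U: "open U"
  shows "v \<in> H20 U \<longleftrightarrow> v \<in> sobolev_space U 2 \<and> (\<exists>\<phi>. (\<forall>n::nat. \<phi> n \<in> test_funs U) \<and>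
    (\<forall>k\<le>2. \<forall>bs\<in>deriv_idx k. (\<lambda>n. L2_norm U (\<lambda>x. weak_deriv U bs v x - multi_deriv (rev bs) (\<phi> n) x)) \<longlonglongrightarrow> 0))"
proof -
  have "(\<lambda>n. sobolev_norm U 2 (\<lambda>x. v x - \<phi> n x)) \<longlonglongrightarrow> 0 \<longleftrightarrow>
    (\<forall>k\<le>2. \<forall>bs\<in>deriv_idx k. (\<lambda>n. L2_norm U (\<lambda>x. weak_deriv U bs v x - multi_deriv (rev bs) (\<phi> n) x)) \<longlonglongrightarrow> 0)"
    if v: "v \<in> sobolev_space U 2" and \<phi>: "\<forall>n. \<phi> n \<in> test_funs U" for \<phi>
  proof -
    have "L2_norm U (weak_deriv U bs (\<lambda>x. v x - \<phi> n x)) = L2_norm U (\<lambda>x. weak_deriv U bs v x - multi_deriv (rev bs) (\<phi> n) x)"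
      if "k \<le> 2" "bs \<in> deriv_idx k" for k bs n
      by (rule L2_norm_ae[OF open_sets_lebesgue[OF U] weak_deriv_diff_test[OF U v _ that]]) (use \<phi> in simp)
    then show ?thesis unfolding sobolev_norm_2_tendsto_0_iff by simp
  qed
  then show ?thesis unfolding H20_def by (simp cong: conj_cong)
qed

lemma H20_sobolev: "v \<in> H20 U \<Longrightarrow> v \<in> sobolev_space U 2"
  by (simp add: H20_def)

lemma H20_L2: "v \<in> H20 U \<Longrightarrow> v \<in> L2_space U"
  by (simp add: H20_def sobolev_space_2_iff)

lemma H20_weak_deriv_L2: "v \<in> H20 U \<Longrightarrow> bs \<in> deriv_idx 2 \<Longrightarrow> weak_deriv U bs v \<in> L2_space U"
  using sobolev2_weak_deriv(1)[OF H20_sobolev] by blast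

lemma test_H20: "open U \<Longrightarrow> \<phi> \<in> test_funs U \<Longrightarrow> \<phi> \<in> H20 U"
proof -
  assume U: "open U" and \<phi>: "\<phi> \<in> test_funs U"
  have "L2_norm U (\<lambda>x. weak_deriv U bs \<phi> x - multi_deriv (rev bs) \<phi> x) = 0" if "bs \<in> deriv_idx k" for bs k
  proof -
    have "ae_eq U (\<lambda>x. weak_deriv U bs \<phi> x - multi_deriv (rev bs) \<phi> x) (\<lambda>x. 0)"
      using weak_deriv_test[OF U \<phi> deriv_idx_Basis[OF that]] by (simp add: ae_eq_diff0_iff)
    from L2_norm_ae[OF open_sets_lebesgue[OF U] this] show ?thesis by (simp add: L2_norm_def L2_inner_def)
  qed
  then show ?thesis
    unfolding H20_iff[OF U] using test_sobolev2[OF U \<phi>] \<phi> by (intro conjI exI[of _ "\<lambda>_. \<phi>"]) auto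
qed

text \<open>The same linear combination of the two approximating sequences approximates; most of the
  work is moving chosen weak derivatives, which are linear only up to null sets, into this
  form.\<close>

lemma H20_lin:
  assumes U: "open U" and v: "v \<in> H20 U" and w: "w \<in> H20 U"
  shows "(\<lambda>x. p * v x + q * w x) \<in> H20 U"
proof -
  note Us = open_sets_lebesgue[OF U]
  obtain \<phi> where \<phi>: "\<forall>n::nat. \<phi> n \<in> test_funs U"
    "\<forall>k\<le>2. \<forall>bs\<in>deriv_idx k. (\<lambda>n. L2_norm U (\<lambda>x. weak_deriv U bs v x - multi_deriv (rev bs) (\<phi> n) x)) \<longlonglongrightarrow> 0"
    using v unfolding H20_iff[OF U] by blast
  obtain \<eta> where \<eta>: "\<forall>n::nat. \<eta> n \<in> test_funs U"
    "\<forall>k\<le>2. \<forall>bs\<in>deriv_idx k. (\<lambda>n. L2_norm U (\<lambda>x. weak_deriv U bs w x - multi_deriv (rev bs) (\<eta> n) x)) \<longlonglongrightarrow> 0"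
    using w unfolding H20_iff[OF U] by blast
  note vs = H20_sobolev[OF v] and ws = H20_sobolev[OF w]
  have "(\<lambda>n. L2_norm U (\<lambda>x. weak_deriv U bs (\<lambda>x. p * v x + q * w x) x - multi_deriv (rev bs) (\<lambda>x. p * \<phi> n x + q * \<eta> n x) x)) \<longlonglongrightarrow> 0"
    if k: "k \<le> 2" "bs \<in> deriv_idx k" for k bs
  proof (rule Lim_null_comparison)
    let ?a = "\<lambda>n x. weak_deriv U bs v x - multi_deriv (rev bs) (\<phi> n) x"
    let ?b = "\<lambda>n x. weak_deriv U bs w x - multi_deriv (rev bs) (\<eta> n) x"
    have "(\<lambda>n. \<bar>p\<bar> * L2_norm U (?a n) + \<bar>q\<bar> * L2_norm U (?b n)) \<longlonglongrightarrow> \<bar>p\<bar> * 0 + \<bar>q\<bar> * 0"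
      using \<phi>(2) \<eta>(2) k by (intro tendsto_intros) auto
    then show "(\<lambda>n. \<bar>p\<bar> * L2_norm U (?a n) + \<bar>q\<bar> * L2_norm U (?b n)) \<longlonglongrightarrow> 0" by simp
    have rb: "set (rev bs) \<subseteq> Basis" using deriv_idx_Basis[OF k(2)] by simp
    have "norm (L2_norm U (\<lambda>x. weak_deriv U bs (\<lambda>x. p * v x + q * w x) x - multi_deriv (rev bs) (\<lambda>x. p * \<phi> n x + q * \<eta> n x) x))
      \<le> \<bar>p\<bar> * L2_norm U (?a n) + \<bar>q\<bar> * L2_norm U (?b n)" for n
    proof -
      have sm: "smooth_fun (\<phi> n)" "smooth_fun (\<eta> n)" using \<phi>(1) \<eta>(1) test_funs_smooth by blast+
      have L: "?a n \<in> L2_space U" "?b n \<in> L2_space U"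
        using sobolev2_weak_deriv(1)[OF vs k] sobolev2_weak_deriv(1)[OF ws k] \<phi>(1) \<eta>(1)
        by (auto intro!: L2.diff_mem test_funs_L2[OF test_funs_multi_deriv[OF _ rb] Us])
      have "ae_eq U (\<lambda>x. weak_deriv U bs (\<lambda>x. p * v x + q * w x) x - multi_deriv (rev bs) (\<lambda>x. p * \<phi> n x + q * \<eta> n x) x)
         (\<lambda>x. (p * weak_deriv U bs v x + q * weak_deriv U bs w x) - (p * multi_deriv (rev bs) (\<phi> n) x + q * multi_deriv (rev bs) (\<eta> n) x))"
        unfolding multi_deriv_lin[OF sm rb] by (rule ae_eq_diff[OF sobolev2_lin(2)[OF U vs ws k] ae_eq_refl])
      then have "L2_norm U (\<lambda>x. weak_deriv U bs (\<lambda>x. p * v x + q * w x) x - multi_deriv (rev bs) (\<lambda>x. p * \<phi> n x + q * \<eta> n x) x)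
        = L2_norm U (\<lambda>x. p * ?a n x + q * ?b n x)"
        using L2_norm_ae[OF Us] by (simp add: algebra_simps)
      also have "\<dots> \<le> L2_norm U (\<lambda>x. p * ?a n x) + L2_norm U (\<lambda>x. q * ?b n x)"
        by (intro L2.nm_triangle L2.scale_mem L)
      also have "\<dots> = \<bar>p\<bar> * L2_norm U (?a n) + \<bar>q\<bar> * L2_norm U (?b n)"
        using L by (simp add: L2_norm_def L2.scale_scale real_sqrt_mult)
      finally show ?thesis by (simp add: L2_norm_def L2_inner_def)
    qed
    then show "\<forall>\<^sub>F n in sequentially. norm (L2_norm U (\<lambda>x. weak_deriv U bs (\<lambda>x. p * v x + q * w x) x - multi_deriv (rev bs) (\<lambda>x. p * \<phi> n x + q * \<eta> n x) x))
      \<le> \<bar>p\<bar> * L2_norm U (?a n) + \<bar>q\<bar> * L2_norm U (?b n)" by simp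
  qed
  then show ?thesis
    unfolding H20_iff[OF U] using \<phi>(1) \<eta>(1) sobolev2_lin(1)[OF U vs ws]
    by (intro conjI exI[of _ "\<lambda>n x. p * \<phi> n x + q * \<eta> n x"]) (auto intro: test_funs_lin)
qed

lemma plate_semi_ip:
  assumes U: "open U"
  shows "semi_ip (H20 U) (plate_form U)"
proof
  note Us = open_sets_lebesgue[OF U]
  show "(\<lambda>x. 0) \<in> H20 U" by (rule test_H20[OF U test_funs_zero])
  fix v w z assume v: "v \<in> H20 U" and w: "w \<in> H20 U"
  show "plate_form U v w = plate_form U w v"
    unfolding plate_form_def by (simp add: L2_inner_def mult.commute)
  show "0 \<le> plate_form U v v"
    unfolding plate_form_def by (simp add: L2_inner_def sum_nonneg)
  fix p q
  show "(\<lambda>x. p * v x + q * w x) \<in> H20 U" by (rule H20_lin[OF U v w])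
  assume z: "z \<in> H20 U"
  have "L2_inner U (weak_deriv U bs (\<lambda>x. p * v x + q * w x)) (weak_deriv U bs z)
     = p * L2_inner U (weak_deriv U bs v) (weak_deriv U bs z) + q * L2_inner U (weak_deriv U bs w) (weak_deriv U bs z)"
    if bs: "bs \<in> deriv_idx 2" for bs
    using L2_inner_ae[OF Us sobolev2_lin(2)[OF U H20_sobolev[OF v] H20_sobolev[OF w] _ bs]]
      H20_weak_deriv_L2[OF v bs] H20_weak_deriv_L2[OF w bs] H20_weak_deriv_L2[OF z bs]
    by (simp add: L2.lin_left)
  then show "plate_form U (\<lambda>x. p * v x + q * w x) z = p * plate_form U v z + q * plate_form U w z"
    unfolding plate_form_def by (simp add: sum.distrib sum_distrib_left)
qed

lemma plate_form_ae:
  assumes "U \<in> sets lebesgue" "ae_eq U v w"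
  shows "plate_form U v z = plate_form U w z" "plate_form U z v = plate_form U z w"
  unfolding plate_form_def by (simp_all add: weak_deriv_ae[OF assms])

section \<open>Completeness of the L2 space and the Poincare inequality\<close>

lemma L2_inner_self_nonneg: "0 \<le> L2_inner U v v"
  by (simp add: L2_inner_def)

lemma L2_norm_nonneg: "0 \<le> L2_norm U v"
  by (simp add: L2_norm_def L2_inner_self_nonneg)

lemma L2_norm_sq: "(L2_norm U v)\<^sup>2 = L2_inner U v v"
  by (simp add: L2_norm_def L2_inner_self_nonneg)

lemma L2_norm_minus_commute: "L2_norm U (\<lambda>x. v x - w x) = L2_norm U (\<lambda>x. w x - v x)"
  unfolding L2_norm_def L2_inner_def by (simp add: algebra_simps)

lemma nn_integral_L2:
  assumes "v \<in> L2_space U"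
  shows "(\<integral>\<^sup>+x. ennreal ((v x)\<^sup>2) \<partial>lebesgue_on U) = ennreal ((L2_norm U v)\<^sup>2)"
  using assms unfolding L2_norm_sq
  by (subst nn_integral_eq_integral) (auto simp: L2_space_def L2_inner_def power2_eq_square)

lemma one_L2: "U \<in> lmeasurable \<Longrightarrow> (\<lambda>x. 1) \<in> L2_space U"
  by (auto simp: L2_space_def finite_measure.integrable_const finite_measure_lebesgue_on)

lemma abs_L2: "v \<in> L2_space U \<Longrightarrow> (\<lambda>x. \<bar>v x\<bar>) \<in> L2_space U"
  by (auto simp: L2_space_def)

lemma L2_abs_integral_le:
  assumes U: "U \<in> lmeasurable" and v: "v \<in> L2_space U"
  shows "integrable (lebesgue_on U) v" "(LINT x|lebesgue_on U. \<bar>v x\<bar>) \<le> L2_norm U (\<lambda>x. 1) * L2_norm U v"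
proof -
  show "integrable (lebesgue_on U) v" using L2_mult_integrable[OF v one_L2[OF U]] by simp
  have "L2_norm U (\<lambda>x. \<bar>v x\<bar>) = L2_norm U v" by (simp add: L2_norm_def L2_inner_def)
  then show "(LINT x|lebesgue_on U. \<bar>v x\<bar>) \<le> L2_norm U (\<lambda>x. 1) * L2_norm U v"
    using L2.cauchy_schwarz[OF one_L2[OF U] abs_L2[OF v]] by (simp add: L2_inner_def)
qed

text \<open>A subsequence whose increments have norm at most \<open>(1 / 2) ^ j\<close> is chosen.
  On a set of finite measure these increments are also summable in L1, so the subsequence converges
  almost everywhere; Fatou's lemma then bounds the distance of the whole sequence to the pointwise
  limit.\<close>

theorem L2_complete:
  fixes F :: "nat \<Rightarrow> 'a::euclidean_space \<Rightarrow> real"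
  assumes U: "U \<in> lmeasurable" and F: "\<And>n. F n \<in> L2_space U"
    and cau: "\<And>e. e > 0 \<Longrightarrow> \<exists>N. \<forall>m\<ge>N. \<forall>n\<ge>N. L2_norm U (\<lambda>x. F m x - F n x) < e"
  shows "\<exists>g\<in>L2_space U. (\<lambda>n. L2_norm U (\<lambda>x. F n x - g x)) \<longlonglongrightarrow> 0"
proof -
  have "\<forall>j. \<exists>N. \<forall>m\<ge>N. \<forall>n\<ge>N. L2_norm U (\<lambda>x. F m x - F n x) < (1 / 2) ^ j"
    using cau by simp
  then obtain N where N: "\<And>j m n. m \<ge> N j \<Longrightarrow> n \<ge> N j \<Longrightarrow> L2_norm U (\<lambda>x. F m x - F n x) < (1 / 2) ^ j"
    unfolding choice_iff by blast
  \<comment> \<open>Summing the thresholds makes the index sequence increasing and at least as large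
    as each \<open>N j\<close>; the summand \<open>j\<close> makes it tend to infinity.\<close>
  define r where "r j = (\<Sum>i\<le>j. N i) + j" for j
  have rN: "N j \<le> r j" for j
    unfolding r_def by (rule trans_le_add1, rule member_le_sum) auto
  have rS: "r j \<le> r (Suc j)" for j by (simp add: r_def)
  have rj: "j \<le> r j" for j by (simp add: r_def)
  define d where "d j = (\<lambda>x. F (r (Suc j)) x - F (r j) x)" for j
  have dL: "d j \<in> L2_space U" for j unfolding d_def by (intro L2.diff_mem F)
  have dn: "L2_norm U (d j) \<le> (1 / 2) ^ j" for j
    unfolding d_def using N[of j "r (Suc j)" "r j"] rN[of j] rS[of j] by simp
  have m: "F n \<in> borel_measurable (lebesgue_on U)" for n using F[of n] by (simp add: L2_space_def)
  have dm [measurable]: "d j \<in> borel_measurable (lebesgue_on U)" for j using dL[of j] by (simp add: L2_space_def)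
  define C where "C = L2_norm U (\<lambda>x. 1)"
  have "(\<integral>\<^sup>+x. (\<Sum>j. ennreal \<bar>d j x\<bar>) \<partial>lebesgue_on U) = (\<Sum>j. \<integral>\<^sup>+x. ennreal \<bar>d j x\<bar> \<partial>lebesgue_on U)"
    by (rule nn_integral_suminf) simp
  also have "\<dots> \<le> (\<Sum>j. ennreal (C * (1 / 2) ^ j))"
  proof (rule suminf_le)
    fix j
    have "(\<integral>\<^sup>+x. ennreal \<bar>d j x\<bar> \<partial>lebesgue_on U) = ennreal (LINT x|lebesgue_on U. \<bar>d j x\<bar>)"
      using L2_abs_integral_le(1)[OF U dL[of j]] by (intro nn_integral_eq_integral) auto
    also have "\<dots> \<le> ennreal (C * (1 / 2) ^ j)"
      using L2_abs_integral_le(2)[OF U dL[of j]] dn[of j] mult_left_mono[OF dn[of j] L2_norm_nonneg[of U "\<lambda>x. 1"]]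
      unfolding C_def by (intro ennreal_leI) linarith
    finally show "(\<integral>\<^sup>+x. ennreal \<bar>d j x\<bar> \<partial>lebesgue_on U) \<le> ennreal (C * (1 / 2) ^ j)" .
  qed auto
  also have "\<dots> < \<infinity>"
  proof -
    have "summable (\<lambda>j. C * (1 / 2) ^ j)" by (intro summable_mult) simp
    then have "(\<Sum>j. ennreal (C * (1 / 2) ^ j)) = ennreal (\<Sum>j. C * (1 / 2) ^ j)"
      by (intro suminf_ennreal2) (auto simp: C_def L2_norm_nonneg)
    then show ?thesis by simp
  qed
  finally have "AE x in lebesgue_on U. (\<Sum>j. ennreal \<bar>d j x\<bar>) \<noteq> \<infinity>"
    by (intro nn_integral_PInf_AE) auto
  then have conv: "AE x in lebesgue_on U. convergent (\<lambda>j. F (r j) x)"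
  proof eventually_elim
    case (elim x)
    then have "summable (\<lambda>j. \<bar>d j x\<bar>)" by (intro summable_suminf_not_top) auto
    then have "summable (\<lambda>j. d j x)" by (rule summable_rabs_cancel)
    then have "convergent (\<lambda>n. (\<Sum>j<n. d j x) + F (r 0) x)"
      by (intro convergent_add convergent_const) (simp add: summable_iff_convergent)
    moreover have "(\<Sum>j<n. d j x) + F (r 0) x = F (r n) x" for n
      unfolding d_def by (induction n) auto
    ultimately show ?case by simp
  qed
  define g where "g x = lim (\<lambda>j. F (r j) x)" for x
  have gm [measurable]: "g \<in> borel_measurable (lebesgue_on U)"
    unfolding g_def by (rule borel_measurable_lim_metric) (rule m)
  have lim: "AE x in lebesgue_on U. (\<lambda>j. F (r j) x) \<longlonglongrightarrow> g x"
    using conv by eventually_elim (simp add: g_def convergent_LIMSEQ_iff)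
  have bnd: "(\<integral>\<^sup>+x. ennreal ((F n x - g x)\<^sup>2) \<partial>lebesgue_on U) \<le> ennreal (((1 / 2) ^ j)\<^sup>2)" if n: "n \<ge> N j" for n j
  proof -
    have "(\<integral>\<^sup>+x. ennreal ((F n x - g x)\<^sup>2) \<partial>lebesgue_on U)
      = (\<integral>\<^sup>+x. liminf (\<lambda>i. ennreal ((F n x - F (r i) x)\<^sup>2)) \<partial>lebesgue_on U)"
    proof (rule nn_integral_cong_AE)
      show "AE x in lebesgue_on U. ennreal ((F n x - g x)\<^sup>2) = liminf (\<lambda>i. ennreal ((F n x - F (r i) x)\<^sup>2))"
        using lim
      proof eventually_elim
        case (elim x)
        then have "(\<lambda>i. ennreal ((F n x - F (r i) x)\<^sup>2)) \<longlonglongrightarrow> ennreal ((F n x - g x)\<^sup>2)"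
          by (intro tendsto_ennrealI tendsto_intros)
        then show ?case by (metis lim_imp_Liminf trivial_limit_sequentially)
      qed
    qed
    also have "\<dots> \<le> liminf (\<lambda>i. \<integral>\<^sup>+x. ennreal ((F n x - F (r i) x)\<^sup>2) \<partial>lebesgue_on U)"
      using m by (intro nn_integral_liminf) auto
    also have "\<dots> \<le> liminf (\<lambda>i. ennreal (((1 / 2) ^ j)\<^sup>2))"
    proof (rule Liminf_mono)
      show "\<forall>\<^sub>F i in sequentially. (\<integral>\<^sup>+x. ennreal ((F n x - F (r i) x)\<^sup>2) \<partial>lebesgue_on U) \<le> ennreal (((1 / 2) ^ j)\<^sup>2)"
        using eventually_ge_at_top[of "N j"]
      proof eventually_elim
        case (elim i)
        then have "L2_norm U (\<lambda>x. F n x - F (r i) x) \<le> (1 / 2) ^ j"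
          using N[of j n "r i"] n rj[of i] by simp
        then have "(L2_norm U (\<lambda>x. F n x - F (r i) x))\<^sup>2 \<le> ((1 / 2) ^ j)\<^sup>2"
          by (intro power_mono L2_norm_nonneg)
        then show ?case by (subst nn_integral_L2) (auto intro!: L2.diff_mem F ennreal_leI)
      qed
    qed
    finally show ?thesis by (simp add: Liminf_const)
  qed
  have dif: "(\<lambda>x. F n x - g x) \<in> L2_space U" if "n \<ge> N j" for n j
    unfolding L2_space_def
  proof (intro CollectI conjI)
    show mm: "(\<lambda>x. F n x - g x) \<in> borel_measurable (lebesgue_on U)" using m by simp
    show "integrable (lebesgue_on U) (\<lambda>x. (F n x - g x)\<^sup>2)"
      using bnd[OF that] mm by (intro integrableI_bounded) (auto intro: le_less_trans)
  qed
  have gL: "g \<in> L2_space U"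
    using L2.diff_mem[OF F dif[OF order_refl, of 0], of "N 0"] by simp
  have "(\<lambda>n. L2_norm U (\<lambda>x. F n x - g x)) \<longlonglongrightarrow> 0"
  proof (rule LIMSEQ_I)
    fix e :: real assume "e > 0"
    then obtain j where j: "(1 / 2) ^ j < e" using real_arch_pow_inv[of e "1 / 2"] by auto
    have "norm (L2_norm U (\<lambda>x. F n x - g x) - 0) < e" if n: "n \<ge> N j" for n
    proof -
      have "ennreal ((L2_norm U (\<lambda>x. F n x - g x))\<^sup>2) \<le> ennreal (((1 / 2) ^ j)\<^sup>2)"
        using bnd[OF n] nn_integral_L2[OF dif[OF n]] by simp
      then have "(L2_norm U (\<lambda>x. F n x - g x))\<^sup>2 \<le> ((1 / 2) ^ j)\<^sup>2"
        by (subst (asm) ennreal_le_iff) auto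
      then have "L2_norm U (\<lambda>x. F n x - g x) \<le> (1 / 2) ^ j"
        by (rule power2_le_imp_le) simp
      then show ?thesis using j L2_norm_nonneg[of U "\<lambda>x. F n x - g x"] by simp
    qed
    then show "\<exists>no. \<forall>n\<ge>no. norm (L2_norm U (\<lambda>x. F n x - g x) - 0) < e" by blast
  qed
  then show ?thesis using gL by blast
qed

text \<open>The derivative of \<open>(x \<bullet> b) * (\<phi> x)^2\<close> in direction
  \<open>b\<close> has integral zero. Since \<open>b \<bullet> b = 1\<close>, this expresses the
  squared norm of \<open>\<phi>\<close> as -2 times its product with \<open>(x \<bullet> b)\<close>
  times the derivative, and Cauchy-Schwarz finishes with
  \<open>\<bar>x \<bullet> b\<bar> \<le> R\<close>.\<close>

lemma poincare_test:
  fixes U :: "'a::euclidean_space set"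
  assumes U: "open U" and \<phi>: "\<phi> \<in> test_funs U" and b: "b \<in> Basis" and R: "\<And>x. x \<in> U \<Longrightarrow> \<bar>x \<bullet> b\<bar> \<le> R" and R0: "R \<ge> 0"
  shows "L2_norm U \<phi> \<le> 2 * R * L2_norm U (multi_deriv [b] \<phi>)"
proof -
  note Us = open_sets_lebesgue[OF U]
  let ?d = "multi_deriv [b] \<phi>"
  have d: "?d \<in> test_funs U" using test_funs_multi_deriv[OF \<phi>, of "[b]"] b by simp
  have dL: "?d \<in> L2_space U" and \<phi>L: "\<phi> \<in> L2_space U" using test_funs_L2[OF d Us] test_funs_L2[OF \<phi> Us] by auto
  obtain K where K: "compact K" "\<And>x. x \<notin> K \<Longrightarrow> \<phi> x = 0" using test_funs_support[OF \<phi>] by blast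
  have c: "continuous_on UNIV \<phi>" "continuous_on UNIV ?d" using test_funs_continuous \<phi> d by blast+
  have Dfun: "((\<lambda>x. (x \<bullet> b) * (\<phi> x * \<phi> x)) has_derivative
     (\<lambda>h. (x \<bullet> b) * (\<phi> x * frechet_derivative \<phi> (at x) h + frechet_derivative \<phi> (at x) h * \<phi> x) + (h \<bullet> b) * (\<phi> x * \<phi> x))) (at x)" for x
    using smooth_fun_has_derivative[OF test_funs_smooth[OF \<phi>], of "[]" x]
    by (intro has_derivative_mult) (auto intro!: has_derivative_inner_left has_derivative_ident)
  have db: "frechet_derivative \<phi> (at x) b = ?d x" for x by (simp add: multi_deriv_Cons partial_deriv_def)
  have bb: "b \<bullet> b = 1" using b by simp
  have "(LINT x|lebesgue. (x \<bullet> b) * (\<phi> x * ?d x + ?d x * \<phi> x) + 1 * (\<phi> x * \<phi> x)) = 0"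
  proof -
    have "continuous_on UNIV (\<lambda>x. (x \<bullet> b) * (\<phi> x * ?d x + ?d x * \<phi> x) + 1 * (\<phi> x * \<phi> x))"
      using c by (intro continuous_intros)
    then show ?thesis
      using integral_directional_deriv_0[OF Dfun _ K(1), of b] K(2) unfolding db bb by simp
  qed
  then have z: "(LINT x|lebesgue. 2 * (\<phi> x * ((x \<bullet> b) * ?d x)) + \<phi> x * \<phi> x) = 0"
    by (simp add: algebra_simps)
  let ?g = "\<lambda>x. (x \<bullet> b) * ?d x"
  have cg: "continuous_on UNIV ?g" using c by (intro continuous_intros)
  have ig: "integrable lebesgue (\<lambda>x. \<phi> x * ?g x)"
    using test_funs_integrable[OF \<phi> cg] by (simp add: mult.commute)
  have "integrable lebesgue (\<lambda>x. \<phi> x * \<phi> x)" by (rule test_funs_integrable[OF \<phi> c(1)])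
  then have "2 * (LINT x|lebesgue. \<phi> x * ?g x) + (LINT x|lebesgue. \<phi> x * \<phi> x) = 0"
    using z ig by simp
  moreover have "L2_inner U \<phi> ?g = (LINT x|lebesgue. \<phi> x * ?g x)" "L2_inner U \<phi> \<phi> = (LINT x|lebesgue. \<phi> x * \<phi> x)"
    by (rule L2_inner_lebesgue[OF Us], simp add: test_funs_outside[OF \<phi>])+
  ultimately have eq: "L2_inner U \<phi> \<phi> = - 2 * L2_inner U \<phi> ?g" by simp
  have i2: "integrable (lebesgue_on U) (\<lambda>x. ?g x * ?g x)"
  proof -
    have "integrable lebesgue (\<lambda>x. ((x \<bullet> b) * ?g x) * ?d x)"
      using c cg by (intro test_funs_integrable[OF d] continuous_intros)
    then have "integrable lebesgue (\<lambda>x. indicator U x *\<^sub>R (((x \<bullet> b) * ?g x) * ?d x))"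
      by (rule integrable_mult_indicator[OF Us])
    then show ?thesis using Us by (simp add: integrable_restrict_space algebra_simps)
  qed
  have gL: "?g \<in> L2_space U"
    using continuous_lebesgue_on_measurable[OF cg] i2 by (simp add: L2_space_def power2_eq_square)
  have "L2_inner U ?g ?g \<le> (LINT x|lebesgue_on U. R\<^sup>2 * (?d x * ?d x))"
    unfolding L2_inner_def
  proof (rule integral_mono[OF i2])
    show "integrable (lebesgue_on U) (\<lambda>x. R\<^sup>2 * (?d x * ?d x))"
      using L2_mult_integrable[OF dL dL] by simp
    fix x assume "x \<in> space (lebesgue_on U)"
    then have "(x \<bullet> b)\<^sup>2 \<le> R\<^sup>2" using R[of x] R0 by (simp add: abs_le_square_iff[symmetric])
    then have "(x \<bullet> b)\<^sup>2 * (?d x)\<^sup>2 \<le> R\<^sup>2 * (?d x)\<^sup>2" by (rule mult_right_mono) simp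
    then show "?g x * ?g x \<le> R\<^sup>2 * (?d x * ?d x)" by (simp add: power2_eq_square algebra_simps)
  qed
  then have "(L2_norm U ?g)\<^sup>2 \<le> (R * L2_norm U ?d)\<^sup>2"
    by (simp add: L2_norm_sq power_mult_distrib L2_inner_def)
  then have gd: "L2_norm U ?g \<le> R * L2_norm U ?d"
    by (rule power2_le_imp_le) (simp add: R0 L2_norm_nonneg)
  have "(L2_norm U \<phi>)\<^sup>2 \<le> 2 * (L2_norm U \<phi> * L2_norm U ?g)"
    using L2.cauchy_schwarz[OF \<phi>L gL] eq by (simp add: L2_norm_sq)
  also have "\<dots> \<le> 2 * (L2_norm U \<phi> * (R * L2_norm U ?d))"
    by (intro mult_left_mono gd L2_norm_nonneg) auto
  finally have "L2_norm U \<phi> * L2_norm U \<phi> \<le> L2_norm U \<phi> * (2 * R * L2_norm U ?d)"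
    by (simp add: power2_eq_square algebra_simps)
  then show ?thesis
    using L2_norm_nonneg[of U \<phi>] R0 L2_norm_nonneg[of U ?d]
    by (cases "L2_norm U \<phi> = 0") (auto simp: mult_le_cancel_left)
qed

lemma L2_norm_tendsto:
  assumes "\<And>n. v n \<in> L2_space U" "w \<in> L2_space U" "((\<lambda>n. L2_norm U (\<lambda>x. w x - v n x)) \<longlongrightarrow> 0) F"
  shows "((\<lambda>n. L2_norm U (v n)) \<longlongrightarrow> L2_norm U w) F"
  using L2.nm_tendsto[of v U F w] assms by (simp add: L2_norm_minus_commute[of U w])

lemma plate_form_sq: "plate_form U v v = (\<Sum>bs\<in>deriv_idx 2. (L2_norm U (weak_deriv U bs v))\<^sup>2)"
  by (simp add: plate_form_def L2_norm_sq)

lemma H20_test_approx: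
  fixes U :: "'a::euclidean_space set"
  assumes U: "open U" and v: "v \<in> H20 U"
  obtains \<phi> :: "nat \<Rightarrow> 'a \<Rightarrow> real" where "\<forall>n. \<phi> n \<in> test_funs U"
    "\<forall>k\<le>2. \<forall>bs\<in>deriv_idx k. (\<lambda>n. L2_norm U (\<lambda>x. weak_deriv U bs v x - multi_deriv (rev bs) (\<phi> n) x)) \<longlonglongrightarrow> 0"
    "\<forall>k\<le>2. \<forall>bs\<in>deriv_idx k. (\<lambda>n. L2_norm U (multi_deriv (rev bs) (\<phi> n))) \<longlonglongrightarrow> L2_norm U (weak_deriv U bs v)"
    "(\<lambda>n. L2_norm U (\<lambda>x. \<phi> n x - v x)) \<longlonglongrightarrow> 0"
proof -
  note Us = open_sets_lebesgue[OF U]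
  obtain \<phi> where \<phi>: "\<forall>n::nat. \<phi> n \<in> test_funs U"
    "\<forall>k\<le>2. \<forall>bs\<in>deriv_idx k. (\<lambda>n. L2_norm U (\<lambda>x. weak_deriv U bs v x - multi_deriv (rev bs) (\<phi> n) x)) \<longlonglongrightarrow> 0"
    using v unfolding H20_iff[OF U] by blast
  have 3: "\<forall>k\<le>2. \<forall>bs\<in>deriv_idx k. (\<lambda>n. L2_norm U (multi_deriv (rev bs) (\<phi> n))) \<longlonglongrightarrow> L2_norm U (weak_deriv U bs v)"
  proof (intro allI impI ballI L2_norm_tendsto)
    fix k n :: nat and bs :: "'a list" assume k: "k \<le> 2" "bs \<in> deriv_idx k"
    show "weak_deriv U bs v \<in> L2_space U" by (rule sobolev2_weak_deriv(1)[OF H20_sobolev[OF v] k])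
    show "(\<lambda>n. L2_norm U (\<lambda>x. weak_deriv U bs v x - multi_deriv (rev bs) (\<phi> n) x)) \<longlonglongrightarrow> 0" using \<phi>(2) k by blast
    show "multi_deriv (rev bs) (\<phi> n) \<in> L2_space U"
      using \<phi>(1) deriv_idx_Basis[OF k(2)] by (intro test_funs_L2[OF test_funs_multi_deriv Us, of _ U]) auto
  qed
  have "ae_eq U (weak_deriv U [] v) v"
    by (rule weak_deriv_eq[OF U H20_L2[OF v]]) (simp add: has_weak_deriv_def)
  then have "ae_eq U (\<lambda>x. weak_deriv U [] v x - \<phi> n x) (\<lambda>x. v x - \<phi> n x)" for n
    by (rule ae_eq_diff[OF _ ae_eq_refl])
  from L2_norm_ae[OF Us this] have "(\<lambda>n. L2_norm U (\<lambda>x. v x - \<phi> n x)) \<longlonglongrightarrow> 0"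
    using \<phi>(2)[rule_format, of 0 "[]"] by (simp add: deriv_idx_0)
  then have 4: "(\<lambda>n. L2_norm U (\<lambda>x. \<phi> n x - v x)) \<longlonglongrightarrow> 0"
    by (simp add: L2_norm_minus_commute[of U v])
  show thesis by (rule that[OF \<phi> 3 4])
qed

text \<open>Each derivative of order at most two of a test function is controlled by a single second
  derivative, obtained by differentiating further in one direction. The bound passes to
  \<open>H20\<close> by density.\<close>

lemma poincare_H20:
  fixes U :: "'a::euclidean_space set"
  assumes U: "open U" "bounded U"
  shows "\<exists>K>0. \<forall>v\<in>H20 U. \<forall>k\<le>2. \<forall>bs\<in>deriv_idx k. (L2_norm U (weak_deriv U bs v))\<^sup>2 \<le> K * plate_form U v v"
proof -
  obtain R0 where R0: "R0 > 0" "\<And>x. x \<in> U \<Longrightarrow> norm x \<le> R0" using U(2) by (auto simp: bounded_pos)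
  \<comment> \<open>\<open>M\<close> exceeds all three factors that occur: 1 for order two,
    \<open>2 * R0\<close> for order one and \<open>(2 * R0)^2\<close> for order zero.\<close>
  define M where "M = (max 1 (2 * R0))\<^sup>2"
  have m1: "1 \<le> max 1 (2 * R0)" by simp
  have M: "1 \<le> M" "2 * R0 \<le> M" "2 * R0 * (2 * R0) \<le> M"
  proof -
    show "1 \<le> M" unfolding M_def using m1 by simp
    have "max 1 (2 * R0) \<le> M" unfolding M_def power2_eq_square using mult_left_mono[OF m1, of "max 1 (2 * R0)"] by simp
    then show "2 * R0 \<le> M" by simp
    show "2 * R0 * (2 * R0) \<le> M" unfolding M_def power2_eq_square using R0(1) by (intro mult_mono) auto
  qed
  have R: "\<bar>x \<bullet> b\<bar> \<le> R0" if "x \<in> U" "b \<in> Basis" for x b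
    using Basis_le_norm[OF that(2), of x] R0(2)[OF that(1)] by simp
  have P: "L2_norm U \<eta> \<le> 2 * R0 * L2_norm U (multi_deriv [b] \<eta>)" if "b \<in> Basis" "\<eta> \<in> test_funs U" for b \<eta>
    using poincare_test[OF U(1) that(2,1) R[OF _ that(1)]] R0(1) by simp
  \<comment> \<open>The index \<open>cs\<close> has to be independent of \<open>\<phi>\<close>,
    since it must be the same along the approximating sequence.\<close>
  have ex: "\<exists>cs\<in>deriv_idx 2. \<forall>\<phi>\<in>test_funs U. L2_norm U (multi_deriv (rev bs) \<phi>) \<le> M * L2_norm U (multi_deriv (rev cs) \<phi>)"
    if k: "k \<le> 2" "bs \<in> deriv_idx k" for k and bs :: "'a list"
  proof -
    have p1: "L2_norm U (multi_deriv [b] \<phi>) \<le> 2 * R0 * L2_norm U (multi_deriv [b, b] \<phi>)"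
      if "b \<in> Basis" "\<phi> \<in> test_funs U" for b \<phi>
      using P[OF that(1) test_funs_multi_deriv[OF that(2), of "[b]"]] that by (simp add: multi_deriv_Cons)
    consider "k = 0" | "k = 1" | "k = 2" using k(1) by linarith
    then show ?thesis
    proof cases
      case 1
      define b :: 'a where "b = (SOME i. i \<in> Basis)"
      have b: "b \<in> Basis" unfolding b_def by (rule SOME_Basis)
      have "L2_norm U \<phi> \<le> M * L2_norm U (multi_deriv [b, b] \<phi>)" if \<phi>: "\<phi> \<in> test_funs U" for \<phi>
      proof -
        have "L2_norm U \<phi> \<le> 2 * R0 * (2 * R0 * L2_norm U (multi_deriv [b, b] \<phi>))"
          by (rule order_trans[OF P[OF b \<phi>] mult_left_mono[OF p1[OF b \<phi>]]]) (use R0(1) in simp)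
        also have "\<dots> \<le> M * L2_norm U (multi_deriv [b, b] \<phi>)"
          using mult_right_mono[OF M(3) L2_norm_nonneg[of U "multi_deriv [b, b] \<phi>"]] by (simp add: mult.assoc mult.left_commute)
        finally show ?thesis .
      qed
      then show ?thesis using 1 k b by (intro bexI[of _ "[b, b]"]) (auto simp: deriv_idx_def)
    next
      case 2
      then obtain b where b: "bs = [b]" "b \<in> Basis" using k by (auto simp: deriv_idx_def length_Suc_conv)
      have "L2_norm U (multi_deriv [b] \<phi>) \<le> M * L2_norm U (multi_deriv [b, b] \<phi>)" if \<phi>: "\<phi> \<in> test_funs U" for \<phi>
        using p1[OF b(2) \<phi>] mult_right_mono[OF M(2) L2_norm_nonneg[of U "multi_deriv [b, b] \<phi>"]] by linarith
      then show ?thesis using b by (intro bexI[of _ "[b, b]"]) (auto simp: deriv_idx_def)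
    next
      case 3
      have "L2_norm U (multi_deriv (rev bs) \<phi>) \<le> M * L2_norm U (multi_deriv (rev bs) \<phi>)" for \<phi>
        using mult_right_mono[OF M(1) L2_norm_nonneg[of U "multi_deriv (rev bs) \<phi>"]] by simp
      then show ?thesis using 3 k by (intro bexI[of _ bs]) auto
    qed
  qed
  have "(L2_norm U (weak_deriv U bs v))\<^sup>2 \<le> M\<^sup>2 * plate_form U v v"
    if v: "v \<in> H20 U" and k: "k \<le> 2" "bs \<in> deriv_idx k" for v k bs
  proof -
    obtain \<phi> where \<phi>: "\<forall>n. \<phi> n \<in> test_funs U"
      and _: "\<forall>k\<le>2. \<forall>bs\<in>deriv_idx k. (\<lambda>n. L2_norm U (\<lambda>x. weak_deriv U bs v x - multi_deriv (rev bs) (\<phi> n) x)) \<longlonglongrightarrow> 0"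
      and \<phi>2: "\<forall>k\<le>2. \<forall>bs\<in>deriv_idx k. (\<lambda>n. L2_norm U (multi_deriv (rev bs) (\<phi> n))) \<longlonglongrightarrow> L2_norm U (weak_deriv U bs v)"
      and _: "(\<lambda>n. L2_norm U (\<lambda>x. \<phi> n x - v x)) \<longlonglongrightarrow> 0"
      by (rule H20_test_approx[OF U(1) v])
    obtain cs where cs: "cs \<in> deriv_idx 2" "\<And>\<phi>. \<phi> \<in> test_funs U \<Longrightarrow> L2_norm U (multi_deriv (rev bs) \<phi>) \<le> M * L2_norm U (multi_deriv (rev cs) \<phi>)"
      using ex[OF k] by blast
    have "L2_norm U (weak_deriv U bs v) \<le> M * L2_norm U (weak_deriv U cs v)"
    proof (rule LIMSEQ_le)
      show "(\<lambda>n. L2_norm U (multi_deriv (rev bs) (\<phi> n))) \<longlonglongrightarrow> L2_norm U (weak_deriv U bs v)" using \<phi>2 k by blast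
      show "(\<lambda>n. M * L2_norm U (multi_deriv (rev cs) (\<phi> n))) \<longlonglongrightarrow> M * L2_norm U (weak_deriv U cs v)"
        using \<phi>2 cs(1) by (intro tendsto_intros) auto
      show "\<exists>N. \<forall>n\<ge>N. L2_norm U (multi_deriv (rev bs) (\<phi> n)) \<le> M * L2_norm U (multi_deriv (rev cs) (\<phi> n))"
        using cs(2) \<phi> by blast
    qed
    then have "(L2_norm U (weak_deriv U bs v))\<^sup>2 \<le> (M * L2_norm U (weak_deriv U cs v))\<^sup>2"
      by (rule power_mono) (rule L2_norm_nonneg)
    also have "\<dots> = M\<^sup>2 * (L2_norm U (weak_deriv U cs v))\<^sup>2" by (simp add: power_mult_distrib)
    also have "\<dots> \<le> M\<^sup>2 * plate_form U v v"
      unfolding plate_form_sq using cs(1) finite_deriv_idx by (intro mult_left_mono member_le_sum) auto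
    finally show ?thesis .
  qed
  then show ?thesis using M(1) by (intro exI[of _ "M\<^sup>2"]) auto
qed

lemma weak_deriv_diff:
  assumes U: "open U" and v: "v \<in> sobolev_space U 2" and w: "w \<in> sobolev_space U 2" and k: "k \<le> 2" "bs \<in> deriv_idx k"
  shows "ae_eq U (weak_deriv U bs (\<lambda>x. v x - w x)) (\<lambda>x. weak_deriv U bs v x - weak_deriv U bs w x)"
  using sobolev2_lin(2)[OF U v w k, of 1 "-1"] by simp

text \<open>The Poincare inequality turns the Cauchy property in plate energy into one for every
  derivative of order at most two. The L2 limits of the derivatives are weak derivatives of
  \<open>z\<close>, and one sufficiently close test function for each \<open>v n\<close> provides
  the approximation of \<open>z\<close>.\<close>

lemma H20_closed:
  fixes U :: "'a::euclidean_space set"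
  assumes U: "open U" "bounded U" and v: "\<And>n. v n \<in> H20 U" and z: "z \<in> L2_space U"
    and lim: "(\<lambda>n. L2_norm U (\<lambda>x. v n x - z x)) \<longlonglongrightarrow> 0"
    and cau: "\<And>e. e > 0 \<Longrightarrow> \<exists>N. \<forall>m\<ge>N. \<forall>n\<ge>N. plate_form U (\<lambda>x. v m x - v n x) (\<lambda>x. v m x - v n x) < e"
  shows "z \<in> H20 U"
proof -
  note Us = open_sets_lebesgue[OF U(1)]
  have Um: "U \<in> lmeasurable" using U by (simp add: lmeasurable_open)
  interpret P: semi_ip "H20 U" "plate_form U" by (rule plate_semi_ip[OF U(1)])
  obtain K where K: "K > 0" "\<And>v k bs. v \<in> H20 U \<Longrightarrow> k \<le> 2 \<Longrightarrow> bs \<in> deriv_idx k \<Longrightarrow> (L2_norm U (weak_deriv U bs v))\<^sup>2 \<le> K * plate_form U v v"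
    using poincare_H20[OF U] by blast
  have wL: "weak_deriv U bs (v n) \<in> L2_space U" if "k \<le> 2" "bs \<in> deriv_idx k" for k bs n
    by (rule sobolev2_weak_deriv(1)[OF H20_sobolev[OF v] that])
  have ex: "\<exists>g\<in>L2_space U. (\<lambda>n. L2_norm U (\<lambda>x. weak_deriv U bs (v n) x - g x)) \<longlonglongrightarrow> 0"
    if k: "k \<le> 2" "bs \<in> deriv_idx k" for k bs
  proof (rule L2_complete[OF Um])
    show "weak_deriv U bs (v n) \<in> L2_space U" for n by (rule wL[OF k])
    fix e :: real assume e: "e > 0"
    then have "e\<^sup>2 / K > 0" using K(1) by simp
    then obtain N where N: "\<forall>m\<ge>N. \<forall>n\<ge>N. plate_form U (\<lambda>x. v m x - v n x) (\<lambda>x. v m x - v n x) < e\<^sup>2 / K"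
      using cau by blast
    have "L2_norm U (\<lambda>x. weak_deriv U bs (v m) x - weak_deriv U bs (v n) x) < e" if "m \<ge> N" "n \<ge> N" for m n
    proof -
      have "L2_norm U (\<lambda>x. weak_deriv U bs (v m) x - weak_deriv U bs (v n) x) = L2_norm U (weak_deriv U bs (\<lambda>x. v m x - v n x))"
        by (rule L2_norm_ae[OF Us ae_eq_sym[OF weak_deriv_diff[OF U(1) H20_sobolev[OF v] H20_sobolev[OF v] k]]])
      moreover have "(L2_norm U (weak_deriv U bs (\<lambda>x. v m x - v n x)))\<^sup>2 \<le> K * plate_form U (\<lambda>x. v m x - v n x) (\<lambda>x. v m x - v n x)"
        by (rule K(2)[OF P.diff_mem[OF v v] k])
      moreover have "K * plate_form U (\<lambda>x. v m x - v n x) (\<lambda>x. v m x - v n x) < e\<^sup>2"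
        using N that K(1) by (simp add: field_simps)
      ultimately have "(L2_norm U (\<lambda>x. weak_deriv U bs (v m) x - weak_deriv U bs (v n) x))\<^sup>2 < e\<^sup>2" by simp
      then show ?thesis using e by (auto intro: power_less_imp_less_base[of _ 2 e])
    qed
    then show "\<exists>N. \<forall>m\<ge>N. \<forall>n\<ge>N. L2_norm U (\<lambda>x. weak_deriv U bs (v m) x - weak_deriv U bs (v n) x) < e" by blast
  qed
  have wd: "has_weak_deriv U bs z g" if k: "k \<le> 2" "bs \<in> deriv_idx k" and g: "g \<in> L2_space U"
    "(\<lambda>n. L2_norm U (\<lambda>x. weak_deriv U bs (v n) x - g x)) \<longlonglongrightarrow> 0" for k bs g
    unfolding has_weak_deriv_def
  proof
    fix \<eta> assume \<eta>: "\<eta> \<in> test_funs U"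
    have L: "\<eta> \<in> L2_space U" "multi_deriv bs \<eta> \<in> L2_space U"
      using test_funs_L2[OF \<eta> Us] test_funs_L2[OF test_funs_multi_deriv[OF \<eta> deriv_idx_Basis[OF k(2)]] Us] by auto
    have "(\<lambda>n. L2_inner U (v n) (multi_deriv bs \<eta>)) \<longlonglongrightarrow> L2_inner U z (multi_deriv bs \<eta>)"
      using H20_L2[OF v] by (intro L2.ip_tendsto z L lim) simp
    moreover have "(\<lambda>n. (- 1) ^ length bs * L2_inner U (weak_deriv U bs (v n)) \<eta>) \<longlonglongrightarrow> (- 1) ^ length bs * L2_inner U g \<eta>"
      using wL[OF k] by (intro tendsto_mult tendsto_const L2.ip_tendsto g L) simp
    moreover have "L2_inner U (v n) (multi_deriv bs \<eta>) = (- 1) ^ length bs * L2_inner U (weak_deriv U bs (v n)) \<eta>" for n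
      using sobolev2_weak_deriv(2)[OF H20_sobolev[OF v] k] \<eta> unfolding has_weak_deriv_def by blast
    ultimately show "L2_inner U z (multi_deriv bs \<eta>) = (- 1) ^ length bs * L2_inner U g \<eta>"
      by (simp only:) (rule LIMSEQ_unique)
  qed
  have zs: "z \<in> sobolev_space U 2" unfolding sobolev_space_2_iff using z wd ex by blast
  have conv: "(\<lambda>n. L2_norm U (\<lambda>x. weak_deriv U bs (v n) x - weak_deriv U bs z x)) \<longlonglongrightarrow> 0"
    if k: "k \<le> 2" "bs \<in> deriv_idx k" for k bs
  proof -
    obtain g where g: "g \<in> L2_space U" "(\<lambda>n. L2_norm U (\<lambda>x. weak_deriv U bs (v n) x - g x)) \<longlonglongrightarrow> 0" using ex[OF k] by blast
    have "ae_eq U (weak_deriv U bs z) g" by (rule weak_deriv_eq[OF U(1) g(1) wd[OF k g]])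
    then have "ae_eq U (\<lambda>x. weak_deriv U bs (v n) x - weak_deriv U bs z x) (\<lambda>x. weak_deriv U bs (v n) x - g x)" for n
      by (rule ae_eq_diff[OF ae_eq_refl])
    from L2_norm_ae[OF Us this] show ?thesis using g(2) by simp
  qed
  \<comment> \<open>There are only finitely many derivatives of order at most two, so one test
    function serves all of them within \<open>1 / Suc n\<close>.\<close>
  have "\<exists>\<phi>. \<phi> \<in> test_funs U \<and> (\<forall>k\<le>2. \<forall>bs\<in>deriv_idx k. L2_norm U (\<lambda>x. weak_deriv U bs (v n) x - multi_deriv (rev bs) \<phi> x) < 1 / Suc n)" for n
  proof -
    obtain \<phi> where \<phi>: "\<forall>n::nat. \<phi> n \<in> test_funs U"
      "\<forall>k\<le>2. \<forall>bs\<in>deriv_idx k. (\<lambda>i. L2_norm U (\<lambda>x. weak_deriv U bs (v n) x - multi_deriv (rev bs) (\<phi> i) x)) \<longlonglongrightarrow> 0"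
      using v[of n] unfolding H20_iff[OF U(1)] by blast
    have "\<forall>\<^sub>F i in sequentially. \<forall>k\<in>{..2}. \<forall>bs\<in>deriv_idx k. L2_norm U (\<lambda>x. weak_deriv U bs (v n) x - multi_deriv (rev bs) (\<phi> i) x) < 1 / Suc n"
      using \<phi>(2) by (intro eventually_ball_finite ballI finite_deriv_idx) (auto intro!: order_tendstoD(2))
    then obtain i where "\<forall>k\<in>{..2}. \<forall>bs\<in>deriv_idx k. L2_norm U (\<lambda>x. weak_deriv U bs (v n) x - multi_deriv (rev bs) (\<phi> i) x) < 1 / Suc n"
      by (auto simp: eventually_sequentially)
    then show ?thesis using \<phi>(1) by (intro exI[of _ "\<phi> i"]) auto
  qed
  then have "\<forall>n. \<exists>\<phi>. \<phi> \<in> test_funs U \<and> (\<forall>k\<le>2. \<forall>bs\<in>deriv_idx k. L2_norm U (\<lambda>x. weak_deriv U bs (v n) x - multi_deriv (rev bs) \<phi> x) < 1 / Suc n)"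
    by (rule allI)
  from choice[OF this] obtain \<phi> where \<phi>0: "\<forall>n. \<phi> n \<in> test_funs U \<and> (\<forall>k\<le>2. \<forall>bs\<in>deriv_idx k. L2_norm U (\<lambda>x. weak_deriv U bs (v n) x - multi_deriv (rev bs) (\<phi> n) x) < 1 / Suc n)"
    by (rule exE)
  have \<phi>: "\<phi> n \<in> test_funs U"
    "k \<le> 2 \<Longrightarrow> bs \<in> deriv_idx k \<Longrightarrow> L2_norm U (\<lambda>x. weak_deriv U bs (v n) x - multi_deriv (rev bs) (\<phi> n) x) < 1 / Suc n" for n k bs
    using \<phi>0[rule_format, of n] by simp_all
  have "(\<lambda>n. L2_norm U (\<lambda>x. weak_deriv U bs z x - multi_deriv (rev bs) (\<phi> n) x)) \<longlonglongrightarrow> 0"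
    if k: "k \<le> 2" "bs \<in> deriv_idx k" for k bs
  proof (rule Lim_null_comparison)
    have "(\<lambda>n. L2_norm U (\<lambda>x. weak_deriv U bs (v n) x - weak_deriv U bs z x) + 1 / Suc n) \<longlonglongrightarrow> 0 + 0"
      by (intro tendsto_add conv[OF k] inv_Suc_tendsto)
    then show "(\<lambda>n. L2_norm U (\<lambda>x. weak_deriv U bs (v n) x - weak_deriv U bs z x) + 1 / Suc n) \<longlonglongrightarrow> 0" by simp
    have "L2_norm U (\<lambda>x. weak_deriv U bs z x - multi_deriv (rev bs) (\<phi> n) x) \<le> L2_norm U (\<lambda>x. weak_deriv U bs (v n) x - weak_deriv U bs z x) + 1 / Suc n" for n
    proof -
      have L: "weak_deriv U bs z \<in> L2_space U" "multi_deriv (rev bs) (\<phi> n) \<in> L2_space U"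
        using sobolev2_weak_deriv(1)[OF zs k] test_funs_L2[OF test_funs_multi_deriv[OF \<phi>(1), of "rev bs"] Us] deriv_idx_Basis[OF k(2)] by auto
      have "L2_norm U (\<lambda>x. (weak_deriv U bs z x - weak_deriv U bs (v n) x) + (weak_deriv U bs (v n) x - multi_deriv (rev bs) (\<phi> n) x))
        \<le> L2_norm U (\<lambda>x. weak_deriv U bs z x - weak_deriv U bs (v n) x) + L2_norm U (\<lambda>x. weak_deriv U bs (v n) x - multi_deriv (rev bs) (\<phi> n) x)"
        by (intro L2.nm_triangle L2.diff_mem L wL[OF k])
      then show ?thesis using \<phi>(2)[OF k, of n] L2_norm_minus_commute[of U "weak_deriv U bs z" "weak_deriv U bs (v n)"] by simp
    qed
    then show "\<forall>\<^sub>F n in sequentially. norm (L2_norm U (\<lambda>x. weak_deriv U bs z x - multi_deriv (rev bs) (\<phi> n) x)) \<le> L2_norm U (\<lambda>x. weak_deriv U bs (v n) x - weak_deriv U bs z x) + 1 / Suc n"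
      by (simp add: L2_norm_nonneg)
  qed
  then show ?thesis unfolding H20_iff[OF U(1)] using zs \<phi>(1) by blast
qed

section \<open>The clamped biharmonic operator\<close>

lemma test_funs_sum:
  "finite I \<Longrightarrow> (\<And>i. i \<in> I \<Longrightarrow> g i \<in> test_funs U) \<Longrightarrow> (\<lambda>x. \<Sum>i\<in>I. g i x) \<in> test_funs U"
proof (induction I rule: finite_induct)
  case (insert i I)
  then show ?case using test_funs_lin[of "g i" U "\<lambda>x. \<Sum>i\<in>I. g i x" 1 1] by simp
qed (simp add: test_funs_zero)

lemma multi_deriv_sum:
  fixes U :: "'a::euclidean_space set"
  assumes "finite I" "\<And>i. i \<in> I \<Longrightarrow> g i \<in> test_funs U" "set bs \<subseteq> Basis"
  shows "multi_deriv bs (\<lambda>x. \<Sum>i\<in>I. g i x) = (\<lambda>x. \<Sum>i\<in>I. multi_deriv bs (g i) x)"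
  using assms(1,2)
proof (induction I rule: finite_induct)
  case empty
  have "multi_deriv bs (\<lambda>x::'a. 0) x = 0" for x
    by (rule multi_deriv_outside_support[of _ "{}"])
      (use assms(3) test_funs_zero test_funs_smooth in auto)
  then show ?case by auto
next
  case (insert i I)
  have "(\<lambda>x. \<Sum>i\<in>I. g i x) \<in> test_funs U" using insert by (intro test_funs_sum) auto
  then show ?case
    using multi_deriv_lin[of "g i" "\<lambda>x. \<Sum>i\<in>I. g i x" bs 1 1] insert assms(3) test_funs_smooth by auto
qed

lemma deriv_idx_2: "deriv_idx 2 = (\<lambda>(i, j). [i, j]) ` (Basis \<times> Basis)"
  by (auto simp: deriv_idx_def length_Suc_conv numeral_2_eq_2 image_iff)

lemma sum_deriv_idx_2: "(\<Sum>bs\<in>deriv_idx 2. F bs) = (\<Sum>i\<in>Basis. \<Sum>j\<in>Basis. F [i, j])"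
  unfolding deriv_idx_2 by (subst sum.reindex) (auto simp: inj_on_def sum.cartesian_product intro!: sum.cong)

lemma laplacian_test: "\<phi> \<in> test_funs U \<Longrightarrow> laplacian \<phi> \<in> test_funs U"
  unfolding laplacian_def by (intro test_funs_sum test_funs_multi_deriv) auto

text \<open>The contraction of Hessians in the plate form leads to fourth derivatives with index
  \<open>bs @ rev bs\<close>, that is \<open>[i, j, j, i]\<close>. Symmetry of mixed derivatives
  rearranges them into \<open>[i, i, j, j]\<close>, the terms of the squared Laplacian.\<close>

lemma bilaplacian_eq:
  fixes U :: "'a::euclidean_space set"
  assumes \<phi>: "\<phi> \<in> test_funs U"
  shows "laplacian (laplacian \<phi>) x = (\<Sum>bs\<in>deriv_idx 2. multi_deriv (bs @ rev bs) \<phi> x)"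
proof -
  have "multi_deriv [i, j, j, i] \<phi> = multi_deriv [i, i, j, j] \<phi>" if i: "i \<in> Basis" and j: "j \<in> Basis" for i j
  proof -
    have s: "smooth_fun \<phi>" using \<phi> by (rule test_funs_smooth)
    have "multi_deriv [j, j, i] \<phi> = multi_deriv [j] (multi_deriv [i, j] \<phi>)"
      using multi_deriv_swap[OF s i j] by (simp add: multi_deriv_Cons)
    also have "\<dots> = multi_deriv [j, i] (multi_deriv [j] \<phi>)" by (simp add: multi_deriv_Cons)
    also have "\<dots> = multi_deriv [i, j] (multi_deriv [j] \<phi>)"
      using j by (intro multi_deriv_swap[OF _ j i] smooth_fun_multi_deriv s) simp
    finally show ?thesis by (simp add: multi_deriv_Cons)
  qed
  then have "(\<Sum>bs\<in>deriv_idx 2. multi_deriv (bs @ rev bs) \<phi> x) = (\<Sum>i\<in>Basis. \<Sum>j\<in>Basis. multi_deriv [i, i, j, j] \<phi> x)"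
    unfolding sum_deriv_idx_2 by (intro sum.cong) auto
  also have "\<dots> = (\<Sum>i\<in>Basis. multi_deriv [i, i] (\<lambda>x. \<Sum>j\<in>Basis. multi_deriv [j, j] \<phi> x) x)"
  proof (rule sum.cong[OF refl])
    fix i :: 'a assume i: "i \<in> Basis"
    have "multi_deriv [i, i] (\<lambda>x. \<Sum>j\<in>Basis. multi_deriv [j, j] \<phi> x) = (\<lambda>x. \<Sum>j\<in>Basis. multi_deriv [i, i] (multi_deriv [j, j] \<phi>) x)"
      using i by (intro multi_deriv_sum[of _ _ U] test_funs_multi_deriv \<phi>) auto
    then show "(\<Sum>j\<in>Basis. multi_deriv [i, i, j, j] \<phi> x) = multi_deriv [i, i] (\<lambda>x. \<Sum>j\<in>Basis. multi_deriv [j, j] \<phi> x) x"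
      by (simp add: multi_deriv_Cons)
  qed
  finally show ?thesis by (simp add: laplacian_def[abs_def])
qed

lemma plate_form_test:
  assumes U: "open U" and w: "w \<in> sobolev_space U 2" and \<phi>: "\<phi> \<in> test_funs U"
  shows "plate_form U w \<phi> = L2_inner U w (laplacian (laplacian \<phi>))"
proof -
  note Us = open_sets_lebesgue[OF U]
  have wL: "w \<in> L2_space U" using w by (simp add: sobolev_space_2_iff)
  have m: "multi_deriv (bs @ rev bs) \<phi> \<in> L2_space U" if "bs \<in> deriv_idx 2" for bs
    using deriv_idx_Basis[OF that] by (intro test_funs_L2[OF test_funs_multi_deriv[OF \<phi>] Us]) auto
  have "L2_inner U (weak_deriv U bs w) (weak_deriv U bs \<phi>) = L2_inner U w (multi_deriv (bs @ rev bs) \<phi>)"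
    if bs: "bs \<in> deriv_idx 2" for bs
  proof -
    have B: "set bs \<subseteq> Basis" and len: "length bs = 2" using bs by (auto simp: deriv_idx_def)
    have "L2_inner U (weak_deriv U bs w) (weak_deriv U bs \<phi>) = L2_inner U (weak_deriv U bs w) (multi_deriv (rev bs) \<phi>)"
      by (rule L2_inner_ae2[OF Us weak_deriv_test[OF U \<phi> B]])
    also have "\<dots> = L2_inner U w (multi_deriv bs (multi_deriv (rev bs) \<phi>))"
      using sobolev2_weak_deriv(2)[OF w _ bs] test_funs_multi_deriv[OF \<phi>, of "rev bs"] B len
      unfolding has_weak_deriv_def by simp
    finally show ?thesis by (simp add: multi_deriv_append)
  qed
  then have "plate_form U w \<phi> = (\<Sum>bs\<in>deriv_idx 2. 1 * L2_inner U w (multi_deriv (bs @ rev bs) \<phi>))"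
    unfolding plate_form_def by simp
  also have "\<dots> = L2_inner U w (\<lambda>x. \<Sum>bs\<in>deriv_idx 2. 1 * multi_deriv (bs @ rev bs) \<phi> x)"
    by (rule L2.sum_right[OF m wL, symmetric])
  also have "(\<lambda>x. \<Sum>bs\<in>deriv_idx 2. 1 * multi_deriv (bs @ rev bs) \<phi> x) = laplacian (laplacian \<phi>)"
    using bilaplacian_eq[OF \<phi>] by auto
  finally show ?thesis .
qed

lemma op_A_some:
  assumes "w \<in> dom_A \<Omega>"
  shows "op_A \<Omega> w \<in> L2_space \<Omega>" "has_weak_bilaplacian \<Omega> w (op_A \<Omega> w)"
proof -
  have "\<exists>g. g \<in> L2_space \<Omega> \<and> has_weak_bilaplacian \<Omega> w g" using assms unfolding dom_A_def by blast
  from someI_ex[OF this] show "op_A \<Omega> w \<in> L2_space \<Omega>" "has_weak_bilaplacian \<Omega> w (op_A \<Omega> w)"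
    unfolding op_A_def by auto
qed

lemma dom_A_H20: "w \<in> dom_A \<Omega> \<Longrightarrow> w \<in> H20 \<Omega>"
  by (simp add: dom_A_def)

lemma dom_A_L2: "w \<in> dom_A \<Omega> \<Longrightarrow> w \<in> L2_space \<Omega>"
  using dom_A_H20 H20_L2 by blast

lemma op_A_unique:
  assumes \<Omega>: "open \<Omega>" and w: "w \<in> dom_A \<Omega>" and g: "g \<in> L2_space \<Omega>" "has_weak_bilaplacian \<Omega> w g"
  shows "ae_eq \<Omega> (op_A \<Omega> w) g"
proof -
  have "L2_inner \<Omega> (\<lambda>x. op_A \<Omega> w x - g x) \<phi> = 0" if \<phi>: "\<phi> \<in> test_funs \<Omega>" for \<phi>
    using g op_A_some[OF w] \<phi> test_funs_L2[OF \<phi> open_sets_lebesgue[OF \<Omega>]]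
    unfolding has_weak_bilaplacian_def by (simp add: L2.diff_left)
  from fundamental_lemma[OF \<Omega> L2.diff_mem[OF op_A_some(1)[OF w] g(1)] this] show ?thesis
    by (simp add: ae_eq_diff0_iff)
qed

text \<open>For test functions this is the distributional definition of \<open>op_A\<close>; both
  sides are continuous along test functions converging to \<open>z\<close> in \<open>H20\<close>. It
  is the bridge between the form and the operator.\<close>

lemma plate_form_dom_A:
  assumes \<Omega>: "open \<Omega>" and w: "w \<in> dom_A \<Omega>" and z: "z \<in> H20 \<Omega>"
  shows "plate_form \<Omega> w z = L2_inner \<Omega> (op_A \<Omega> w) z"
proof -
  note Us = open_sets_lebesgue[OF \<Omega>]
  have ws: "w \<in> sobolev_space \<Omega> 2" using dom_A_H20[OF w] H20_sobolev by blast
  obtain \<phi> where \<phi>: "\<forall>n. \<phi> n \<in> test_funs \<Omega>"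
    and \<phi>2: "\<forall>k\<le>2. \<forall>bs\<in>deriv_idx k. (\<lambda>n. L2_norm \<Omega> (\<lambda>x. weak_deriv \<Omega> bs z x - multi_deriv (rev bs) (\<phi> n) x)) \<longlonglongrightarrow> 0"
    and _: "\<forall>k\<le>2. \<forall>bs\<in>deriv_idx k. (\<lambda>n. L2_norm \<Omega> (multi_deriv (rev bs) (\<phi> n))) \<longlonglongrightarrow> L2_norm \<Omega> (weak_deriv \<Omega> bs z)"
    and \<phi>4: "(\<lambda>n. L2_norm \<Omega> (\<lambda>x. \<phi> n x - z x)) \<longlonglongrightarrow> 0"
    by (rule H20_test_approx[OF \<Omega> z])
  have \<phi>t: "\<phi> n \<in> test_funs \<Omega>" for n using \<phi> by simp
  have "(\<lambda>n. L2_inner \<Omega> (weak_deriv \<Omega> bs w) (weak_deriv \<Omega> bs (\<phi> n))) \<longlonglongrightarrow> L2_inner \<Omega> (weak_deriv \<Omega> bs w) (weak_deriv \<Omega> bs z)"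
    if bs: "bs \<in> deriv_idx 2" for bs
  proof -
    have B: "set bs \<subseteq> Basis" using deriv_idx_Basis[OF bs] .
    have L: "weak_deriv \<Omega> bs w \<in> L2_space \<Omega>" "weak_deriv \<Omega> bs z \<in> L2_space \<Omega>" "\<And>n. multi_deriv (rev bs) (\<phi> n) \<in> L2_space \<Omega>"
      using H20_weak_deriv_L2[OF _ bs] dom_A_H20[OF w] z B by (auto intro!: test_funs_L2[OF test_funs_multi_deriv[OF \<phi>t] Us])
    have "(\<lambda>n. L2_inner \<Omega> (multi_deriv (rev bs) (\<phi> n)) (weak_deriv \<Omega> bs w)) \<longlonglongrightarrow> L2_inner \<Omega> (weak_deriv \<Omega> bs z) (weak_deriv \<Omega> bs w)"
      using \<phi>2[rule_format, OF _ bs] L by (intro L2.ip_tendsto) (auto simp: L2_norm_minus_commute[of \<Omega> "weak_deriv \<Omega> bs z"])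
    then have "(\<lambda>n. L2_inner \<Omega> (weak_deriv \<Omega> bs w) (multi_deriv (rev bs) (\<phi> n))) \<longlonglongrightarrow> L2_inner \<Omega> (weak_deriv \<Omega> bs w) (weak_deriv \<Omega> bs z)"
      by (simp add: L2_inner_def mult.commute)
    then show ?thesis using L2_inner_ae2[OF Us weak_deriv_test[OF \<Omega> \<phi>t B]] by simp
  qed
  then have "(\<lambda>n. plate_form \<Omega> w (\<phi> n)) \<longlonglongrightarrow> plate_form \<Omega> w z"
    unfolding plate_form_def by (intro tendsto_sum)
  moreover have "plate_form \<Omega> w (\<phi> n) = L2_inner \<Omega> (\<phi> n) (op_A \<Omega> w)" for n
    using plate_form_test[OF \<Omega> ws \<phi>t] op_A_some(2)[OF w] \<phi>t
    unfolding has_weak_bilaplacian_def by (simp add: L2_inner_def mult.commute)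
  moreover have "(\<lambda>n. L2_inner \<Omega> (\<phi> n) (op_A \<Omega> w)) \<longlonglongrightarrow> L2_inner \<Omega> z (op_A \<Omega> w)"
    using test_funs_L2[OF \<phi>t Us] by (intro L2.ip_tendsto H20_L2[OF z] op_A_some(1)[OF w] \<phi>4) simp
  ultimately show ?thesis using LIMSEQ_unique by (simp add: L2_inner_def mult.commute)
qed

text \<open>\<open>op_A\<close> picks some representative of the bilaplacian, so its linearity can
  only hold up to null sets.\<close>

lemma dom_A_lin:
  assumes \<Omega>: "open \<Omega>" and v: "v \<in> dom_A \<Omega>" and w: "w \<in> dom_A \<Omega>"
  shows "(\<lambda>x. p * v x + q * w x) \<in> dom_A \<Omega>"
    "ae_eq \<Omega> (op_A \<Omega> (\<lambda>x. p * v x + q * w x)) (\<lambda>x. p * op_A \<Omega> v x + q * op_A \<Omega> w x)"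
proof -
  have g: "(\<lambda>x. p * op_A \<Omega> v x + q * op_A \<Omega> w x) \<in> L2_space \<Omega>"
    by (intro L2.lin_mem op_A_some v w)
  have "has_weak_bilaplacian \<Omega> (\<lambda>x. p * v x + q * w x) (\<lambda>x. p * op_A \<Omega> v x + q * op_A \<Omega> w x)"
    unfolding has_weak_bilaplacian_def
  proof
    fix \<phi> assume \<phi>: "\<phi> \<in> test_funs \<Omega>"
    have "\<phi> \<in> L2_space \<Omega>" "laplacian (laplacian \<phi>) \<in> L2_space \<Omega>"
      using \<phi> by (auto intro!: test_funs_L2[of _ \<Omega>] laplacian_test open_sets_lebesgue \<Omega>)
    then show "L2_inner \<Omega> (\<lambda>x. p * v x + q * w x) (laplacian (laplacian \<phi>)) = L2_inner \<Omega> (\<lambda>x. p * op_A \<Omega> v x + q * op_A \<Omega> w x) \<phi>"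
      using op_A_some[OF v] op_A_some[OF w] dom_A_L2[OF v] dom_A_L2[OF w] \<phi>
      by (simp add: L2.lin_left has_weak_bilaplacian_def)
  qed
  moreover show 1: "(\<lambda>x. p * v x + q * w x) \<in> dom_A \<Omega>"
    using calculation g H20_lin[OF \<Omega> dom_A_H20[OF v] dom_A_H20[OF w]] by (auto simp: dom_A_def)
  ultimately show "ae_eq \<Omega> (op_A \<Omega> (\<lambda>x. p * v x + q * w x)) (\<lambda>x. p * op_A \<Omega> v x + q * op_A \<Omega> w x)"
    using op_A_unique[OF \<Omega> 1 g] by blast
qed

text \<open>Closedness of the operator. The plate energy of a difference is
  \<open>(A w_m - A w_n, w_m - w_n)\<close>, so convergence of both sequences in L2 makes the
  energies Cauchy and puts the limit into \<open>H20\<close>.\<close>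

lemma dom_A_closed:
  assumes \<Omega>: "open \<Omega>" "bounded \<Omega>" and w: "\<And>n. w n \<in> dom_A \<Omega>" and z: "z \<in> L2_space \<Omega>" and g: "g \<in> L2_space \<Omega>"
    and lim: "(\<lambda>n. L2_norm \<Omega> (\<lambda>x. w n x - z x)) \<longlonglongrightarrow> 0"
    and limA: "(\<lambda>n. L2_norm \<Omega> (\<lambda>x. op_A \<Omega> (w n) x - g x)) \<longlonglongrightarrow> 0"
  shows "z \<in> dom_A \<Omega>" "ae_eq \<Omega> (op_A \<Omega> z) g"
proof -
  note Us = open_sets_lebesgue[OF \<Omega>(1)]
  have wL: "w n \<in> L2_space \<Omega>" "op_A \<Omega> (w n) \<in> L2_space \<Omega>" for n
    using dom_A_L2[OF w] op_A_some(1)[OF w] by auto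
  have "z \<in> H20 \<Omega>"
  proof (rule H20_closed[OF \<Omega> dom_A_H20[OF w] z lim])
    fix e :: real assume "e > 0"
    \<comment> \<open>Each of the two factors of the energy is a difference of two members of a
      sequence within \<open>e'\<close> of its limit, hence below \<open>2 * e'\<close>; the product
      must be \<open>e\<close>.\<close>
    define e' where "e' = sqrt e / 2"
    have e': "e' > 0" "(2 * e') * (2 * e') = e" using \<open>e > 0\<close> by (auto simp: e'_def)
    have "\<forall>\<^sub>F n in sequentially. L2_norm \<Omega> (\<lambda>x. w n x - z x) < e' \<and> L2_norm \<Omega> (\<lambda>x. op_A \<Omega> (w n) x - g x) < e'"
      using order_tendstoD(2)[OF lim e'(1)] order_tendstoD(2)[OF limA e'(1)] by (rule eventually_conj)
    then obtain N where N: "\<And>n. n \<ge> N \<Longrightarrow> L2_norm \<Omega> (\<lambda>x. w n x - z x) < e' \<and> L2_norm \<Omega> (\<lambda>x. op_A \<Omega> (w n) x - g x) < e'"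
      by (auto simp: eventually_sequentially)
    have tri: "L2_norm \<Omega> (\<lambda>x. a x - b x) < 2 * e'" if "a \<in> L2_space \<Omega>" "b \<in> L2_space \<Omega>" "c \<in> L2_space \<Omega>"
      "L2_norm \<Omega> (\<lambda>x. a x - c x) < e'" "L2_norm \<Omega> (\<lambda>x. b x - c x) < e'" for a b c
      using L2.nm_diff_triangle[OF L2.diff_mem[OF that(1,3)] L2.diff_mem[OF that(2,3)]] that(4,5) by simp
    have "plate_form \<Omega> (\<lambda>x. w m x - w n x) (\<lambda>x. w m x - w n x) < e" if mn: "m \<ge> N" "n \<ge> N" for m n
    proof -
      have d: "(\<lambda>x. w m x - w n x) \<in> dom_A \<Omega>" "ae_eq \<Omega> (op_A \<Omega> (\<lambda>x. w m x - w n x)) (\<lambda>x. op_A \<Omega> (w m) x - op_A \<Omega> (w n) x)"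
        using dom_A_lin[OF \<Omega>(1) w[of m] w[of n], of 1 "-1"] by simp_all
      have "plate_form \<Omega> (\<lambda>x. w m x - w n x) (\<lambda>x. w m x - w n x) = L2_inner \<Omega> (\<lambda>x. op_A \<Omega> (w m) x - op_A \<Omega> (w n) x) (\<lambda>x. w m x - w n x)"
        unfolding plate_form_dom_A[OF \<Omega>(1) d(1) dom_A_H20[OF d(1)]] by (rule L2_inner_ae[OF Us d(2)])
      also have "\<dots> \<le> L2_norm \<Omega> (\<lambda>x. op_A \<Omega> (w m) x - op_A \<Omega> (w n) x) * L2_norm \<Omega> (\<lambda>x. w m x - w n x)"
        using L2.cauchy_schwarz[OF L2.diff_mem[OF wL(2) wL(2)] L2.diff_mem[OF wL(1) wL(1)]] by (simp add: abs_le_iff)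
      also have "\<dots> < (2 * e') * (2 * e')"
        using N[OF mn(1)] N[OF mn(2)]
        by (intro mult_strict_mono' L2_norm_nonneg tri[OF wL(2) wL(2) g] tri[OF wL(1) wL(1) z]) auto
      finally show ?thesis using e'(2) by simp
    qed
    then show "\<exists>N. \<forall>m\<ge>N. \<forall>n\<ge>N. plate_form \<Omega> (\<lambda>x. w m x - w n x) (\<lambda>x. w m x - w n x) < e" by blast
  qed
  moreover have bl: "has_weak_bilaplacian \<Omega> z g"
    unfolding has_weak_bilaplacian_def
  proof
    fix \<phi> assume \<phi>: "\<phi> \<in> test_funs \<Omega>"
    have L: "\<phi> \<in> L2_space \<Omega>" "laplacian (laplacian \<phi>) \<in> L2_space \<Omega>"
      using \<phi> by (auto intro!: test_funs_L2[of _ \<Omega>] laplacian_test Us)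
    have "(\<lambda>n. L2_inner \<Omega> (w n) (laplacian (laplacian \<phi>))) \<longlonglongrightarrow> L2_inner \<Omega> z (laplacian (laplacian \<phi>))"
      using wL by (intro L2.ip_tendsto z L lim) simp
    moreover have "(\<lambda>n. L2_inner \<Omega> (op_A \<Omega> (w n)) \<phi>) \<longlonglongrightarrow> L2_inner \<Omega> g \<phi>"
      using wL by (intro L2.ip_tendsto g L limA) simp
    moreover have "L2_inner \<Omega> (w n) (laplacian (laplacian \<phi>)) = L2_inner \<Omega> (op_A \<Omega> (w n)) \<phi>" for n
      using op_A_some(2)[OF w] \<phi> unfolding has_weak_bilaplacian_def by blast
    ultimately show "L2_inner \<Omega> z (laplacian (laplacian \<phi>)) = L2_inner \<Omega> g \<phi>" using LIMSEQ_unique by simp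
  qed
  ultimately show 1: "z \<in> dom_A \<Omega>" using g by (auto simp: dom_A_def)
  show "ae_eq \<Omega> (op_A \<Omega> z) g" by (rule op_A_unique[OF \<Omega>(1) 1 g bl])
qed

section \<open>Weak derivatives in time\<close>

text \<open>Exchange of the order of integration over the triangle \<open>r \<le> s\<close>. Both
  functions live on the whole line, so that the indicators carry the domain.\<close>

lemma fubini_triangle:
  fixes d G :: "real \<Rightarrow> real"
  assumes d: "integrable lborel d" and G: "integrable lborel G"
  shows "(LINT s|lborel. d s * (LINT r|lborel. indicator {..s} r * G r))
    = (LINT r|lborel. G r * (LINT s|lborel. indicator {r..} s * d s))"
proof -
  define F where "F = (\<lambda>s r. d s * (indicator {..s} r * G r))"
  have [measurable]: "d \<in> borel_measurable borel" "G \<in> borel_measurable borel" using d G by auto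
  have eq: "indicator {..s} r = (if r \<le> s then 1 else (0::real))" for s r :: real by simp
  have Fm: "case_prod F \<in> borel_measurable (lborel \<Otimes>\<^sub>M lborel)"
    unfolding F_def eq by measurable
  have iG: "integrable lborel (\<lambda>r. indicator {..s} r * G r)" for s
    using integrable_mult_indicator[OF _ G, of "{..s}"] by simp
  have bnd: "(LINT r|lborel. norm (F s r)) \<le> \<bar>d s\<bar> * (LINT r|lborel. \<bar>G r\<bar>)" for s
  proof -
    have "(LINT r|lborel. norm (F s r)) \<le> (LINT r|lborel. \<bar>d s\<bar> * \<bar>G r\<bar>)"
    proof (rule integral_mono)
      show "integrable lborel (\<lambda>r. norm (F s r))" unfolding F_def
        by (intro integrable_norm integrable_mult_right iG)
      show "integrable lborel (\<lambda>r. \<bar>d s\<bar> * \<bar>G r\<bar>)" using G by auto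
      show "norm (F s r) \<le> \<bar>d s\<bar> * \<bar>G r\<bar>" for r by (auto simp: F_def abs_mult indicator_def)
    qed
    then show ?thesis by simp
  qed
  have "integrable (lborel \<Otimes>\<^sub>M lborel) (case_prod F)"
  proof (rule lborel_pair.Fubini_integrable[OF Fm])
    show "AE s in lborel. integrable lborel (\<lambda>r. case_prod F (s, r))"
      unfolding F_def using iG by auto
    have 1: "integrable lborel (\<lambda>s. \<bar>d s\<bar> * (LINT r|lborel. \<bar>G r\<bar>))" using d by auto
    have 2: "(\<lambda>s. LINT r|lborel. norm (F s r)) \<in> borel_measurable lborel"
      using Fm by (intro lborel.borel_measurable_lebesgue_integral) simp
    have 3: "AE s in lborel. norm (LINT r|lborel. norm (F s r)) \<le> norm (\<bar>d s\<bar> * (LINT r|lborel. \<bar>G r\<bar>))"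
      using bnd by (intro AE_I2) (auto simp: abs_of_nonneg)
    show "integrable lborel (\<lambda>s. LINT r|lborel. norm (case_prod F (s, r)))"
      unfolding split by (rule Bochner_Integration.integrable_bound[OF 1 2 3])
  qed
  then have "(LINT r|lborel. (LINT s|lborel. F s r)) = (LINT s|lborel. (LINT r|lborel. F s r))"
    by (rule lborel_pair.Fubini_integral)
  moreover have "(LINT s|lborel. F s r) = G r * (LINT s|lborel. indicator {r..} s * d s)" for r
  proof -
    have "F s r = G r * (indicator {r..} s * d s)" for s by (auto simp: F_def indicator_def)
    then show ?thesis by simp
  qed
  ultimately show ?thesis unfolding F_def by simp
qed

text \<open>\<open>g\<close> is merely integrable, so its primitive need not be differentiable at
  every point and the classical rule does not apply. Exchanging the order of integration replaces
  it: only the continuously differentiable factor \<open>c\<close> is integrated by the fundamental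
  theorem.\<close>

lemma absolutely_continuous_by_parts:
  fixes c c' g :: "real \<Rightarrow> real"
  assumes t: "0 \<le> t" and c: "\<And>s. s \<in> {0..t} \<Longrightarrow> (c has_real_derivative c' s) (at s within {0..t})"
    and cc: "continuous_on {0..t} c'" and g: "integrable (lebesgue_on {0..t}) g"
  shows "integral {0..t} (\<lambda>s. c' s * integral {0..s} g) = c t * integral {0..t} g - integral {0..t} (\<lambda>s. c s * g s)"
proof -
  let ?I = "indicat_real {0..t}"
  have il: "integrable lebesgue (\<lambda>x. ?I x * g x)"
    using g by (simp add: integrable_restrict_space)
  \<comment> \<open>Fubini's theorem is applied to functions that are Borel measurable on the
    product, so \<open>g\<close> is replaced by a Borel version.\<close>
  obtain G where G: "G \<in> borel_measurable lborel" "AE x in lborel. ?I x * g x = G x"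
    using completion_ex_borel_measurable_real[of "\<lambda>x. ?I x * g x" lborel] il by auto
  have Gae: "AE x in lebesgue. ?I x * g x = G x" using G(2) by (rule AE_completion)
  have Gl: "integrable lebesgue G"
    by (rule integrable_cong_AE_imp[OF il measurable_completion[OF G(1)] Gae])
  then have Gi: "integrable lborel G" using G(1) by (simp add: integrable_completion)
  define d where "d s = ?I s * c' s" for s
  have di: "integrable lborel d"
    unfolding d_def using borel_integrable_compact[OF compact_Icc cc] by simp
  \<comment> \<open>Passes from a gauge integral over \<open>{0..t}\<close> to the Lebesgue integral
    of a Borel function that agrees with the cut-off integrand almost everywhere.\<close>
  have hk: "integral {0..t} h = (LINT x|lborel. w x)"
    if "AE x in lebesgue. ?I x * h x = w x" "integrable lborel w" "w \<in> borel_measurable lborel" for h w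
  proof -
    have wl: "integrable lebesgue w" using that by (simp add: integrable_completion)
    have ae: "AE x in lebesgue. w x = ?I x * h x" using that(1) by (rule eventually_mono) simp
    have m: "(\<lambda>x. ?I x * h x) \<in> borel_measurable lebesgue"
      by (rule borel_measurable_AE[OF borel_measurable_integrable[OF wl] ae])
    have hl: "integrable lebesgue (\<lambda>x. ?I x * h x)"
      by (rule integrable_cong_AE_imp[OF wl m ae])
    have "integral {0..t} h = (LINT x|lebesgue_on {0..t}. h x)"
      using hl by (intro lebesgue_integral_eq_integral[symmetric]) (auto simp: integrable_restrict_space)
    also have "\<dots> = (LINT x|lebesgue. ?I x * h x)" by (simp add: integral_restrict_space)
    also have "\<dots> = (LINT x|lebesgue. w x)" using m wl that(1) by (intro integral_cong_AE) auto
    also have "\<dots> = (LINT x|lborel. w x)" using that by (simp add: integral_completion)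
    finally show ?thesis .
  qed
  have inner: "integral {0..s} g = (LINT r|lborel. indicator {..s} r * G r)" if s: "s \<in> {0..t}" for s
  proof -
    have "integral {0..s} g = integral {0..t} (\<lambda>r. if r \<in> {0..s} then g r else 0)"
      using s by (subst integral_restrict_Int[of "{0..t}" "{0..s}"]) (auto simp: Int_absorb1 intro!: arg_cong[of _ _ "\<lambda>S. integral S g"])
    also have "\<dots> = (LINT r|lborel. indicator {..s} r * G r)"
    proof (rule hk)
      show "AE x in lebesgue. ?I x * (if x \<in> {0..s} then g x else 0) = indicator {..s} x * G x"
        using Gae by (rule eventually_mono) (use s in \<open>auto simp: indicator_def split: if_splits\<close>)
      show "integrable lborel (\<lambda>r. indicator {..s} r * G r)"
        using integrable_mult_indicator[OF _ Gi, of "{..s}"] by simp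
      then show "(\<lambda>r. indicator {..s} r * G r) \<in> borel_measurable lborel" by auto
    qed
    finally show ?thesis .
  qed
  \<comment> \<open>After the exchange, the inner integral contains only \<open>c'\<close> and is
    evaluated by the fundamental theorem.\<close>
  have cd: "(LINT s|lborel. indicator {r..} s * d s) = c t - c r" if r: "r \<in> {0..t}" for r
  proof -
    have "(c' has_integral (c t - c r)) {r..t}"
    proof (rule fundamental_theorem_of_calculus)
      fix x assume "x \<in> {r..t}"
      then show "(c has_vector_derivative c' x) (at x within {r..t})"
        using c[of x] r unfolding has_real_derivative_iff_has_vector_derivative[symmetric]
        by (auto intro: DERIV_subset)
    qed (use r in simp)
    moreover have "set_integrable lborel {r..t} c'"
      unfolding set_integrable_def using borel_integrable_compact[OF compact_Icc continuous_on_subset[OF cc]] r by auto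
    ultimately have "(LINT x:{r..t}|lborel. c' x) = c t - c r"
      by (simp add: set_borel_integral_eq_integral(2) integral_unique)
    moreover have "(\<lambda>s. indicator {r..} s * d s) = (\<lambda>s. indicator {r..t} s *\<^sub>R c' s)"
      using r by (auto simp: d_def indicator_def fun_eq_iff)
    ultimately show ?thesis by (simp add: set_lebesgue_integral_def)
  qed
  have ccont: "continuous_on {0..t} c" using c by (rule DERIV_continuous_on)
  have cbi: "(\<lambda>r. ?I r * c r) \<in> borel_measurable lborel"
    using borel_measurable_continuous_on_indicator[OF _ ccont] by simp
  obtain M where "\<forall>y\<in>c ` {0..t}. norm y \<le> M"
    using compact_imp_bounded[OF compact_continuous_image[OF ccont compact_Icc]] unfolding bounded_iff by blast
  then have M: "\<bar>c r\<bar> \<le> M" if "r \<in> {0..t}" for r using that by auto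
  have cG: "integrable lborel (\<lambda>r. (?I r * c r) * G r)"
  proof (rule Bochner_Integration.integrable_bound[of _ "\<lambda>r. M * G r"])
    show "integrable lborel (\<lambda>r. M * G r)" using Gi by simp
    show "(\<lambda>r. (?I r * c r) * G r) \<in> borel_measurable lborel" using cbi G(1) by (rule borel_measurable_times)
    show "AE r in lborel. norm ((?I r * c r) * G r) \<le> norm (M * G r)"
      using M by (intro AE_I2) (auto simp: abs_mult indicator_def intro!: mult_right_mono order_trans[OF M abs_ge_self])
  qed
  have L: "integral {0..t} (\<lambda>s. c' s * integral {0..s} g) = (LINT s|lborel. d s * (LINT r|lborel. indicator {..s} r * G r))"
  proof (rule hk)
    show "AE x in lebesgue. ?I x * (c' x * integral {0..x} g) = d x * (LINT r|lborel. indicator {..x} r * G r)"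
      using inner by (intro AE_I2) (auto simp: d_def indicator_def)
    have m: "(\<lambda>s. LINT r|lborel. indicator {..s} r * G r) \<in> borel_measurable lborel"
    proof (rule lborel.borel_measurable_lebesgue_integral)
      have [measurable]: "G \<in> borel_measurable borel" using G(1) by simp
      have "(\<lambda>(s::real, r::real). (if r \<le> s then 1 else 0) * G r) \<in> borel_measurable (lborel \<Otimes>\<^sub>M lborel)" by measurable
      then show "(\<lambda>(s, r). indicator {..s} r * G r) \<in> borel_measurable (lborel \<Otimes>\<^sub>M lborel)"
        by (simp add: indicator_def of_bool_def)
    qed
    show m2: "(\<lambda>s. d s * (LINT r|lborel. indicator {..s} r * G r)) \<in> borel_measurable lborel"
      using m di by (intro borel_measurable_times) auto
    show "integrable lborel (\<lambda>s. d s * (LINT r|lborel. indicator {..s} r * G r))"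
    proof (rule Bochner_Integration.integrable_bound[of _ "\<lambda>s. d s * (LINT r|lborel. \<bar>G r\<bar>)"])
      show "integrable lborel (\<lambda>s. d s * (LINT r|lborel. \<bar>G r\<bar>))" using di by simp
      have b: "\<bar>LINT r|lborel. indicator {..s} r * G r\<bar> \<le> (LINT r|lborel. \<bar>G r\<bar>)" for s
      proof -
        have i: "integrable lborel (\<lambda>r. indicator {..s} r * G r)"
          using integrable_mult_indicator[OF _ Gi, of "{..s}"] by simp
        have "\<bar>LINT r|lborel. indicator {..s} r * G r\<bar> \<le> (LINT r|lborel. \<bar>indicator {..s} r * G r\<bar>)"
          using integral_norm_bound[of lborel "\<lambda>r. indicator {..s} r * G r"] by simp
        also have "\<dots> \<le> (LINT r|lborel. \<bar>G r\<bar>)"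
          using i Gi by (intro integral_mono) (auto simp: indicator_def)
        finally show ?thesis .
      qed
      have "\<bar>d s\<bar> * \<bar>LINT r|lborel. indicator {..s} r * G r\<bar> \<le> \<bar>d s\<bar> * \<bar>LINT r|lborel. \<bar>G r\<bar>\<bar>" for s
        by (rule mult_left_mono[OF order_trans[OF b abs_ge_self]]) simp
      then show "AE s in lborel. norm (d s * (LINT r|lborel. indicator {..s} r * G r)) \<le> norm (d s * (LINT r|lborel. \<bar>G r\<bar>))"
        unfolding real_norm_def abs_mult by (intro AE_I2)
    qed (rule m2)
  qed
  have "(LINT r|lborel. G r * (LINT s|lborel. indicator {r..} s * d s)) = (LINT r|lborel. c t * G r - (?I r * c r) * G r)"
  proof (rule integral_cong_AE)
    have m: "(\<lambda>r. LINT s|lborel. indicator {r..} s * d s) \<in> borel_measurable lborel"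
    proof (rule lborel.borel_measurable_lebesgue_integral)
      have [measurable]: "d \<in> borel_measurable borel" using di by auto
      have "(\<lambda>(r::real, s::real). (if r \<le> s then 1 else 0) * d s) \<in> borel_measurable (lborel \<Otimes>\<^sub>M lborel)" by measurable
      then show "(\<lambda>(r, s). indicator {r..} s * d s) \<in> borel_measurable (lborel \<Otimes>\<^sub>M lborel)"
        by (simp add: indicator_def of_bool_def)
    qed
    show "(\<lambda>r. G r * (LINT s|lborel. indicator {r..} s * d s)) \<in> borel_measurable lborel"
      using m G(1) by (intro borel_measurable_times)
    show "(\<lambda>r. c t * G r - (?I r * c r) * G r) \<in> borel_measurable lborel"
      by (rule borel_measurable_diff[OF _ borel_measurable_times[OF cbi G(1)]]) (use G in simp)
    show "AE r in lborel. G r * (LINT s|lborel. indicator {r..} s * d s) = c t * G r - (?I r * c r) * G r"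
      using G(2)
    proof (rule eventually_mono)
      fix r assume e: "?I r * g r = G r"
      show "G r * (LINT s|lborel. indicator {r..} s * d s) = c t * G r - (?I r * c r) * G r"
      proof (cases "r \<in> {0..t}")
        case True then show ?thesis unfolding cd[OF True] by (simp add: algebra_simps)
      next
        case False then have "G r = 0" using e by simp
        then show ?thesis by simp
      qed
    qed
  qed
  also have "\<dots> = c t * (LINT r|lborel. G r) - (LINT r|lborel. (?I r * c r) * G r)"
    using Gi cG by simp
  also have "(LINT r|lborel. G r) = integral {0..t} g"
    by (rule hk[symmetric]) (use Gae Gi G in auto)
  also have "(LINT r|lborel. (?I r * c r) * G r) = integral {0..t} (\<lambda>s. c s * g s)"
  proof (rule hk[symmetric])
    show "AE x in lebesgue. ?I x * (c x * g x) = (?I x * c x) * G x"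
      using Gae by (rule eventually_mono) (auto simp: indicator_def)
  qed (use cG in auto)
  finally show ?thesis using L fubini_triangle[OF di Gi] by simp
qed

lemma test_fun_real_deriv:
  assumes "\<phi> \<in> test_funs (U :: real set)"
  shows "(\<phi> has_real_derivative multi_deriv [1] \<phi> x) (at x)"
  using smooth_fun_line_deriv[OF test_funs_smooth[OF assms], of "[]" 0 1 x] by (simp add: multi_deriv_Cons)

lemma integral_open_closed:
  fixes h :: "real \<Rightarrow> real"
  assumes "integrable (lebesgue_on {0..T}) h"
  shows "integrable (lebesgue_on {0<..<T}) h" "(LINT x|lebesgue_on {0<..<T}. h x) = integral {0..T} h"
proof -
  have "set_integrable lebesgue {0..T} h" using assms by (simp add: integrable_restrict_space set_integrable_def)
  then have "set_integrable lebesgue {0<..<T} h" by (rule set_integrable_subset) auto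
  then show i: "integrable (lebesgue_on {0<..<T}) h" by (simp add: integrable_restrict_space set_integrable_def)
  show "(LINT x|lebesgue_on {0<..<T}. h x) = integral {0..T} h"
    using lebesgue_integral_eq_integral[OF i] integral_open_interval_real[of 0 T h] by simp
qed

lemma integrable_open_closed:
  fixes h :: "real \<Rightarrow> real"
  assumes "integrable (lebesgue_on {0<..<T}) h"
  shows "integrable (lebesgue_on {0..T}) h"
proof -
  have "set_integrable lebesgue {0<..<T} h" using assms by (simp add: integrable_restrict_space set_integrable_def)
  then have "h absolutely_integrable_on {0<..<T}" .
  then have "h absolutely_integrable_on {0..T}"
  proof (subst absolutely_integrable_spike_set_eq[of "{0..T}" "{0<..<T}"])
    show "negligible {x \<in> {0..T} - {0<..<T}. h x \<noteq> 0}" "negligible {x \<in> {0<..<T} - {0..T}. h x \<noteq> 0}"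
      by (rule negligible_subset[of "{0, T}"]; auto)+
  qed
  then show ?thesis by (simp add: integrable_restrict_space set_integrable_def)
qed

lemma continuous_integrable_lebesgue_on:
  fixes h :: "real \<Rightarrow> real"
  assumes "continuous_on {a..b} h"
  shows "integrable (lebesgue_on {a..b}) h"
  using borel_integrable_compact[OF compact_Icc assms] borel_measurable_continuous_on_indicator[OF _ assms]
  by (simp add: integrable_restrict_space integrable_completion)

lemma classical_imp_weak_time_deriv:
  assumes T: "T > 0" and g: "\<And>t. t \<in> {0..T} \<Longrightarrow> (g has_real_derivative g' t) (at t within {0..T})"
    and c: "continuous_on {0..T} g'"
  shows "has_scalar_weak_time_deriv T g g'"
proof -
  have cg: "continuous_on {0..T} g"
    using g by (rule DERIV_continuous_on)
  have "has_weak_deriv {0<..<T} [1] g g'" unfolding has_weak_deriv_def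
  proof
    fix \<phi> :: "real \<Rightarrow> real" assume \<phi>: "\<phi> \<in> test_funs {0<..<T}"
    have d: "multi_deriv [1] \<phi> \<in> test_funs {0<..<T}" by (rule test_funs_multi_deriv[OF \<phi>]) simp
    note ct = test_funs_continuous[OF \<phi>] test_funs_continuous[OF d]
    have "((\<lambda>x. g x * multi_deriv [1] \<phi> x + g' x * \<phi> x) has_integral (g T * \<phi> T - g 0 * \<phi> 0)) {0..T}"
    proof (rule fundamental_theorem_of_calculus)
      fix x assume "x \<in> {0..T}"
      then have "((\<lambda>x. g x * \<phi> x) has_real_derivative (g' x * \<phi> x + multi_deriv [1] \<phi> x * g x)) (at x within {0..T})"
        by (rule DERIV_mult[OF g has_field_derivative_at_within[OF test_fun_real_deriv[OF \<phi>]]])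
      then show "((\<lambda>x. g x * \<phi> x) has_vector_derivative g x * multi_deriv [1] \<phi> x + g' x * \<phi> x) (at x within {0..T})"
        unfolding has_real_derivative_iff_has_vector_derivative[symmetric] by (simp add: algebra_simps)
    qed (use T in simp)
    then have s: "integral {0..T} (\<lambda>x. g x * multi_deriv [1] \<phi> x + g' x * \<phi> x) = 0"
      using test_funs_outside[OF \<phi>] by (simp add: integral_unique)
    have i: "integrable (lebesgue_on {0..T}) (\<lambda>x. g x * multi_deriv [1] \<phi> x)" "integrable (lebesgue_on {0..T}) (\<lambda>x. g' x * \<phi> x)"
      using cg c ct by (auto intro!: continuous_integrable_lebesgue_on continuous_intros)
    have "integral {0..T} (\<lambda>x. g x * multi_deriv [1] \<phi> x) + integral {0..T} (\<lambda>x. g' x * \<phi> x) = 0"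
      using s by (subst integral_add[symmetric]) (auto intro!: integrable_on_lebesgue_on i)
    then show "L2_inner {0<..<T} g (multi_deriv [1] \<phi>) = (- 1) ^ length [1::real] * L2_inner {0<..<T} g' \<phi>"
      unfolding L2_inner_def integral_open_closed(2)[OF i(1)] integral_open_closed(2)[OF i(2)] by simp
  qed
  then show ?thesis
    using integral_open_closed(1)[OF continuous_integrable_lebesgue_on[OF cg]] integral_open_closed(1)[OF continuous_integrable_lebesgue_on[OF c]]
    by (simp add: has_scalar_weak_time_deriv_def)
qed

text \<open>The zero mean is what makes the primitive vanish again to the right of the support.
  Higher derivatives are those of \<open>\<phi>\<close>, which gives smoothness.\<close>

lemma test_fun_antiderivative:
  assumes \<phi>: "\<phi> \<in> test_funs {0<..<T::real}" and 0: "integral {0..T} \<phi> = 0"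
  shows "\<exists>\<Phi>\<in>test_funs {0<..<T}. multi_deriv [1] \<Phi> = \<phi>"
proof -
  obtain K where K: "compact K" "K \<subseteq> {0<..<T}" "\<And>x. x \<notin> K \<Longrightarrow> \<phi> x = 0" using test_funs_support[OF \<phi>] by blast
  obtain a b where ab: "0 < a" "b < T" "K \<subseteq> {a..b}"
  proof (cases "K = {}")
    case True then show ?thesis using that[of 1 "T - 1"] by simp
  next
    case False
    obtain a where "a \<in> K" "\<forall>x\<in>K. a \<le> x" using compact_attains_inf[OF K(1) False] by blast
    moreover obtain b where "b \<in> K" "\<forall>x\<in>K. x \<le> b" using compact_attains_sup[OF K(1) False] by blast
    ultimately show ?thesis using K(2) by (intro that[of a b]) auto
  qed
  have z: "\<phi> x = 0" if "x < a \<or> x > b" for x using K(3) ab(3) that by force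
  define \<Phi> where "\<Phi> x = integral {0..x} \<phi>" for x
  have cont: "continuous_on S \<phi>" for S by (rule test_funs_continuous[OF \<phi>])
  have \<Phi>a: "\<Phi> x = 0" if "x < a" for x
    unfolding \<Phi>_def using z that by (intro integral_unique has_integral_is_0) auto
  \<comment> \<open>The primitive is defined on the whole line, so points outside
    \<open>{0..T}\<close> and an empty interval have to be covered as well; the integral over an
    empty interval is 0.\<close>
  have \<Phi>b: "\<Phi> x = 0" if "x > b" for x
  proof -
    have "integral {0..x} \<phi> = integral {0..T} \<phi>"
    proof (cases "x \<le> T")
      case True
      show ?thesis
      proof (cases "0 \<le> x")
        case x0: True
        have "integral {0..x} \<phi> + integral {x..T} \<phi> = integral {0..T} \<phi>"
          using x0 True cont by (intro Henstock_Kurzweil_Integration.integral_combine integrable_continuous_real) auto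
        moreover have "integral {x..T} \<phi> = 0" using z that
          by (intro integral_unique has_integral_is_0) (use ab(3) K(3) in force)+
        ultimately show ?thesis by simp
      next
        case False
        then show ?thesis using 0 by simp
      qed
    next
      case False
      have "0 \<le> T \<or> T < 0" by linarith
      then show ?thesis
      proof
        assume "0 \<le> T"
        then have "integral {0..T} \<phi> + integral {T..x} \<phi> = integral {0..x} \<phi>"
          using False cont by (intro Henstock_Kurzweil_Integration.integral_combine integrable_continuous_real) auto
        moreover have "integral {T..x} \<phi> = 0" using z ab(2)
          by (intro integral_unique has_integral_is_0) auto
        ultimately show ?thesis by simp
      next
        assume "T < 0"
        then have "\<phi> = (\<lambda>x. 0)" using K by auto
        then show ?thesis by simp
      qed
    qed
    then show ?thesis using 0 by (simp add: \<Phi>_def)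
  qed
  have D: "(\<Phi> has_real_derivative \<phi> x) (at x)" for x
  proof (cases "x < a")
    case True
    have "\<forall>\<^sub>F y in nhds x. 0 = \<Phi> y"
      using eventually_nhds_in_open[of "{..<a}" x] True \<Phi>a by (auto elim!: eventually_mono)
    from DERIV_cong_ev[OF refl this refl, THEN iffD1, OF DERIV_const] show ?thesis using z True by simp
  next
    case False
    then have x: "0 < x" using ab(1) by linarith
    have "(\<Phi> has_real_derivative \<phi> x) (at x within {0..x + 1})"
      unfolding \<Phi>_def using x cont by (intro integral_has_real_derivative) auto
    then show ?thesis using x by (simp add: at_within_Icc_at)
  qed
  have Dd: "(\<Phi> has_derivative (\<lambda>h. \<phi> x * h)) (at x)" for x
    using D[of x] by (simp add: has_field_derivative_def)
  have p1: "partial_deriv 1 \<Phi> = \<phi>" using partial_deriv_eq[OF Dd, of 1] by simp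
  have "smooth_fun \<Phi>" unfolding smooth_fun_def
  proof (intro allI impI)
    fix bs :: "real list" assume bs: "set bs \<subseteq> Basis"
    show "multi_deriv bs \<Phi> differentiable_on UNIV"
    proof (cases bs rule: rev_cases)
      case Nil
      then show ?thesis using Dd by (auto simp: differentiable_on_def differentiable_def)
    next
      case (snoc cs b)
      then have "multi_deriv bs \<Phi> = multi_deriv cs \<phi>" using bs p1 by (simp add: multi_deriv_append multi_deriv_Cons)
      then show ?thesis using test_funs_smooth[OF \<phi>] bs snoc by (simp add: smooth_fun_def)
    qed
  qed
  moreover have "{a..b} \<subseteq> {0<..<T}" using ab by auto
  ultimately have "\<Phi> \<in> test_funs {0<..<T}"
    by (intro test_funsI[of _ "{a..b}"]) (auto simp: \<Phi>a \<Phi>b not_le)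
  then show ?thesis using p1 by (intro bexI[of _ \<Phi>]) (auto simp: multi_deriv_Cons)
qed

lemma ae_zero_continuous:
  fixes w :: "'a::euclidean_space \<Rightarrow> real"
  assumes "open U" "continuous_on U w" "ae_eq U w (\<lambda>x. 0)" "x \<in> U"
  shows "w x = 0"
proof (rule ccontr)
  assume "w x \<noteq> 0"
  let ?S = "{x \<in> U. w x \<noteq> 0}"
  have "?S = U \<inter> w -` (- {0})" by auto
  then have "open ?S" using continuous_open_preimage[OF assms(2,1), of "- {0}"] by (simp add: open_Compl)
  moreover have "negligible ?S"
  proof -
    have "AE x in lebesgue. x \<in> U \<longrightarrow> w x = 0"
      using assms(3) open_sets_lebesgue[OF assms(1)] by (simp add: ae_eq_def AE_restrict_space_iff)
    then have "AE x in lebesgue. x \<notin> ?S" by (rule eventually_mono) simp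
    then show ?thesis
      using \<open>open ?S\<close> by (simp add: negligible_iff_null_sets AE_iff_null_sets open_sets_lebesgue)
  qed
  ultimately show False using open_not_negligible \<open>w x \<noteq> 0\<close> assms(4) by blast
qed

text \<open>The du Bois-Reymond argument. Every test function is the derivative of a test function
  plus a multiple of one fixed \<open>\<psi>\<close> with nonzero integral, so \<open>k\<close> acts
  on it like the constant \<open>C\<close> found by testing with \<open>\<psi>\<close>. The
  fundamental lemma and continuity then give equality everywhere.\<close>

lemma weak_time_deriv_zero_const:
  fixes k :: "real \<Rightarrow> real"
  assumes T: "T > 0" and k: "continuous_on {0..T} k"
    and 0: "\<And>\<phi>. \<phi> \<in> test_funs {0<..<T} \<Longrightarrow> L2_inner {0<..<T} k (multi_deriv [1] \<phi>) = 0" and t: "t \<in> {0..T}"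
  shows "k t = k 0"
proof -
  let ?U = "{0<..<T}"
  have L2c: "h \<in> L2_space ?U" if "continuous_on {0..T} h" for h
  proof -
    have "integrable (lebesgue_on ?U) h" "integrable (lebesgue_on ?U) (\<lambda>x. (h x)\<^sup>2)"
      using that by (auto intro!: integral_open_closed(1) continuous_integrable_lebesgue_on continuous_intros)
    then show ?thesis by (auto simp: L2_space_def)
  qed
  define \<psi> where "\<psi> = bump (T / 3) (2 * T / 3) 0"
  have \<psi>: "\<psi> \<in> test_funs ?U" unfolding \<psi>_def using T by (intro bump_test) auto
  define I where "I = (LINT x|lebesgue_on ?U. \<psi> x)"
  have int: "integrable (lebesgue_on ?U) \<phi>" "(LINT x|lebesgue_on ?U. \<phi> x) = integral {0..T} \<phi>" if "\<phi> \<in> test_funs ?U" for \<phi>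
    using integral_open_closed[OF continuous_integrable_lebesgue_on[OF test_funs_continuous[OF that]]] by auto
  have "I \<noteq> 0"
  proof
    assume "I = 0"
    then have "integral {0..T} \<psi> = 0" using int(2)[OF \<psi>] by (simp add: I_def)
    then have "(\<psi> has_integral 0) (cbox 0 T)"
      using integrable_continuous_real[OF test_funs_continuous[OF \<psi>], of 0 T] by (simp add: has_integral_integrable_integral)
    then have "\<psi> (T / 2) = 0"
      by (rule has_integral_0_cbox_imp_0[rotated 2]) (use T bump_bounds test_funs_continuous[OF \<psi>] in \<open>auto simp: \<psi>_def\<close>)
    then show False using bump_nz[of "T / 3" "2 * T / 3" 0 "T / 2"] T by (simp add: \<psi>_def)
  qed
  define C where "C = L2_inner ?U k \<psi> / I"
  have kL: "k \<in> L2_space ?U" by (rule L2c[OF k])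
  have "L2_inner ?U (\<lambda>x. k x - C) \<phi> = 0" if \<phi>: "\<phi> \<in> test_funs ?U" for \<phi>
  proof -
    have L: "\<phi> \<in> L2_space ?U" "\<psi> \<in> L2_space ?U" "(\<lambda>x. C) \<in> L2_space ?U"
      by (intro L2c test_funs_continuous[OF \<phi>] test_funs_continuous[OF \<psi>] continuous_on_const)+
    define q where "q = (LINT x|lebesgue_on ?U. \<phi> x) / I"
    let ?h = "\<lambda>x. 1 * \<phi> x + (- q) * \<psi> x"
    have h: "?h \<in> test_funs ?U" by (rule test_funs_lin[OF \<phi> \<psi>])
    have "(LINT x|lebesgue_on ?U. ?h x) = 0"
      using int(1)[OF \<phi>] int(1)[OF \<psi>] \<open>I \<noteq> 0\<close> by (simp add: q_def I_def[symmetric])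
    then have "integral {0..T} ?h = 0" using int(2)[OF h] by simp
    from test_fun_antiderivative[OF h this] obtain \<Phi> where \<Phi>: "\<Phi> \<in> test_funs ?U" "multi_deriv [1] \<Phi> = ?h" by blast
    have "L2_inner ?U k ?h = 0" using 0[OF \<Phi>(1)] \<Phi>(2) by simp
    then have "L2_inner ?U k \<phi> = q * L2_inner ?U k \<psi>"
      using L2.lin_right[OF L(1,2) kL, of 1 "- q"] by simp
    moreover have "L2_inner ?U (\<lambda>x. C) \<phi> = C * (LINT x|lebesgue_on ?U. \<phi> x)" by (simp add: L2_inner_def)
    ultimately show ?thesis using L kL \<open>I \<noteq> 0\<close> by (simp add: L2.diff_left C_def q_def)
  qed
  then have "ae_eq ?U (\<lambda>x. k x - C) (\<lambda>x. 0)"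
    using k by (intro fundamental_lemma L2c continuous_intros) auto
  then have *: "k x - C = 0" if "x \<in> ?U" for x
    using that k by (intro ae_zero_continuous[of ?U "\<lambda>x. k x - C"]) (auto intro!: continuous_intros elim: continuous_on_subset)
  have "k x - C = 0" if "x \<in> {0..T}" for x
  proof -
    have "x \<in> closure ?U" using that T by simp
    then show ?thesis
      using k * T by (intro continuous_constant_on_closure[of ?U "\<lambda>x. k x - C" 0 x]) (auto intro!: continuous_intros)
  qed
  from this[OF t] this[of 0] T show ?thesis by simp
qed

text \<open>By the integration by parts above, \<open>g\<close> minus the primitive of
  \<open>g'\<close> has weak derivative zero and is continuous, hence constant.\<close>

lemma weak_time_deriv_integral:
  assumes T: "T > 0" and g: "continuous_on {0..T} g" and w: "has_scalar_weak_time_deriv T g g'"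
  shows "integrable (lebesgue_on {0..T}) g'" "t \<in> {0..T} \<Longrightarrow> g t = g 0 + integral {0..t} g'"
proof -
  let ?U = "{0<..<T}"
  show g'i: "integrable (lebesgue_on {0..T}) g'"
    using w integrable_open_closed unfolding has_scalar_weak_time_deriv_def by blast
  have g'on: "g' integrable_on {0..T}" using integrable_on_lebesgue_on[OF g'i] by simp
  define G where "G t = integral {0..t} g'" for t
  have cG: "continuous_on {0..T} G" unfolding G_def by (rule indefinite_integral_continuous_1[OF g'on])
  have "g t - G t = g 0 - G 0" if t: "t \<in> {0..T}" for t
  proof (rule weak_time_deriv_zero_const[OF T _ _ t])
    show "continuous_on {0..T} (\<lambda>t. g t - G t)" by (intro continuous_intros g cG)
    fix \<phi> :: "real \<Rightarrow> real" assume \<phi>: "\<phi> \<in> test_funs ?U"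
    have d: "multi_deriv [1] \<phi> \<in> test_funs ?U" by (rule test_funs_multi_deriv[OF \<phi>]) simp
    have i: "integrable (lebesgue_on {0..T}) (\<lambda>x. g x * multi_deriv [1] \<phi> x)" "integrable (lebesgue_on {0..T}) (\<lambda>x. multi_deriv [1] \<phi> x * G x)"
      using g cG test_funs_continuous[OF d] by (auto intro!: continuous_integrable_lebesgue_on continuous_intros)
    have "integral {0..T} (\<lambda>s. multi_deriv [1] \<phi> s * G s) = \<phi> T * integral {0..T} g' - integral {0..T} (\<lambda>s. \<phi> s * g' s)"
      unfolding G_def using T
      by (intro absolutely_continuous_by_parts g'i has_field_derivative_at_within[OF test_fun_real_deriv[OF \<phi>]] test_funs_continuous[OF d]) auto
    then have *: "integral {0..T} (\<lambda>s. multi_deriv [1] \<phi> s * G s) = - integral {0..T} (\<lambda>s. \<phi> s * g' s)"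
      using test_funs_outside[OF \<phi>] by simp
    obtain M where "\<forall>y\<in>\<phi> ` {0..T}. norm y \<le> M"
      using compact_imp_bounded[OF compact_continuous_image[OF test_funs_continuous[OF \<phi>] compact_Icc]] unfolding bounded_iff by blast
    then have M: "\<bar>\<phi> r\<bar> \<le> M" if "r \<in> {0..T}" for r using that by auto
    have \<phi>g: "integrable (lebesgue_on {0..T}) (\<lambda>s. \<phi> s * g' s)"
    proof (rule Bochner_Integration.integrable_bound[of _ "\<lambda>s. M * g' s"])
      show "integrable (lebesgue_on {0..T}) (\<lambda>s. M * g' s)" using g'i by simp
      show "(\<lambda>s. \<phi> s * g' s) \<in> borel_measurable (lebesgue_on {0..T})"
        using continuous_lebesgue_on_measurable[OF test_funs_continuous[OF \<phi>]] borel_measurable_integrable[OF g'i]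
        by (rule borel_measurable_times)
      have "\<bar>\<phi> s\<bar> * \<bar>g' s\<bar> \<le> \<bar>M\<bar> * \<bar>g' s\<bar>" if "s \<in> {0..T}" for s
        by (rule mult_right_mono[OF order_trans[OF M[OF that] abs_ge_self]]) simp
      then show "AE s in lebesgue_on {0..T}. norm (\<phi> s * g' s) \<le> norm (M * g' s)"
        unfolding real_norm_def abs_mult by (intro AE_I2) simp
    qed
    have "L2_inner ?U g (multi_deriv [1] \<phi>) = - L2_inner ?U g' \<phi>"
      using w \<phi> by (simp add: has_scalar_weak_time_deriv_def has_weak_deriv_def)
    also have "L2_inner ?U g' \<phi> = integral {0..T} (\<lambda>s. \<phi> s * g' s)"
      using integral_open_closed(2)[OF \<phi>g] by (simp add: L2_inner_def mult.commute)
    finally have "L2_inner ?U g (multi_deriv [1] \<phi>) = - integral {0..T} (\<lambda>s. \<phi> s * g' s)" .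
    moreover have "L2_inner ?U (\<lambda>t. g t - G t) (multi_deriv [1] \<phi>)
      = (LINT x|lebesgue_on ?U. g x * multi_deriv [1] \<phi> x) - (LINT x|lebesgue_on ?U. multi_deriv [1] \<phi> x * G x)"
      unfolding L2_inner_def
      by (subst Bochner_Integration.integral_diff[OF integral_open_closed(1)[OF i(1)] integral_open_closed(1)[OF i(2)], symmetric])
        (simp add: algebra_simps)
    ultimately show "L2_inner ?U (\<lambda>t. g t - G t) (multi_deriv [1] \<phi>) = 0"
      using * integral_open_closed(2)[OF i(2)] by (simp add: L2_inner_def)
  qed
  then show "t \<in> {0..T} \<Longrightarrow> g t = g 0 + integral {0..t} g'" for t
    by (fastforce simp: G_def)
qed

text \<open>This converts the weak equations for the source and the solution into ordinary
  differential equations for each mode.\<close>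

lemma weak_time_deriv_classical:
  assumes T: "T > 0" and g: "continuous_on {0..T} g" and w: "has_scalar_weak_time_deriv T g g'"
    and c: "continuous_on {0..T} g'" and t: "t \<in> {0..T}"
  shows "(g has_real_derivative g' t) (at t within {0..T})"
proof -
  have "((\<lambda>t. g 0 + integral {0..t} g') has_real_derivative 0 + g' t) (at t within {0..T})"
    using t by (intro DERIV_add DERIV_const integral_has_real_derivative c) auto
  then have "((\<lambda>t. g 0 + integral {0..t} g') has_real_derivative g' t) (at t within {0..T})" by simp
  then show ?thesis
    by (rule has_field_derivative_transform_within[OF _ zero_less_one t])
      (rule weak_time_deriv_integral(2)[OF T g w, symmetric])
qed

lemma time_C0_inner_continuous:
  assumes w: "w \<in> time_C0 (L2_space \<Omega>) (L2_norm \<Omega>) T" and v: "v \<in> L2_space \<Omega>"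
  shows "continuous_on {0..T} (\<lambda>t. L2_inner \<Omega> (w t) v)"
  unfolding continuous_on_def
proof
  fix t assume t: "t \<in> {0..T}"
  have "eventually (\<lambda>s. w s \<in> L2_space \<Omega>) (at t within {0..T})"
    using w by (auto simp: eventually_at_filter time_C0_def)
  then show "((\<lambda>t. L2_inner \<Omega> (w t) v) \<longlongrightarrow> L2_inner \<Omega> (w t) v) (at t within {0..T})"
    using w t v by (intro L2.ip_tendsto) (auto simp: time_C0_def)
qed

lemma time_C0_norm_continuous:
  assumes w: "w \<in> time_C0 (L2_space \<Omega>) (L2_norm \<Omega>) T"
  shows "continuous_on {0..T} (\<lambda>t. L2_norm \<Omega> (w t))"
  unfolding continuous_on_def
proof
  fix t assume t: "t \<in> {0..T}"
  have "eventually (\<lambda>s. w s \<in> L2_space \<Omega>) (at t within {0..T})" using w by (auto simp: eventually_at_filter time_C0_def)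
  then show "((\<lambda>t. L2_norm \<Omega> (w t)) \<longlongrightarrow> L2_norm \<Omega> (w t)) (at t within {0..T})"
    using w t by (intro L2.nm_tendsto) (auto simp: time_C0_def)
qed

lemma has_time_deriv_inner:
  assumes d: "has_time_deriv \<Omega> T w w'" and w: "\<And>t. t \<in> {0..T} \<Longrightarrow> w t \<in> L2_space \<Omega>"
    "\<And>t. t \<in> {0..T} \<Longrightarrow> w' t \<in> L2_space \<Omega>" and v: "v \<in> L2_space \<Omega>" and t: "t \<in> {0..T}"
  shows "((\<lambda>t. L2_inner \<Omega> (w t) v) has_real_derivative L2_inner \<Omega> (w' t) v) (at t within {0..T})"
proof -
  have q: "(\<lambda>x. (w s x - w t x) / (s - t)) \<in> L2_space \<Omega>" if "s \<in> {0..T}" for s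
    using L2.scale_mem[OF L2.diff_mem[OF w(1)[OF that] w(1)[OF t]], of "1 / (s - t)"] by simp
  have "((\<lambda>s. L2_inner \<Omega> (\<lambda>x. (w s x - w t x) / (s - t)) v) \<longlongrightarrow> L2_inner \<Omega> (w' t) v) (at t within {0..T})"
    using d t q by (intro L2.ip_tendsto w v) (auto simp: has_time_deriv_def eventually_at_filter)
  moreover have "eventually (\<lambda>s. L2_inner \<Omega> (\<lambda>x. (w s x - w t x) / (s - t)) v = (L2_inner \<Omega> (w s) v - L2_inner \<Omega> (w t) v) / (s - t)) (at t within {0..T})"
  proof -
    have "L2_inner \<Omega> (\<lambda>x. (w s x - w t x) / (s - t)) v = (L2_inner \<Omega> (w s) v - L2_inner \<Omega> (w t) v) / (s - t)" if "s \<in> {0..T}" for s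
      using L2.scale_left[OF L2.diff_mem[OF w(1)[OF that] w(1)[OF t]] v, of "1 / (s - t)"] w t that v
      by (simp add: L2.diff_left)
    then show ?thesis by (auto simp: eventually_at_filter)
  qed
  ultimately have "((\<lambda>s. (L2_inner \<Omega> (w s) v - L2_inner \<Omega> (w t) v) / (s - t)) \<longlongrightarrow> L2_inner \<Omega> (w' t) v) (at t within {0..T})"
    by (rule Lim_transform_eventually)
  then show ?thesis by (simp add: has_field_derivative_iff)
qed

section \<open>Eigenfunction expansion and regularity of the solution\<close>

definition l2_seq :: "(nat \<Rightarrow> real) \<Rightarrow> bool" where
  "l2_seq a \<longleftrightarrow> summable (\<lambda>n. (a n)\<^sup>2)"

lemma l2_seq_dominated: "l2_seq b \<Longrightarrow> (\<And>n. \<bar>a n\<bar> \<le> \<bar>b n\<bar>) \<Longrightarrow> l2_seq a"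
  unfolding l2_seq_def by (rule summable_comparison_test') (auto simp: abs_le_square_iff)

lemma l2_seq_scale: "l2_seq a \<Longrightarrow> l2_seq (\<lambda>n. c * a n)"
  unfolding l2_seq_def by (simp add: power_mult_distrib summable_mult)

lemma l2_seq_add:
  assumes "l2_seq a" "l2_seq b"
  shows "l2_seq (\<lambda>n. a n + b n)"
  unfolding l2_seq_def
proof (rule summable_comparison_test')
  show "summable (\<lambda>n. 2 * (a n)\<^sup>2 + 2 * (b n)\<^sup>2)"
    using assms unfolding l2_seq_def by (intro summable_add summable_mult)
  have "(a n + b n)\<^sup>2 \<le> 2 * (a n)\<^sup>2 + 2 * (b n)\<^sup>2" for n
    using zero_le_power2[of "a n - b n"] by (simp add: power2_sum power2_diff)
  then show "norm ((a n + b n)\<^sup>2) \<le> 2 * (a n)\<^sup>2 + 2 * (b n)\<^sup>2" for n by simp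
qed

lemma l2_seq_abs: "l2_seq (\<lambda>n. \<bar>a n\<bar>) \<longleftrightarrow> l2_seq a"
  by (simp add: l2_seq_def)

lemma l2_seq_mult_summable:
  assumes "l2_seq a" "l2_seq b"
  shows "summable (\<lambda>n. \<bar>a n\<bar> * \<bar>b n\<bar>)"
proof (rule summable_comparison_test')
  show "summable (\<lambda>n. (a n)\<^sup>2 + (b n)\<^sup>2)" using assms unfolding l2_seq_def by (intro summable_add)
  have "\<bar>a n\<bar> * \<bar>b n\<bar> \<le> (a n)\<^sup>2 + (b n)\<^sup>2" for n
    using sum_squares_bound[of "\<bar>a n\<bar>" "\<bar>b n\<bar>"] mult_nonneg_nonneg[OF abs_ge_zero abs_ge_zero, of "a n" "b n"]
    unfolding power2_abs by linarith
  then show "norm (\<bar>a n\<bar> * \<bar>b n\<bar>) \<le> (a n)\<^sup>2 + (b n)\<^sup>2" for n by (simp add: abs_mult)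
qed

locale eigen_plate =
  fixes \<Omega> :: "plane set" and ev :: "nat \<Rightarrow> real" and \<psi> :: "nat \<Rightarrow> plane \<Rightarrow> real"
  assumes op: "open \<Omega>" and bd: "bounded \<Omega>" and eb: "eigenbasis_A \<Omega> ev \<psi>"
begin

lemma \<Omega>_leb: "\<Omega> \<in> sets lebesgue" by (rule open_sets_lebesgue[OF op])

lemma \<Omega>_meas: "\<Omega> \<in> lmeasurable" using op bd by (simp add: lmeasurable_open)

lemma \<psi>_dom: "\<psi> n \<in> dom_A \<Omega>" and op_\<psi>: "ae_eq \<Omega> (op_A \<Omega> (\<psi> n)) (\<lambda>x. ev n * \<psi> n x)"
  using eb by (auto simp: eigenbasis_A_def)

lemma \<psi>_L2: "\<psi> n \<in> L2_space \<Omega>" by (rule dom_A_L2[OF \<psi>_dom])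

lemma \<psi>_H20: "\<psi> n \<in> H20 \<Omega>" by (rule dom_A_H20[OF \<psi>_dom])

lemma \<psi>_ortho: "L2_inner \<Omega> (\<psi> m) (\<psi> n) = (if m = n then 1 else 0)"
  using eb by (simp add: eigenbasis_A_def)

lemma plate_\<psi>: "z \<in> H20 \<Omega> \<Longrightarrow> plate_form \<Omega> z (\<psi> n) = ev n * L2_inner \<Omega> z (\<psi> n)"
proof -
  assume z: "z \<in> H20 \<Omega>"
  interpret P: semi_ip "H20 \<Omega>" "plate_form \<Omega>" by (rule plate_semi_ip[OF op])
  have "plate_form \<Omega> z (\<psi> n) = L2_inner \<Omega> (\<lambda>x. ev n * \<psi> n x) z"
    using P.sym[OF z \<psi>_H20] plate_form_dom_A[OF op \<psi>_dom z] L2_inner_ae[OF \<Omega>_leb op_\<psi>] by simp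
  then show ?thesis
    using L2.scale_left[OF \<psi>_L2 H20_L2[OF z]] L2.sym[OF \<psi>_L2 H20_L2[OF z]] by simp
qed

lemma ev_nonneg: "ev n \<ge> 0"
  using semi_ip.nonneg[OF plate_semi_ip[OF op] \<psi>_H20[of n]] plate_\<psi>[OF \<psi>_H20[of n], of n] \<psi>_ortho[of n n] by simp

definition cf :: "(plane \<Rightarrow> real) \<Rightarrow> nat \<Rightarrow> real" where
  "cf w n = L2_inner \<Omega> w (\<psi> n)"

definition psum :: "nat \<Rightarrow> (nat \<Rightarrow> real) \<Rightarrow> plane \<Rightarrow> real" where
  "psum N c x = (\<Sum>n<N. c n * \<psi> n x)"

lemma psum_L2: "psum N c \<in> L2_space \<Omega>"
  unfolding psum_def[abs_def] by (intro L2.sum_mem \<psi>_L2)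

lemma psum_inner: "v \<in> L2_space \<Omega> \<Longrightarrow> L2_inner \<Omega> (psum N c) v = (\<Sum>n<N. c n * cf v n)"
  unfolding psum_def[abs_def] using L2.sym[OF \<psi>_L2] by (simp add: L2.sum_left \<psi>_L2 cf_def)

lemma cf_psum: "cf (psum N c) m = (if m < N then c m else 0)"
proof -
  have "cf (psum N c) m = (\<Sum>n<N. c n * (if m = n then 1 else 0))"
    using psum_inner[OF \<psi>_L2] by (simp add: cf_def \<psi>_ortho)
  also have "\<dots> = (\<Sum>n<N. if n = m then c n else 0)" by (rule sum.cong) auto
  finally show ?thesis by simp
qed

lemma parseval_tendsto: "w \<in> L2_space \<Omega> \<Longrightarrow> (\<lambda>N. L2_norm \<Omega> (\<lambda>x. psum N (cf w) x - w x)) \<longlonglongrightarrow> 0"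
  using eb L2_norm_minus_commute[of \<Omega> "psum _ (cf w)" w] by (simp add: eigenbasis_A_def psum_def cf_def)

lemma parseval:
  assumes w: "w \<in> L2_space \<Omega>" and v: "v \<in> L2_space \<Omega>"
  shows "(\<lambda>n. cf w n * cf v n) sums L2_inner \<Omega> w v"
proof -
  have "(\<lambda>N. L2_inner \<Omega> (psum N (cf w)) v) \<longlonglongrightarrow> L2_inner \<Omega> w v"
    using psum_L2 by (intro L2.ip_tendsto w v parseval_tendsto) simp
  then show ?thesis by (simp add: psum_inner[OF v] sums_def)
qed

lemma cf_l2: "w \<in> L2_space \<Omega> \<Longrightarrow> l2_seq (cf w)"
  using parseval[of w w] sums_summable by (auto simp: l2_seq_def power2_eq_square)

lemma norm_sums: "w \<in> L2_space \<Omega> \<Longrightarrow> (\<lambda>n. (cf w n)\<^sup>2) sums (L2_norm \<Omega> w)\<^sup>2"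
  by (subst L2_norm_sq) (simp add: power2_eq_square parseval)

lemma bessel: "w \<in> L2_space \<Omega> \<Longrightarrow> (\<Sum>n<N. (cf w n)\<^sup>2) \<le> (L2_norm \<Omega> w)\<^sup>2"
  using sum_le_suminf[OF sums_summable[OF norm_sums], of w "{..<N}"] sums_unique[OF norm_sums, of w] by simp

lemma cf_diff: "v \<in> L2_space \<Omega> \<Longrightarrow> w \<in> L2_space \<Omega> \<Longrightarrow> cf (\<lambda>x. v x - w x) n = cf v n - cf w n"
  by (simp add: cf_def L2.diff_left \<psi>_L2)

lemma cf_ae: "ae_eq \<Omega> v w \<Longrightarrow> cf v = cf w"
  unfolding cf_def[abs_def] by (simp add: L2_inner_ae[OF \<Omega>_leb])

lemma cf_eq_imp_ae:
  assumes "v \<in> L2_space \<Omega>" "w \<in> L2_space \<Omega>" "\<And>n. cf v n = cf w n"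
  shows "ae_eq \<Omega> v w"
proof -
  have d: "(\<lambda>x. v x - w x) \<in> L2_space \<Omega>" by (rule L2.diff_mem[OF assms(1,2)])
  have "(L2_norm \<Omega> (\<lambda>x. v x - w x))\<^sup>2 = 0"
    using sums_unique2[OF norm_sums[OF d], of 0] by (simp add: cf_diff assms)
  then show ?thesis using L2_null_iff[OF d] by (simp add: L2_norm_sq ae_eq_diff0_iff)
qed

text \<open>Partial sums are Cauchy by orthonormality, and the coefficients of the limit are limits
  of eventually constant sequences.\<close>

lemma riesz_fischer:
  assumes c: "l2_seq c"
  shows "\<exists>w\<in>L2_space \<Omega>. \<forall>n. cf w n = c n"
proof -
  have n: "(L2_norm \<Omega> (\<lambda>x. psum M c x - psum N c x))\<^sup>2 = (\<Sum>n\<in>{N..<M}. (c n)\<^sup>2)" if "N \<le> M" for M N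
  proof -
    have "(\<lambda>n. (cf (\<lambda>x. psum M c x - psum N c x) n)\<^sup>2) sums (L2_norm \<Omega> (\<lambda>x. psum M c x - psum N c x))\<^sup>2"
      by (intro norm_sums L2.diff_mem psum_L2)
    moreover have "(cf (\<lambda>x. psum M c x - psum N c x) n)\<^sup>2 = (if n \<in> {N..<M} then (c n)\<^sup>2 else 0)" for n
      using that by (auto simp: cf_diff psum_L2 cf_psum)
    ultimately show ?thesis using sums_If_finite_set[of "{N..<M}" "\<lambda>n. (c n)\<^sup>2"] sums_unique2 by auto
  qed
  have "\<exists>w\<in>L2_space \<Omega>. (\<lambda>N. L2_norm \<Omega> (\<lambda>x. psum N c x - w x)) \<longlonglongrightarrow> 0"
  proof (rule L2_complete[OF \<Omega>_meas psum_L2])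
    fix e :: real assume e: "e > 0"
    then have e2: "e\<^sup>2 > 0" by simp
    obtain N where N: "\<And>m n. m \<ge> N \<Longrightarrow> norm (\<Sum>n\<in>{m..<n}. (c n)\<^sup>2) < e\<^sup>2"
      using c e2 unfolding l2_seq_def summable_Cauchy by blast
    have one: "L2_norm \<Omega> (\<lambda>x. psum m c x - psum n c x) < e" if "n \<ge> N" "n \<le> m" for m n
    proof -
      have "(L2_norm \<Omega> (\<lambda>x. psum m c x - psum n c x))\<^sup>2 < e\<^sup>2" using N[OF that(1), of m] n[OF that(2)] by simp
      then show ?thesis using e by (auto intro: power_less_imp_less_base[of _ 2 e])
    qed
    have "L2_norm \<Omega> (\<lambda>x. psum m c x - psum n c x) < e" if "m \<ge> N" "n \<ge> N" for m n
      using one[of n m] one[of m n] that L2_norm_minus_commute[of \<Omega> "psum m c" "psum n c"] by (cases "n \<le> m") auto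
    then show "\<exists>N. \<forall>m\<ge>N. \<forall>n\<ge>N. L2_norm \<Omega> (\<lambda>x. psum m c x - psum n c x) < e" by blast
  qed
  then obtain w where w: "w \<in> L2_space \<Omega>" "(\<lambda>N. L2_norm \<Omega> (\<lambda>x. psum N c x - w x)) \<longlonglongrightarrow> 0" by blast
  have "cf w n = c n" for n
  proof -
    have "(\<lambda>N. L2_inner \<Omega> (psum N c) (\<psi> n)) \<longlonglongrightarrow> L2_inner \<Omega> w (\<psi> n)"
      using psum_L2 by (intro L2.ip_tendsto w \<psi>_L2) simp
    moreover have "\<forall>\<^sub>F N in sequentially. L2_inner \<Omega> (psum N c) (\<psi> n) = c n"
      using eventually_gt_at_top[of n] by eventually_elim (use cf_psum in \<open>simp add: cf_def\<close>)
    ultimately have "(\<lambda>N. c n) \<longlonglongrightarrow> L2_inner \<Omega> w (\<psi> n)" by (rule Lim_transform_eventually)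
    then show ?thesis by (simp add: LIMSEQ_const_iff cf_def)
  qed
  then show ?thesis using w(1) by blast
qed

lemma psum_dom: "psum N c \<in> dom_A \<Omega> \<and> ae_eq \<Omega> (op_A \<Omega> (psum N c)) (psum N (\<lambda>n. ev n * c n))"
proof (induction N)
  case 0
  have "(\<lambda>x. 0) \<in> dom_A \<Omega>" "ae_eq \<Omega> (op_A \<Omega> (\<lambda>x. 0)) (\<lambda>x. 0)"
    using dom_A_lin[OF op \<psi>_dom \<psi>_dom, of 0 0 0 0] by simp_all
  then show ?case by (simp add: psum_def[abs_def])
next
  case (Suc N)
  have p: "psum (Suc N) d = (\<lambda>x. 1 * psum N d x + d N * \<psi> N x)" for d
    by (simp add: psum_def fun_eq_iff)
  have "ae_eq \<Omega> (\<lambda>x. 1 * op_A \<Omega> (psum N c) x + c N * op_A \<Omega> (\<psi> N) x) (\<lambda>x. 1 * psum N (\<lambda>n. ev n * c n) x + c N * (ev N * \<psi> N x))"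
    using Suc op_\<psi> by (intro ae_eq_lin) auto
  then show ?case
    using dom_A_lin[OF op conjunct1[OF Suc] \<psi>_dom, of 1 "c N" N] ae_eq_trans
    unfolding p by (auto simp: mult.assoc mult.left_commute)
qed

lemma cf_op_A: "w \<in> dom_A \<Omega> \<Longrightarrow> cf (op_A \<Omega> w) n = ev n * cf w n"
  using plate_form_dom_A[OF op _ \<psi>_H20] plate_\<psi>[OF dom_A_H20] by (simp add: cf_def)

text \<open>Finite eigenfunction sums lie in the domain, and applying \<open>A\<close> to the
  partial sums of \<open>w\<close> gives the partial sums of a function with coefficients
  \<open>ev n * cf w n\<close>. The operator is closed.\<close>

lemma dom_A_char:
  assumes w: "w \<in> L2_space \<Omega>" and s: "l2_seq (\<lambda>n. ev n * cf w n)"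
  shows "w \<in> dom_A \<Omega>"
proof -
  obtain g where g: "g \<in> L2_space \<Omega>" "\<And>n. cf g n = ev n * cf w n" using riesz_fischer[OF s] by blast
  show ?thesis
  proof (rule dom_A_closed(1)[OF op bd _ w g(1) parseval_tendsto[OF w]])
    show "psum n (cf w) \<in> dom_A \<Omega>" for n using psum_dom by blast
    have "L2_norm \<Omega> (\<lambda>x. op_A \<Omega> (psum n (cf w)) x - g x) = L2_norm \<Omega> (\<lambda>x. psum n (cf g) x - g x)" for n
    proof (rule L2_norm_ae[OF \<Omega>_leb ae_eq_diff[OF _ ae_eq_refl]])
      have "cf g = (\<lambda>n. ev n * cf w n)" using g(2) by auto
      then show "ae_eq \<Omega> (op_A \<Omega> (psum n (cf w))) (psum n (cf g))" using psum_dom[of n "cf w"] by simp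
    qed
    then show "(\<lambda>n. L2_norm \<Omega> (\<lambda>x. op_A \<Omega> (psum n (cf w)) x - g x)) \<longlonglongrightarrow> 0" using parseval_tendsto[OF g(1)] by simp
  qed
qed

definition rf :: "(nat \<Rightarrow> real) \<Rightarrow> plane \<Rightarrow> real" where
  "rf c = (SOME w. w \<in> L2_space \<Omega> \<and> (\<forall>n. cf w n = c n))"

lemma rf:
  assumes "l2_seq c"
  shows "rf c \<in> L2_space \<Omega>" "cf (rf c) n = c n"
proof -
  have "\<exists>w. w \<in> L2_space \<Omega> \<and> (\<forall>n. cf w n = c n)" using riesz_fischer[OF assms] by blast
  from someI_ex[OF this] show "rf c \<in> L2_space \<Omega>" "cf (rf c) n = c n" unfolding rf_def by auto
qed

text \<open>By Parseval the squared distance to \<open>w t\<close> is a series of continuous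
  functions of time, dominated by \<open>4 * (m n)^2\<close>. Uniform convergence makes the sum
  continuous, and its value at \<open>t\<close> itself is 0.\<close>

lemma series_time_C0:
  assumes c: "\<And>n. continuous_on {0..T} (c n)" and m: "l2_seq m" "\<And>n t. t \<in> {0..T} \<Longrightarrow> \<bar>c n t\<bar> \<le> m n"
    and w: "\<And>t. t \<in> {0..T} \<Longrightarrow> w t \<in> L2_space \<Omega>" "\<And>t n. t \<in> {0..T} \<Longrightarrow> cf (w t) n = c n t"
  shows "w \<in> time_C0 (L2_space \<Omega>) (L2_norm \<Omega>) T"
  unfolding time_C0_def
proof (intro CollectI ballI conjI w(1))
  fix t assume t: "t \<in> {0..T}"
  let ?h = "\<lambda>s. \<Sum>n. (c n s - c n t)\<^sup>2"
  have "uniform_limit {0..T} (\<lambda>N s. \<Sum>n<N. (c n s - c n t)\<^sup>2) ?h sequentially"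
  proof (rule Weierstrass_m_test[where M = "\<lambda>n. 4 * (m n)\<^sup>2"])
    show "summable (\<lambda>n. 4 * (m n)\<^sup>2)" using m(1) unfolding l2_seq_def by (rule summable_mult)
    fix n s assume "s \<in> {0..T}"
    then have "\<bar>c n s - c n t\<bar> \<le> 2 * m n" using m(2)[of s n] m(2)[OF t, of n] by linarith
    then have "(c n s - c n t)\<^sup>2 \<le> (2 * m n)\<^sup>2" by (metis abs_ge_zero power2_abs power_mono)
    then show "norm ((c n s - c n t)\<^sup>2) \<le> 4 * (m n)\<^sup>2" by (simp add: power_mult_distrib)
  qed
  then have "continuous_on {0..T} ?h"
    by (rule uniform_limit_theorem[rotated]) (auto intro!: always_eventually continuous_intros c)
  then have "(?h \<longlongrightarrow> ?h t) (at t within {0..T})" using t unfolding continuous_on_def by blast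
  moreover have "?h s = (L2_norm \<Omega> (\<lambda>x. w s x - w t x))\<^sup>2" if s: "s \<in> {0..T}" for s
    using norm_sums[OF L2.diff_mem[OF w(1)[OF s] w(1)[OF t]]] 
    by (simp add: cf_diff[OF w(1)[OF s] w(1)[OF t]] w(2)[OF s] w(2)[OF t] sums_iff)
  then have "eventually (\<lambda>s. ?h s = (L2_norm \<Omega> (\<lambda>x. w s x - w t x))\<^sup>2) (at t within {0..T})"
    by (auto simp: eventually_at_filter)
  ultimately have "((\<lambda>s. (L2_norm \<Omega> (\<lambda>x. w s x - w t x))\<^sup>2) \<longlongrightarrow> 0) (at t within {0..T})"
    using Lim_transform_eventually by fastforce
  then have "((\<lambda>s. sqrt ((L2_norm \<Omega> (\<lambda>x. w s x - w t x))\<^sup>2)) \<longlongrightarrow> sqrt 0) (at t within {0..T})"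
    by (rule tendsto_real_sqrt)
  then show "((\<lambda>s. L2_norm \<Omega> (\<lambda>x. w s x - w t x)) \<longlongrightarrow> 0) (at t within {0..T})"
    by (simp add: L2_norm_nonneg)
qed

text \<open>Termwise differentiation of the Parseval series. The differentiated series is dominated
  by products of two square-summable sequences, which is why the derivative is taken against a fixed
  \<open>v\<close>.\<close>

lemma series_inner_deriv:
  assumes d: "\<And>n t. t \<in> {0..T} \<Longrightarrow> (c n has_real_derivative c' n t) (at t within {0..T})"
    and m: "l2_seq m" "\<And>n t. t \<in> {0..T} \<Longrightarrow> \<bar>c' n t\<bar> \<le> m n"
    and w: "\<And>t. t \<in> {0..T} \<Longrightarrow> w t \<in> L2_space \<Omega>" "\<And>t n. t \<in> {0..T} \<Longrightarrow> cf (w t) n = c n t"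
    and w': "\<And>t. t \<in> {0..T} \<Longrightarrow> w' t \<in> L2_space \<Omega>" "\<And>t n. t \<in> {0..T} \<Longrightarrow> cf (w' t) n = c' n t"
    and v: "v \<in> L2_space \<Omega>" and t: "t \<in> {0..T}"
  shows "((\<lambda>t. L2_inner \<Omega> (w t) v) has_real_derivative L2_inner \<Omega> (w' t) v) (at t within {0..T})"
proof -
  have S: "(\<lambda>n. c n s * cf v n) sums L2_inner \<Omega> (w s) v" "(\<lambda>n. c' n s * cf v n) sums L2_inner \<Omega> (w' s) v"
    if "s \<in> {0..T}" for s using parseval[OF w(1)[OF that] v] parseval[OF w'(1)[OF that] v] w(2) w'(2) that by auto
  have "uniform_limit {0..T} (\<lambda>N s. \<Sum>n<N. c' n s * cf v n) (\<lambda>s. \<Sum>n. c' n s * cf v n) sequentially"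
  proof (rule Weierstrass_m_test[where M = "\<lambda>n. \<bar>m n\<bar> * \<bar>cf v n\<bar>"])
    show "summable (\<lambda>n. \<bar>m n\<bar> * \<bar>cf v n\<bar>)" by (rule l2_seq_mult_summable[OF m(1) cf_l2[OF v]])
    fix n s assume "s \<in> {0..T}"
    then show "norm (c' n s * cf v n) \<le> \<bar>m n\<bar> * \<bar>cf v n\<bar>"
      unfolding real_norm_def abs_mult using m(2)[of s n] by (intro mult_right_mono) auto
  qed
  moreover have "((\<lambda>t. c n t * cf v n) has_real_derivative c' n s * cf v n) (at s within {0..T})" if "s \<in> {0..T}" for n s
    using d[OF that] by (rule DERIV_cmult_right)
  ultimately obtain g where g: "\<forall>s\<in>{0..T}. (\<lambda>n. c n s * cf v n) sums g s \<and> (g has_real_derivative (\<Sum>n. c' n s * cf v n)) (at s within {0..T})"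
    using has_field_derivative_series[of "{0..T}" "\<lambda>n t. c n t * cf v n" "\<lambda>n t. c' n t * cf v n" "\<lambda>s. \<Sum>n. c' n s * cf v n" t] t S(1)[OF t]
    by (auto simp: sums_iff)
  have gs: "g s = L2_inner \<Omega> (w s) v" if "s \<in> {0..T}" for s using g S(1)[OF that] that sums_unique2 by blast
  have gd: "(g has_real_derivative L2_inner \<Omega> (w' t) v) (at t within {0..T})" using g t sums_unique[OF S(2)[OF t]] by simp
  show ?thesis by (rule has_field_derivative_transform_within[OF gd zero_less_one t]) (rule gs)
qed

end

section \<open>Bounds for a single mode, uniform in time\<close>

lemma increment_bound:
  fixes g :: "real \<Rightarrow> real"
  assumes "\<And>t. t \<in> {0..T} \<Longrightarrow> (g has_real_derivative g' t) (at t within {0..T})" "\<And>t. t \<in> {0..T} \<Longrightarrow> \<bar>g' t\<bar> \<le> B" "t \<in> {0..T}"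
  shows "\<bar>g t\<bar> \<le> \<bar>g 0\<bar> + T * B"
proof -
  have "norm (g t - g 0) \<le> B * norm (t - 0)"
    by (rule field_differentiable_bound[of "{0..T}" g g']) (use assms in auto)
  also have "\<dots> \<le> B * T"
    using assms(2)[OF assms(3)] assms(3) by (intro mult_left_mono) auto
  finally show ?thesis by (simp add: mult.commute)
qed

text \<open>A Duhamel formula for the fourth derivative of a mode. The third derivative
  \<open>f3\<close> of the source is only integrable, so the equation cannot be differentiated once
  more pointwise. With the cosine kernel the formula contains \<open>f3\<close> without any factor
  of \<open>l\<close>, and \<open>l\<close> enters otherwise only through initial values.\<close>

lemma mode_fourth_deriv_bound:
  fixes l T :: real
  assumes l: "l \<ge> 0"
    and d2: "\<And>t. t \<in> {0..T} \<Longrightarrow> (c2 has_real_derivative c3 t) (at t within {0..T})"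
    and d3: "\<And>t. t \<in> {0..T} \<Longrightarrow> (c3 has_real_derivative f2 t - l * c2 t) (at t within {0..T})"
    and f2: "continuous_on {0..T} f2" "\<And>t. t \<in> {0..T} \<Longrightarrow> f2 t = f2 0 + integral {0..t} f3"
    and f3: "integrable (lebesgue_on {0..T}) f3" and t: "t \<in> {0..T}"
  shows "\<bar>f2 t - l * c2 t\<bar> \<le> \<bar>f2 0 - l * c2 0\<bar> + sqrt l * \<bar>c3 0\<bar> + integral {0..T} (\<lambda>s. \<bar>f3 s\<bar>)"
proof -
  define w where "w = sqrt l"
  have w: "w * w = l" "w \<ge> 0" using l by (auto simp: w_def)
  \<comment> \<open>The backward solution of the oscillator with values \<open>c t = 1\<close> and
    \<open>c' t = 0\<close>; the boundary terms at \<open>t\<close> then reduce to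
    \<open>c2 t\<close>.\<close>
  define c where "c s = cos (w * (t - s))" for s
  define c' where "c' s = w * sin (w * (t - s))" for s
  have dc: "(c has_real_derivative c' s) (at s within S)" for s S
    unfolding c_def c'_def by (auto intro!: derivative_eq_intros)
  have dc': "(c' has_real_derivative - l * c s) (at s within S)" for s S
    unfolding c_def c'_def w(1)[symmetric] by (auto intro!: derivative_eq_intros)
  have cc: "continuous_on S c" "continuous_on S c'" for S
    by (rule DERIV_continuous_on[OF dc], rule DERIV_continuous_on[OF dc'])
  have f3t: "integrable (lebesgue_on {0..t}) f3" "f3 integrable_on {0..t}" "f3 integrable_on {0..T}"
  proof -
    have "set_integrable lebesgue {0..T} f3" using f3 by (simp add: integrable_restrict_space set_integrable_def)
    then have "set_integrable lebesgue {0..t} f3" by (rule set_integrable_subset) (use t in auto)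
    then show 1: "integrable (lebesgue_on {0..t}) f3" by (simp add: integrable_restrict_space set_integrable_def)
    show "f3 integrable_on {0..t}" by (rule integrable_on_lebesgue_on[OF 1]) simp
    show "f3 integrable_on {0..T}" by (rule integrable_on_lebesgue_on[OF f3]) simp
  qed
  have parts: "integral {0..t} (\<lambda>s. c' s * integral {0..s} f3) = c t * integral {0..t} f3 - integral {0..t} (\<lambda>s. c s * f3 s)"
    using t by (intro absolutely_continuous_by_parts dc cc f3t) auto
  have sub: "{0..t} \<subseteq> {0..T}" using t by auto
  have ct: "c t = 1" "c' t = 0" "c 0 = cos (w * t)" "c' 0 = w * sin (w * t)" by (simp_all add: c_def c'_def)
  \<comment> \<open>Lagrange's identity: the terms with \<open>c2\<close> and \<open>c3\<close>
    cancel because \<open>c\<close> and \<open>c2\<close> belong to the same oscillator, and only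
    the source remains.\<close>
  have "((\<lambda>s. - (c' s * f2 s)) has_integral (c t * (- l * c2 t) - c' t * c3 t) - (c 0 * (- l * c2 0) - c' 0 * c3 0)) {0..t}"
  proof (rule fundamental_theorem_of_calculus)
    fix s assume s: "s \<in> {0..t}"
    then have "((\<lambda>s. c s * (- l * c2 s) - c' s * c3 s) has_real_derivative
       ((c' s * (- l * c2 s) + (- l * c3 s) * c s) - ((- l * c s) * c3 s + (f2 s - l * c2 s) * c' s))) (at s within {0..t})"
      using DERIV_subset[OF d2 sub] DERIV_subset[OF d3 sub] t
      by (intro DERIV_diff DERIV_mult dc dc' DERIV_cmult) auto
    then show "((\<lambda>s. c s * (- l * c2 s) - c' s * c3 s) has_vector_derivative - (c' s * f2 s)) (at s within {0..t})"
      unfolding has_real_derivative_iff_has_vector_derivative[symmetric] by (simp add: algebra_simps)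
  qed (use t in simp)
  from has_integral_neg[OF this]
  have "((\<lambda>s. c' s * f2 s) has_integral - ((c t * (- l * c2 t) - c' t * c3 t) - (c 0 * (- l * c2 0) - c' 0 * c3 0))) {0..t}"
    by (simp only: minus_minus)
  from integral_unique[OF this]
  have e1: "integral {0..t} (\<lambda>s. c' s * f2 s) = l * c2 t - cos (w * t) * (l * c2 0) - w * sin (w * t) * c3 0"
    by (simp add: ct)
  \<comment> \<open>Writing \<open>f2\<close> as its initial value plus the primitive of
    \<open>f3\<close> brings the integral into the form handled by \<open>parts\<close>.\<close>
  have e2: "integral {0..t} (\<lambda>s. c' s * f2 s) = f2 0 * (1 - cos (w * t)) + integral {0..t} (\<lambda>s. c' s * integral {0..s} f3)"
  proof -
    have "(c' has_integral (c t - c 0)) {0..t}"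
      using t dc by (intro fundamental_theorem_of_calculus) (auto simp: has_real_derivative_iff_has_vector_derivative[symmetric])
    then have "((\<lambda>s. f2 0 * c' s) has_integral (f2 0 * (c t - c 0))) {0..t}" by (rule has_integral_mult_right)
    moreover have "(\<lambda>s. c' s * integral {0..s} f3) integrable_on {0..t}"
      by (intro integrable_continuous_real continuous_intros cc indefinite_integral_continuous_1 f3t)
    ultimately have "((\<lambda>s. f2 0 * c' s + c' s * integral {0..s} f3) has_integral
        (f2 0 * (c t - c 0) + integral {0..t} (\<lambda>s. c' s * integral {0..s} f3))) {0..t}"
      by (intro has_integral_add integrable_integral)
    moreover have "f2 0 * c' s + c' s * integral {0..s} f3 = c' s * f2 s" if "s \<in> {0..t}" for s
      using f2(2)[of s] that t by (simp add: algebra_simps)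
    ultimately have "((\<lambda>s. c' s * f2 s) has_integral (f2 0 * (c t - c 0) + integral {0..t} (\<lambda>s. c' s * integral {0..s} f3))) {0..t}"
      by (rule has_integral_eq[rotated])
    then show ?thesis by (simp add: integral_unique ct)
  qed
  have main: "f2 t - l * c2 t = cos (w * t) * (f2 0 - l * c2 0) - w * sin (w * t) * c3 0 + integral {0..t} (\<lambda>s. c s * f3 s)"
    using e1 e2 parts f2(2)[OF t] by (simp add: ct algebra_simps)
  have "\<bar>integral {0..t} (\<lambda>s. c s * f3 s)\<bar> \<le> integral {0..t} (\<lambda>s. \<bar>f3 s\<bar>)"
  proof -
    have i: "integrable (lebesgue_on {0..t}) (\<lambda>s. c s * f3 s)"
    proof (rule Bochner_Integration.integrable_bound[OF f3t(1)])
      show "(\<lambda>s. c s * f3 s) \<in> borel_measurable (lebesgue_on {0..t})"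
        using continuous_lebesgue_on_measurable[OF cc(1)] borel_measurable_integrable[OF f3t(1)] by (rule borel_measurable_times)
      show "AE s in lebesgue_on {0..t}. norm (c s * f3 s) \<le> norm (f3 s)"
        by (intro AE_I2) (simp add: abs_mult c_def mult_left_le_one_le)
    qed
    have "norm (integral {0..t} (\<lambda>s. c s * f3 s)) \<le> integral {0..t} (\<lambda>s. \<bar>f3 s\<bar>)"
      using integrable_on_lebesgue_on[OF i] integrable_on_lebesgue_on[of "{0..t}" "\<lambda>s. \<bar>f3 s\<bar>"] f3t(1)
      by (intro integral_norm_bound_integral) (auto simp: abs_mult c_def mult_left_le_one_le)
    then show ?thesis by simp
  qed
  also have "\<dots> \<le> integral {0..T} (\<lambda>s. \<bar>f3 s\<bar>)"
    using t f3t(1) f3 by (intro integral_subset_le integrable_on_lebesgue_on) auto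
  finally have b3: "\<bar>integral {0..t} (\<lambda>s. c s * f3 s)\<bar> \<le> integral {0..T} (\<lambda>s. \<bar>f3 s\<bar>)" .
  have b1: "\<bar>cos (w * t) * (f2 0 - l * c2 0)\<bar> \<le> \<bar>f2 0 - l * c2 0\<bar>"
    by (simp add: abs_mult mult_left_le_one_le)
  have b2: "\<bar>w * sin (w * t) * c3 0\<bar> \<le> w * \<bar>c3 0\<bar>"
    using w(2) by (simp add: abs_mult mult_right_mono mult_left_le)
  show ?thesis unfolding main w_def[symmetric] using b1 b2 b3 by linarith
qed

text \<open>\<open>Z\<close> collects the initial values and the L1 norm of \<open>f3\<close>. The
  fourth derivative is bounded by \<open>Z\<close>; each integration downwards costs a factor
  \<open>1 + T\<close>, hence the power 4. The products with \<open>l\<close> are recovered from the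
  equation as a difference of two bounded terms, hence the factor 2 and no dependence on
  \<open>l\<close>.\<close>

lemma mode_bounds:
  fixes l T :: real
  assumes T: "T > 0" and l: "l \<ge> 0"
    and d0: "\<And>t. t \<in> {0..T} \<Longrightarrow> (c0 has_real_derivative c1 t) (at t within {0..T})"
    and d1: "\<And>t. t \<in> {0..T} \<Longrightarrow> (c1 has_real_derivative f0 t - l * c0 t) (at t within {0..T})"
    and e0: "\<And>t. t \<in> {0..T} \<Longrightarrow> (f0 has_real_derivative f1 t) (at t within {0..T})"
    and e1: "\<And>t. t \<in> {0..T} \<Longrightarrow> (f1 has_real_derivative f2 t) (at t within {0..T})"
    and f2: "continuous_on {0..T} f2" "\<And>t. t \<in> {0..T} \<Longrightarrow> f2 t = f2 0 + integral {0..t} f3"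
    and f3: "integrable (lebesgue_on {0..T}) f3"
    and c2: "c2 = (\<lambda>t. f0 t - l * c0 t)" and c3: "c3 = (\<lambda>t. f1 t - l * c1 t)" and c4: "c4 = (\<lambda>t. f2 t - l * c2 t)"
    and Z: "Z = \<bar>c0 0\<bar> + \<bar>c1 0\<bar> + \<bar>c2 0\<bar> + \<bar>c3 0\<bar> + \<bar>c4 0\<bar> + sqrt l * \<bar>c3 0\<bar> + \<bar>f0 0\<bar> + \<bar>f1 0\<bar> + \<bar>f2 0\<bar> + integral {0..T} (\<lambda>s. \<bar>f3 s\<bar>)"
    and t: "t \<in> {0..T}"
  shows "\<bar>c0 t\<bar> \<le> 2 * (1 + T) ^ 4 * Z" "\<bar>c1 t\<bar> \<le> 2 * (1 + T) ^ 4 * Z" "\<bar>c2 t\<bar> \<le> 2 * (1 + T) ^ 4 * Z"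
    "\<bar>c3 t\<bar> \<le> 2 * (1 + T) ^ 4 * Z" "\<bar>c4 t\<bar> \<le> 2 * (1 + T) ^ 4 * Z"
    "\<bar>l * c0 t\<bar> \<le> 2 * (1 + T) ^ 4 * Z" "\<bar>l * c1 t\<bar> \<le> 2 * (1 + T) ^ 4 * Z" "\<bar>l * c2 t\<bar> \<le> 2 * (1 + T) ^ 4 * Z"
proof -
  define B where "B = integral {0..T} (\<lambda>s. \<bar>f3 s\<bar>)"
  have f3a: "(\<lambda>s. \<bar>f3 s\<bar>) integrable_on {0..T}" using f3 by (intro integrable_on_lebesgue_on) auto
  have B0: "B \<ge> 0" unfolding B_def by (rule integral_nonneg[OF f3a]) simp
  have l0: "sqrt l * \<bar>c3 0\<bar> \<ge> 0" using l by simp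
  note Z' = Z[folded B_def]
  note pos = abs_ge_zero[of "c0 0"] abs_ge_zero[of "c1 0"] abs_ge_zero[of "c2 0"] abs_ge_zero[of "c3 0"] abs_ge_zero[of "c4 0"]
    abs_ge_zero[of "f0 0"] abs_ge_zero[of "f1 0"] abs_ge_zero[of "f2 0"]
  have Zge: "0 \<le> Z" "\<bar>c0 0\<bar> \<le> Z" "\<bar>c1 0\<bar> \<le> Z" "\<bar>c2 0\<bar> \<le> Z" "\<bar>c3 0\<bar> \<le> Z" "\<bar>f0 0\<bar> \<le> Z" "\<bar>f1 0\<bar> \<le> Z"
    "\<bar>f2 0\<bar> + B \<le> Z" "\<bar>c4 0\<bar> + sqrt l * \<bar>c3 0\<bar> + B \<le> Z"
    unfolding Z' using B0 l0 pos by linarith+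
  note Z0 = Zge(1)
  have step: "\<bar>g s\<bar> \<le> (1 + T) ^ Suc k * Z" if "\<And>t. t \<in> {0..T} \<Longrightarrow> (g has_real_derivative g' t) (at t within {0..T})"
    "\<And>t. t \<in> {0..T} \<Longrightarrow> \<bar>g' t\<bar> \<le> (1 + T) ^ k * Z" "\<bar>g 0\<bar> \<le> Z" "s \<in> {0..T}" for g g' k s
  proof -
    have "\<bar>g s\<bar> \<le> \<bar>g 0\<bar> + T * ((1 + T) ^ k * Z)" by (rule increment_bound[OF that(1,2,4)])
    moreover have "1 * Z \<le> (1 + T) ^ k * Z" using T Z0 by (intro mult_right_mono one_le_power) auto
    ultimately show ?thesis using that(3) by (simp add: algebra_simps)
  qed
  have d2: "(c2 has_real_derivative c3 s) (at s within {0..T})" if "s \<in> {0..T}" for s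
    unfolding c2 c3 using that by (intro DERIV_diff e0 DERIV_cmult d0)
  have d3: "(c3 has_real_derivative f2 s - l * c2 s) (at s within {0..T})" if "s \<in> {0..T}" for s
    unfolding c2 c3 using that by (intro DERIV_diff e1 DERIV_cmult d1)
  have b4: "\<bar>c4 s\<bar> \<le> (1 + T) ^ 0 * Z" if "s \<in> {0..T}" for s
    using order_trans[OF mode_fourth_deriv_bound[OF l d2 d3 f2 f3 that] Zge(9)[unfolded c4 B_def]] by (simp add: c4)
  have b3: "\<bar>c3 s\<bar> \<le> (1 + T) ^ Suc 0 * Z" if "s \<in> {0..T}" for s
    by (rule step[OF d3 b4[unfolded c4] _ that]) (assumption | rule Zge)+
  have b2: "\<bar>c2 s\<bar> \<le> (1 + T) ^ Suc (Suc 0) * Z" if "s \<in> {0..T}" for s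
    by (rule step[OF d2 b3 _ that]) (assumption | rule Zge)+
  have b1: "\<bar>c1 s\<bar> \<le> (1 + T) ^ Suc (Suc (Suc 0)) * Z" if "s \<in> {0..T}" for s
    by (rule step[OF d1 b2[unfolded c2] _ that]) (assumption | rule Zge)+
  have b0: "\<bar>c0 s\<bar> \<le> (1 + T) ^ Suc (Suc (Suc (Suc 0))) * Z" if "s \<in> {0..T}" for s
    by (rule step[OF d0 b1 _ that]) (assumption | rule Zge)+
  have g2: "\<bar>f2 s\<bar> \<le> (1 + T) ^ 0 * Z" if s: "s \<in> {0..T}" for s
  proof -
    have "f3 integrable_on {0..T}" using f3 by (intro integrable_on_lebesgue_on) auto
    then have i: "f3 integrable_on {0..s}" "(\<lambda>s. \<bar>f3 s\<bar>) integrable_on {0..s}"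
      using f3a integrable_on_subinterval[of _ "{0..T}" 0 s] s by auto
    have "norm (integral {0..s} f3) \<le> integral {0..s} (\<lambda>s. \<bar>f3 s\<bar>)"
      using i by (intro integral_norm_bound_integral) auto
    also have "\<dots> \<le> B" unfolding B_def using i f3a s by (intro integral_subset_le) auto
    finally have "\<bar>integral {0..s} f3\<bar> \<le> B" by simp
    then show ?thesis using f2(2)[OF s] Zge(8) by simp
  qed
  have g1: "\<bar>f1 s\<bar> \<le> (1 + T) ^ Suc 0 * Z" if "s \<in> {0..T}" for s
    by (rule step[OF e1 g2 _ that]) (assumption | rule Zge)+
  have g0: "\<bar>f0 s\<bar> \<le> (1 + T) ^ Suc (Suc 0) * Z" if "s \<in> {0..T}" for s
    by (rule step[OF e0 g1 _ that]) (assumption | rule Zge)+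
  have up: "(1 + T) ^ k * Z \<le> (1 + T) ^ 4 * Z" if "k \<le> 4" for k
    using that T Z0 by (intro mult_right_mono power_increasing) auto
  have E0: "0 \<le> (1 + T) ^ 4 * Z" using T Z0 by simp
  have c: "\<bar>c4 t\<bar> \<le> (1 + T) ^ 4 * Z" "\<bar>c3 t\<bar> \<le> (1 + T) ^ 4 * Z" "\<bar>c2 t\<bar> \<le> (1 + T) ^ 4 * Z" "\<bar>c1 t\<bar> \<le> (1 + T) ^ 4 * Z"
    "\<bar>c0 t\<bar> \<le> (1 + T) ^ 4 * Z" "\<bar>f2 t\<bar> \<le> (1 + T) ^ 4 * Z" "\<bar>f1 t\<bar> \<le> (1 + T) ^ 4 * Z" "\<bar>f0 t\<bar> \<le> (1 + T) ^ 4 * Z"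
    by (rule order_trans[OF b4[OF t] up], simp, rule order_trans[OF b3[OF t] up], simp, rule order_trans[OF b2[OF t] up], simp,
      rule order_trans[OF b1[OF t] up], simp, rule order_trans[OF b0[OF t] up], simp, rule order_trans[OF g2[OF t] up], simp,
      rule order_trans[OF g1[OF t] up], simp, rule order_trans[OF g0[OF t] up], simp)
  have eqs: "l * c0 t = f0 t - c2 t" "l * c1 t = f1 t - c3 t" "l * c2 t = f2 t - c4 t" by (simp_all add: c2 c3 c4)
  have ab: "\<bar>x - y\<bar> \<le> 2 * K" if "\<bar>x\<bar> \<le> K" "\<bar>y\<bar> \<le> K" for x y K :: real using that by linarith
  show "\<bar>l * c0 t\<bar> \<le> 2 * (1 + T) ^ 4 * Z" "\<bar>l * c1 t\<bar> \<le> 2 * (1 + T) ^ 4 * Z" "\<bar>l * c2 t\<bar> \<le> 2 * (1 + T) ^ 4 * Z"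
    unfolding eqs mult.assoc by (rule ab[OF c(8) c(3)], rule ab[OF c(7) c(2)], rule ab[OF c(6) c(1)])
  have tw: "x \<le> 2 * K" if "x \<le> K" "0 \<le> K" for x K :: real using that by linarith
  show "\<bar>c0 t\<bar> \<le> 2 * (1 + T) ^ 4 * Z" "\<bar>c1 t\<bar> \<le> 2 * (1 + T) ^ 4 * Z" "\<bar>c2 t\<bar> \<le> 2 * (1 + T) ^ 4 * Z"
    "\<bar>c3 t\<bar> \<le> 2 * (1 + T) ^ 4 * Z" "\<bar>c4 t\<bar> \<le> 2 * (1 + T) ^ 4 * Z"
    unfolding mult.assoc
    by (rule tw[OF c(5) E0], rule tw[OF c(4) E0], rule tw[OF c(3) E0], rule tw[OF c(2) E0], rule tw[OF c(1) E0])
qed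

lemma time_L2_AE_mem: "w \<in> time_L2 X N T \<Longrightarrow> AE t in lebesgue_on {0<..<T}. w t \<in> X"
  unfolding time_L2_def bochner_measurable_def by (auto elim!: eventually_mono)

context eigen_plate
begin

text \<open>Bessel's inequality integrated in time bounds the sum of the squared time norms of the
  coefficients. Cauchy-Schwarz on the bounded time interval then passes from their L2 norms in time
  to their L1 norms.\<close>

lemma time_L2_cf_l2:
  assumes T: "T > 0" and w: "w \<in> time_L2 (L2_space \<Omega>) (L2_norm \<Omega>) T"
    and i: "\<And>n. integrable (lebesgue_on {0<..<T}) (\<lambda>t. cf (w t) n)"
  shows "l2_seq (\<lambda>n. integral {0..T} (\<lambda>s. \<bar>cf (w s) n\<bar>))"
proof -
  let ?U = "{0<..<T}"
  let ?M = "lebesgue_on ?U"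
  define I where "I = (\<integral>\<^sup>+t. ennreal ((L2_norm \<Omega> (w t))\<^sup>2) \<partial>?M)"
  have I: "I < \<infinity>" using w by (simp add: I_def time_L2_def)
  have m: "(\<lambda>t. cf (w t) n) \<in> borel_measurable ?M" for n using i by (rule borel_measurable_integrable)
  have sumle: "(\<Sum>n<N. \<integral>\<^sup>+t. ennreal ((cf (w t) n)\<^sup>2) \<partial>?M) \<le> I" for N
  proof -
    have "(\<Sum>n<N. \<integral>\<^sup>+t. ennreal ((cf (w t) n)\<^sup>2) \<partial>?M) = (\<integral>\<^sup>+t. (\<Sum>n<N. ennreal ((cf (w t) n)\<^sup>2)) \<partial>?M)"
      using m by (intro nn_integral_sum[symmetric]) auto
    also have "\<dots> \<le> I" unfolding I_def
    proof (rule nn_integral_mono_AE)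
      show "AE t in ?M. (\<Sum>n<N. ennreal ((cf (w t) n)\<^sup>2)) \<le> ennreal ((L2_norm \<Omega> (w t))\<^sup>2)"
        using time_L2_AE_mem[OF w]
      proof (rule eventually_mono)
        fix t assume "w t \<in> L2_space \<Omega>"
        from bessel[OF this, of N] show "(\<Sum>n<N. ennreal ((cf (w t) n)\<^sup>2)) \<le> ennreal ((L2_norm \<Omega> (w t))\<^sup>2)"
          by (simp add: sum_ennreal ennreal_leI)
      qed
    qed
    finally show ?thesis .
  qed
  have fin: "(\<integral>\<^sup>+t. ennreal ((cf (w t) n)\<^sup>2) \<partial>?M) < \<infinity>" for n
  proof -
    have "(\<integral>\<^sup>+t. ennreal ((cf (w t) n)\<^sup>2) \<partial>?M) \<le> (\<Sum>n<Suc n. \<integral>\<^sup>+t. ennreal ((cf (w t) n)\<^sup>2) \<partial>?M)"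
      by (simp add: add_increasing)
    then show ?thesis using sumle[of "Suc n"] I by (meson le_less_trans order_trans)
  qed
  have L: "(\<lambda>t. cf (w t) n) \<in> L2_space ?U" for n
    unfolding L2_space_def using m fin by (auto intro!: integrableI_bounded)
  define C where "C = L2_norm ?U (\<lambda>x. 1)"
  have Um: "?U \<in> lmeasurable" by simp
  have le: "(integral {0..T} (\<lambda>s. \<bar>cf (w s) n\<bar>))\<^sup>2 \<le> C\<^sup>2 * (L2_norm ?U (\<lambda>t. cf (w t) n))\<^sup>2" for n
  proof -
    have "integrable ?M (\<lambda>s. \<bar>cf (w s) n\<bar>)" using i by auto
    from integral_open_closed(2)[OF integrable_open_closed[OF this]]
    have "integral {0..T} (\<lambda>s. \<bar>cf (w s) n\<bar>) = (LINT s|?M. \<bar>cf (w s) n\<bar>)" by simp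
    moreover have "(LINT s|?M. \<bar>cf (w s) n\<bar>) \<le> C * L2_norm ?U (\<lambda>t. cf (w t) n)"
      unfolding C_def by (rule L2_abs_integral_le(2)[OF Um L])
    ultimately show ?thesis by (simp add: power_mult_distrib[symmetric] power_mono)
  qed
  have bnd: "(\<Sum>n<N. (L2_norm ?U (\<lambda>t. cf (w t) n))\<^sup>2) \<le> enn2real I" for N
  proof -
    have "ennreal (\<Sum>n<N. (L2_norm ?U (\<lambda>t. cf (w t) n))\<^sup>2) = (\<Sum>n<N. \<integral>\<^sup>+t. ennreal ((cf (w t) n)\<^sup>2) \<partial>?M)"
      by (subst sum_ennreal[symmetric]) (auto simp: nn_integral_L2[OF L])
    then have "ennreal (\<Sum>n<N. (L2_norm ?U (\<lambda>t. cf (w t) n))\<^sup>2) \<le> I" using sumle[of N] by simp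
    then have "enn2real (ennreal (\<Sum>n<N. (L2_norm ?U (\<lambda>t. cf (w t) n))\<^sup>2)) \<le> enn2real I"
      using I by (intro enn2real_mono) auto
    then show ?thesis by (simp add: sum_nonneg)
  qed
  show ?thesis unfolding l2_seq_def
  proof (rule summableI_nonneg_bounded[where x = "C\<^sup>2 * enn2real I"])
    fix N
    have "(\<Sum>n<N. (integral {0..T} (\<lambda>s. \<bar>cf (w s) n\<bar>))\<^sup>2) \<le> (\<Sum>n<N. C\<^sup>2 * (L2_norm ?U (\<lambda>t. cf (w t) n))\<^sup>2)"
      by (intro sum_mono le)
    also have "\<dots> \<le> C\<^sup>2 * enn2real I" unfolding sum_distrib_left[symmetric] by (intro mult_left_mono bnd) simp
    finally show "(\<Sum>n<N. (integral {0..T} (\<lambda>s. \<bar>cf (w s) n\<bar>))\<^sup>2) \<le> C\<^sup>2 * enn2real I" .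
  qed simp
qed

lemma dom_A_pow_l2:
  assumes "w \<in> dom_A_pow \<Omega> ev \<psi> r"
  shows "w \<in> L2_space \<Omega>" "l2_seq (cf w)" "l2_seq (\<lambda>n. ev n powr r * cf w n)"
proof -
  show 1: "w \<in> L2_space \<Omega>" using assms by (simp add: dom_A_pow_def)
  then show "l2_seq (cf w)" by (rule cf_l2)
  have "(ev n powr r * cf w n)\<^sup>2 = ev n powr (2 * r) * \<bar>L2_inner \<Omega> w (\<psi> n)\<bar>\<^sup>2" for n
    by (simp add: power_mult_distrib cf_def power2_eq_square powr_add[symmetric])
  then show "l2_seq (\<lambda>n. ev n powr r * cf w n)" using assms by (simp add: dom_A_pow_def l2_seq_def)
qed

text \<open>The sequence is the \<open>Z\<close> of the modes, written in terms of the data. The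
  highest terms match the hypotheses: \<open>ev n * ev n\<close> acts on \<open>u0\<close>,
  \<open>ev n * sqrt (ev n)\<close> on \<open>v0\<close>, \<open>ev n\<close> on \<open>f0\<close>
  and \<open>sqrt (ev n)\<close> on \<open>f1\<close>. Lower powers are interpolated by
  \<open>x \<le> 1 + x^2\<close> and \<open>x \<le> 1 + x^(3/2)\<close>.\<close>

lemma initial_l2:
  assumes u0: "u0 \<in> dom_A_pow \<Omega> ev \<psi> 2" and v0: "v0 \<in> dom_A_pow \<Omega> ev \<psi> (3 / 2)"
    and f0: "f0 \<in> dom_A \<Omega>" and f1: "f1 \<in> dom_A_pow \<Omega> ev \<psi> (1 / 2)" and f2: "f2 \<in> L2_space \<Omega>" and B: "l2_seq B"
  shows "l2_seq (\<lambda>n. \<bar>cf u0 n\<bar> + \<bar>cf v0 n\<bar> + \<bar>cf f0 n - ev n * cf u0 n\<bar> + \<bar>cf f1 n - ev n * cf v0 n\<bar> +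
    \<bar>cf f2 n - ev n * (cf f0 n - ev n * cf u0 n)\<bar> + sqrt (ev n) * \<bar>cf f1 n - ev n * cf v0 n\<bar> + \<bar>cf f0 n\<bar> + \<bar>cf f1 n\<bar> + \<bar>cf f2 n\<bar> + B n)"
proof -
  have lin: "x \<le> 1 + x * x" "x \<le> 1 + x * sqrt x" if "x \<ge> 0" for x :: real
  proof -
    show "x \<le> 1 + x * x" using zero_le_power2[of "x - 1"] that by (simp add: power2_eq_square algebra_simps)
    show "x \<le> 1 + x * sqrt x"
    proof (cases "x \<le> 1")
      case True
      have "0 \<le> x * sqrt x" using that by simp
      then show ?thesis using True by linarith
    next
      case False
      then have "x * 1 \<le> x * sqrt x" using that by (intro mult_left_mono) auto
      then show ?thesis by simp
    qed
  qed
  have p: "ev n powr 2 = ev n * ev n" "ev n powr (3 / 2) = ev n * sqrt (ev n)" "ev n powr (1 / 2) = sqrt (ev n)" for n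
  proof -
    show "ev n powr 2 = ev n * ev n" using ev_nonneg[of n] by (simp add: power2_eq_square)
    show h: "ev n powr (1 / 2) = sqrt (ev n)" using ev_nonneg[of n] by (simp add: powr_half_sqrt)
    have "ev n powr (3 / 2) = ev n powr (1 + 1 / 2)" by simp
    also have "\<dots> = ev n powr 1 * ev n powr (1 / 2)" by (rule powr_add)
    finally show "ev n powr (3 / 2) = ev n * sqrt (ev n)" using ev_nonneg[of n] h by simp
  qed
  note U = dom_A_pow_l2[OF u0, unfolded p] and V = dom_A_pow_l2[OF v0, unfolded p] and F1 = dom_A_pow_l2[OF f1, unfolded p]
  have F0: "l2_seq (cf f0)" "l2_seq (\<lambda>n. ev n * cf f0 n)"
    using cf_l2[OF dom_A_L2[OF f0]] cf_l2[OF op_A_some(1)[OF f0]] cf_op_A[OF f0] by (auto simp: l2_seq_def)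
  have F2: "l2_seq (cf f2)" by (rule cf_l2[OF f2])
  have eU: "l2_seq (\<lambda>n. ev n * cf u0 n)"
  proof (rule l2_seq_dominated)
    show "l2_seq (\<lambda>n. \<bar>cf u0 n\<bar> + \<bar>ev n * ev n * cf u0 n\<bar>)"
      using U by (intro l2_seq_add) (simp_all add: l2_seq_abs)
    fix n
    have "ev n * \<bar>cf u0 n\<bar> \<le> (1 + ev n * ev n) * \<bar>cf u0 n\<bar>" using lin(1)[OF ev_nonneg[of n]] by (rule mult_right_mono) simp
    then show "\<bar>ev n * cf u0 n\<bar> \<le> \<bar>\<bar>cf u0 n\<bar> + \<bar>ev n * ev n * cf u0 n\<bar>\<bar>"
      using ev_nonneg[of n] by (simp add: abs_mult algebra_simps)
  qed
  have eV: "l2_seq (\<lambda>n. ev n * cf v0 n)"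
  proof (rule l2_seq_dominated)
    show "l2_seq (\<lambda>n. \<bar>cf v0 n\<bar> + \<bar>ev n * sqrt (ev n) * cf v0 n\<bar>)"
      using V by (intro l2_seq_add) (simp_all add: l2_seq_abs)
    fix n
    have "ev n * \<bar>cf v0 n\<bar> \<le> (1 + ev n * sqrt (ev n)) * \<bar>cf v0 n\<bar>" using lin(2)[OF ev_nonneg[of n]] by (rule mult_right_mono) simp
    then show "\<bar>ev n * cf v0 n\<bar> \<le> \<bar>\<bar>cf v0 n\<bar> + \<bar>ev n * sqrt (ev n) * cf v0 n\<bar>\<bar>"
      using ev_nonneg[of n] by (simp add: abs_mult algebra_simps)
  qed
  have sub: "l2_seq (\<lambda>n. a n - b n)" if "l2_seq a" "l2_seq b" for a b
    using l2_seq_add[OF that(1) l2_seq_scale[OF that(2), of "-1"]] by simp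
  have "l2_seq (\<lambda>n. sqrt (ev n) * (cf f1 n - ev n * cf v0 n))"
    using sub[OF F1(3) V(3)] by (simp add: algebra_simps)
  then have s: "l2_seq (\<lambda>n. sqrt (ev n) * \<bar>cf f1 n - ev n * cf v0 n\<bar>)"
    by (rule l2_seq_dominated) (simp add: abs_mult)
  have q: "l2_seq (\<lambda>n. cf f2 n - ev n * (cf f0 n - ev n * cf u0 n))"
    using sub[OF F2 sub[OF F0(2) U(3)]] by (simp add: algebra_simps)
  show ?thesis
    by (intro l2_seq_add s B) (simp_all only: l2_seq_abs U V F0 F1 F2 q sub eU eV)
qed

text \<open>The higher derivatives are prescribed by their coefficients, each new one being obtained
  from the oscillator equation. A time-independent square-summable majorant makes all series
  continuous and differentiable termwise, and the equations with \<open>A\<close> become identities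
  between coefficients.\<close>

lemma regularity:
  assumes T: "T > 0" and data: "smooth_data \<Omega> T ev \<psi> u0 v0 f f_t f_tt f_ttt" and sol: "weak_solution \<Omega> T f u0 v0 u u_t"
  shows "\<exists>u2 u3 u4.
    (\<forall>t\<in>{0..T}. u t \<in> dom_A \<Omega> \<and> u_t t \<in> dom_A \<Omega> \<and> u2 t \<in> dom_A \<Omega> \<and> u3 t \<in> L2_space \<Omega> \<and> u4 t \<in> L2_space \<Omega> \<and>
       ae_eq \<Omega> (op_A \<Omega> (u t)) (\<lambda>x. f t x - u2 t x) \<and> ae_eq \<Omega> (op_A \<Omega> (u_t t)) (\<lambda>x. f_t t x - u3 t x) \<and>
       ae_eq \<Omega> (op_A \<Omega> (u2 t)) (\<lambda>x. f_tt t x - u4 t x)) \<and>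
    {u, u_t, u2, u3, u4} \<subseteq> time_C0 (L2_space \<Omega>) (L2_norm \<Omega>) T \<and>
    (\<forall>v\<in>L2_space \<Omega>. \<forall>t\<in>{0..T}.
       ((\<lambda>t. L2_inner \<Omega> (u t) v) has_real_derivative L2_inner \<Omega> (u_t t) v) (at t within {0..T}) \<and>
       ((\<lambda>t. L2_inner \<Omega> (u_t t) v) has_real_derivative L2_inner \<Omega> (u2 t) v) (at t within {0..T}) \<and>
       ((\<lambda>t. L2_inner \<Omega> (u2 t) v) has_real_derivative L2_inner \<Omega> (u3 t) v) (at t within {0..T}) \<and>
       ((\<lambda>t. L2_inner \<Omega> (u3 t) v) has_real_derivative L2_inner \<Omega> (u4 t) v) (at t within {0..T}))"
proof -
  have fC: "f \<in> time_C0 (L2_space \<Omega>) (L2_norm \<Omega>) T" "f_t \<in> time_C0 (L2_space \<Omega>) (L2_norm \<Omega>) T" "f_tt \<in> time_C0 (L2_space \<Omega>) (L2_norm \<Omega>) T"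
    and f3: "f_ttt \<in> time_L2 (L2_space \<Omega>) (L2_norm \<Omega>) T"
    and fw: "has_weak_time_deriv \<Omega> T f f_t" "has_weak_time_deriv \<Omega> T f_t f_tt" "has_weak_time_deriv \<Omega> T f_tt f_ttt"
    and init: "u0 \<in> dom_A_pow \<Omega> ev \<psi> 2" "v0 \<in> dom_A_pow \<Omega> ev \<psi> (3 / 2)" "f 0 \<in> dom_A \<Omega>" "f_t 0 \<in> dom_A_pow \<Omega> ev \<psi> (1 / 2)" "f_tt 0 \<in> L2_space \<Omega>"
    using data by (auto simp: smooth_data_def)
  have uH: "u t \<in> H20 \<Omega>" if "t \<in> {0..T}" for t using sol that by (auto simp: weak_solution_def time_C0_def)
  have utC: "u_t \<in> time_C0 (L2_space \<Omega>) (L2_norm \<Omega>) T" and ud: "has_time_deriv \<Omega> T u u_t"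
    and wk: "\<And>v. v \<in> H20 \<Omega> \<Longrightarrow> has_scalar_weak_time_deriv T (\<lambda>t. L2_inner \<Omega> (u_t t) v) (\<lambda>t. L2_inner \<Omega> (f t) v - plate_form \<Omega> (u t) v)"
    and u0: "ae_eq \<Omega> (u 0) u0" and v0: "ae_eq \<Omega> (u_t 0) v0"
    using sol by (auto simp: weak_solution_def)
  have uL: "u t \<in> L2_space \<Omega>" "u_t t \<in> L2_space \<Omega>" "f t \<in> L2_space \<Omega>" "f_t t \<in> L2_space \<Omega>" "f_tt t \<in> L2_space \<Omega>" if "t \<in> {0..T}" for t
    using H20_L2[OF uH[OF that]] utC fC that by (auto simp: time_C0_def)
  define c0 where "c0 n t = cf (u t) n" for n t
  define c1 where "c1 n t = cf (u_t t) n" for n t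
  define F0 where "F0 n t = cf (f t) n" for n t
  define F1 where "F1 n t = cf (f_t t) n" for n t
  define F2 where "F2 n t = cf (f_tt t) n" for n t
  define F3 where "F3 n t = cf (f_ttt t) n" for n t
  define c2 where "c2 n t = F0 n t - ev n * c0 n t" for n t
  define c3 where "c3 n t = F1 n t - ev n * c1 n t" for n t
  define c4 where "c4 n t = F2 n t - ev n * c2 n t" for n t
  have d0: "(c0 n has_real_derivative c1 n t) (at t within {0..T})" if "t \<in> {0..T}" for n t
    unfolding c0_def c1_def cf_def by (rule has_time_deriv_inner[OF ud uL(1) uL(2) \<psi>_L2 that])
  have cont: "continuous_on {0..T} (c1 n)" "continuous_on {0..T} (F0 n)" "continuous_on {0..T} (F1 n)" "continuous_on {0..T} (F2 n)" for n
    unfolding c1_def F0_def F1_def F2_def cf_def by (intro time_C0_inner_continuous utC fC \<psi>_L2)+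
  have cc0: "continuous_on {0..T} (c0 n)" for n by (rule DERIV_continuous_on[OF d0])
  have e0: "(F0 n has_real_derivative F1 n t) (at t within {0..T})" if "t \<in> {0..T}" for n t
    using weak_time_deriv_classical[OF T cont(2) _ cont(3) that, of n n] fw(1) \<psi>_L2
    unfolding has_weak_time_deriv_def F0_def F1_def cf_def by blast
  have e1: "(F1 n has_real_derivative F2 n t) (at t within {0..T})" if "t \<in> {0..T}" for n t
    using weak_time_deriv_classical[OF T cont(3) _ cont(4) that, of n n] fw(2) \<psi>_L2
    unfolding has_weak_time_deriv_def F1_def F2_def cf_def by blast
  have w3: "has_scalar_weak_time_deriv T (F2 n) (F3 n)" for n
    using fw(3) \<psi>_L2 unfolding has_weak_time_deriv_def F2_def F3_def cf_def by blast
  note F2i = weak_time_deriv_integral(2)[OF T cont(4) w3] and F3i = weak_time_deriv_integral(1)[OF T cont(4) w3]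
  \<comment> \<open>The weak formulation tested with an eigenfunction. Its right-hand side is
    continuous in time, which turns the weak derivative of \<open>c1 n\<close> into a classical
    one.\<close>
  have d1: "(c1 n has_real_derivative F0 n t - ev n * c0 n t) (at t within {0..T})" if t: "t \<in> {0..T}" for n t
  proof -
    let ?g = "\<lambda>t. L2_inner \<Omega> (f t) (\<psi> n) - plate_form \<Omega> (u t) (\<psi> n)"
    have eq: "?g s = F0 n s - ev n * c0 n s" if "s \<in> {0..T}" for s
      using plate_\<psi>[OF uH[OF that]] by (simp add: F0_def c0_def cf_def)
    have "continuous_on {0..T} (\<lambda>s. F0 n s - ev n * c0 n s)" by (intro continuous_intros cont cc0)
    then have cg: "continuous_on {0..T} ?g" by (rule continuous_on_eq) (rule eq[symmetric])
    have "(c1 n has_real_derivative ?g t) (at t within {0..T})"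
      using weak_time_deriv_classical[OF T cont(1) _ cg t, of n] wk[OF \<psi>_H20[of n]] unfolding c1_def cf_def by blast
    then show ?thesis using eq[OF t] by simp
  qed
  define B where "B n = integral {0..T} (\<lambda>s. \<bar>F3 n s\<bar>)" for n
  have "integrable (lebesgue_on {0<..<T}) (F3 n)" for n using w3 by (simp add: has_scalar_weak_time_deriv_def)
  then have Bl: "l2_seq B" unfolding B_def F3_def by (intro time_L2_cf_l2[OF T f3])
  define Z where "Z n = \<bar>c0 n 0\<bar> + \<bar>c1 n 0\<bar> + \<bar>c2 n 0\<bar> + \<bar>c3 n 0\<bar> + \<bar>c4 n 0\<bar> + sqrt (ev n) * \<bar>c3 n 0\<bar> + \<bar>F0 n 0\<bar> + \<bar>F1 n 0\<bar> + \<bar>F2 n 0\<bar> + B n" for n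
  \<comment> \<open>The initial values of the solution agree with the data almost everywhere and
    therefore have the same coefficients.\<close>
  have "l2_seq Z"
    using initial_l2[OF init Bl] cf_ae[OF u0] cf_ae[OF v0]
    unfolding Z_def[abs_def] c4_def c3_def c2_def c1_def c0_def F0_def F1_def F2_def by simp
  define m where "m n = 2 * (1 + T) ^ 4 * Z n" for n
  have ml: "l2_seq m" unfolding m_def by (rule l2_seq_scale[OF \<open>l2_seq Z\<close>])
  have bounds: "\<bar>c0 n t\<bar> \<le> m n" "\<bar>c1 n t\<bar> \<le> m n" "\<bar>c2 n t\<bar> \<le> m n" "\<bar>c3 n t\<bar> \<le> m n" "\<bar>c4 n t\<bar> \<le> m n"
    "\<bar>ev n * c0 n t\<bar> \<le> m n" "\<bar>ev n * c1 n t\<bar> \<le> m n" "\<bar>ev n * c2 n t\<bar> \<le> m n" if t: "t \<in> {0..T}" for n t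
  proof -
    have h: "c2 n = (\<lambda>t. F0 n t - ev n * c0 n t)" "c3 n = (\<lambda>t. F1 n t - ev n * c1 n t)" "c4 n = (\<lambda>t. F2 n t - ev n * c2 n t)"
      by (auto simp: c2_def c3_def c4_def)
    note mb = mode_bounds[OF T ev_nonneg d0 d1 e0 e1 cont(4) F2i F3i h(1) h(2) h(3) Z_def[unfolded B_def] t]
    show "\<bar>c0 n t\<bar> \<le> m n" "\<bar>c1 n t\<bar> \<le> m n" "\<bar>c2 n t\<bar> \<le> m n" "\<bar>c3 n t\<bar> \<le> m n" "\<bar>c4 n t\<bar> \<le> m n"
      "\<bar>ev n * c0 n t\<bar> \<le> m n" "\<bar>ev n * c1 n t\<bar> \<le> m n" "\<bar>ev n * c2 n t\<bar> \<le> m n"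
      unfolding m_def using mb by blast+
  qed
  have dom: "l2_seq (\<lambda>n. a n)" if "\<And>n. \<bar>a n\<bar> \<le> m n" for a
    by (rule l2_seq_dominated[OF ml]) (rule order_trans[OF that abs_ge_self])
  \<comment> \<open>The functions are chosen at each time separately; their regularity in time is
    recovered from that of the coefficients.\<close>
  define u2 where "u2 t = rf (\<lambda>n. c2 n t)" for t
  define u3 where "u3 t = rf (\<lambda>n. c3 n t)" for t
  define u4 where "u4 t = rf (\<lambda>n. c4 n t)" for t
  have u2: "u2 t \<in> L2_space \<Omega>" "cf (u2 t) n = c2 n t" if "t \<in> {0..T}" for t n
    using rf[OF dom[OF bounds(3)[OF that]]] by (simp_all add: u2_def)
  have u3: "u3 t \<in> L2_space \<Omega>" "cf (u3 t) n = c3 n t" if "t \<in> {0..T}" for t n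
    using rf[OF dom[OF bounds(4)[OF that]]] by (simp_all add: u3_def)
  have u4: "u4 t \<in> L2_space \<Omega>" "cf (u4 t) n = c4 n t" if "t \<in> {0..T}" for t n
    using rf[OF dom[OF bounds(5)[OF that]]] by (simp_all add: u4_def)
  have d2: "(c2 n has_real_derivative c3 n t) (at t within {0..T})" if "t \<in> {0..T}" for n t
    unfolding c2_def[abs_def] c3_def using that by (intro DERIV_diff e0 DERIV_cmult d0)
  have d3: "(c3 n has_real_derivative c4 n t) (at t within {0..T})" if "t \<in> {0..T}" for n t
    unfolding c3_def[abs_def] c4_def c2_def using that by (intro DERIV_diff e1 DERIV_cmult d1)
  have cc2: "continuous_on {0..T} (c2 n)" for n by (rule DERIV_continuous_on[OF d2])
  have cc3: "continuous_on {0..T} (c3 n)" for n by (rule DERIV_continuous_on[OF d3])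
  have cc4: "continuous_on {0..T} (c4 n)" for n
    unfolding c4_def[abs_def] by (intro continuous_intros cont cc2)
  have C: "u \<in> time_C0 (L2_space \<Omega>) (L2_norm \<Omega>) T" "u2 \<in> time_C0 (L2_space \<Omega>) (L2_norm \<Omega>) T"
    "u3 \<in> time_C0 (L2_space \<Omega>) (L2_norm \<Omega>) T" "u4 \<in> time_C0 (L2_space \<Omega>) (L2_norm \<Omega>) T"
    using series_time_C0[OF cc0 ml bounds(1) uL(1) c0_def[symmetric]]
      series_time_C0[OF cc2 ml bounds(3) u2] series_time_C0[OF cc3 ml bounds(4) u3] series_time_C0[OF cc4 ml bounds(5) u4] by simp_all
  have D: "((\<lambda>t. L2_inner \<Omega> (u t) v) has_real_derivative L2_inner \<Omega> (u_t t) v) (at t within {0..T})"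
    "((\<lambda>t. L2_inner \<Omega> (u_t t) v) has_real_derivative L2_inner \<Omega> (u2 t) v) (at t within {0..T})"
    "((\<lambda>t. L2_inner \<Omega> (u2 t) v) has_real_derivative L2_inner \<Omega> (u3 t) v) (at t within {0..T})"
    "((\<lambda>t. L2_inner \<Omega> (u3 t) v) has_real_derivative L2_inner \<Omega> (u4 t) v) (at t within {0..T})"
    if v: "v \<in> L2_space \<Omega>" and t: "t \<in> {0..T}" for v t
    using has_time_deriv_inner[OF ud uL(1) uL(2) v t]
      series_inner_deriv[OF d1[folded c2_def] ml bounds(3) uL(2) c1_def[symmetric] u2 v t]
      series_inner_deriv[OF d2 ml bounds(4) u2 u3 v t]
      series_inner_deriv[OF d3 ml bounds(5) u3 u4 v t] by simp_all
  \<comment> \<open>The majorant of \<open>ev n * cf w n\<close> gives membership in the domain; the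
    equation follows because a function in L2 is determined almost everywhere by its
    coefficients.\<close>
  have A: "w \<in> dom_A \<Omega>" "ae_eq \<Omega> (op_A \<Omega> w) (\<lambda>x. g x - z x)"
    if "w \<in> L2_space \<Omega>" "\<And>n. \<bar>ev n * cf w n\<bar> \<le> m n" "g \<in> L2_space \<Omega>" "z \<in> L2_space \<Omega>" "\<And>n. ev n * cf w n = cf g n - cf z n" for w g z
  proof -
    show 1: "w \<in> dom_A \<Omega>" by (rule dom_A_char[OF that(1) dom[OF that(2)]])
    show "ae_eq \<Omega> (op_A \<Omega> w) (\<lambda>x. g x - z x)"
      by (rule cf_eq_imp_ae[OF op_A_some(1)[OF 1] L2.diff_mem[OF that(3,4)]]) (simp add: cf_op_A[OF 1] cf_diff[OF that(3,4)] that(5))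
  qed
  have "u t \<in> dom_A \<Omega> \<and> u_t t \<in> dom_A \<Omega> \<and> u2 t \<in> dom_A \<Omega> \<and> u3 t \<in> L2_space \<Omega> \<and> u4 t \<in> L2_space \<Omega> \<and>
       ae_eq \<Omega> (op_A \<Omega> (u t)) (\<lambda>x. f t x - u2 t x) \<and> ae_eq \<Omega> (op_A \<Omega> (u_t t)) (\<lambda>x. f_t t x - u3 t x) \<and>
       ae_eq \<Omega> (op_A \<Omega> (u2 t)) (\<lambda>x. f_tt t x - u4 t x)" if t: "t \<in> {0..T}" for t
  proof -
    have "ev n * cf (u t) n = cf (f t) n - cf (u2 t) n" "ev n * cf (u_t t) n = cf (f_t t) n - cf (u3 t) n"
      "ev n * cf (u2 t) n = cf (f_tt t) n - cf (u4 t) n" for n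
      unfolding u2(2)[OF t] u3(2)[OF t] u4(2)[OF t] by (simp_all add: c4_def c3_def c2_def c0_def c1_def F0_def F1_def F2_def)
    then show ?thesis
      using A[OF uL(1)[OF t] bounds(6)[OF t, unfolded c0_def] uL(3)[OF t] u2(1)[OF t]]
        A[OF uL(2)[OF t] bounds(7)[OF t, unfolded c1_def] uL(4)[OF t] u3(1)[OF t]]
        A[OF u2(1)[OF t] _ uL(5)[OF t] u4(1)[OF t]] bounds(8)[OF t] u2(2)[OF t] u3(1)[OF t] u4(1)[OF t] by simp
  qed
  note fin = this
  show ?thesis
    by (rule exI[of _ u2], rule exI[of _ u3], rule exI[of _ u4], intro conjI ballI)
      (simp_all add: fin C utC D del: atLeastAtMost_iff)
qed

end

section \<open>The discrete problem\<close>

lemma indicator_measurable_Union: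
  fixes v :: "'a::euclidean_space \<Rightarrow> real"
  assumes "finite \<U>" "\<And>U. U \<in> \<U> \<Longrightarrow> U \<in> sets lebesgue \<and> v \<in> borel_measurable (lebesgue_on U)"
  shows "(\<lambda>x. indicat_real (\<Union>\<U>) x * v x) \<in> borel_measurable lebesgue"
  using assms
proof (induction \<U> rule: finite_induct)
  case (insert U \<U>)
  have U: "U \<in> sets lebesgue" "(\<lambda>x. indicat_real U x * v x) \<in> borel_measurable lebesgue"
    using insert.prems[of U] by (auto simp: borel_measurable_restrict_space_iff)
  have W: "(\<lambda>x. indicat_real (\<Union>\<U>) x * v x) \<in> borel_measurable lebesgue" using insert by auto
  \<comment> \<open>The sets may overlap, so the old part is counted only outside the new
    set.\<close>
  have "(\<lambda>x. indicat_real U x * v x + (1 - indicat_real U x) * (indicat_real (\<Union>\<U>) x * v x)) \<in> borel_measurable lebesgue"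
    by (intro borel_measurable_add borel_measurable_times[OF _ W] borel_measurable_diff borel_measurable_indicator borel_measurable_const U)
  also have "(\<lambda>x. indicat_real U x * v x + (1 - indicat_real U x) * (indicat_real (\<Union>\<U>) x * v x)) = (\<lambda>x. indicat_real (\<Union>(insert U \<U>)) x * v x)"
    by (auto simp: indicator_def fun_eq_iff)
  finally show ?case .
qed simp

text \<open>Used to assemble a function on \<open>\<Omega>\<close> from the triangles, and to pass
  from \<open>\<Omega>\<close> to a triangle. Only an inequality is claimed, so the sets may overlap
  or reach beyond \<open>W\<close>.\<close>

lemma L2_cover:
  fixes W :: "'a::euclidean_space set"
  assumes fin: "finite \<U>" and W: "W \<in> sets lebesgue" and U: "\<And>U. U \<in> \<U> \<Longrightarrow> U \<in> sets lebesgue"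
    and n: "negligible (W - \<Union>\<U>)" and v: "\<And>U. U \<in> \<U> \<Longrightarrow> v \<in> L2_space U"
  shows "v \<in> L2_space W" "L2_inner W v v \<le> (\<Sum>U\<in>\<U>. L2_inner U v v)"
proof -
  have ae: "AE x in lebesgue. x \<notin> W - \<Union>\<U>" using n by (intro AE_not_in) (simp add: negligible_iff_null_sets)
  have m: "(\<lambda>x. indicat_real (\<Union>\<U>) x * v x) \<in> borel_measurable lebesgue"
    using U v by (intro indicator_measurable_Union fin) (auto simp: L2_space_def)
  have "(\<lambda>x. indicat_real W x * (indicat_real (\<Union>\<U>) x * v x)) \<in> borel_measurable lebesgue"
    by (intro borel_measurable_times[OF _ m] borel_measurable_indicator W)
  moreover have "AE x in lebesgue. indicat_real W x * (indicat_real (\<Union>\<U>) x * v x) = indicat_real W x * v x"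
    using ae by (rule eventually_mono) (auto simp: indicator_def)
  ultimately have "(\<lambda>x. indicat_real W x * v x) \<in> borel_measurable lebesgue" by (rule borel_measurable_AE)
  then have mW: "v \<in> borel_measurable (lebesgue_on W)" using W by (simp add: borel_measurable_restrict_space_iff)
  have "(\<integral>\<^sup>+x. ennreal ((v x)\<^sup>2) \<partial>lebesgue_on W) = (\<integral>\<^sup>+x. ennreal ((v x)\<^sup>2) * indicator W x \<partial>lebesgue)"
    using W by (simp add: nn_integral_restrict_space)
  also have "\<dots> \<le> (\<integral>\<^sup>+x. (\<Sum>U\<in>\<U>. ennreal ((v x)\<^sup>2) * indicator U x) \<partial>lebesgue)"
  proof (rule nn_integral_mono_AE)
    show "AE x in lebesgue. ennreal ((v x)\<^sup>2) * indicator W x \<le> (\<Sum>U\<in>\<U>. ennreal ((v x)\<^sup>2) * indicator U x)"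
      using ae
    proof (rule eventually_mono)
      fix x assume x: "x \<notin> W - \<Union>\<U>"
      show "ennreal ((v x)\<^sup>2) * indicator W x \<le> (\<Sum>U\<in>\<U>. ennreal ((v x)\<^sup>2) * indicator U x)"
      proof (cases "x \<in> W")
        case True
        then obtain U where "U \<in> \<U>" "x \<in> U" using x by blast
        then have "ennreal ((v x)\<^sup>2) * indicator W x = ennreal ((v x)\<^sup>2) * indicator U x" using True by simp
        also have "\<dots> \<le> (\<Sum>U\<in>\<U>. ennreal ((v x)\<^sup>2) * indicator U x)"
          using fin \<open>U \<in> \<U>\<close> by (intro member_le_sum) auto
        finally show ?thesis .
      qed simp
    qed
  qed
  also have "\<dots> = (\<Sum>U\<in>\<U>. \<integral>\<^sup>+x. ennreal ((v x)\<^sup>2) * indicator U x \<partial>lebesgue)"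
  proof (rule nn_integral_sum)
    fix V assume V: "V \<in> \<U>"
    have "(\<lambda>x. indicat_real V x * v x) \<in> borel_measurable lebesgue"
      using v[OF V] U[OF V] by (auto simp: L2_space_def borel_measurable_restrict_space_iff)
    then have "(\<lambda>x. ennreal ((indicat_real V x * v x)\<^sup>2)) \<in> borel_measurable lebesgue" by measurable
    also have "(\<lambda>x. ennreal ((indicat_real V x * v x)\<^sup>2)) = (\<lambda>x. ennreal ((v x)\<^sup>2) * indicator V x)"
      by (auto simp: indicator_def fun_eq_iff)
    finally show "(\<lambda>x. ennreal ((v x)\<^sup>2) * indicator V x) \<in> borel_measurable lebesgue" .
  qed
  also have "\<dots> = (\<Sum>U\<in>\<U>. ennreal (L2_inner U v v))"
  proof (rule sum.cong[OF refl])
    fix V assume V: "V \<in> \<U>"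
    show "(\<integral>\<^sup>+x. ennreal ((v x)\<^sup>2) * indicator V x \<partial>lebesgue) = ennreal (L2_inner V v v)"
      using nn_integral_L2[OF v[OF V]] U[OF V] by (simp add: nn_integral_restrict_space L2_norm_sq)
  qed
  finally have le: "(\<integral>\<^sup>+x. ennreal ((v x)\<^sup>2) \<partial>lebesgue_on W) \<le> ennreal (\<Sum>U\<in>\<U>. L2_inner U v v)"
    by (simp add: sum_ennreal L2_inner_self_nonneg)
  show vL: "v \<in> L2_space W"
    unfolding L2_space_def using mW le by (auto intro!: integrableI_bounded intro: le_less_trans)
  show "L2_inner W v v \<le> (\<Sum>U\<in>\<U>. L2_inner U v v)"
    using le nn_integral_L2[OF vL] by (simp add: L2_norm_sq sum_nonneg L2_inner_self_nonneg)
qed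

lemma ae_eq_subset:
  fixes U W :: "'a::euclidean_space set"
  assumes "U \<in> sets lebesgue" "W \<in> sets lebesgue" "negligible (U - W)" "ae_eq W v w"
  shows "ae_eq U v w"
proof -
  have "AE x in lebesgue. x \<in> W \<longrightarrow> v x = w x" using assms by (simp add: ae_eq_def AE_restrict_space_iff)
  moreover have "AE x in lebesgue. x \<notin> U - W" using assms(3) by (intro AE_not_in) (simp add: negligible_iff_null_sets)
  ultimately have "AE x in lebesgue. x \<in> U \<longrightarrow> v x = w x" by eventually_elim auto
  then show ?thesis using assms by (simp add: ae_eq_def AE_restrict_space_iff)
qed

lemma ae_eq_cover:
  fixes W :: "'a::euclidean_space set"
  assumes fin: "finite \<U>" and W: "W \<in> sets lebesgue" and U: "\<And>U. U \<in> \<U> \<Longrightarrow> U \<in> sets lebesgue"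
    and n: "negligible (W - \<Union>\<U>)" and v: "\<And>U. U \<in> \<U> \<Longrightarrow> ae_eq U v w"
  shows "ae_eq W v w"
proof -
  have "AE x in lebesgue. \<forall>U\<in>\<U>. x \<in> U \<longrightarrow> v x = w x"
    using v U by (subst AE_finite_all[OF fin]) (auto simp: ae_eq_def AE_restrict_space_iff)
  moreover have "AE x in lebesgue. x \<notin> W - \<Union>\<U>" using n by (intro AE_not_in) (simp add: negligible_iff_null_sets)
  ultimately have "AE x in lebesgue. x \<in> W \<longrightarrow> v x = w x" by eventually_elim auto
  then show ?thesis using W by (simp add: ae_eq_def AE_restrict_space_iff)
qed

lemma L2_space_subset:
  assumes "v \<in> L2_space W" "U \<subseteq> W" "U \<in> sets lebesgue" "W \<in> sets lebesgue"
  shows "v \<in> L2_space U"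
proof -
  have i: "integrable lebesgue (\<lambda>x. indicat_real W x *\<^sub>R (v x)\<^sup>2)" and m: "(\<lambda>x. indicat_real W x *\<^sub>R v x) \<in> borel_measurable lebesgue"
    using assms by (auto simp: L2_space_def integrable_restrict_space borel_measurable_restrict_space_iff)
  have e: "indicat_real U x *\<^sub>R (indicat_real W x *\<^sub>R z) = indicat_real U x *\<^sub>R z" for x and z :: real
    using assms(2) by (auto simp: indicator_def)
  have "(\<lambda>x. indicat_real U x *\<^sub>R (indicat_real W x *\<^sub>R v x)) \<in> borel_measurable lebesgue"
    by (rule borel_measurable_scaleR[OF borel_measurable_indicator[OF assms(3)] m])
  moreover have "integrable lebesgue (\<lambda>x. indicat_real U x *\<^sub>R (indicat_real W x *\<^sub>R (v x)\<^sup>2))"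
    by (rule integrable_mult_indicator[OF assms(3) i])
  ultimately show ?thesis
    using assms(3) unfolding e by (simp add: L2_space_def integrable_restrict_space borel_measurable_restrict_space_iff)
qed

lemma L2_inner_restrict:
  assumes "U \<subseteq> W" "U \<in> sets lebesgue" "W \<in> sets lebesgue" "\<And>x. x \<notin> U \<Longrightarrow> \<phi> x = 0"
  shows "L2_inner W v \<phi> = L2_inner U v \<phi>"
proof -
  have "L2_inner X v \<phi> = (LINT x|lebesgue. v x * \<phi> x)" if "U \<subseteq> X" "X \<in> sets lebesgue" for X
    by (rule L2_inner_lebesgue[OF that(2)]) (use assms(4) that(1) in auto)
  then show ?thesis using assms by simp
qed

text \<open>The Poincare inequality for the derivative of order zero: clamped functions without
  plate energy are null.\<close>

lemma plate_null:
  assumes "open \<Omega>" "bounded \<Omega>" "z \<in> H20 \<Omega>" "plate_form \<Omega> z z = 0"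
  shows "ae_eq \<Omega> z (\<lambda>x. 0)"
proof -
  obtain K where K: "K > 0" "\<forall>v\<in>H20 \<Omega>. \<forall>k\<le>2. \<forall>bs\<in>deriv_idx k. (L2_norm \<Omega> (weak_deriv \<Omega> bs v))\<^sup>2 \<le> K * plate_form \<Omega> v v"
    using poincare_H20[OF assms(1,2)] by blast
  have e: "ae_eq \<Omega> (weak_deriv \<Omega> [] z) z"
    by (rule weak_deriv_eq[OF assms(1) H20_L2[OF assms(3)]]) (simp add: has_weak_deriv_def)
  have "(L2_norm \<Omega> (weak_deriv \<Omega> [] z))\<^sup>2 \<le> K * plate_form \<Omega> z z"
    using K(2) assms(3) deriv_idx_0 by (metis insertI1 zero_le_numeral le0)
  then have "L2_norm \<Omega> z = 0" using assms(4) L2_norm_ae[OF open_sets_lebesgue[OF assms(1)] e] by simp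
  then have "L2_inner \<Omega> z z = 0" by (metis L2_norm_sq power_zero_numeral)
  then show ?thesis using L2_null_iff[OF H20_L2[OF assms(3)]] by blast
qed

section \<open>Null sets and traces in a triangulation\<close>

lemma closed_segment_negligible: "negligible (closed_segment a (b :: plane))"
  using negligible_convex_interior[of "closed_segment a b"] interior_closed_segment_ge2[of a b] by simp

lemma polygonal_frontier_negligible:
  assumes "polygonal_lipschitz_domain \<Omega>"
  shows "negligible (frontier \<Omega>)"
proof -
  obtain S where S: "finite S" "frontier \<Omega> = (\<Union>(a, b)\<in>S. closed_segment a b)"
    using assms by (auto simp: polygonal_lipschitz_domain_def)
  show ?thesis unfolding S(2) using S(1)
    by (intro negligible_Union finite_imageI) (auto simp: closed_segment_negligible)
qed

lemma tri_int_negligible: "finite t \<Longrightarrow> negligible (convex hull t - tri_int t)"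
proof -
  assume "finite t"
  then have "closed (convex hull t)" using finite_imp_compact_convex_hull compact_imp_closed by blast
  then have "convex hull t - tri_int t \<subseteq> frontier (convex hull t)" by (auto simp: frontier_def tri_int_def)
  then show ?thesis using negligible_convex_frontier[of "convex hull t"] negligible_subset by auto
qed

lemma point_trace_ae:
  assumes "ae_eq (convex hull t) v w"
  shows "point_trace t v z = point_trace t w z"
proof -
  have "ae_eq (convex hull t) x v \<longleftrightarrow> ae_eq (convex hull t) x w" for x
    using assms ae_eq_trans ae_eq_sym by blast
  then show ?thesis by (simp add: point_trace_def)
qed

text \<open>\<open>point_trace\<close> is a definite description, so uniqueness of the continuous
  representative has to be proved. Vanishing almost everywhere forces it to be 0 in the interior,
  and the closed triangle is the closure of its interior.\<close>

lemma point_trace_zero: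
  assumes t: "finite t" "interior (convex hull t) \<noteq> {}" and z: "z \<in> convex hull t"
  shows "point_trace t (\<lambda>x. 0) z = 0"
  unfolding point_trace_def
proof (rule the_equality)
  show "\<exists>w. continuous_on (convex hull t) w \<and> ae_eq (convex hull t) w (\<lambda>x. 0) \<and> w z = 0"
    by (intro exI[of _ "\<lambda>x. 0"]) auto
  fix y assume "\<exists>w. continuous_on (convex hull t) w \<and> ae_eq (convex hull t) w (\<lambda>x. 0) \<and> w z = y"
  then obtain w where w: "continuous_on (convex hull t) w" "ae_eq (convex hull t) w (\<lambda>x. 0)" "w z = y" by blast
  have cl: "closed (convex hull t)" using t(1) finite_imp_compact_convex_hull compact_imp_closed by blast
  have c: "closure (interior (convex hull t)) = convex hull t"
    using convex_closure_interior[of "convex hull t"] t(2) cl by simp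
  have "ae_eq (interior (convex hull t)) w (\<lambda>x. 0)"
    by (intro ae_eq_subset[OF _ _ _ w(2)] open_sets_lebesgue sets_completionI_sets) (use cl interior_subset[of "convex hull t"] in \<open>auto simp: Diff_eq_empty_iff[THEN iffD2]\<close>)
  then have "w x = 0" if "x \<in> interior (convex hull t)" for x
    using that by (intro ae_zero_continuous[OF open_interior]) (auto intro: continuous_on_subset[OF w(1) interior_subset])
  then show "y = 0" using continuous_constant_on_closure[of "interior (convex hull t)" w 0 z] w z unfolding c by auto
qed

text \<open>Traces and weak derivatives are defined through almost everywhere equality, so every
  term of the mesh norm depends only on the class of the function. This is what lets boundedness of
  \<open>a\<close> control null functions.\<close>

lemma h_norm_ae:
  assumes "\<And>t. t \<in> \<T> \<Longrightarrow> ae_eq (convex hull t) v w" "\<And>t. t \<in> \<T> \<Longrightarrow> ae_eq (tri_int t) v w"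
  shows "h_norm \<T> v = h_norm \<T> w"
proof -
  have wd: "weak_deriv (tri_int t) bs v = weak_deriv (tri_int t) bs w" if "t \<in> \<T>" for t bs
    by (rule weak_deriv_ae[OF _ assms(2)[OF that]]) (simp add: tri_int_def open_sets_lebesgue)
  have jump: "edge_jump \<T> e F = edge_jump \<T> e G" if "e \<in> mesh_edges \<T>" "\<And>t. t \<in> \<T> \<Longrightarrow> F t = G t" for e F G
  proof -
    \<comment> \<open>\<open>edge_jump\<close> selects a triangle by choice; existence guarantees
      that the selected one belongs to the mesh.\<close>
    have "\<exists>t. t \<in> tris_on \<T> e" using that(1) by (auto simp: mesh_edges_def tris_on_def)
    then have "(SOME t. t \<in> tris_on \<T> e) \<in> tris_on \<T> e" by (rule someI_ex)
    then show ?thesis using that(2) unfolding edge_jump_def Let_def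
      by (intro arg_cong2[of _ _ _ _ minus] sum.cong) (auto simp: tris_on_def)
  qed
  have 1: "(\<Sum>t\<in>\<T>. (sobolev_seminorm2 (tri_int t) v)\<^sup>2) = (\<Sum>t\<in>\<T>. (sobolev_seminorm2 (tri_int t) w)\<^sup>2)"
    unfolding sobolev_seminorm2_def by (intro sum.cong refl) (simp add: wd)
  have 2: "edge_jump \<T> e (\<lambda>t. point_trace t v z) = edge_jump \<T> e (\<lambda>t. point_trace t w z)" if "e \<in> mesh_edges \<T>" for e z
    by (rule jump[OF that]) (rule point_trace_ae[OF assms(1)])
  have 3: "edge_jump \<T> e (\<lambda>t. normal_deriv_int t e v) = edge_jump \<T> e (\<lambda>t. normal_deriv_int t e w)" if "e \<in> mesh_edges \<T>" for e
    by (rule jump[OF that]) (simp add: normal_deriv_int_def wd)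
  show ?thesis unfolding h_norm_def using 1 2 3 by (simp cong: sum.cong)
qed

lemma h_norm_nonneg: "0 \<le> h_norm \<T> v"
  unfolding h_norm_def by (intro real_sqrt_ge_zero add_nonneg_nonneg sum_nonneg) auto

lemma triangle_interior:
  assumes "card t = 3" "\<not> collinear (t :: plane set)"
  shows "finite t" "interior (convex hull t) \<noteq> {}"
proof -
  show f: "finite t" using assms(1) card.infinite by fastforce
  have "\<not> affine_dependent t"
  proof -
    obtain a b c where t: "t = {a, b, c}" "a \<noteq> b" "a \<noteq> c" "b \<noteq> c"
      using assms(1) by (metis card_3_iff)
    then show ?thesis using assms(2) affine_dependent_imp_collinear_3 by blast
  qed
  then have "aff_dim t = 2" using aff_dim_affine_independent[of t] assms(1) by simp
  then have "aff_dim (convex hull t) = int (DIM(plane))" by (simp add: aff_dim_convex_hull)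
  then show "interior (convex hull t) \<noteq> {}"
    using interior_rel_interior_gen[of "convex hull t"] rel_interior_eq_empty[of "convex hull t"] assms(1) by auto
qed

text \<open>The discrete form is given on the sum of \<open>V\<close> and the Morley space; the zero
  Morley function embeds \<open>V\<close> in it. The point values at issue are definite
  descriptions, hence the work.\<close>

lemma zero_mem_morley:
  assumes ct: "conforming_triangulation \<Omega> \<T>"
  shows "(\<lambda>x. 0) \<in> morley_space \<Omega> \<T>"
proof -
  have T: "finite t" "interior (convex hull t) \<noteq> {}" if "t \<in> \<T>" for t
    using triangle_interior[of t] ct that by (auto simp: conforming_triangulation_def)
  have pt: "point_trace t (\<lambda>x. 0) z = 0" if "t \<in> tris_at \<T> z" for t z
    using that T hull_subset[of t convex] by (intro point_trace_zero) (auto simp: tris_at_def)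
  have nd: "normal_deriv_mid t e (\<lambda>x. 0) = 0" if e: "e \<in> mesh_edges \<T>" and t: "t \<in> tris_on \<T> e" for t e
  proof -
    have tt: "t \<in> \<T>" "e \<subseteq> t" using t by (auto simp: tris_on_def)
    have "\<exists>p. e = {fst p, snd p}"
    proof -
      obtain x y where "e = {x, y}" using e unfolding mesh_edges_def by (metis (mono_tags, lifting) card_2_iff mem_Collect_eq)
      then show ?thesis by (intro exI[of _ "(x, y)"]) simp
    qed
    then have ee: "e = {fst (edge_ends e), snd (edge_ends e)}" unfolding edge_ends_def by (rule someI_ex)
    have "fst (edge_ends e) \<in> convex hull t" "snd (edge_ends e) \<in> convex hull t"
      using ee tt(2) hull_subset[of t convex] by auto
    then have mid: "edge_point e (1 / 2) \<in> convex hull t"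
      unfolding edge_point_def by (intro convexD[OF convex_convex_hull]) auto
    have "point_trace t (weak_deriv (tri_int t) [b] (\<lambda>x. 0)) (edge_point e (1 / 2)) = 0" for b
    proof -
      have op: "open (tri_int t)" by (simp add: tri_int_def)
      have hl: "convex hull t \<in> sets lebesgue"
        using finite_imp_compact_convex_hull[OF T(1)[OF tt(1)]] by (intro sets_completionI_sets) (simp add: borel_compact)
      have "ae_eq (tri_int t) (weak_deriv (tri_int t) [b] (\<lambda>x. 0)) (\<lambda>x. 0)"
        by (rule weak_deriv_eq[OF op L2.zero_mem]) (simp add: has_weak_deriv_def L2_inner_def)
      then have "ae_eq (convex hull t) (weak_deriv (tri_int t) [b] (\<lambda>x. 0)) (\<lambda>x. 0)"
        by (rule ae_eq_subset[OF hl open_sets_lebesgue[OF op] tri_int_negligible[OF T(1)[OF tt(1)]]])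
      from point_trace_ae[OF this] show ?thesis using point_trace_zero[OF T[OF tt(1)] mid] by simp
    qed
    then show ?thesis by (simp add: normal_deriv_mid_def)
  qed
  have "(\<lambda>x. 0) \<in> pw_poly 2 \<T>" unfolding pw_poly_def
    by (intro CollectI ballI exI[of _ "\<lambda>i j. 0"]) simp
  then show ?thesis unfolding morley_space_def using pt nd by auto
qed

section \<open>The discrete space, its form and the smoother\<close>

locale plate_fem =
  fixes \<Omega> :: "plane set" and \<T> :: "triangle set" and \<alpha> \<beta> C1 :: real and V :: "(plane \<Rightarrow> real) set"
    and a :: "(plane \<Rightarrow> real) \<Rightarrow> (plane \<Rightarrow> real) \<Rightarrow> real" and Q R :: "(plane \<Rightarrow> real) \<Rightarrow> plane \<Rightarrow> real"
  assumes op: "open \<Omega>" and bd: "bounded \<Omega>" and fr: "negligible (frontier \<Omega>)"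
    and ct: "conforming_triangulation \<Omega> \<T>" and fd: "fin_dim_space V" and Vpw: "V \<subseteq> pw_sobolev_space \<T> 2"
    and df: "discrete_form \<Omega> \<T> \<alpha> \<beta> V a" and QH: "\<And>v. v \<in> V \<Longrightarrow> Q v \<in> H20 \<Omega>"
    and sm: "smoother_estimate \<Omega> \<T> C1 V Q" and rp: "ritz_projection \<Omega> V a Q R" and \<alpha>: "\<alpha> > 0" and C1: "C1 > 0"
begin

lemma \<Omega>_leb: "\<Omega> \<in> sets lebesgue" by (rule open_sets_lebesgue[OF op])

lemma tri:
  assumes "t \<in> \<T>"
  shows "finite t" "interior (convex hull t) \<noteq> {}" "open (tri_int t)" "tri_int t \<in> sets lebesgue" "convex hull t \<in> sets lebesgue"
    "negligible (convex hull t - \<Omega>)" "negligible (tri_int t - \<Omega>)" "negligible (convex hull t - tri_int t)"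
proof -
  show f: "finite t" and "interior (convex hull t) \<noteq> {}"
    using triangle_interior[of t] ct assms by (auto simp: conforming_triangulation_def)
  show o: "open (tri_int t)" by (simp add: tri_int_def)
  show "tri_int t \<in> sets lebesgue" by (rule open_sets_lebesgue[OF o])
  show "convex hull t \<in> sets lebesgue"
    using finite_imp_compact_convex_hull[OF f] by (intro sets_completionI_sets) (simp add: borel_compact)
  have "convex hull t \<subseteq> closure \<Omega>" using ct assms by (auto simp: conforming_triangulation_def)
  then have "convex hull t - \<Omega> \<subseteq> frontier \<Omega>" using op by (auto simp: frontier_def interior_open)
  then show n: "negligible (convex hull t - \<Omega>)" by (rule negligible_subset[OF fr])
  then show "negligible (tri_int t - \<Omega>)"
    by (rule negligible_subset) (use interior_subset[of "convex hull t"] in \<open>auto simp: tri_int_def\<close>)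
  show "negligible (convex hull t - tri_int t)" by (rule tri_int_negligible[OF f])
qed

lemma finT: "finite \<T>" using ct by (simp add: conforming_triangulation_def)

text \<open>The closed triangles cover \<open>\<Omega>\<close> and their boundaries are null. The
  second version is cut with \<open>\<Omega>\<close> because an open triangle is known to lie in
  \<open>\<Omega>\<close> only up to a null set.\<close>

lemma cover: "negligible (\<Omega> - \<Union>(tri_int ` \<T>))" "negligible (\<Omega> - \<Union>((\<lambda>t. tri_int t \<inter> \<Omega>) ` \<T>))"
proof -
  have "negligible (\<Union>t\<in>\<T>. convex hull t - tri_int t)"
    using finT tri(8) by (intro negligible_Union finite_imageI) auto
  moreover have "\<Omega> \<subseteq> (\<Union>t\<in>\<T>. convex hull t)"
    using ct closure_subset[of \<Omega>] by (simp add: conforming_triangulation_def)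
  then have "\<Omega> - \<Union>(tri_int ` \<T>) \<subseteq> (\<Union>t\<in>\<T>. convex hull t - tri_int t)" "\<Omega> - \<Union>((\<lambda>t. tri_int t \<inter> \<Omega>) ` \<T>) \<subseteq> (\<Union>t\<in>\<T>. convex hull t - tri_int t)"
    by auto
  ultimately show "negligible (\<Omega> - \<Union>(tri_int ` \<T>))" "negligible (\<Omega> - \<Union>((\<lambda>t. tri_int t \<inter> \<Omega>) ` \<T>))"
    using negligible_subset by blast+
qed

lemma V_tri: "v \<in> V \<Longrightarrow> t \<in> \<T> \<Longrightarrow> v \<in> sobolev_space (tri_int t) 2" "v \<in> V \<Longrightarrow> t \<in> \<T> \<Longrightarrow> v \<in> L2_space (tri_int t)"
  using Vpw by (auto simp: pw_sobolev_space_def sobolev_space_2_iff)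

lemma V_L2: "v \<in> V \<Longrightarrow> v \<in> L2_space \<Omega>"
  by (rule L2_cover(1)[OF finite_imageI[OF finT] \<Omega>_leb _ cover(1)]) (use V_tri(2) tri(4) in auto)

lemma V_span: "\<exists>B. finite B \<and> V = lin_span B"
  using fd by (simp add: fin_dim_space_def lin_span_def)

lemma V_lin: "v \<in> V \<Longrightarrow> w \<in> V \<Longrightarrow> (\<lambda>x. p * v x + q * w x) \<in> V"
  using V_span lin_span_lin by blast

lemma V_zero: "(\<lambda>x. 0) \<in> V"
  using V_span lin_span_0 by blast

lemma V_sum_space: "V \<subseteq> sum_space V (morley_space \<Omega> \<T>)"
proof
  fix v assume v: "v \<in> V"
  have "v = (\<lambda>x. v x + (\<lambda>x. 0) x)" by simp
  then show "v \<in> sum_space V (morley_space \<Omega> \<T>)"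
    unfolding sum_space_def using v zero_mem_morley[OF ct]
    by (intro CollectI exI[of _ v] exI[of _ "\<lambda>x. 0"]) simp
qed

lemma a_coercive: "w \<in> V \<Longrightarrow> \<alpha> * (h_norm \<T> w)\<^sup>2 \<le> a w w"
  using df by (simp add: discrete_form_def)

lemma a_semi_ip: "semi_ip V a"
proof
  show "(\<lambda>x. 0) \<in> V" by (rule V_zero)
  have sb: "symmetric_bilinear_on (sum_space V (morley_space \<Omega> \<T>)) a" using df by (simp add: discrete_form_def)
  fix v w assume v: "v \<in> V" and w: "w \<in> V"
  show "a v w = a w v" using sb v w V_sum_space unfolding symmetric_bilinear_on_def by blast
  show "0 \<le> a v v" using a_coercive[OF v] \<alpha> by (meson mult_nonneg_nonneg less_imp_le zero_le_power2 order_trans)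
  fix p q show "(\<lambda>x. p * v x + q * w x) \<in> V" by (rule V_lin[OF v w])
  fix z assume z: "z \<in> V"
  show "a (\<lambda>x. p * v x + q * w x) z = p * a v z + q * a w z"
    using sb v w z V_sum_space unfolding symmetric_bilinear_on_def by blast
qed

sublocale A: semi_ip V a by (rule a_semi_ip)

lemma h_norm_le: "w \<in> V \<Longrightarrow> h_norm \<T> w \<le> sqrt (a w w / \<alpha>)"
  using a_coercive[of w] \<alpha> by (intro real_le_rsqrt) (simp add: field_simps)

text \<open>A null function agrees almost everywhere with all its multiples \<open>c * v\<close>,
  which therefore have the same mesh norm. The value \<open>a w (c * v)\<close> is linear in
  \<open>c\<close> but bounded above independently of \<open>c\<close>, so the slope is
  zero.\<close>

lemma a_null:
  assumes v: "v \<in> V" "ae_eq \<Omega> v (\<lambda>x. 0)" and w: "w \<in> V"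
  shows "a w v = 0"
proof -
  have h: "h_norm \<T> (\<lambda>x. c * v x) = h_norm \<T> v" for c
  proof (rule h_norm_ae)
    have "ae_eq \<Omega> (\<lambda>x. c * v x) v" using v(2) unfolding ae_eq_def by (rule eventually_mono) simp
    then show "ae_eq (convex hull t) (\<lambda>x. c * v x) v" "ae_eq (tri_int t) (\<lambda>x. c * v x) v" if "t \<in> \<T>" for t
      using tri[OF that] by (auto intro: ae_eq_subset[OF _ \<Omega>_leb])
  qed
  have "a w (\<lambda>x. c * v x) \<le> \<beta> * h_norm \<T> w * h_norm \<T> (\<lambda>x. c * v x)" for c
    using df w A.scale_mem[OF v(1)] by (simp add: discrete_form_def)
  then have b: "c * a w v \<le> \<beta> * h_norm \<T> w * h_norm \<T> v" for c
    using A.scale_right[OF v(1) w] h by simp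
  show ?thesis
  proof (rule ccontr)
    assume "a w v \<noteq> 0"
    then show False using b[of "(\<beta> * h_norm \<T> w * h_norm \<T> v + 1) / a w v"] by simp
  qed
qed

lemma Q_L2: "v \<in> V \<Longrightarrow> Q v \<in> L2_space \<Omega>"
  using H20_L2[OF QH] .

text \<open>The smoother estimate with \<open>s = 0\<close>. The minimum over \<open>H20\<close> is
  bounded with the zero function as competitor, and coercivity turns the mesh norm into the discrete
  energy.\<close>

lemma smoother_L2:
  assumes v: "v \<in> V"
  shows "L2_norm \<Omega> (\<lambda>x. Q v x - v x) \<le> C1 * mesh_size \<T> powr 2 * sqrt (a v v / \<alpha>)"
proof -
  let ?d = "\<lambda>x. v x - Q v x"
  have dL: "?d \<in> L2_space (tri_int t)" if t: "t \<in> \<T>" for t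
  proof (intro L2.diff_mem V_tri(2)[OF v t])
    \<comment> \<open>The open triangle lies in \<open>\<Omega>\<close> up to a null set, so the
      square integrability of \<open>Q v\<close> is carried over through the intersection.\<close>
    have o: "open (tri_int t \<inter> \<Omega>)" using tri(3)[OF t] op by blast
    have q: "Q v \<in> L2_space (tri_int t \<inter> \<Omega>)"
      by (rule L2_space_subset[OF Q_L2[OF v] _ open_sets_lebesgue[OF o] \<Omega>_leb]) blast
    have "tri_int t - \<Union>{tri_int t \<inter> \<Omega>} = tri_int t - \<Omega>" by auto
    then have n: "negligible (tri_int t - \<Union>{tri_int t \<inter> \<Omega>})" using tri(7)[OF t] by simp
    show "Q v \<in> L2_space (tri_int t)"
      by (rule L2_cover(1)[OF _ tri(4)[OF t] _ n]) (use q open_sets_lebesgue[OF o] in auto)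
  qed
  have sn: "(sobolev_norm (tri_int t) 0 ?d)\<^sup>2 = L2_inner (tri_int t) ?d ?d" if t: "t \<in> \<T>" for t
  proof -
    have "ae_eq (tri_int t) (weak_deriv (tri_int t) [] ?d) ?d"
      by (rule weak_deriv_eq[OF tri(3)[OF t] dL[OF t]]) (simp add: has_weak_deriv_def)
    from L2_norm_ae[OF tri(4)[OF t] this] show ?thesis by (simp add: sobolev_norm_0 L2_norm_sq)
  qed
  \<comment> \<open>Passing to the image could identify indices, hence an inequality between sums of
    nonnegative terms.\<close>
  have inj: "(\<Sum>U\<in>tri_int ` \<T>. L2_inner U ?d ?d) \<le> (\<Sum>t\<in>\<T>. L2_inner (tri_int t) ?d ?d)"
    by (rule sum_image_le[OF finT, of "\<lambda>U. L2_inner U ?d ?d" tri_int, unfolded o_def]) (rule L2_inner_self_nonneg)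
  have "L2_inner \<Omega> ?d ?d \<le> (\<Sum>U\<in>tri_int ` \<T>. L2_inner U ?d ?d)"
    by (rule L2_cover(2)[OF finite_imageI[OF finT] \<Omega>_leb _ cover(1)]) (use tri(4) dL in auto)
  also have "\<dots> \<le> (\<Sum>t\<in>\<T>. (sobolev_norm (tri_int t) 0 ?d)\<^sup>2)"
    using inj sn by (simp cong: sum.cong)
  finally have "L2_norm \<Omega> ?d \<le> pw_sobolev_norm \<T> 0 ?d"
    unfolding L2_norm_def pw_sobolev_norm_def by (rule real_sqrt_le_mono)
  also have "\<dots> \<le> C1 * mesh_size \<T> powr (2 - 0) * (INF z\<in>H20 \<Omega>. h_norm \<T> (\<lambda>x. z x - v x))"
    using sm v unfolding smoother_estimate_def by fastforce
  also have "\<dots> \<le> C1 * mesh_size \<T> powr 2 * sqrt (a v v / \<alpha>)"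
  proof -
    have "(INF z\<in>H20 \<Omega>. h_norm \<T> (\<lambda>x. z x - v x)) \<le> h_norm \<T> (\<lambda>x. 0 - v x)"
      using test_H20[OF op test_funs_zero] by (intro cINF_lower bdd_belowI2[of _ 0] h_norm_nonneg)
    also have "\<dots> \<le> sqrt (a (\<lambda>x. 0 - v x) (\<lambda>x. 0 - v x) / \<alpha>)"
      by (rule h_norm_le) (rule A.diff_mem[OF V_zero v])
    also have "a (\<lambda>x. 0 - v x) (\<lambda>x. 0 - v x) = a v v" using A.scale_scale[OF v, of "-1"] by simp
    finally have i: "(INF z\<in>H20 \<Omega>. h_norm \<T> (\<lambda>x. z x - v x)) \<le> sqrt (a v v / \<alpha>)" .
    show ?thesis using mult_left_mono[OF i, of "C1 * mesh_size \<T> powr 2"] C1 by simp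
  qed
  finally show ?thesis by (simp add: L2_norm_minus_commute[of \<Omega> "Q v"])
qed

text \<open>Coercivity alone gives a vanishing mesh norm. The smoother estimate adds that
  \<open>Q w\<close> equals \<open>w\<close> almost everywhere, and \<open>Q w\<close> is clamped.
  Its second derivatives vanish on every triangle because those of \<open>w\<close> do, so its plate
  energy is zero.\<close>

lemma a_definite:
  assumes w: "w \<in> V" and a0: "a w w = 0"
  shows "ae_eq \<Omega> w (\<lambda>x. 0)"
proof -
  have "L2_norm \<Omega> (\<lambda>x. Q w x - w x) \<le> 0" using smoother_L2[OF w] a0 by simp
  then have "L2_inner \<Omega> (\<lambda>x. Q w x - w x) (\<lambda>x. Q w x - w x) = 0"
    using L2_norm_nonneg[of \<Omega> "\<lambda>x. Q w x - w x"] by (simp add: L2_norm_sq[symmetric])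
  then have Qw: "ae_eq \<Omega> (Q w) w"
    using L2_null_iff[OF L2.diff_mem[OF Q_L2[OF w] V_L2[OF w]]] by (simp add: ae_eq_diff0_iff)
  have "h_norm \<T> w \<le> 0" using h_norm_le[OF w] a0 by simp
  then have "h_norm \<T> w = 0" using h_norm_nonneg[of \<T> w] by simp
  then have "(\<Sum>t\<in>\<T>. (sobolev_seminorm2 (tri_int t) w)\<^sup>2) +
     (\<Sum>e\<in>mesh_edges \<T>. \<Sum>z\<in>e. (1 / edge_length e)\<^sup>2 * \<bar>edge_jump \<T> e (\<lambda>t. point_trace t w z)\<bar>\<^sup>2) +
     (\<Sum>e\<in>mesh_edges \<T>. \<bar>1 / edge_length e * edge_jump \<T> e (\<lambda>t. normal_deriv_int t e w)\<bar>\<^sup>2) = 0"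
    unfolding h_norm_def real_sqrt_eq_0_iff .
  moreover have "0 \<le> (\<Sum>e\<in>mesh_edges \<T>. \<Sum>z\<in>e. (1 / edge_length e)\<^sup>2 * \<bar>edge_jump \<T> e (\<lambda>t. point_trace t w z)\<bar>\<^sup>2)"
    "0 \<le> (\<Sum>e\<in>mesh_edges \<T>. \<bar>1 / edge_length e * edge_jump \<T> e (\<lambda>t. normal_deriv_int t e w)\<bar>\<^sup>2)"
    "0 \<le> (\<Sum>t\<in>\<T>. (sobolev_seminorm2 (tri_int t) w)\<^sup>2)"
    by (intro sum_nonneg; simp)+
  ultimately have "(\<Sum>t\<in>\<T>. (sobolev_seminorm2 (tri_int t) w)\<^sup>2) = 0" by linarith
  then have s0: "sobolev_seminorm2 (tri_int t) w = 0" if "t \<in> \<T>" for t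
    using that finT by (subst (asm) sum_nonneg_eq_0_iff) auto
  have g0: "ae_eq \<Omega> (weak_deriv \<Omega> bs (Q w)) (\<lambda>x. 0)" if bs: "bs \<in> deriv_idx 2" for bs
  proof (rule ae_eq_cover[of "(\<lambda>t. tri_int t \<inter> \<Omega>) ` \<T>"])
    let ?g = "weak_deriv \<Omega> bs (Q w)"
    have gL: "?g \<in> L2_space \<Omega>" "has_weak_deriv \<Omega> bs (Q w) ?g"
      using sobolev2_weak_deriv[OF H20_sobolev[OF QH[OF w]] _ bs] by auto
    have len: "length bs = 2" and B: "set bs \<subseteq> Basis" using bs by (auto simp: deriv_idx_def)
    fix U assume "U \<in> (\<lambda>t. tri_int t \<inter> \<Omega>) ` \<T>"
    then obtain t where t: "t \<in> \<T>" "U = tri_int t \<inter> \<Omega>" by blast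
    have oU: "open U" using t tri(3) op by blast
    show Ul: "U \<in> sets lebesgue" by (rule open_sets_lebesgue[OF oU])
    let ?k = "weak_deriv (tri_int t) bs w"
    have k: "?k \<in> L2_space (tri_int t)" "has_weak_deriv (tri_int t) bs w ?k"
      using sobolev2_weak_deriv[OF V_tri(1)[OF w t(1)] _ bs] by auto
    have "(\<Sum>bs\<in>deriv_idx 2. (L2_norm (tri_int t) (weak_deriv (tri_int t) bs w))\<^sup>2) = 0"
      using s0[OF t(1)] unfolding sobolev_seminorm2_def real_sqrt_eq_0_iff .
    then have "(L2_norm (tri_int t) ?k)\<^sup>2 = 0"
      using bs by (subst (asm) sum_nonneg_eq_0_iff[OF finite_deriv_idx]) auto
    then have k0: "ae_eq (tri_int t) ?k (\<lambda>x. 0)" using L2_null_iff[OF k(1)] by (simp add: L2_norm_sq)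
    show "ae_eq U ?g (\<lambda>x. 0)"
    proof (rule fundamental_lemma[OF oU])
      show "?g \<in> L2_space U" by (rule L2_space_subset[OF gL(1) _ Ul \<Omega>_leb]) (use t in blast)
      \<comment> \<open>A test function of \<open>U\<close> is one of \<open>\<Omega>\<close> and of
        the triangle, so it compares the weak derivative of \<open>Q w\<close> in
        \<open>\<Omega>\<close> with that of \<open>w\<close> in the triangle.\<close>
      fix \<phi> assume \<phi>: "\<phi> \<in> test_funs U"
      have \<phi>': "\<phi> \<in> test_funs \<Omega>" "\<phi> \<in> test_funs (tri_int t)"
        using \<phi> test_funs_mono[of U \<Omega>] test_funs_mono[of U "tri_int t"] t(2) by auto
      have m: "multi_deriv bs \<phi> \<in> test_funs U" by (rule test_funs_multi_deriv[OF \<phi> B])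
      have "L2_inner U ?g \<phi> = L2_inner \<Omega> ?g \<phi>"
        using t(2) by (intro L2_inner_restrict[symmetric] Ul \<Omega>_leb test_funs_outside[OF \<phi>]) auto
      also have "\<dots> = L2_inner \<Omega> (Q w) (multi_deriv bs \<phi>)" using gL(2) \<phi>'(1) len by (simp add: has_weak_deriv_def)
      also have "\<dots> = L2_inner \<Omega> w (multi_deriv bs \<phi>)" by (rule L2_inner_ae[OF \<Omega>_leb Qw])
      also have "\<dots> = L2_inner U w (multi_deriv bs \<phi>)"
        using t(2) by (intro L2_inner_restrict Ul \<Omega>_leb test_funs_outside[OF m]) auto
      also have "\<dots> = L2_inner (tri_int t) w (multi_deriv bs \<phi>)"
        using t(2) by (intro L2_inner_restrict[symmetric] Ul tri(4)[OF t(1)] test_funs_outside[OF m]) auto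
      also have "\<dots> = L2_inner (tri_int t) ?k \<phi>" using k(2) \<phi>'(2) len by (simp add: has_weak_deriv_def)
      also have "\<dots> = 0" using L2_inner_ae[OF tri(4)[OF t(1)] k0, of \<phi>] by (simp add: L2_inner_def)
      finally show "L2_inner U ?g \<phi> = 0" .
    qed
  qed (use finT cover(2) \<Omega>_leb in auto)
  have "L2_inner \<Omega> (weak_deriv \<Omega> bs (Q w)) (weak_deriv \<Omega> bs (Q w)) = 0" if "bs \<in> deriv_idx 2" for bs
    using L2_inner_ae[OF \<Omega>_leb g0[OF that]] by (simp add: L2_inner_def)
  then have "plate_form \<Omega> (Q w) (Q w) = 0" by (simp add: plate_form_def)
  from plate_null[OF op bd QH[OF w] this] show ?thesis using ae_eq_trans[OF ae_eq_sym[OF Qw]] by blast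
qed

end

context plate_fem
begin

lemma L2_V_semi_ip: "semi_ip V (L2_inner \<Omega>)"
proof
  show "(\<lambda>x. 0) \<in> V" by (rule V_zero)
  fix v w z assume v: "v \<in> V" and w: "w \<in> V"
  show "L2_inner \<Omega> v w = L2_inner \<Omega> w v" by (rule L2.sym[OF V_L2[OF v] V_L2[OF w]])
  show "0 \<le> L2_inner \<Omega> v v" by (rule L2_inner_self_nonneg)
  fix p q show "(\<lambda>x. p * v x + q * w x) \<in> V" by (rule V_lin[OF v w])
  assume z: "z \<in> V"
  show "L2_inner \<Omega> (\<lambda>x. p * v x + q * w x) z = p * L2_inner \<Omega> v z + q * L2_inner \<Omega> w z"
    by (rule L2.lin_left[OF V_L2[OF v] V_L2[OF w] V_L2[OF z]])
qed

lemma R_V: "z \<in> H20 \<Omega> \<Longrightarrow> R z \<in> V"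
  and R_eq: "z \<in> H20 \<Omega> \<Longrightarrow> v \<in> V \<Longrightarrow> a (R z) v = plate_form \<Omega> z (Q v)"
  using rp by (auto simp: ritz_projection_def)

text \<open>The defining relation of the Ritz projection forces the smoother to be linear up to null sets.\<close>

lemma Q_lin:
  assumes v: "v \<in> V" and w: "w \<in> V"
  shows "ae_eq \<Omega> (Q (\<lambda>x. p * v x + q * w x)) (\<lambda>x. p * Q v x + q * Q w x)"
proof -
  interpret P: semi_ip "H20 \<Omega>" "plate_form \<Omega>" by (rule plate_semi_ip[OF op])
  let ?l = "\<lambda>x. p * Q v x + q * Q w x" and ?c = "\<lambda>x. p * v x + q * w x"
  have l: "?l \<in> H20 \<Omega>" by (rule P.lin_mem[OF QH[OF v] QH[OF w]])
  have c: "?c \<in> V" by (rule V_lin[OF v w])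
  let ?d = "\<lambda>x. Q ?c x - ?l x"
  have d: "?d \<in> H20 \<Omega>" by (rule P.diff_mem[OF QH[OF c] l])
  \<comment> \<open>The defect is paired with itself. The relation for \<open>R ?d\<close> turns
    every plate product with a value of \<open>Q\<close> into a value of \<open>a\<close>, which is
    linear.\<close>
  have "plate_form \<Omega> ?d ?d = plate_form \<Omega> ?d (Q ?c) - (p * plate_form \<Omega> ?d (Q v) + q * plate_form \<Omega> ?d (Q w))"
    using P.diff_right[OF QH[OF c] l d] P.lin_right[OF QH[OF v] QH[OF w] d] by simp
  also have "\<dots> = a (R ?d) ?c - (p * a (R ?d) v + q * a (R ?d) w)" using R_eq[OF d] v w c by simp
  also have "\<dots> = 0" using A.lin_right[OF v w R_V[OF d]] by simp
  finally show ?thesis using plate_null[OF op bd d] by (simp add: ae_eq_diff0_iff)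
qed

lemma Q_sum:
  fixes n :: nat
  assumes "\<And>i. i < n \<Longrightarrow> e i \<in> V"
  shows "ae_eq \<Omega> (Q (\<lambda>x. \<Sum>i<n. c i * e i x)) (\<lambda>x. \<Sum>i<n. c i * Q (e i) x)"
  using assms
proof (induction n)
  case 0
  show ?case using Q_lin[OF V_zero V_zero, of 0 0] by simp
next
  case (Suc n)
  have s: "(\<lambda>x. \<Sum>i<n. c i * e i x) \<in> V" using Suc.prems by (intro A.sum_mem) auto
  have "ae_eq \<Omega> (Q (\<lambda>x. 1 * (\<Sum>i<n. c i * e i x) + c n * e n x)) (\<lambda>x. 1 * Q (\<lambda>x. \<Sum>i<n. c i * e i x) x + c n * Q (e n) x)"
    by (rule Q_lin[OF s]) (use Suc.prems in simp)
  moreover have "ae_eq \<Omega> (\<lambda>x. 1 * Q (\<lambda>x. \<Sum>i<n. c i * e i x) x + c n * Q (e n) x) (\<lambda>x. 1 * (\<Sum>i<n. c i * Q (e i) x) + c n * Q (e n) x)"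
    using Suc by (intro ae_eq_lin ae_eq_refl) auto
  ultimately show ?case using ae_eq_trans by (simp add: algebra_simps)
qed

text \<open>The plate energy of \<open>Q v\<close> is \<open>a (R (Q v)) v\<close>, and
  \<open>a\<close> does not see null functions.\<close>

lemma Q_null:
  assumes v: "v \<in> V" "ae_eq \<Omega> v (\<lambda>x. 0)"
  shows "ae_eq \<Omega> (Q v) (\<lambda>x. 0)"
proof -
  have q: "Q v \<in> H20 \<Omega>" by (rule QH[OF v(1)])
  have "plate_form \<Omega> (Q v) (Q v) = 0" using R_eq[OF q v(1)] a_null[OF v R_V[OF q]] by simp
  then show ?thesis by (rule plate_null[OF op bd q])
qed

lemma ex_onb:
  "\<exists>m e. (\<forall>i<m::nat. e i \<in> V) \<and> (\<forall>i<m. \<forall>j<m. L2_inner \<Omega> (e i) (e j) = (if i = j then 1 else 0)) \<and>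
    (\<forall>v\<in>V. ae_eq \<Omega> v (\<lambda>x. \<Sum>i<m. L2_inner \<Omega> v (e i) * e i x))"
proof -
  interpret L: semi_ip V "L2_inner \<Omega>" by (rule L2_V_semi_ip)
  obtain B where B: "finite B" "V = lin_span B" using V_span by blast
  have BV: "B \<subseteq> V" using B lin_span_superset by blast
  obtain m :: nat and e where me: "\<forall>i<m. e i \<in> lin_span B" "\<forall>i<m. \<forall>j<m. L2_inner \<Omega> (e i) (e j) = (if i = j then 1 else 0)"
    "\<forall>v\<in>lin_span B. L2_inner \<Omega> (\<lambda>x. v x - (\<Sum>i<m. L2_inner \<Omega> v (e i) * e i x)) (\<lambda>x. v x - (\<Sum>i<m. L2_inner \<Omega> v (e i) * e i x)) = 0"
    using L.gram_schmidt[OF B(1) BV] by (elim exE conjE) (erule (2) that)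
  have "ae_eq \<Omega> v (\<lambda>x. \<Sum>i<m. L2_inner \<Omega> v (e i) * e i x)" if v: "v \<in> V" for v
  proof -
    have s: "(\<lambda>x. \<Sum>i<m. L2_inner \<Omega> v (e i) * e i x) \<in> V" using me(1) B(2) by (intro L.sum_mem) auto
    have "ae_eq \<Omega> (\<lambda>x. v x - (\<Sum>i<m. L2_inner \<Omega> v (e i) * e i x)) (\<lambda>x. 0)"
      using me(3) v B(2) L2_null_iff[OF V_L2[OF L.diff_mem[OF v s]]] by blast
    then show ?thesis by (simp add: ae_eq_diff0_iff)
  qed
  then show ?thesis using me(1,2) B(2) by (intro exI[of _ m] exI[of _ e]) simp
qed

text \<open>Representation of the functional \<open>v\<close> to \<open>(v, k)\<close> by the form
  \<open>a\<close>, built from an \<open>a\<close>-orthonormal system. The expansion of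
  \<open>v\<close> holds up to an \<open>a\<close>-null function, which is null almost everywhere,
  so it may be inserted into the L2 product.\<close>

lemma ex_riesz:
  assumes k: "k \<in> V"
  shows "\<exists>d\<in>V. \<forall>v\<in>V. a v d = L2_inner \<Omega> v k"
proof -
  obtain B where B: "finite B" "V = lin_span B" using V_span by blast
  have BV: "B \<subseteq> V" using B lin_span_superset by blast
  obtain m :: nat and e where me: "\<forall>i<m. e i \<in> lin_span B" "\<forall>i<m. \<forall>j<m. a (e i) (e j) = (if i = j then 1 else 0)"
    "\<forall>v\<in>lin_span B. a (\<lambda>x. v x - (\<Sum>i<m. a v (e i) * e i x)) (\<lambda>x. v x - (\<Sum>i<m. a v (e i) * e i x)) = 0"
    using A.gram_schmidt[OF B(1) BV] by (elim exE conjE) (erule (2) that)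
  have e: "e i \<in> V" if "i < m" for i using me(1) B(2) that by simp
  define d where "d = (\<lambda>x. \<Sum>i<m. L2_inner \<Omega> (e i) k * e i x)"
  have d: "d \<in> V" unfolding d_def using e by (intro A.sum_mem) auto
  have "a v d = L2_inner \<Omega> v k" if v: "v \<in> V" for v
  proof -
    have s: "(\<lambda>x. \<Sum>i<m. a v (e i) * e i x) \<in> V" using e by (intro A.sum_mem) auto
    have "ae_eq \<Omega> (\<lambda>x. v x - (\<Sum>i<m. a v (e i) * e i x)) (\<lambda>x. 0)"
      using me(3) v B(2) by (intro a_definite A.diff_mem v s) auto
    then have "L2_inner \<Omega> v k = L2_inner \<Omega> (\<lambda>x. \<Sum>i<m. a v (e i) * e i x) k"
      by (intro L2_inner_ae[OF \<Omega>_leb]) (simp add: ae_eq_diff0_iff)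
    also have "\<dots> = (\<Sum>i<m. a v (e i) * L2_inner \<Omega> (e i) k)" using e by (intro L2.sum_left V_L2 k) auto
    also have "\<dots> = (\<Sum>i<m. L2_inner \<Omega> (e i) k * a v (e i))" by (simp add: mult.commute)
    also have "\<dots> = a v d" unfolding d_def using e by (intro A.sum_right[symmetric] v) auto
    finally show ?thesis by simp
  qed
  then show ?thesis using d by blast
qed

end

section \<open>The energy argument for the discrete error\<close>

lemma coordinate_bilinear_deriv:
  fixes X Y X' Y' :: "nat \<Rightarrow> real \<Rightarrow> real"
  assumes "\<And>i. i < m \<Longrightarrow> (X i has_real_derivative X' i t) (at t within S)" "\<And>i. i < m \<Longrightarrow> (Y i has_real_derivative Y' i t) (at t within S)"
  shows "((\<lambda>t. \<Sum>i<m. \<Sum>j<m. X i t * Y j t * b i j) has_real_derivative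
    (\<Sum>i<m. \<Sum>j<m. X' i t * Y j t * b i j) + (\<Sum>i<m. \<Sum>j<m. X i t * Y' j t * b i j)) (at t within S)"
proof -
  have "((\<lambda>t. X i t * Y j t * b i j) has_real_derivative (X' i t * Y j t * b i j + X i t * Y' j t * b i j)) (at t within S)"
    if "i < m" "j < m" for i j
    using DERIV_cmult_right[OF DERIV_mult[OF assms(1)[OF that(1)] assms(2)[OF that(2)]], of "b i j"] by (simp add: algebra_simps)
  then have "((\<lambda>t. \<Sum>i<m. \<Sum>j<m. X i t * Y j t * b i j) has_real_derivative
    (\<Sum>i<m. \<Sum>j<m. X' i t * Y j t * b i j + X i t * Y' j t * b i j)) (at t within S)"
    by (intro DERIV_sum) auto
  then show ?thesis by (simp add: sum.distrib)
qed

lemma coordinate_linear_deriv: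
  fixes X F X' F' :: "nat \<Rightarrow> real \<Rightarrow> real"
  assumes "\<And>i. i < m \<Longrightarrow> (X i has_real_derivative X' i t) (at t within S)" "\<And>i. i < m \<Longrightarrow> (F i has_real_derivative F' i t) (at t within S)"
  shows "((\<lambda>t. \<Sum>i<m. X i t * F i t) has_real_derivative (\<Sum>i<m. X' i t * F i t) + (\<Sum>i<m. X i t * F' i t)) (at t within S)"
proof -
  have "((\<lambda>t. \<Sum>i<m. X i t * F i t) has_real_derivative (\<Sum>i<m. X' i t * F i t + F' i t * X i t)) (at t within S)"
    using assms by (intro DERIV_sum DERIV_mult) auto
  then show ?thesis by (simp add: sum.distrib mult.commute)
qed

text \<open>The maximum of \<open>E\<close> absorbs one factor \<open>sqrt E\<close> of the right-hand side.\<close>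

lemma energy_sup_bound:
  fixes E D g :: "real \<Rightarrow> real"
  assumes T: "T > 0" and E: "continuous_on {0..T} E" "\<And>t. t \<in> {0..T} \<Longrightarrow> 0 \<le> E t"
    and g: "continuous_on {0..T} g" "\<And>t. t \<in> {0..T} \<Longrightarrow> 0 \<le> g t"
    and d: "\<And>t. t \<in> {0..T} \<Longrightarrow> ((\<lambda>t. E t - D t) has_real_derivative h t) (at t within {0..T})"
    and h: "\<And>t. t \<in> {0..T} \<Longrightarrow> h t \<le> 2 * g t * sqrt (E t)" and D: "\<And>t. t \<in> {0..T} \<Longrightarrow> D t \<le> 2 * K * sqrt (E t)"
    and 0: "E 0 = 0" "D 0 = 0" and K: "K \<ge> 0" and t: "t \<in> {0..T}"
  shows "sqrt (E t) \<le> 2 * K + 2 * integral {0..T} g"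
proof -
  obtain s where s: "s \<in> {0..T}" "\<And>r. r \<in> {0..T} \<Longrightarrow> E r \<le> E s"
    using continuous_attains_sup[OF compact_Icc _ E(1)] T by auto
  define S where "S = sqrt (E s)"
  have S: "S \<ge> 0" "S * S = E s" using E(2)[OF s(1)] by (auto simp: S_def)
  have le: "sqrt (E r) \<le> S" if "r \<in> {0..T}" for r unfolding S_def using s(2)[OF that] by simp
  have gi: "g integrable_on {0..T}" by (rule integrable_continuous_real[OF g(1)])
  have "(h has_integral (E s - D s - (E 0 - D 0))) {0..s}"
  proof (rule fundamental_theorem_of_calculus)
    fix x assume "x \<in> {0..s}"
    then have "((\<lambda>t. E t - D t) has_real_derivative h x) (at x within {0..s})"
      using s(1) by (intro DERIV_subset[OF d]) auto
    then show "((\<lambda>t. E t - D t) has_vector_derivative h x) (at x within {0..s})"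
      by (simp add: has_real_derivative_iff_has_vector_derivative)
  qed (use s in simp)
  then have hi: "(h has_integral (E s - D s)) {0..s}" using 0 by simp
  have gs: "g integrable_on {0..s}" using integrable_on_subinterval[OF gi, of 0 s] s(1) by auto
  \<comment> \<open>Integration ends at the maximum point, where every factor
    \<open>sqrt (E x)\<close> is at most \<open>S\<close> and the left-hand side is
    \<open>S * S\<close> up to \<open>D s\<close>.\<close>
  have "E s - D s \<le> 2 * S * integral {0..s} g"
  proof (rule has_integral_le[OF hi])
    show "((\<lambda>x. 2 * S * g x) has_integral 2 * S * integral {0..s} g) {0..s}"
      using gs by (intro has_integral_mult_right integrable_integral)
    fix x assume "x \<in> {0..s}"
    then have x: "x \<in> {0..T}" using s(1) by auto
    have "2 * g x * sqrt (E x) \<le> 2 * g x * S" using le[OF x] g(2)[OF x] by (intro mult_left_mono) auto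
    then show "h x \<le> 2 * S * g x" using h[OF x] by (simp add: algebra_simps)
  qed
  also have "\<dots> \<le> 2 * S * integral {0..T} g"
    using S(1) s(1) gs gi g(2) by (intro mult_left_mono integral_subset_le) auto
  finally have "S * S \<le> S * (2 * K + 2 * integral {0..T} g)"
    using D[OF s(1)] S(2) by (simp add: S_def[symmetric] algebra_simps)
  moreover have "0 \<le> integral {0..T} g" using gi g(2) by (rule integral_nonneg)
  ultimately have "S \<le> 2 * K + 2 * integral {0..T} g"
    using S(1) K by (cases "S = 0") (auto simp: mult_le_cancel_left)
  then show ?thesis using le[OF t] by linarith
qed

context plate_fem
begin

text \<open>The solution attains its initial data almost everywhere, so \<open>R\<close> has to
  respect null sets for the initial error to vanish.\<close>

lemma R_ae:
  assumes z: "z \<in> H20 \<Omega>" "z' \<in> H20 \<Omega>" "ae_eq \<Omega> z z'"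
  shows "ae_eq \<Omega> (R z) (R z')"
proof -
  have d: "(\<lambda>x. R z x - R z' x) \<in> V" by (rule A.diff_mem[OF R_V[OF z(1)] R_V[OF z(2)]])
  have "a (\<lambda>x. R z x - R z' x) (\<lambda>x. R z x - R z' x) = 0"
    using A.diff_left[OF R_V[OF z(1)] R_V[OF z(2)] d] R_eq[OF z(1) d] R_eq[OF z(2) d] plate_form_ae(1)[OF \<Omega>_leb z(3)] by simp
  from a_definite[OF d this] show ?thesis by (simp add: ae_eq_diff0_iff)
qed

text \<open>The three equations state \<open>A u = f - u_tt\<close> and its time derivatives in weak
  form; \<open>\<kappa>\<close> is the factor in
  \<open>\<parallel>Q v - v\<parallel> \<le> \<kappa> * sqrt (a v v)\<close>. The continuity claims
  serve the final estimate, where almost everywhere bounds are turned into bounds at every time and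
  integrals in time are formed.\<close>

lemma error_estimate:
  assumes T: "T > 0" and \<kappa>: "\<kappa> = C1 * mesh_size \<T> powr 2 / sqrt \<alpha>"
    and H: "\<And>t. t \<in> {0..T} \<Longrightarrow> u t \<in> H20 \<Omega>" "\<And>t. t \<in> {0..T} \<Longrightarrow> u1 t \<in> H20 \<Omega>" "\<And>t. t \<in> {0..T} \<Longrightarrow> u2 t \<in> H20 \<Omega>"
    and C: "f \<in> time_C0 (L2_space \<Omega>) (L2_norm \<Omega>) T" "f1 \<in> time_C0 (L2_space \<Omega>) (L2_norm \<Omega>) T" "f2 \<in> time_C0 (L2_space \<Omega>) (L2_norm \<Omega>) T"
      "u2 \<in> time_C0 (L2_space \<Omega>) (L2_norm \<Omega>) T" "u3 \<in> time_C0 (L2_space \<Omega>) (L2_norm \<Omega>) T" "u4 \<in> time_C0 (L2_space \<Omega>) (L2_norm \<Omega>) T"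
    and eq: "\<And>t z. t \<in> {0..T} \<Longrightarrow> z \<in> H20 \<Omega> \<Longrightarrow> plate_form \<Omega> (u t) z = L2_inner \<Omega> (\<lambda>x. f t x - u2 t x) z"
      "\<And>t z. t \<in> {0..T} \<Longrightarrow> z \<in> H20 \<Omega> \<Longrightarrow> plate_form \<Omega> (u1 t) z = L2_inner \<Omega> (\<lambda>x. f1 t x - u3 t x) z"
      "\<And>t z. t \<in> {0..T} \<Longrightarrow> z \<in> H20 \<Omega> \<Longrightarrow> plate_form \<Omega> (u2 t) z = L2_inner \<Omega> (\<lambda>x. f2 t x - u4 t x) z"
    and df: "\<And>t v. t \<in> {0..T} \<Longrightarrow> v \<in> L2_space \<Omega> \<Longrightarrow> ((\<lambda>t. L2_inner \<Omega> (f t) v) has_real_derivative L2_inner \<Omega> (f1 t) v) (at t within {0..T})"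
      "\<And>t v. t \<in> {0..T} \<Longrightarrow> v \<in> L2_space \<Omega> \<Longrightarrow> ((\<lambda>t. L2_inner \<Omega> (f1 t) v) has_real_derivative L2_inner \<Omega> (f2 t) v) (at t within {0..T})"
      "\<And>t v. t \<in> {0..T} \<Longrightarrow> v \<in> L2_space \<Omega> \<Longrightarrow> ((\<lambda>t. L2_inner \<Omega> (u2 t) v) has_real_derivative L2_inner \<Omega> (u3 t) v) (at t within {0..T})"
      "\<And>t v. t \<in> {0..T} \<Longrightarrow> v \<in> L2_space \<Omega> \<Longrightarrow> ((\<lambda>t. L2_inner \<Omega> (u3 t) v) has_real_derivative L2_inner \<Omega> (u4 t) v) (at t within {0..T})"
    and sd: "semidiscrete_solution \<Omega> T V a f (R u0) (R v0) uh" and init: "ae_eq \<Omega> (u 0) u0" "ae_eq \<Omega> (u1 0) v0"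
    and K: "\<And>t. t \<in> {0..T} \<Longrightarrow> \<kappa> * L2_norm \<Omega> (\<lambda>x. f t x - u2 t x) \<le> K" and t: "t \<in> {0..T}"
  shows "uh t \<in> V" "L2_norm \<Omega> (\<lambda>x. R (u t) x - uh t x) \<le>
      T * (2 * K + 2 * integral {0..T} (\<lambda>t. L2_norm \<Omega> (\<lambda>x. R (u2 t) x - u2 t x) + \<kappa> * L2_norm \<Omega> (\<lambda>x. f1 t x - u3 t x)))"
    "continuous_on {0..T} (\<lambda>t. L2_norm \<Omega> (\<lambda>x. R (u2 t) x - u2 t x))"
    "continuous_on {0..T} (\<lambda>t. L2_norm \<Omega> (\<lambda>x. f1 t x - u3 t x))"
    "u \<in> time_C0 (L2_space \<Omega>) (L2_norm \<Omega>) T \<Longrightarrow> continuous_on {0..T} (\<lambda>t. L2_norm \<Omega> (\<lambda>x. R (u t) x - u t x))"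
proof -
  have 0: "0 \<in> {0..T}" using T by simp
  have \<kappa>0: "\<kappa> \<ge> 0" unfolding \<kappa> using C1 \<alpha> by simp
  have FL: "f t \<in> L2_space \<Omega>" "f1 t \<in> L2_space \<Omega>" "f2 t \<in> L2_space \<Omega>" "u2 t \<in> L2_space \<Omega>" "u3 t \<in> L2_space \<Omega>" "u4 t \<in> L2_space \<Omega>"
    if "t \<in> {0..T}" for t using C that by (auto simp: time_C0_def)
  obtain uh1 uh2 where uhA: "\<forall>t\<in>{0..T}. uh t \<in> V \<and> uh1 t \<in> V \<and> uh2 t \<in> V"
    and dh: "has_time_deriv \<Omega> T uh uh1" "has_time_deriv \<Omega> T uh1 uh2"
    and eqA: "\<forall>t\<in>{0..T}. \<forall>v\<in>V. L2_inner \<Omega> (uh2 t) v + a (uh t) v = L2_inner \<Omega> (f t) v"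
    and ih: "ae_eq \<Omega> (uh 0) (R u0)" "ae_eq \<Omega> (uh1 0) (R v0)"
    using sd[unfolded semidiscrete_solution_def] by (elim exE conjE) (erule (5) that)
  have uh: "uh t \<in> V" "uh1 t \<in> V" "uh2 t \<in> V" if "t \<in> {0..T}" for t using uhA that by auto
  have eqh: "L2_inner \<Omega> (uh2 t) v + a (uh t) v = L2_inner \<Omega> (f t) v" if "t \<in> {0..T}" "v \<in> V" for t v
    using eqA that by blast
  show "uh t \<in> V" by (rule uh(1)[OF t])
  obtain m :: nat and e where e: "\<forall>i<m. e i \<in> V" and on: "\<forall>i<m. \<forall>j<m. L2_inner \<Omega> (e i) (e j) = (if i = j then 1 else 0)"
    and ex: "\<forall>v\<in>V. ae_eq \<Omega> v (\<lambda>x. \<Sum>i<m. L2_inner \<Omega> v (e i) * e i x)"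
    using ex_onb by (elim exE conjE) (erule (2) that)
  have eV: "e i \<in> V" if "i < m" for i using e that by simp
  have eL: "e i \<in> L2_space \<Omega>" if "i < m" for i by (rule V_L2[OF eV[OF that]])
  define d where "d i = (SOME d. d \<in> V \<and> (\<forall>v\<in>V. a v d = L2_inner \<Omega> v (e i)))" for i
  have d: "d i \<in> V" "\<And>v. v \<in> V \<Longrightarrow> a v (d i) = L2_inner \<Omega> v (e i)" if "i < m" for i
  proof -
    have "\<exists>d. d \<in> V \<and> (\<forall>v\<in>V. a v d = L2_inner \<Omega> v (e i))" using ex_riesz[OF eV[OF that]] by blast
    from someI_ex[OF this] show "d i \<in> V" "\<And>v. v \<in> V \<Longrightarrow> a v (d i) = L2_inner \<Omega> v (e i)" unfolding d_def by auto
  qed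
  \<comment> \<open>The coordinates of \<open>R z\<close> are plate products of \<open>z\<close>
    with fixed clamped functions, so their behaviour in time can be read off from
    \<open>z\<close>.\<close>
  have Rd: "L2_inner \<Omega> (R z) (e i) = plate_form \<Omega> z (Q (d i))" if "z \<in> H20 \<Omega>" "i < m" for z i
    using d(2)[OF that(2) R_V[OF that(1)]] R_eq[OF that(1) d(1)[OF that(2)]] by simp
  define x where "x v i = L2_inner \<Omega> v (e i)" for v i
  have sV: "(\<lambda>y. \<Sum>i<m. x v i * e i y) \<in> V" for v using eV by (intro A.sum_mem) auto
  have ex': "ae_eq \<Omega> v (\<lambda>y. \<Sum>i<m. x v i * e i y)" if "v \<in> V" for v using ex that by (simp add: x_def)
  have expL: "L2_inner \<Omega> v w = (\<Sum>i<m. x v i * L2_inner \<Omega> (e i) w)" if "v \<in> V" "w \<in> L2_space \<Omega>" for v w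
    using L2_inner_ae[OF \<Omega>_leb ex'[OF that(1)], of w] L2.sum_left[OF eL that(2), of "{..<m}" "\<lambda>i. i" "x v"] by simp
  have inn: "L2_inner \<Omega> v w = (\<Sum>i<m. x v i * x w i)" if "v \<in> V" "w \<in> V" for v w
    unfolding expL[OF that(1) V_L2[OF that(2)]] using L2.sym[OF eL V_L2[OF that(2)]] by (intro sum.cong) (auto simp: x_def)
  have ax: "a v w = (\<Sum>i<m. \<Sum>j<m. x v i * x w j * a (e i) (e j))" if v: "v \<in> V" and w: "w \<in> V" for v w
  proof -
    \<comment> \<open>An element of \<open>V\<close> equals its expansion only almost everywhere;
      the null difference is invisible to \<open>a\<close>.\<close>
    have red: "a p q = a p (\<lambda>y. \<Sum>i<m. x q i * e i y)" if "p \<in> V" "q \<in> V" for p q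
    proof -
      have "a p (\<lambda>y. q y - (\<Sum>i<m. x q i * e i y)) = 0"
        using ex'[OF that(2)] by (intro a_null A.diff_mem that sV) (simp add: ae_eq_diff0_iff)
      then show ?thesis using A.diff_right[OF that(2) sV that(1)] by simp
    qed
    have "a v w = a (\<lambda>y. \<Sum>i<m. x v i * e i y) (\<lambda>y. \<Sum>i<m. x w i * e i y)"
      using red[OF v w] red[OF sV v, of w] A.sym[OF v sV] A.sym[OF sV sV] by simp
    also have "\<dots> = (\<Sum>i<m. x v i * a (e i) (\<lambda>y. \<Sum>i<m. x w i * e i y))" using eV by (intro A.sum_left sV) auto
    also have "\<dots> = (\<Sum>i<m. x v i * (\<Sum>j<m. x w j * a (e i) (e j)))"
      using eV by (intro sum.cong refl arg_cong2[of _ _ _ _ "(*)"] A.sum_right) auto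
    finally show ?thesis by (simp add: sum_distrib_left mult.assoc)
  qed
  \<comment> \<open>Linearity of \<open>Q\<close> up to null sets makes the consistency term a
    finite sum with coefficients depending on time and fixed test functions.\<close>
  have qx: "L2_inner \<Omega> F (\<lambda>y. Q v y - v y) = (\<Sum>i<m. x v i * L2_inner \<Omega> F (\<lambda>y. Q (e i) y - e i y))" if v: "v \<in> V" and F: "F \<in> L2_space \<Omega>" for v F
  proof -
    let ?s = "\<lambda>y. \<Sum>i<m. x v i * e i y"
    have "ae_eq \<Omega> (\<lambda>y. Q v y - Q ?s y) (\<lambda>y. 0)"
    proof -
      have n: "ae_eq \<Omega> (Q (\<lambda>y. 1 * v y + (-1) * ?s y)) (\<lambda>y. 0)"
        using ex'[OF v] by (intro Q_null V_lin v sV) (simp add: ae_eq_diff0_iff)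
      from ae_eq_trans[OF ae_eq_sym[OF Q_lin[OF v sV, of 1 "-1"]] n] show ?thesis by simp
    qed
    then have "ae_eq \<Omega> (Q v) (\<lambda>y. \<Sum>i<m. x v i * Q (e i) y)"
      using ae_eq_trans[OF _ Q_sum[OF eV]] by (simp add: ae_eq_diff0_iff)
    from ae_eq_diff[OF this ex'[OF v]]
    have "ae_eq \<Omega> (\<lambda>y. Q v y - v y) (\<lambda>y. \<Sum>i<m. x v i * (Q (e i) y - e i y))"
      by (simp add: sum_subtractf right_diff_distrib)
    from L2_inner_ae2[OF \<Omega>_leb this, of F] show ?thesis
      using L2.sum_right[of "{..<m}" "\<lambda>i y. Q (e i) y - e i y" \<Omega> F "x v"] F eV by (simp add: L2.diff_mem Q_L2 V_L2)
  qed
  have dinner: "((\<lambda>t. L2_inner \<Omega> (\<lambda>x. p t x - q t x) v) has_real_derivative L2_inner \<Omega> (\<lambda>x. p' t x - q' t x) v) (at t within {0..T})"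
    if "\<And>t. t \<in> {0..T} \<Longrightarrow> p t \<in> L2_space \<Omega> \<and> q t \<in> L2_space \<Omega> \<and> p' t \<in> L2_space \<Omega> \<and> q' t \<in> L2_space \<Omega>" "v \<in> L2_space \<Omega>" "t \<in> {0..T}"
      "((\<lambda>t. L2_inner \<Omega> (p t) v) has_real_derivative L2_inner \<Omega> (p' t) v) (at t within {0..T})"
      "((\<lambda>t. L2_inner \<Omega> (q t) v) has_real_derivative L2_inner \<Omega> (q' t) v) (at t within {0..T})" for p q p' q' v t
  proof -
    have "((\<lambda>t. L2_inner \<Omega> (p t) v - L2_inner \<Omega> (q t) v) has_real_derivative L2_inner \<Omega> (\<lambda>x. p' t x - q' t x) v) (at t within {0..T})"
      using DERIV_diff[OF that(4,5)] that(1)[OF that(3)] that(2) by (simp add: L2.diff_left)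
    then show ?thesis
      by (rule has_field_derivative_transform_within[OF _ zero_less_one that(3)])
        (use that(1,2) in \<open>simp add: L2.diff_left del: atLeastAtMost_iff\<close>)
  qed
  define \<theta> where "\<theta> t = (\<lambda>y. R (u t) y - uh t y)" for t
  define \<theta>1 where "\<theta>1 t = (\<lambda>y. R (u1 t) y - uh1 t y)" for t
  define \<theta>2 where "\<theta>2 t = (\<lambda>y. R (u2 t) y - uh2 t y)" for t
  have RV: "R (u t) \<in> V" "R (u1 t) \<in> V" "R (u2 t) \<in> V" if "t \<in> {0..T}" for t using R_V H that by auto
  have \<theta>V: "\<theta> t \<in> V" "\<theta>1 t \<in> V" "\<theta>2 t \<in> V" if "t \<in> {0..T}" for t
    unfolding \<theta>_def \<theta>1_def \<theta>2_def by (intro A.diff_mem RV uh that)+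
  \<comment> \<open>Stated for a generic function and its derivative, since it is used for the pair
    \<open>\<theta>\<close>, \<open>\<theta>1\<close> and again for \<open>\<theta>1\<close>,
    \<open>\<theta>2\<close>.\<close>
  have xd: "((\<lambda>t. x (p t) i) has_real_derivative x (p' t) i) (at t within {0..T})"
    if i: "i < m" and t: "t \<in> {0..T}" and p: "\<And>t. p t = (\<lambda>y. R (w t) y - wh t y)" "\<And>t. p' t = (\<lambda>y. R (w' t) y - wh' t y)"
      and w: "\<And>t. t \<in> {0..T} \<Longrightarrow> w t \<in> H20 \<Omega>" "\<And>t. t \<in> {0..T} \<Longrightarrow> w' t \<in> H20 \<Omega>" "\<And>t. t \<in> {0..T} \<Longrightarrow> wh t \<in> V" "\<And>t. t \<in> {0..T} \<Longrightarrow> wh' t \<in> V"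
      and dh: "has_time_deriv \<Omega> T wh wh'"
      and pl: "\<And>z. z \<in> H20 \<Omega> \<Longrightarrow> ((\<lambda>t. plate_form \<Omega> (w t) z) has_real_derivative plate_form \<Omega> (w' t) z) (at t within {0..T})"
    for i t p p' w w' wh wh'
  proof -
    have Qd: "Q (d i) \<in> H20 \<Omega>" by (rule QH[OF d(1)[OF i]])
    have e1: "x (p s) i = plate_form \<Omega> (w s) (Q (d i)) - L2_inner \<Omega> (wh s) (e i)" if "s \<in> {0..T}" for s
      unfolding x_def p(1) using Rd[OF w(1)[OF that] i] R_V[OF w(1)[OF that]] w(3)[OF that] by (simp add: L2.diff_left V_L2 eL[OF i])
    have e2: "x (p' t) i = plate_form \<Omega> (w' t) (Q (d i)) - L2_inner \<Omega> (wh' t) (e i)"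
      unfolding x_def p(2) using Rd[OF w(2)[OF t] i] R_V[OF w(2)[OF t]] w(4)[OF t] by (simp add: L2.diff_left V_L2 eL[OF i])
    have "((\<lambda>t. plate_form \<Omega> (w t) (Q (d i)) - L2_inner \<Omega> (wh t) (e i)) has_real_derivative x (p' t) i) (at t within {0..T})"
      unfolding e2 using V_L2 w(3,4) by (intro DERIV_diff pl[OF Qd] has_time_deriv_inner[OF dh _ _ eL[OF i] t]) auto
    then show ?thesis by (rule has_field_derivative_transform_within[OF _ zero_less_one t]) (rule e1[symmetric])
  qed
  \<comment> \<open>The plate product is differentiated through the equation as an L2 product;
    differentiability of \<open>u\<close> with values in \<open>H20\<close> is never
    established.\<close>
  have pl0: "((\<lambda>t. plate_form \<Omega> (u t) z) has_real_derivative plate_form \<Omega> (u1 t) z) (at t within {0..T})" if "t \<in> {0..T}" "z \<in> H20 \<Omega>" for t z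
  proof -
    have "((\<lambda>t. L2_inner \<Omega> (\<lambda>x. f t x - u2 t x) z) has_real_derivative L2_inner \<Omega> (\<lambda>x. f1 t x - u3 t x) z) (at t within {0..T})"
      using FL by (intro dinner df that H20_L2[OF that(2)]) auto
    then show ?thesis unfolding eq(2)[OF that]
      by (rule has_field_derivative_transform_within[OF _ zero_less_one that(1)]) (rule eq(1)[OF _ that(2), symmetric])
  qed
  have pl1: "((\<lambda>t. plate_form \<Omega> (u1 t) z) has_real_derivative plate_form \<Omega> (u2 t) z) (at t within {0..T})" if "t \<in> {0..T}" "z \<in> H20 \<Omega>" for t z
  proof -
    have "((\<lambda>t. L2_inner \<Omega> (\<lambda>x. f1 t x - u3 t x) z) has_real_derivative L2_inner \<Omega> (\<lambda>x. f2 t x - u4 t x) z) (at t within {0..T})"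
      using FL by (intro dinner df that H20_L2[OF that(2)]) auto
    then show ?thesis unfolding eq(3)[OF that]
      by (rule has_field_derivative_transform_within[OF _ zero_less_one that(1)]) (rule eq(2)[OF _ that(2), symmetric])
  qed
  have dX: "((\<lambda>t. x (\<theta> t) i) has_real_derivative x (\<theta>1 t) i) (at t within {0..T})" if "i < m" "t \<in> {0..T}" for i t
    by (rule xd[OF that \<theta>_def \<theta>1_def H(1) H(2) uh(1) uh(2) dh(1) pl0[OF that(2)]])
  have dY: "((\<lambda>t. x (\<theta>1 t) i) has_real_derivative x (\<theta>2 t) i) (at t within {0..T})" if "i < m" "t \<in> {0..T}" for i t
    by (rule xd[OF that \<theta>1_def \<theta>2_def H(2) H(3) uh(2) uh(3) dh(2) pl1[OF that(2)]])
  have gL: "(\<lambda>y. f t y - u2 t y) \<in> L2_space \<Omega>" "(\<lambda>y. f1 t y - u3 t y) \<in> L2_space \<Omega>" if "t \<in> {0..T}" for t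
    using FL[OF that] by (auto intro: L2.diff_mem)
  txt \<open>The consistency term \<open>(f - u\<^sub>t\<^sub>t, Q \<theta>\<^sub>t - \<theta>\<^sub>t)\<close> must not see \<open>\<theta>\<^sub>t\<close>, whose energy norm is not controlled;
    it is integrated by parts in time, and \<open>D\<close> is the resulting boundary term.\<close>
  define E where "E t = L2_inner \<Omega> (\<theta>1 t) (\<theta>1 t) + a (\<theta> t) (\<theta> t)" for t
  define D where "D t = 2 * L2_inner \<Omega> (\<lambda>y. f t y - u2 t y) (\<lambda>y. Q (\<theta> t) y - \<theta> t y)" for t
  have dE: "(E has_real_derivative 2 * (L2_inner \<Omega> (\<theta>2 t) (\<theta>1 t) + a (\<theta> t) (\<theta>1 t))) (at t within {0..T})" if t: "t \<in> {0..T}" for t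
  proof -
    have "((\<lambda>t. (\<Sum>i<m. x (\<theta>1 t) i * x (\<theta>1 t) i) + (\<Sum>i<m. \<Sum>j<m. x (\<theta> t) i * x (\<theta> t) j * a (e i) (e j))) has_real_derivative
      ((\<Sum>i<m. x (\<theta>2 t) i * x (\<theta>1 t) i) + (\<Sum>i<m. x (\<theta>1 t) i * x (\<theta>2 t) i)) +
      ((\<Sum>i<m. \<Sum>j<m. x (\<theta>1 t) i * x (\<theta> t) j * a (e i) (e j)) + (\<Sum>i<m. \<Sum>j<m. x (\<theta> t) i * x (\<theta>1 t) j * a (e i) (e j)))) (at t within {0..T})"
      by (intro DERIV_add coordinate_linear_deriv[of m "\<lambda>i t. x (\<theta>1 t) i" "\<lambda>i t. x (\<theta>2 t) i" t "{0..T}" "\<lambda>i t. x (\<theta>1 t) i" "\<lambda>i t. x (\<theta>2 t) i"]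
          coordinate_bilinear_deriv[of m "\<lambda>i t. x (\<theta> t) i" "\<lambda>i t. x (\<theta>1 t) i" t "{0..T}" "\<lambda>i t. x (\<theta> t) i" "\<lambda>i t. x (\<theta>1 t) i"] dX dY t)
    also have "((\<Sum>i<m. x (\<theta>2 t) i * x (\<theta>1 t) i) + (\<Sum>i<m. x (\<theta>1 t) i * x (\<theta>2 t) i)) +
      ((\<Sum>i<m. \<Sum>j<m. x (\<theta>1 t) i * x (\<theta> t) j * a (e i) (e j)) + (\<Sum>i<m. \<Sum>j<m. x (\<theta> t) i * x (\<theta>1 t) j * a (e i) (e j)))
      = 2 * (L2_inner \<Omega> (\<theta>2 t) (\<theta>1 t) + a (\<theta> t) (\<theta>1 t))"
      unfolding ax[OF \<theta>V(2)[OF t] \<theta>V(1)[OF t], symmetric] ax[OF \<theta>V(1)[OF t] \<theta>V(2)[OF t], symmetric]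
        inn[OF \<theta>V(3)[OF t] \<theta>V(2)[OF t], symmetric] inn[OF \<theta>V(2)[OF t] \<theta>V(3)[OF t], symmetric]
      using A.sym[OF \<theta>V(1)[OF t] \<theta>V(2)[OF t]] L2.sym[OF V_L2[OF \<theta>V(2)[OF t]] V_L2[OF \<theta>V(3)[OF t]]] by simp
    finally show ?thesis
      by (rule has_field_derivative_transform_within[OF _ zero_less_one t])
        (use ax[OF \<theta>V(1) \<theta>V(1)] inn[OF \<theta>V(2) \<theta>V(2)] in \<open>simp add: E_def\<close>)
  qed
  have dD: "(D has_real_derivative 2 * (L2_inner \<Omega> (\<lambda>y. f t y - u2 t y) (\<lambda>y. Q (\<theta>1 t) y - \<theta>1 t y) + L2_inner \<Omega> (\<lambda>y. f1 t y - u3 t y) (\<lambda>y. Q (\<theta> t) y - \<theta> t y))) (at t within {0..T})"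
    if t: "t \<in> {0..T}" for t
  proof -
    have ql: "(\<lambda>y. Q (e i) y - e i y) \<in> L2_space \<Omega>" if "i < m" for i using eV[OF that] by (intro L2.diff_mem Q_L2 V_L2)
    have "((\<lambda>t. \<Sum>i<m. x (\<theta> t) i * L2_inner \<Omega> (\<lambda>y. f t y - u2 t y) (\<lambda>y. Q (e i) y - e i y)) has_real_derivative
       (\<Sum>i<m. x (\<theta>1 t) i * L2_inner \<Omega> (\<lambda>y. f t y - u2 t y) (\<lambda>y. Q (e i) y - e i y)) + (\<Sum>i<m. x (\<theta> t) i * L2_inner \<Omega> (\<lambda>y. f1 t y - u3 t y) (\<lambda>y. Q (e i) y - e i y))) (at t within {0..T})"
      using FL by (intro coordinate_linear_deriv dX dinner df ql t) auto
    then have "((\<lambda>t. \<Sum>i<m. x (\<theta> t) i * L2_inner \<Omega> (\<lambda>y. f t y - u2 t y) (\<lambda>y. Q (e i) y - e i y)) has_real_derivative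
       (L2_inner \<Omega> (\<lambda>y. f t y - u2 t y) (\<lambda>y. Q (\<theta>1 t) y - \<theta>1 t y) + L2_inner \<Omega> (\<lambda>y. f1 t y - u3 t y) (\<lambda>y. Q (\<theta> t) y - \<theta> t y))) (at t within {0..T})"
      unfolding qx[OF \<theta>V(2)[OF t] gL(1)[OF t]] qx[OF \<theta>V(1)[OF t] gL(2)[OF t]] .
    from DERIV_cmult[OF this, of 2] show ?thesis
      by (rule has_field_derivative_transform_within[OF _ zero_less_one t])
        (use qx[OF \<theta>V(1) gL(1)] in \<open>simp add: D_def\<close>)
  qed
  let ?\<rho> = "\<lambda>t y. R (u2 t) y - u2 t y"
  have \<rho>L: "?\<rho> t \<in> L2_space \<Omega>" if "t \<in> {0..T}" for t
    by (rule L2.diff_mem[OF V_L2[OF RV(3)[OF that]] FL(4)[OF that]])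
  have ident: "L2_inner \<Omega> (\<theta>2 t) v + a (\<theta> t) v = L2_inner \<Omega> (?\<rho> t) v + L2_inner \<Omega> (\<lambda>y. f t y - u2 t y) (\<lambda>y. Q v y - v y)"
    if t: "t \<in> {0..T}" and v: "v \<in> V" for t v
  proof -
    have "L2_inner \<Omega> (\<theta>2 t) v = L2_inner \<Omega> (R (u2 t)) v - L2_inner \<Omega> (uh2 t) v"
      unfolding \<theta>2_def by (rule L2.diff_left) (intro V_L2 RV uh t v)+
    moreover have "a (\<theta> t) v = L2_inner \<Omega> (\<lambda>y. f t y - u2 t y) (Q v) - a (uh t) v"
      unfolding \<theta>_def using A.diff_left[OF RV(1)[OF t] uh(1)[OF t] v] R_eq[OF H(1)[OF t] v] eq(1)[OF t QH[OF v]] by simp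
    moreover have "L2_inner \<Omega> (?\<rho> t) v = L2_inner \<Omega> (R (u2 t)) v - L2_inner \<Omega> (u2 t) v"
      by (rule L2.diff_left) (intro V_L2 RV FL t v)+
    moreover have "L2_inner \<Omega> (\<lambda>y. f t y - u2 t y) (\<lambda>y. Q v y - v y) = L2_inner \<Omega> (\<lambda>y. f t y - u2 t y) (Q v) - L2_inner \<Omega> (\<lambda>y. f t y - u2 t y) v"
      by (rule L2.diff_right) (intro V_L2 Q_L2 gL t v)+
    moreover have "L2_inner \<Omega> (\<lambda>y. f t y - u2 t y) v = L2_inner \<Omega> (f t) v - L2_inner \<Omega> (u2 t) v"
      by (rule L2.diff_left) (intro V_L2 FL t v)+
    ultimately show ?thesis using eqh[OF t v] by simp
  qed
  \<comment> \<open>The derivative of \<open>E - D\<close>: the products with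
    \<open>Q (\<theta>1 t) y - \<theta>1 t y\<close> cancel, and what remains contains
    \<open>\<theta>1\<close> only in the L2 norm.\<close>
  define h where "h t = 2 * L2_inner \<Omega> (?\<rho> t) (\<theta>1 t) - 2 * L2_inner \<Omega> (\<lambda>y. f1 t y - u3 t y) (\<lambda>y. Q (\<theta> t) y - \<theta> t y)" for t
  have dED: "((\<lambda>t. E t - D t) has_real_derivative h t) (at t within {0..T})" if t: "t \<in> {0..T}" for t
    using DERIV_diff[OF dE[OF t] dD[OF t]] unfolding ident[OF t \<theta>V(2)[OF t]] h_def by (simp add: algebra_simps)
  define g where "g t = L2_norm \<Omega> (?\<rho> t) + \<kappa> * L2_norm \<Omega> (\<lambda>y. f1 t y - u3 t y)" for t
  have sm': "L2_norm \<Omega> (\<lambda>y. Q v y - v y) \<le> \<kappa> * sqrt (a v v)" if "v \<in> V" for v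
    using smoother_L2[OF that] by (simp add: \<kappa> real_sqrt_divide)
  have E0: "0 \<le> E t" "L2_norm \<Omega> (\<theta>1 t) \<le> sqrt (E t)" "sqrt (a (\<theta> t) (\<theta> t)) \<le> sqrt (E t)" if t: "t \<in> {0..T}" for t
    using A.nonneg[OF \<theta>V(1)[OF t]] L2_inner_self_nonneg[of \<Omega> "\<theta>1 t"] by (auto simp: E_def L2_norm_def)
  have Qb: "\<bar>L2_inner \<Omega> F (\<lambda>y. Q (\<theta> t) y - \<theta> t y)\<bar> \<le> \<kappa> * L2_norm \<Omega> F * sqrt (E t)" if t: "t \<in> {0..T}" and F: "F \<in> L2_space \<Omega>" for t F
  proof -
    have "\<bar>L2_inner \<Omega> F (\<lambda>y. Q (\<theta> t) y - \<theta> t y)\<bar> \<le> L2_norm \<Omega> F * L2_norm \<Omega> (\<lambda>y. Q (\<theta> t) y - \<theta> t y)"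
      by (rule L2.cauchy_schwarz[OF F]) (intro L2.diff_mem Q_L2 V_L2 \<theta>V t)
    also have "\<dots> \<le> L2_norm \<Omega> F * (\<kappa> * sqrt (E t))"
      using order_trans[OF sm'[OF \<theta>V(1)[OF t]] mult_left_mono[OF E0(3)[OF t] \<kappa>0]] by (rule mult_left_mono) (rule L2_norm_nonneg)
    finally show ?thesis by (simp add: algebra_simps)
  qed
  have hb: "h t \<le> 2 * g t * sqrt (E t)" if t: "t \<in> {0..T}" for t
  proof -
    have "\<bar>L2_inner \<Omega> (?\<rho> t) (\<theta>1 t)\<bar> \<le> L2_norm \<Omega> (?\<rho> t) * L2_norm \<Omega> (\<theta>1 t)"
      by (rule L2.cauchy_schwarz[OF \<rho>L[OF t] V_L2[OF \<theta>V(2)[OF t]]])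
    also have "\<dots> \<le> L2_norm \<Omega> (?\<rho> t) * sqrt (E t)" by (rule mult_left_mono[OF E0(2)[OF t] L2_norm_nonneg])
    finally have "\<bar>L2_inner \<Omega> (?\<rho> t) (\<theta>1 t)\<bar> \<le> L2_norm \<Omega> (?\<rho> t) * sqrt (E t)" .
    then show ?thesis using Qb[OF t gL(2)[OF t]] unfolding h_def g_def by (simp add: algebra_simps)
  qed
  have Db: "D t \<le> 2 * K * sqrt (E t)" if t: "t \<in> {0..T}" for t
  proof -
    have "D t \<le> 2 * (\<kappa> * L2_norm \<Omega> (\<lambda>y. f t y - u2 t y) * sqrt (E t))" using Qb[OF t gL(1)[OF t]] unfolding D_def by linarith
    also have "\<dots> \<le> 2 * (K * sqrt (E t))" using mult_right_mono[OF K[OF t], of "sqrt (E t)"] E0(1)[OF t] by simp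
    finally show ?thesis by simp
  qed
  have ini: "ae_eq \<Omega> (\<theta> 0) (\<lambda>y. 0)" "ae_eq \<Omega> (\<theta>1 0) (\<lambda>y. 0)"
  proof -
    have "ae_eq \<Omega> (R (u 0)) (R u0)" "ae_eq \<Omega> (R (u1 0)) (R v0)"
      using R_ae[OF H(1)[OF 0] H20_ae[OF \<Omega>_leb init(1) H(1)[OF 0]] init(1)] R_ae[OF H(2)[OF 0] H20_ae[OF \<Omega>_leb init(2) H(2)[OF 0]] init(2)] by auto
    then show "ae_eq \<Omega> (\<theta> 0) (\<lambda>y. 0)" "ae_eq \<Omega> (\<theta>1 0) (\<lambda>y. 0)"
      unfolding \<theta>_def \<theta>1_def ae_eq_diff0_iff using ih ae_eq_trans ae_eq_sym by blast+
  qed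
  have z1: "E 0 = 0" unfolding E_def
    using L2_inner_ae[OF \<Omega>_leb ini(2)] a_null[OF \<theta>V(1)[OF 0] ini(1) \<theta>V(1)[OF 0]] by (simp add: L2_inner_def)
  have z2: "D 0 = 0" unfolding D_def
    using L2_inner_ae2[OF \<Omega>_leb ae_eq_diff[OF Q_null[OF \<theta>V(1)[OF 0] ini(1)] ini(1)]] by (simp add: L2_inner_def)
  \<comment> \<open>The squared norm is expanded into coordinates: those of \<open>R (w t)\<close>
    are plate products, continuous by assumption, and the rest involves \<open>w\<close> only in
    L2.\<close>
  have normc: "continuous_on {0..T} (\<lambda>t. L2_norm \<Omega> (\<lambda>y. R (w t) y - w t y))"
    if w: "\<And>t. t \<in> {0..T} \<Longrightarrow> w t \<in> H20 \<Omega>" "w \<in> time_C0 (L2_space \<Omega>) (L2_norm \<Omega>) T"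
      and pc: "\<And>z. z \<in> H20 \<Omega> \<Longrightarrow> continuous_on {0..T} (\<lambda>t. plate_form \<Omega> (w t) z)" for w
  proof -
    note wn = time_C0_norm_continuous[OF w(2)]
    have "continuous_on {0..T} (\<lambda>t. sqrt ((\<Sum>i<m. (plate_form \<Omega> (w t) (Q (d i)))\<^sup>2) - 2 * (\<Sum>i<m. plate_form \<Omega> (w t) (Q (d i)) * L2_inner \<Omega> (w t) (e i)) + (L2_norm \<Omega> (w t))\<^sup>2))"
      using d(1) by (intro continuous_intros wn pc time_C0_inner_continuous[OF w(2)] QH eL) auto
    then show ?thesis
    proof (rule continuous_on_eq)
      fix t assume t: "t \<in> {0..T}"
      have RL: "R (w t) \<in> V" "w t \<in> L2_space \<Omega>" using R_V[OF w(1)[OF t]] H20_L2[OF w(1)[OF t]] by auto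
      have xR: "x (R (w t)) i = plate_form \<Omega> (w t) (Q (d i))" if "i < m" for i unfolding x_def by (rule Rd[OF w(1)[OF t] that])
      have "L2_inner \<Omega> (R (w t)) (R (w t)) = (\<Sum>i<m. (plate_form \<Omega> (w t) (Q (d i)))\<^sup>2)"
        unfolding inn[OF RL(1) RL(1)] by (intro sum.cong) (auto simp: xR power2_eq_square)
      moreover have "L2_inner \<Omega> (R (w t)) (w t) = (\<Sum>i<m. plate_form \<Omega> (w t) (Q (d i)) * L2_inner \<Omega> (w t) (e i))"
        unfolding expL[OF RL] using L2.sym[OF eL RL(2)] by (intro sum.cong) (auto simp: xR)
      ultimately show "sqrt ((\<Sum>i<m. (plate_form \<Omega> (w t) (Q (d i)))\<^sup>2) - 2 * (\<Sum>i<m. plate_form \<Omega> (w t) (Q (d i)) * L2_inner \<Omega> (w t) (e i)) + (L2_norm \<Omega> (w t))\<^sup>2)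
        = L2_norm \<Omega> (\<lambda>y. R (w t) y - w t y)"
        unfolding L2_norm_def[of _ "\<lambda>y. R (w t) y - w t y"] L2.diff_diff[OF V_L2[OF RL(1)] RL(2)] by (simp add: L2_norm_sq)
    qed
  qed
  have pc: "continuous_on {0..T} (\<lambda>t. plate_form \<Omega> (u t) z)" "continuous_on {0..T} (\<lambda>t. plate_form \<Omega> (u2 t) z)" if "z \<in> H20 \<Omega>" for z
  proof -
    show "continuous_on {0..T} (\<lambda>t. plate_form \<Omega> (u t) z)" by (rule DERIV_continuous_on[OF pl0[OF _ that]])
    \<comment> \<open>For \<open>u2\<close> continuity is enough, and here the fourth time
      derivative enters through \<open>A u_tt = f_tt - u_tttt\<close>.\<close>
    have "continuous_on {0..T} (\<lambda>t. L2_inner \<Omega> (f2 t) z - L2_inner \<Omega> (u4 t) z)"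
      by (intro continuous_intros time_C0_inner_continuous C H20_L2 that)
    then show "continuous_on {0..T} (\<lambda>t. plate_form \<Omega> (u2 t) z)"
      by (rule continuous_on_eq) (use eq(3)[OF _ that] FL H20_L2[OF that] in \<open>simp add: L2.diff_left del: atLeastAtMost_iff\<close>)
  qed
  show \<rho>c: "continuous_on {0..T} (\<lambda>t. L2_norm \<Omega> (?\<rho> t))" by (rule normc[OF H(3) C(4) pc(2)])
  show "u \<in> time_C0 (L2_space \<Omega>) (L2_norm \<Omega>) T \<Longrightarrow> continuous_on {0..T} (\<lambda>t. L2_norm \<Omega> (\<lambda>x. R (u t) x - u t x))"
    by (rule normc[OF H(1) _ pc(1)])
  show fc: "continuous_on {0..T} (\<lambda>t. L2_norm \<Omega> (\<lambda>x. f1 t x - u3 t x))"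
    unfolding continuous_on_def
  proof
    fix t assume t: "t \<in> {0..T}"
    have lim: "((\<lambda>s. L2_norm \<Omega> (\<lambda>x. f1 s x - f1 t x) + L2_norm \<Omega> (\<lambda>x. u3 s x - u3 t x)) \<longlongrightarrow> 0 + 0) (at t within {0..T})"
      using C(2,5) t by (intro tendsto_add) (auto simp: time_C0_def)
    show "((\<lambda>t. L2_norm \<Omega> (\<lambda>x. f1 t x - u3 t x)) \<longlongrightarrow> L2_norm \<Omega> (\<lambda>x. f1 t x - u3 t x)) (at t within {0..T})"
    proof (rule L2.nm_tendsto)
      show "\<forall>\<^sub>F s in at t within {0..T}. (\<lambda>x. f1 s x - u3 s x) \<in> L2_space \<Omega>" using gL(2) by (auto simp: eventually_at_filter)
      show "(\<lambda>x. f1 t x - u3 t x) \<in> L2_space \<Omega>" by (rule gL(2)[OF t])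
      show "((\<lambda>s. L2_norm \<Omega> (\<lambda>x. f1 s x - u3 s x - (f1 t x - u3 t x))) \<longlongrightarrow> 0) (at t within {0..T})"
      proof (rule Lim_null_comparison[OF _ lim[simplified]])
        have "norm (L2_norm \<Omega> (\<lambda>x. f1 s x - u3 s x - (f1 t x - u3 t x))) \<le> L2_norm \<Omega> (\<lambda>x. f1 s x - f1 t x) + L2_norm \<Omega> (\<lambda>x. u3 s x - u3 t x)"
          if s: "s \<in> {0..T}" for s
        proof -
          have "(\<lambda>x. f1 s x - u3 s x - (f1 t x - u3 t x)) = (\<lambda>x. (f1 s x - f1 t x) - (u3 s x - u3 t x))" by auto
          then show ?thesis using L2.nm_diff_triangle[of "\<lambda>x. f1 s x - f1 t x" \<Omega> "\<lambda>x. u3 s x - u3 t x"] FL[OF s] FL[OF t]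
            by (simp add: L2.diff_mem L2_norm_nonneg)
        qed
        then show "\<forall>\<^sub>F s in at t within {0..T}. norm (L2_norm \<Omega> (\<lambda>x. f1 s x - u3 s x - (f1 t x - u3 t x))) \<le> L2_norm \<Omega> (\<lambda>x. f1 s x - f1 t x) + L2_norm \<Omega> (\<lambda>x. u3 s x - u3 t x)"
          by (auto simp: eventually_at_filter)
      qed
    qed
  qed
  have gc: "continuous_on {0..T} g" unfolding g_def by (intro continuous_intros \<rho>c fc)
  have g0: "0 \<le> g t" for t unfolding g_def using \<kappa>0 by (simp add: L2_norm_nonneg)
  have K0: "K \<ge> 0" using K[OF 0] mult_nonneg_nonneg[OF \<kappa>0 L2_norm_nonneg] by (rule order_trans[rotated])
  have Ec: "continuous_on {0..T} E" by (rule DERIV_continuous_on[OF dE])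
  let ?S = "2 * K + 2 * integral {0..T} g"
  have ES: "sqrt (E s) \<le> ?S" if s: "s \<in> {0..T}" for s
    by (rule energy_sup_bound[OF T Ec E0(1) gc g0 dED hb Db z1 z2 K0 s])
  have S0: "0 \<le> ?S" using ES[OF 0] z1 by simp
  have "L2_norm \<Omega> (\<theta> t) \<le> T * ?S"
  proof -
    \<comment> \<open>The scalar function \<open>(\<theta> t, \<theta> s)\<close> of
      \<open>s\<close> is differentiated with \<open>t\<close> held fixed. This avoids
      differentiating a norm where it vanishes and costs one factor \<open>T\<close>.\<close>
    have "\<bar>L2_inner \<Omega> (\<theta> t) (\<theta> t)\<bar> \<le> \<bar>L2_inner \<Omega> (\<theta> t) (\<theta> 0)\<bar> + T * (L2_norm \<Omega> (\<theta> t) * ?S)"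
    proof (rule increment_bound[where g = "\<lambda>s. L2_inner \<Omega> (\<theta> t) (\<theta> s)" and g' = "\<lambda>s. L2_inner \<Omega> (\<theta> t) (\<theta>1 s)"])
      fix s assume s: "s \<in> {0..T}"
      have "((\<lambda>s. \<Sum>i<m. x (\<theta> t) i * x (\<theta> s) i) has_real_derivative (\<Sum>i<m. x (\<theta> t) i * x (\<theta>1 s) i)) (at s within {0..T})"
        using s by (intro DERIV_sum DERIV_cmult dX) auto
      then have "((\<lambda>s. \<Sum>i<m. x (\<theta> t) i * x (\<theta> s) i) has_real_derivative L2_inner \<Omega> (\<theta> t) (\<theta>1 s)) (at s within {0..T})"
        unfolding inn[OF \<theta>V(1)[OF t] \<theta>V(2)[OF s]] .
      then show "((\<lambda>s. L2_inner \<Omega> (\<theta> t) (\<theta> s)) has_real_derivative L2_inner \<Omega> (\<theta> t) (\<theta>1 s)) (at s within {0..T})"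
        by (rule has_field_derivative_transform_within[OF _ zero_less_one s]) (rule inn[OF \<theta>V(1)[OF t] \<theta>V(1), symmetric])
      have "\<bar>L2_inner \<Omega> (\<theta> t) (\<theta>1 s)\<bar> \<le> L2_norm \<Omega> (\<theta> t) * L2_norm \<Omega> (\<theta>1 s)"
        by (intro L2.cauchy_schwarz V_L2 \<theta>V t s)
      also have "\<dots> \<le> L2_norm \<Omega> (\<theta> t) * ?S"
        using order_trans[OF E0(2)[OF s] ES[OF s]] by (rule mult_left_mono) (rule L2_norm_nonneg)
      finally show "\<bar>L2_inner \<Omega> (\<theta> t) (\<theta>1 s)\<bar> \<le> L2_norm \<Omega> (\<theta> t) * ?S" .
    qed (rule t)
    moreover have "L2_inner \<Omega> (\<theta> t) (\<theta> 0) = 0" using L2_inner_ae2[OF \<Omega>_leb ini(1), of "\<theta> t"] by (simp add: L2_inner_def)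
    ultimately have "L2_norm \<Omega> (\<theta> t) * L2_norm \<Omega> (\<theta> t) \<le> L2_norm \<Omega> (\<theta> t) * (T * ?S)"
      using L2_norm_sq[of \<Omega> "\<theta> t"] L2_inner_self_nonneg[of \<Omega> "\<theta> t"] by (simp add: power2_eq_square mult.left_commute)
    then show ?thesis using L2_norm_nonneg[of \<Omega> "\<theta> t"] mult_nonneg_nonneg[OF less_imp_le[OF T] S0]
      by (cases "L2_norm \<Omega> (\<theta> t) = 0") (auto simp: mult_le_cancel_left)
  qed
  then show "L2_norm \<Omega> (\<lambda>x. R (u t) x - uh t x) \<le>
      T * (2 * K + 2 * integral {0..T} (\<lambda>t. L2_norm \<Omega> (\<lambda>x. R (u2 t) x - u2 t x) + \<kappa> * L2_norm \<Omega> (\<lambda>x. f1 t x - u3 t x)))"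
    unfolding \<theta>_def g_def[abs_def] .
qed

end

section \<open>Norms in time and the error estimate\<close>

text \<open>The approximants are the values of \<open>w\<close> at the nearest point to the left on
  a grid of spacing \<open>T / (n + 1)\<close>. They take finitely many values and converge by
  continuity.\<close>

lemma bochner_measurable_time_C0:
  assumes T: "T > 0" and N: "N (\<lambda>x. 0) = 0" and w: "w \<in> time_C0 X N T"
  shows "bochner_measurable X N T w"
proof -
  define g where "g n t = T * real_of_int \<lfloor>(real n + 1) * t / T\<rfloor> / (real n + 1)" for n :: nat and t
  have g: "g n t \<in> {0..T}" "\<bar>g n t - t\<bar> \<le> T * inverse (real (Suc n))" if t: "t \<in> {0<..<T}" for n t
  proof -
    let ?r = "(real n + 1) * t / T"
    have r: "real_of_int \<lfloor>?r\<rfloor> \<le> ?r" "?r < real_of_int \<lfloor>?r\<rfloor> + 1" by linarith+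
    have c: "0 < T / (real n + 1)" using T by simp
    have t': "t = ?r * (T / (real n + 1))" using T by simp
    have g': "g n t = real_of_int \<lfloor>?r\<rfloor> * (T / (real n + 1))" by (simp add: g_def)
    have f0: "0 \<le> real_of_int \<lfloor>?r\<rfloor>" using t T by simp
    have le: "g n t \<le> t" using mult_right_mono[OF r(1) less_imp_le[OF c]] g' t' by argo
    have "t \<le> (real_of_int \<lfloor>?r\<rfloor> + 1) * (T / (real n + 1))" using mult_right_mono[OF less_imp_le[OF r(2)] less_imp_le[OF c]] t' by argo
    then have ge: "t \<le> g n t + T / (real n + 1)" unfolding g' by (simp only: distrib_right mult_1)
    have "0 \<le> g n t" unfolding g' using f0 c by (intro mult_nonneg_nonneg) auto
    then show "g n t \<in> {0..T}" using le t by auto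
    have "T / (real n + 1) = T * inverse (real (Suc n))" by (simp add: divide_inverse add.commute)
    then show "\<bar>g n t - t\<bar> \<le> T * inverse (real (Suc n))" using le ge by linarith
  qed
  let ?s = "\<lambda>n t. w (g n t)"
  have fin: "finite (g n ` {0<..<T})" for n
  proof (rule finite_subset)
    show "g n ` {0<..<T} \<subseteq> (\<lambda>k. T * real_of_int k / (real n + 1)) ` {0..int n + 1}"
    proof
      fix p assume "p \<in> g n ` {0<..<T}"
      then obtain t where t: "t \<in> {0<..<T}" "p = g n t" by auto
      have "(real n + 1) * t / T \<le> real n + 1" using t T by (simp add: divide_le_eq)
      then have "\<lfloor>(real n + 1) * t / T\<rfloor> \<in> {0..int n + 1}" using t T by (simp add: floor_le_iff)
      then show "p \<in> (\<lambda>k. T * real_of_int k / (real n + 1)) ` {0..int n + 1}"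
        unfolding t(2) g_def by (rule imageI)
    qed
  qed simp
  have meas: "{t \<in> {0<..<T}. ?s n t = y} \<in> sets lebesgue" for n y
  proof -
    \<comment> \<open>\<open>w\<close> may take the value \<open>y\<close> at several grid points,
      so the set in question is the preimage under \<open>g n\<close> of a finite set.\<close>
    let ?P = "{p \<in> g n ` {0<..<T}. w p = y}"
    have m: "g n \<in> borel_measurable borel" unfolding g_def by measurable
    have "finite ?P" using fin[of n] by simp
    then have "?P \<in> sets borel" by (intro borel_closed finite_imp_closed)
    from measurable_sets[OF m this] have "g n -` ?P \<in> sets borel" by simp
    then have "{0<..<T} \<inter> g n -` ?P \<in> sets borel" by (intro sets.Int) auto
    moreover have "{t \<in> {0<..<T}. ?s n t = y} = {0<..<T} \<inter> g n -` ?P" by auto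
    ultimately show ?thesis by (intro sets_completionI_sets) simp
  qed
  have lim: "(\<lambda>n. N (\<lambda>x. ?s n t x - w t x)) \<longlonglongrightarrow> 0" if t: "t \<in> {0<..<T}" for t
  proof -
    have t': "t \<in> {0..T}" using t by auto
    have "(\<lambda>n. g n t - t) \<longlonglongrightarrow> 0"
    proof (rule Lim_null_comparison)
      show "(\<lambda>n. T * inverse (real (Suc n))) \<longlonglongrightarrow> 0" using tendsto_mult_right_zero[OF LIMSEQ_inverse_real_of_nat, of T] by simp
      show "\<forall>\<^sub>F n in sequentially. norm (g n t - t) \<le> T * inverse (real (Suc n))" using g(2)[OF t] by simp
    qed
    then have gt: "(\<lambda>n. g n t) \<longlonglongrightarrow> t" by (rule LIM_zero_cancel)
    have "((\<lambda>s. N (\<lambda>x. w s x - w t x)) \<longlongrightarrow> 0) (at t within {0..T})" using w t' by (auto simp: time_C0_def)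
    \<comment> \<open>The limit in \<open>time_C0\<close> excludes \<open>s = t\<close>, but a grid
      point may coincide with \<open>t\<close>; \<open>N (\<lambda>x. 0) = 0\<close> supplies the
      value there.\<close>
    then have "continuous (at t within {0..T}) (\<lambda>s. N (\<lambda>x. w s x - w t x))" by (simp add: continuous_within N)
    from continuous_within_tendsto_compose'[OF this _ gt] g(1)[OF t] show ?thesis by (simp add: N)
  qed
  have "(\<forall>n. finite (?s n ` {0<..<T}) \<and> ?s n ` {0<..<T} \<subseteq> X \<and> (\<forall>y. {t \<in> {0<..<T}. ?s n t = y} \<in> sets lebesgue)) \<and>
    (AE t in lebesgue_on {0<..<T}. w t \<in> X \<and> (\<lambda>n. N (\<lambda>x. ?s n t x - w t x)) \<longlonglongrightarrow> 0)"
  proof (intro conjI allI)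
    fix n
    show "finite (?s n ` {0<..<T})" using finite_imageI[OF fin[of n], of w] by (simp add: image_image)
    show "?s n ` {0<..<T} \<subseteq> X"
    proof
      fix v assume "v \<in> ?s n ` {0<..<T}"
      then obtain t where "t \<in> {0<..<T}" "v = ?s n t" by blast
      then show "v \<in> X" using g(1)[of t n] w unfolding time_C0_def by blast
    qed
    show "AE t in lebesgue_on {0<..<T}. w t \<in> X \<and> (\<lambda>n. N (\<lambda>x. ?s n t x - w t x)) \<longlonglongrightarrow> 0"
    proof (rule AE_I2)
      fix t assume "t \<in> space (lebesgue_on {0<..<T})"
      then have t: "t \<in> {0<..<T}" by simp
      then have "t \<in> {0..T}" by auto
      then show "w t \<in> X \<and> (\<lambda>n. N (\<lambda>x. ?s n t x - w t x)) \<longlonglongrightarrow> 0" using w lim[OF t] unfolding time_C0_def by blast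
    qed
  qed (rule meas)
  then show ?thesis unfolding bochner_measurable_def by (intro exI[of _ ?s])
qed

lemma continuous_bounded_above:
  fixes q :: "real \<Rightarrow> real"
  assumes "continuous_on {0..T} q"
  shows "\<exists>c. \<forall>t\<in>{0..T}. q t \<le> c"
proof -
  have "bounded (q ` {0..T})" by (rule compact_imp_bounded[OF compact_continuous_image[OF assms compact_Icc]])
  then obtain c where "\<forall>t\<in>{0..T}. \<bar>q t\<bar> \<le> c" by (auto simp: bounded_iff)
  then show ?thesis by (intro exI[of _ c]) fastforce
qed

lemma time_Linf_time_C0:
  assumes T: "T > 0" and N: "N (\<lambda>x. 0) = 0" and w: "w \<in> time_C0 X N T" and c: "\<exists>c. \<forall>t\<in>{0..T}. N (w t) \<le> c"
  shows "w \<in> time_Linf X N T"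
proof -
  obtain c where "\<forall>t\<in>{0..T}. N (w t) \<le> c" using c by blast
  then have "AE t in lebesgue_on {0<..<T}. N (w t) \<le> c" by (intro AE_I2) auto
  then show ?thesis using bochner_measurable_time_C0[OF T N w] unfolding time_Linf_def by blast
qed

lemma sobolev_norm_nonneg: "0 \<le> sobolev_norm U s v"
  unfolding sobolev_norm_def using frac_lt_1[of s]
  by (intro real_sqrt_ge_zero add_nonneg_nonneg sum_nonneg) (auto intro!: mult_nonneg_nonneg sum_nonneg)

lemma elliptic_regularity_bound:
  assumes "elliptic_regularity \<Omega> \<gamma>"
  shows "\<exists>c\<ge>0. \<forall>w\<in>dom_A \<Omega>. sobolev_norm \<Omega> (2 + \<gamma>) w \<le> c * (L2_norm \<Omega> w + L2_norm \<Omega> (op_A \<Omega> w))"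
proof -
  obtain c where c: "\<forall>w\<in>dom_A \<Omega>. sobolev_norm \<Omega> (2 + \<gamma>) w \<le> c * (L2_norm \<Omega> w + L2_norm \<Omega> (op_A \<Omega> w))"
    using assms unfolding elliptic_regularity_def by blast
  have "sobolev_norm \<Omega> (2 + \<gamma>) w \<le> \<bar>c\<bar> * (L2_norm \<Omega> w + L2_norm \<Omega> (op_A \<Omega> w))" if "w \<in> dom_A \<Omega>" for w
    using c[rule_format, OF that] by (rule order_trans) (intro mult_right_mono add_nonneg_nonneg L2_norm_nonneg abs_ge_self)
  then show ?thesis by (intro exI[of _ "\<bar>c\<bar>"]) auto
qed

text \<open>The norm is built from chosen weak derivatives; its value at zero is read off from the
  elliptic bound instead of from the choices.\<close>

lemma sobolev_norm_zero:
  assumes "open \<Omega>" "elliptic_regularity \<Omega> \<gamma>" "w \<in> dom_A \<Omega>"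
  shows "sobolev_norm \<Omega> (2 + \<gamma>) (\<lambda>x. 0) = 0"
proof -
  have z: "(\<lambda>x. 0) \<in> dom_A \<Omega>" "ae_eq \<Omega> (op_A \<Omega> (\<lambda>x. 0)) (\<lambda>x. 0)" using dom_A_lin[OF assms(1,3,3), of 0 0] by auto
  have n0: "L2_norm \<Omega> (\<lambda>x. 0) = 0" by (simp add: L2_norm_def L2_inner_def)
  then have "L2_norm \<Omega> (op_A \<Omega> (\<lambda>x. 0)) = 0" using L2_norm_ae[OF open_sets_lebesgue[OF assms(1)] z(2)] by simp
  then show ?thesis using elliptic_regularity_bound[OF assms(2)] z(1) n0 sobolev_norm_nonneg[of \<Omega> "2 + \<gamma>" "\<lambda>x. 0"] by fastforce
qed

text \<open>Elliptic regularity is applied to differences in time: their image under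
  \<open>A\<close> is a difference of \<open>F - G\<close>, so L2 continuity of three functions
  gives continuity in the higher Sobolev norm.\<close>

lemma elliptic_regularity_time_C0:
  assumes op: "open \<Omega>" and er: "elliptic_regularity \<Omega> \<gamma>"
    and w: "\<And>t. t \<in> {0..T} \<Longrightarrow> w t \<in> dom_A \<Omega>" "\<And>t. t \<in> {0..T} \<Longrightarrow> ae_eq \<Omega> (op_A \<Omega> (w t)) (\<lambda>x. F t x - G t x)"
    and C: "w \<in> time_C0 (L2_space \<Omega>) (L2_norm \<Omega>) T" "F \<in> time_C0 (L2_space \<Omega>) (L2_norm \<Omega>) T" "G \<in> time_C0 (L2_space \<Omega>) (L2_norm \<Omega>) T"
  shows "w \<in> time_C0 (sobolev_space \<Omega> (2 + \<gamma>)) (sobolev_norm \<Omega> (2 + \<gamma>)) T"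
    "\<exists>c. \<forall>t\<in>{0..T}. sobolev_norm \<Omega> (2 + \<gamma>) (w t) \<le> c"
proof -
  let ?N = "sobolev_norm \<Omega> (2 + \<gamma>)" and ?n = "L2_norm \<Omega>"
  note leb = open_sets_lebesgue[OF op]
  obtain c where c: "c \<ge> 0" "\<forall>w\<in>dom_A \<Omega>. ?N w \<le> c * (?n w + ?n (op_A \<Omega> w))" using elliptic_regularity_bound[OF er] by blast
  have L: "w t \<in> L2_space \<Omega>" "F t \<in> L2_space \<Omega>" "G t \<in> L2_space \<Omega>" if "t \<in> {0..T}" for t using C that by (auto simp: time_C0_def)
  have d: "?N (\<lambda>x. w s x - w t x) \<le> c * (?n (\<lambda>x. w s x - w t x) + (?n (\<lambda>x. F s x - F t x) + ?n (\<lambda>x. G s x - G t x)))"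
    if s: "s \<in> {0..T}" and t: "t \<in> {0..T}" for s t
  proof -
    let ?d = "\<lambda>x. w s x - w t x"
    have dA: "?d \<in> dom_A \<Omega>" and dE: "ae_eq \<Omega> (op_A \<Omega> ?d) (\<lambda>x. op_A \<Omega> (w s) x - op_A \<Omega> (w t) x)"
      using dom_A_lin[OF op w(1)[OF s] w(1)[OF t], of 1 "-1"] by auto
    have "ae_eq \<Omega> (op_A \<Omega> ?d) (\<lambda>x. (F s x - G s x) - (F t x - G t x))"
      by (rule ae_eq_trans[OF dE ae_eq_diff[OF w(2)[OF s] w(2)[OF t]]])
    then have "?n (op_A \<Omega> ?d) = ?n (\<lambda>x. (F s x - G s x) - (F t x - G t x))" by (rule L2_norm_ae[OF leb])
    also have "\<dots> = ?n (\<lambda>x. (F s x - F t x) - (G s x - G t x))" by (simp add: algebra_simps)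
    also have "\<dots> \<le> ?n (\<lambda>x. F s x - F t x) + ?n (\<lambda>x. G s x - G t x)"
      by (intro L2.nm_diff_triangle L2.diff_mem L s t)
    finally have "?n ?d + ?n (op_A \<Omega> ?d) \<le> ?n ?d + (?n (\<lambda>x. F s x - F t x) + ?n (\<lambda>x. G s x - G t x))" by simp
    from mult_left_mono[OF this c(1)] c(2)[rule_format, OF dA] show ?thesis by (rule order_trans[rotated])
  qed
  show "w \<in> time_C0 (sobolev_space \<Omega> (2 + \<gamma>)) ?N T" unfolding time_C0_def
  proof (intro CollectI ballI conjI)
    fix t assume t: "t \<in> {0..T}"
    show "w t \<in> sobolev_space \<Omega> (2 + \<gamma>)" using er w(1)[OF t] unfolding elliptic_regularity_def by blast
    have "((\<lambda>s. c * (?n (\<lambda>x. w s x - w t x) + (?n (\<lambda>x. F s x - F t x) + ?n (\<lambda>x. G s x - G t x)))) \<longlongrightarrow> c * (0 + (0 + 0))) (at t within {0..T})"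
      using C t by (intro tendsto_intros) (auto simp: time_C0_def)
    then have lim: "((\<lambda>s. c * (?n (\<lambda>x. w s x - w t x) + (?n (\<lambda>x. F s x - F t x) + ?n (\<lambda>x. G s x - G t x)))) \<longlongrightarrow> 0) (at t within {0..T})" by simp
    show "((\<lambda>s. ?N (\<lambda>x. w s x - w t x)) \<longlongrightarrow> 0) (at t within {0..T})"
    proof (rule Lim_null_comparison[OF _ lim])
      show "eventually (\<lambda>s. norm (?N (\<lambda>x. w s x - w t x)) \<le> c * (?n (\<lambda>x. w s x - w t x) + (?n (\<lambda>x. F s x - F t x) + ?n (\<lambda>x. G s x - G t x)))) (at t within {0..T})"
        using d[OF _ t] by (auto simp: eventually_at_filter abs_of_nonneg[OF sobolev_norm_nonneg])
    qed
  qed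
  have "continuous_on {0..T} (\<lambda>t. c * (?n (w t) + (?n (F t) + ?n (G t))))"
    by (intro continuous_intros time_C0_norm_continuous C)
  from continuous_bounded_above[OF this] obtain b where b: "\<forall>t\<in>{0..T}. c * (?n (w t) + (?n (F t) + ?n (G t))) \<le> b" by blast
  have "?N (w t) \<le> b" if t: "t \<in> {0..T}" for t
  proof -
    have "?n (op_A \<Omega> (w t)) \<le> ?n (F t) + ?n (G t)"
      using L2_norm_ae[OF leb w(2)[OF t]] L2.nm_diff_triangle[OF L(2)[OF t] L(3)[OF t]] by simp
    then have "c * (?n (w t) + ?n (op_A \<Omega> (w t))) \<le> c * (?n (w t) + (?n (F t) + ?n (G t)))" using c(1) by (intro mult_left_mono) auto
    then show ?thesis using c(2)[rule_format, OF w(1)[OF t]] b[rule_format, OF t] by linarith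
  qed
  then show "\<exists>c. \<forall>t\<in>{0..T}. ?N (w t) \<le> c" by blast
qed

text \<open>Keeps the infimum in \<open>time_Linf_norm\<close> away from the empty set, where it
  would be meaningless.\<close>

lemma essential_bounds_nonempty:
  fixes T :: real
  assumes "\<exists>c. \<forall>t\<in>{0..T}. N (w t) \<le> c"
  shows "{c. (0 :: real) \<le> c \<and> (AE t in lebesgue_on {0<..<T}. N (w t) \<le> c)} \<noteq> {}"
proof -
  obtain c where "\<forall>t\<in>{0..T}. N (w t) \<le> c" using assms by blast
  then have "AE t in lebesgue_on {0<..<T}. N (w t) \<le> max c 0" by (intro AE_I2) (auto simp: le_max_iff_disj)
  then have "max c 0 \<in> {c. 0 \<le> c \<and> (AE t in lebesgue_on {0<..<T}. N (w t) \<le> c)}" by simp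
  then show ?thesis by blast
qed

lemma time_Linf_norm_nonneg:
  assumes "\<exists>c. \<forall>t\<in>{0..T}. N (w t) \<le> c"
  shows "0 \<le> time_Linf_norm N T w"
  unfolding time_Linf_norm_def by (rule cInf_greatest[OF essential_bounds_nonempty[of T N w, OF assms]]) auto

text \<open>A continuous function bounded almost everywhere is bounded everywhere, also at the
  endpoints. The continuous minorant \<open>q\<close> is what the error estimate compares with;
  \<open>N (w t)\<close> itself is only assumed bounded.\<close>

lemma le_time_Linf_norm:
  assumes T: "T > 0" and q: "continuous_on {0..T} q" "\<And>t. t \<in> {0..T} \<Longrightarrow> q t \<le> N (w t)"
    and b: "\<exists>c. \<forall>t\<in>{0..T}. N (w t) \<le> c" and t: "t \<in> {0..T}"
  shows "q t \<le> time_Linf_norm N T w"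
  unfolding time_Linf_norm_def
proof (rule cInf_greatest[OF essential_bounds_nonempty[of T N w, OF b]])
  fix c assume "c \<in> {c. 0 \<le> c \<and> (AE t in lebesgue_on {0<..<T}. N (w t) \<le> c)}"
  then have ae: "AE t in lebesgue_on {0<..<T}. N (w t) \<le> c" by simp
  have "ae_eq {0<..<T} (\<lambda>s. max (q s - c) 0) (\<lambda>s. 0)" unfolding ae_eq_def
    using ae AE_space
  proof eventually_elim
    case (elim s)
    then have "q s \<le> N (w s)" by (intro q(2)) auto
    then show ?case using elim by simp
  qed
  moreover have "continuous_on {0<..<T} (\<lambda>s. max (q s - c) 0)"
    by (intro continuous_intros continuous_on_subset[OF q(1)]) auto
  ultimately have "max (q s - c) 0 = 0" if "s \<in> {0<..<T}" for s using that by (intro ae_zero_continuous[of "{0<..<T}"]) auto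
  then have le: "q s \<le> c" if "s \<in> {0<..<T}" for s using that by fastforce
  have cl: "closure {0<..<T} = {0..T}" using T by simp
  show "q t \<le> c" by (rule continuous_le_on_closure[of "{0<..<T}" q t c]) (use q(1) t le in \<open>simp_all add: cl\<close>)
qed

text \<open>Cauchy-Schwarz against the constant 1, which has norm \<open>sqrt T\<close>. The
  integral of \<open>N (w t)\<close> is compared by monotonicity alone, and finiteness matters
  because \<open>enn2real\<close> sends infinity to 0.\<close>

lemma integral_le_time_L2_norm:
  assumes T: "T > 0" and q: "continuous_on {0..T} q" "\<And>t. t \<in> {0..T} \<Longrightarrow> 0 \<le> q t" "\<And>t. t \<in> {0..T} \<Longrightarrow> q t \<le> N (w t)"
    and fin: "(\<integral>\<^sup>+t. ennreal ((N (w t))\<^sup>2) \<partial>lebesgue_on {0<..<T}) < \<infinity>"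
  shows "integral {0..T} q \<le> sqrt T * time_L2_norm N T w"
proof -
  have q2: "continuous_on {0..T} (\<lambda>t. (q t)\<^sup>2)" by (intro continuous_intros q)
  note i = integral_open_closed[OF continuous_integrable_lebesgue_on[OF q(1)]]
  have qL: "q \<in> L2_space {0<..<T}" unfolding L2_space_def
    using i(1) integral_open_closed(1)[OF continuous_integrable_lebesgue_on[OF q2]] by auto
  have oL: "(\<lambda>t. 1) \<in> L2_space {0<..<T}" by (rule one_L2) simp
  have "L2_inner {0<..<T} q (\<lambda>t. 1) \<le> L2_norm {0<..<T} q * L2_norm {0<..<T} (\<lambda>t. 1)"
    using L2.cauchy_schwarz[OF qL oL] by linarith
  moreover have "L2_inner {0<..<T} q (\<lambda>t. 1) = integral {0..T} q" using i(2) by (simp add: L2_inner_def)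
  moreover have "L2_norm {0<..<T} (\<lambda>t. 1) = sqrt T" using T by (simp add: L2_norm_def L2_inner_def measure_restrict_space)
  moreover have "L2_norm {0<..<T} q \<le> time_L2_norm N T w"
  proof -
    have "ennreal ((L2_norm {0<..<T} q)\<^sup>2) \<le> (\<integral>\<^sup>+t. ennreal ((N (w t))\<^sup>2) \<partial>lebesgue_on {0<..<T})"
      unfolding nn_integral_L2[OF qL, symmetric]
      by (rule nn_integral_mono) (use q(2,3) in \<open>auto intro!: ennreal_leI power_mono\<close>)
    then have "enn2real (ennreal ((L2_norm {0<..<T} q)\<^sup>2)) \<le> enn2real (\<integral>\<^sup>+t. ennreal ((N (w t))\<^sup>2) \<partial>lebesgue_on {0<..<T})"
      by (rule enn2real_mono) (use fin in simp)
    then show ?thesis unfolding time_L2_norm_def by (intro real_le_rsqrt) simp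
  qed
  moreover from this have "L2_norm {0<..<T} q * sqrt T \<le> time_L2_norm N T w * sqrt T" using T by (intro mult_right_mono) auto
  ultimately show ?thesis by (simp add: mult.commute)
qed

lemma bounded_time_L2_finite:
  fixes T :: real
  assumes c: "\<exists>c. \<forall>t\<in>{0..T}. N (w t) \<le> c" and N: "\<And>v. 0 \<le> N v"
  shows "(\<integral>\<^sup>+t. ennreal ((N (w t))\<^sup>2) \<partial>lebesgue_on {0<..<T}) < \<infinity>"
proof -
  obtain c where c: "\<forall>t\<in>{0..T}. N (w t) \<le> c" using c by blast
  have "(\<integral>\<^sup>+t. ennreal ((N (w t))\<^sup>2) \<partial>lebesgue_on {0<..<T}) \<le> (\<integral>\<^sup>+t. ennreal (c\<^sup>2) \<partial>lebesgue_on {0<..<T})"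
  proof (rule nn_integral_mono)
    fix t assume "t \<in> space (lebesgue_on {0<..<T})"
    then have "t \<in> {0..T}" by auto
    then show "ennreal ((N (w t))\<^sup>2) \<le> ennreal (c\<^sup>2)" using c N by (intro ennreal_leI power_mono) auto
  qed
  also have "\<dots> < \<infinity>"
    using fmeasurableD2[of "{0<..<T}" lebesgue] by (simp add: emeasure_restrict_space ennreal_mult_less_top less_top)
  finally show ?thesis .
qed

section \<open>Mesh size and the final error bound\<close>

lemma mesh_size_bounds:
  assumes ct: "conforming_triangulation \<Omega> \<T>" and \<Omega>: "bounded \<Omega>" "\<Omega> \<noteq> {}"
  shows "0 < mesh_size \<T>" "mesh_size \<T> \<le> diameter (closure \<Omega>)"
proof -
  have fin: "finite \<T>" and c3: "\<And>t. t \<in> \<T> \<Longrightarrow> card t = 3" and un: "(\<Union>t\<in>\<T>. convex hull t) = closure \<Omega>"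
    using ct by (auto simp: conforming_triangulation_def)
  have bc: "bounded (closure \<Omega>)" by (rule bounded_closure[OF \<Omega>(1)])
  have sub: "convex hull t \<subseteq> closure \<Omega>" if "t \<in> \<T>" for t using un that by blast
  have ne: "\<T> \<noteq> {}" using un \<Omega>(2) closure_subset[of \<Omega>] by auto
  then obtain t where t: "t \<in> \<T>" by blast
  obtain p r where pr: "p \<in> t" "r \<in> t" "p \<noteq> r"
    using c3[OF t] by (metis card_3_iff insertCI)
  have "0 < dist p r" using pr by simp
  also have "\<dots> \<le> diameter (convex hull t)"
    using pr by (intro diameter_bounded_bound bounded_subset[OF bc sub[OF t]] hull_inc)
  also have "\<dots> \<le> mesh_size \<T>" unfolding mesh_size_def using t fin by (intro Max_ge) auto
  finally show "0 < mesh_size \<T>" .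
  show "mesh_size \<T> \<le> diameter (closure \<Omega>)" unfolding mesh_size_def
    using ne fin by (intro Max.boundedI) (auto intro!: diameter_subset sub bc)
qed

theorem theorem2p8:
  fixes \<Omega> :: "(real^2) set" and T \<gamma>\<^sub>0 \<alpha> \<beta> C1 C2 :: real
    and ev :: "nat \<Rightarrow> real" and \<psi> :: "nat \<Rightarrow> real^2 \<Rightarrow> real"
  assumes "polygonal_lipschitz_domain \<Omega>" and "T > 0"
    and "1 / 2 < \<gamma>\<^sub>0" and "\<gamma>\<^sub>0 \<le> 1" and "elliptic_regularity \<Omega> \<gamma>\<^sub>0"
    and "eigenbasis_A \<Omega> ev \<psi>"
    and "\<alpha> > 0" and "\<beta> > 0" and "C1 > 0" and "C2 > 0"
  shows "\<exists>C>0. \<forall>\<kappa> \<T> V\<^sub>h a\<^sub>h I\<^sub>M J R\<^sub>h u0 v0 f f_t f_tt f_ttt u u_t u\<^sub>h.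
      conforming_triangulation \<Omega> \<T> \<longrightarrow> shape_regular \<kappa> \<T> \<longrightarrow>
      fin_dim_space V\<^sub>h \<longrightarrow> V\<^sub>h \<subseteq> pw_sobolev_space \<T> 2 \<longrightarrow>
      discrete_form \<Omega> \<T> \<alpha> \<beta> V\<^sub>h a\<^sub>h \<longrightarrow>
      morley_interpolation \<Omega> \<T> I\<^sub>M \<longrightarrow> companion \<Omega> \<T> J \<longrightarrow>
      smoother_estimate \<Omega> \<T> C1 V\<^sub>h (J \<circ> I\<^sub>M) \<longrightarrow>
      ritz_projection \<Omega> V\<^sub>h a\<^sub>h (J \<circ> I\<^sub>M) R\<^sub>h \<longrightarrow> ritz_estimate \<Omega> \<T> \<gamma>\<^sub>0 C2 R\<^sub>h \<longrightarrow>
      smooth_data \<Omega> T ev \<psi> u0 v0 f f_t f_tt f_ttt \<longrightarrow>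
      weak_solution \<Omega> T f u0 v0 u u_t \<longrightarrow>
      semidiscrete_solution \<Omega> T V\<^sub>h a\<^sub>h f (R\<^sub>h u0) (R\<^sub>h v0) u\<^sub>h \<longrightarrow>
      (\<exists>u_tt u_ttt u_tttt.
         has_weak_time_deriv \<Omega> T u_t u_tt \<and> has_weak_time_deriv \<Omega> T u_tt u_ttt \<and>
         has_weak_time_deriv \<Omega> T u_ttt u_tttt \<and>
         {u, u_t, u_tt}
           \<subseteq> time_Linf (sobolev_space \<Omega> (2 + \<gamma>\<^sub>0)) (sobolev_norm \<Omega> (2 + \<gamma>\<^sub>0)) T \<and>
         {u_tt, u_ttt, u_tttt} \<subseteq> time_Linf (L2_space \<Omega>) (L2_norm \<Omega>) T \<and>
         (\<forall>t\<in>{0<..T}.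
            L2_norm \<Omega> (\<lambda>x. u t x - u\<^sub>h t x)
              \<le> C * mesh_size \<T> powr (2 * \<gamma>\<^sub>0) * L_fu \<Omega> T \<gamma>\<^sub>0 f f_t u u_t u_tt u_ttt))"
proof -
  have op: "open \<Omega>" and bd: "bounded \<Omega>" and ne: "\<Omega> \<noteq> {}" and fr: "negligible (frontier \<Omega>)"
    using assms(1) polygonal_frontier_negligible[OF assms(1)] by (auto simp: polygonal_lipschitz_domain_def)
  note leb = open_sets_lebesgue[OF op] and T = assms(2)
  interpret eigen_plate \<Omega> ev \<psi> by unfold_locales (rule op bd assms(6))+
  \<comment> \<open>Since \<open>2 - 2 * \<gamma>\<^sub>0\<close> is nonnegative and the mesh size
    is at most the diameter, \<open>D\<close> bounds the surplus factor between the squared mesh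
    size and its power \<open>2 * \<gamma>\<^sub>0\<close>.\<close>
  define D where "D = (1 + diameter (closure \<Omega>)) powr (2 - 2 * \<gamma>\<^sub>0)"
  define \<kappa>' where "\<kappa>' = C1 * D / sqrt \<alpha>"
  \<comment> \<open>The summands come in turn from \<open>u - R u\<close>, the boundary term of the
    integration by parts, and the two parts of the time integral: the Ritz error of
    \<open>u_tt\<close> and the consistency term. \<open>sqrt T\<close> is the cost of passing from
    L1 to L2 in time.\<close>
  define C where "C = C2 + 2 * T * \<kappa>' + 2 * T * sqrt T * C2 + 2 * T * sqrt T * \<kappa>'"
  have dpos: "0 \<le> diameter (closure \<Omega>)" by (rule diameter_ge_0[OF bounded_closure[OF bd]])
  have \<kappa>'0: "0 \<le> \<kappa>'" unfolding \<kappa>'_def D_def using assms(7,9) by simp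
  have C0: "C > 0" unfolding C_def using assms(10) \<kappa>'0 T by (intro add_pos_nonneg) auto
  let ?S = "sobolev_norm \<Omega> (2 + \<gamma>\<^sub>0)" and ?n = "L2_norm \<Omega>"
  show ?thesis
  proof (intro exI[of _ C] conjI C0 allI impI)
    fix \<kappa> \<T> V\<^sub>h a\<^sub>h I\<^sub>M J R\<^sub>h u0 v0 f f_t f_tt f_ttt u u_t u\<^sub>h
    assume ct: "conforming_triangulation \<Omega> \<T>" and "shape_regular \<kappa> \<T>" and fd: "fin_dim_space V\<^sub>h" and Vpw: "V\<^sub>h \<subseteq> pw_sobolev_space \<T> 2"
      and df: "discrete_form \<Omega> \<T> \<alpha> \<beta> V\<^sub>h a\<^sub>h" and IM: "morley_interpolation \<Omega> \<T> I\<^sub>M" and J: "companion \<Omega> \<T> J"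
      and sm: "smoother_estimate \<Omega> \<T> C1 V\<^sub>h (J \<circ> I\<^sub>M)" and rp: "ritz_projection \<Omega> V\<^sub>h a\<^sub>h (J \<circ> I\<^sub>M) R\<^sub>h"
      and re: "ritz_estimate \<Omega> \<T> \<gamma>\<^sub>0 C2 R\<^sub>h" and data: "smooth_data \<Omega> T ev \<psi> u0 v0 f f_t f_tt f_ttt"
      and sol: "weak_solution \<Omega> T f u0 v0 u u_t" and sd: "semidiscrete_solution \<Omega> T V\<^sub>h a\<^sub>h f (R\<^sub>h u0) (R\<^sub>h v0) u\<^sub>h"
    \<comment> \<open>The interpolation lands in the Morley space, and the companion maps that space
      into the clamped functions.\<close>
    have QH: "(J \<circ> I\<^sub>M) v \<in> H20 \<Omega>" if "v \<in> V\<^sub>h" for v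
      using IM J Vpw that unfolding morley_interpolation_def companion_def comp_def by blast
    interpret plate_fem \<Omega> \<T> \<alpha> \<beta> C1 V\<^sub>h a\<^sub>h "J \<circ> I\<^sub>M" R\<^sub>h
      by unfold_locales (rule op bd fr ct fd Vpw df QH sm rp assms(7) assms(9) | assumption)+
    have fC: "f \<in> time_C0 (L2_space \<Omega>) ?n T" "f_t \<in> time_C0 (L2_space \<Omega>) ?n T" "f_tt \<in> time_C0 (L2_space \<Omega>) ?n T"
      and f1L: "f_t \<in> time_L2 (L2_space \<Omega>) ?n T"
      and fw: "has_weak_time_deriv \<Omega> T f f_t" "has_weak_time_deriv \<Omega> T f_t f_tt"
      using data by (auto simp: smooth_data_def)
    have init: "ae_eq \<Omega> (u 0) u0" "ae_eq \<Omega> (u_t 0) v0" using sol by (auto simp: weak_solution_def)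
    obtain u2 u3 u4 where reg: "\<forall>t\<in>{0..T}. u t \<in> dom_A \<Omega> \<and> u_t t \<in> dom_A \<Omega> \<and> u2 t \<in> dom_A \<Omega> \<and> u3 t \<in> L2_space \<Omega> \<and> u4 t \<in> L2_space \<Omega> \<and>
       ae_eq \<Omega> (op_A \<Omega> (u t)) (\<lambda>x. f t x - u2 t x) \<and> ae_eq \<Omega> (op_A \<Omega> (u_t t)) (\<lambda>x. f_t t x - u3 t x) \<and>
       ae_eq \<Omega> (op_A \<Omega> (u2 t)) (\<lambda>x. f_tt t x - u4 t x)"
      and uC': "{u, u_t, u2, u3, u4} \<subseteq> time_C0 (L2_space \<Omega>) ?n T"
      and du: "\<forall>v\<in>L2_space \<Omega>. \<forall>t\<in>{0..T}.
       ((\<lambda>t. L2_inner \<Omega> (u t) v) has_real_derivative L2_inner \<Omega> (u_t t) v) (at t within {0..T}) \<and>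
       ((\<lambda>t. L2_inner \<Omega> (u_t t) v) has_real_derivative L2_inner \<Omega> (u2 t) v) (at t within {0..T}) \<and>
       ((\<lambda>t. L2_inner \<Omega> (u2 t) v) has_real_derivative L2_inner \<Omega> (u3 t) v) (at t within {0..T}) \<and>
       ((\<lambda>t. L2_inner \<Omega> (u3 t) v) has_real_derivative L2_inner \<Omega> (u4 t) v) (at t within {0..T})"
      using regularity[OF T data sol] by (elim exE conjE) (erule (2) that)
    have uC: "u \<in> time_C0 (L2_space \<Omega>) ?n T" "u_t \<in> time_C0 (L2_space \<Omega>) ?n T" "u2 \<in> time_C0 (L2_space \<Omega>) ?n T"
      "u3 \<in> time_C0 (L2_space \<Omega>) ?n T" "u4 \<in> time_C0 (L2_space \<Omega>) ?n T" using uC' by auto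
    have dA: "u t \<in> dom_A \<Omega>" "u_t t \<in> dom_A \<Omega>" "u2 t \<in> dom_A \<Omega>"
      and opA: "ae_eq \<Omega> (op_A \<Omega> (u t)) (\<lambda>x. f t x - u2 t x)" "ae_eq \<Omega> (op_A \<Omega> (u_t t)) (\<lambda>x. f_t t x - u3 t x)"
        "ae_eq \<Omega> (op_A \<Omega> (u2 t)) (\<lambda>x. f_tt t x - u4 t x)" if "t \<in> {0..T}" for t using bspec[OF reg that] by simp_all
    have L: "f t \<in> L2_space \<Omega>" "f_t t \<in> L2_space \<Omega>" "u t \<in> L2_space \<Omega>" "u2 t \<in> L2_space \<Omega>" "u3 t \<in> L2_space \<Omega>" if "t \<in> {0..T}" for t
      using fC uC that by (auto simp: time_C0_def)
    have d: "((\<lambda>t. L2_inner \<Omega> (u_t t) v) has_real_derivative L2_inner \<Omega> (u2 t) v) (at t within {0..T})"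
      "((\<lambda>t. L2_inner \<Omega> (u2 t) v) has_real_derivative L2_inner \<Omega> (u3 t) v) (at t within {0..T})"
      "((\<lambda>t. L2_inner \<Omega> (u3 t) v) has_real_derivative L2_inner \<Omega> (u4 t) v) (at t within {0..T})"
      if "t \<in> {0..T}" "v \<in> L2_space \<Omega>" for t v using bspec[OF bspec[OF du that(2)] that(1)] by simp_all
    have fd: "((\<lambda>t. L2_inner \<Omega> (f t) v) has_real_derivative L2_inner \<Omega> (f_t t) v) (at t within {0..T})"
      "((\<lambda>t. L2_inner \<Omega> (f_t t) v) has_real_derivative L2_inner \<Omega> (f_tt t) v) (at t within {0..T})"
      if "t \<in> {0..T}" "v \<in> L2_space \<Omega>" for t v
    proof -
      have w: "has_scalar_weak_time_deriv T (\<lambda>t. L2_inner \<Omega> (f t) v) (\<lambda>t. L2_inner \<Omega> (f_t t) v)"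
        "has_scalar_weak_time_deriv T (\<lambda>t. L2_inner \<Omega> (f_t t) v) (\<lambda>t. L2_inner \<Omega> (f_tt t) v)"
        using fw that(2) unfolding has_weak_time_deriv_def by blast+
      note c = time_C0_inner_continuous[OF fC(1) that(2)] time_C0_inner_continuous[OF fC(2) that(2)] time_C0_inner_continuous[OF fC(3) that(2)]
      show "((\<lambda>t. L2_inner \<Omega> (f t) v) has_real_derivative L2_inner \<Omega> (f_t t) v) (at t within {0..T})"
        by (rule weak_time_deriv_classical[OF T c(1) w(1) c(2) that(1)])
      show "((\<lambda>t. L2_inner \<Omega> (f_t t) v) has_real_derivative L2_inner \<Omega> (f_tt t) v) (at t within {0..T})"
        by (rule weak_time_deriv_classical[OF T c(2) w(2) c(3) that(1)])
    qed
    have wd: "has_weak_time_deriv \<Omega> T u_t u2" "has_weak_time_deriv \<Omega> T u2 u3" "has_weak_time_deriv \<Omega> T u3 u4"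
      unfolding has_weak_time_deriv_def
      by (intro ballI classical_imp_weak_time_deriv[OF T] d time_C0_inner_continuous uC; assumption)+
    have eq: "plate_form \<Omega> w z = L2_inner \<Omega> g z" if "w \<in> dom_A \<Omega>" "ae_eq \<Omega> (op_A \<Omega> w) g" "z \<in> H20 \<Omega>" for w g z
      using plate_form_dom_A[OF op that(1,3)] L2_inner_ae[OF leb that(2)] by simp
    have sz: "?S (\<lambda>x. 0) = 0" by (rule sobolev_norm_zero[OF op assms(5) dA(1)[of 0]]) (use T in simp)
    have nz: "?n (\<lambda>x. 0) = 0" by (simp add: L2_norm_def L2_inner_def)
    note Su = elliptic_regularity_time_C0[OF op assms(5) dA(1) opA(1) uC(1) fC(1) uC(3)]
      and Su1 = elliptic_regularity_time_C0[OF op assms(5) dA(2) opA(2) uC(2) fC(2) uC(4)]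
      and Su2 = elliptic_regularity_time_C0[OF op assms(5) dA(3) opA(3) uC(3) fC(3) uC(5)]
    note nb = continuous_bounded_above[OF time_C0_norm_continuous]
    have inf: "{u, u_t, u2} \<subseteq> time_Linf (sobolev_space \<Omega> (2 + \<gamma>\<^sub>0)) ?S T" "{u2, u3, u4} \<subseteq> time_Linf (L2_space \<Omega>) ?n T"
      using time_Linf_time_C0[OF T sz Su] time_Linf_time_C0[OF T sz Su1] time_Linf_time_C0[OF T sz Su2]
        time_Linf_time_C0[OF T nz uC(3) nb[OF uC(3)]] time_Linf_time_C0[OF T nz uC(4) nb[OF uC(4)]] time_Linf_time_C0[OF T nz uC(5) nb[OF uC(5)]]
      by simp_all
    define h where "h = mesh_size \<T>"
    have h: "0 < h" "h \<le> diameter (closure \<Omega>)" unfolding h_def by (rule mesh_size_bounds[OF ct bd ne])+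
    define H where "H = h powr (2 * \<gamma>\<^sub>0)"
    have H0: "0 < H" unfolding H_def using h by simp
    have hD: "h powr 2 \<le> H * D"
    proof -
      have "h powr 2 = H * h powr (2 - 2 * \<gamma>\<^sub>0)" unfolding H_def powr_add[symmetric] by simp
      also have "h powr (2 - 2 * \<gamma>\<^sub>0) \<le> D" unfolding D_def using h assms(4) by (intro powr_mono2) auto
      finally show ?thesis using H0 by simp
    qed
    define k where "k = C1 * mesh_size \<T> powr 2 / sqrt \<alpha>"
    have k: "0 \<le> k" "k \<le> H * \<kappa>'"
    proof -
      show "0 \<le> k" unfolding k_def using assms(7,9) by simp
      have "C1 * h powr 2 / sqrt \<alpha> \<le> C1 * (H * D) / sqrt \<alpha>" using hD assms(7,9) by (intro divide_right_mono mult_left_mono) auto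
      then show "k \<le> H * \<kappa>'" unfolding k_def \<kappa>'_def h_def by (simp add: mult.left_commute)
    qed
    \<comment> \<open>The mesh-norm part of the Ritz estimate is nonnegative and is dropped;
      membership in the domain of \<open>A\<close> supplies the Sobolev regularity.\<close>
    have ritz: "?n (\<lambda>x. R\<^sub>h v x - v x) \<le> C2 * H * ?S v" if "v \<in> dom_A \<Omega>" for v
    proof -
      have "v \<in> H20 \<Omega> \<inter> sobolev_space \<Omega> (2 + \<gamma>\<^sub>0)" using that dom_A_H20 assms(5) unfolding elliptic_regularity_def by blast
      from re[unfolded ritz_estimate_def, rule_format, OF this]
      have "?n (\<lambda>x. v x - R\<^sub>h v x) + h powr \<gamma>\<^sub>0 * h_norm \<T> (\<lambda>x. v x - R\<^sub>h v x) \<le> C2 * H * ?S v" unfolding H_def h_def .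
      moreover have "0 \<le> h powr \<gamma>\<^sub>0 * h_norm \<T> (\<lambda>x. v x - R\<^sub>h v x)" by (intro mult_nonneg_nonneg h_norm_nonneg) simp
      ultimately show ?thesis by (subst L2_norm_minus_commute) linarith
    qed
    let ?a1 = "time_Linf_norm ?n T f" and ?a2 = "time_L2_norm ?n T f_t" and ?a3 = "time_Linf_norm ?S T u" and ?a4 = "time_Linf_norm ?S T u_t"
      and ?a5 = "time_Linf_norm ?n T u2" and ?a6 = "time_L2_norm ?S T u2" and ?a7 = "time_L2_norm ?n T u3"
    have a0: "0 \<le> ?a1" "0 \<le> ?a3" "0 \<le> ?a4" "0 \<le> ?a5" "0 \<le> ?a2" "0 \<le> ?a6" "0 \<le> ?a7"
      using time_Linf_norm_nonneg[where N = ?n, OF nb[OF fC(1)]] time_Linf_norm_nonneg[where N = ?S, OF Su(2)] time_Linf_norm_nonneg[where N = ?S, OF Su1(2)]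
        time_Linf_norm_nonneg[where N = ?n, OF nb[OF uC(3)]] by (auto simp: time_L2_norm_def)
    have K: "k * ?n (\<lambda>x. f t x - u2 t x) \<le> k * (?a1 + ?a5)" if t: "t \<in> {0..T}" for t
    proof -
      have "?n (f t) \<le> ?a1" by (rule le_time_Linf_norm[where N = ?n, OF T time_C0_norm_continuous[OF fC(1)] order_refl nb[OF fC(1)] t])
      moreover have "?n (u2 t) \<le> ?a5" by (rule le_time_Linf_norm[where N = ?n, OF T time_C0_norm_continuous[OF uC(3)] order_refl nb[OF uC(3)] t])
      ultimately show ?thesis using L2.nm_diff_triangle[OF L(1)[OF t] L(4)[OF t]] k(1) by (intro mult_left_mono) auto
    qed
    \<comment> \<open>The premises of \<open>error_estimate\<close> in its order, with
      \<open>K\<close> taken as \<open>k\<close> times the two essential suprema that bound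
      \<open>f - u_tt\<close>.\<close>
    note pre = T k_def dom_A_H20[OF dA(1)] dom_A_H20[OF dA(2)] dom_A_H20[OF dA(3)] fC uC(3) uC(4) uC(5)
        eq[OF dA(1) opA(1)] eq[OF dA(2) opA(2)] eq[OF dA(3) opA(3)] fd(1) fd(2) d(2) d(3) sd init K
    let ?\<rho> = "\<lambda>t. ?n (\<lambda>x. R\<^sub>h (u2 t) x - u2 t x)" and ?g = "\<lambda>t. ?n (\<lambda>x. f_t t x - u3 t x)"
    have 0: "0 \<in> {0..T}" using T by simp
    have \<rho>c: "continuous_on {0..T} ?\<rho>" by (rule error_estimate(3)[OF pre 0])
    have gc: "continuous_on {0..T} ?g" by (rule error_estimate(4)[OF pre 0])
    have uc: "continuous_on {0..T} (\<lambda>t. ?n (\<lambda>x. R\<^sub>h (u t) x - u t x))" by (rule error_estimate(5)[OF pre 0 uC(1)])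
    have c2: "0 < C2 * H" using assms(10) H0 by simp
    have I\<rho>: "integral {0..T} ?\<rho> \<le> C2 * H * (sqrt T * ?a6)"
    proof -
      \<comment> \<open>Division by \<open>C2 * H\<close> turns the Ritz error into a continuous
        minorant of the Sobolev norm of \<open>u_tt\<close>.\<close>
      have "integral {0..T} (\<lambda>t. ?\<rho> t / (C2 * H)) \<le> sqrt T * ?a6"
      proof (rule integral_le_time_L2_norm[OF T])
        show "continuous_on {0..T} (\<lambda>t. ?\<rho> t / (C2 * H))" using c2 by (intro continuous_intros \<rho>c) auto
        show "0 \<le> ?\<rho> t / (C2 * H)" for t by (intro divide_nonneg_nonneg L2_norm_nonneg less_imp_le[OF c2])
        show "?\<rho> t / (C2 * H) \<le> ?S (u2 t)" if "t \<in> {0..T}" for t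
          using ritz[OF dA(3)[OF that]] c2 by (simp add: divide_le_eq mult.commute)
        show "(\<integral>\<^sup>+t. ennreal ((?S (u2 t))\<^sup>2) \<partial>lebesgue_on {0<..<T}) < \<infinity>" by (rule bounded_time_L2_finite[OF Su2(2) sobolev_norm_nonneg])
      qed
      then have "C2 * H * integral {0..T} (\<lambda>t. ?\<rho> t / (C2 * H)) \<le> C2 * H * (sqrt T * ?a6)" using c2 by (intro mult_left_mono) auto
      then show ?thesis using assms(10) H0 by simp
    qed
    have Ig: "integral {0..T} ?g \<le> sqrt T * (?a2 + ?a7)"
    proof -
      note nc = time_C0_norm_continuous[OF fC(2)] time_C0_norm_continuous[OF uC(4)]
      have "integral {0..T} ?g \<le> integral {0..T} (\<lambda>t. ?n (f_t t) + ?n (u3 t))"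
        by (intro integral_le integrable_continuous_real gc continuous_intros nc L2.nm_diff_triangle L)
      also have "\<dots> = integral {0..T} (\<lambda>t. ?n (f_t t)) + integral {0..T} (\<lambda>t. ?n (u3 t))"
        by (intro Henstock_Kurzweil_Integration.integral_add integrable_continuous_real nc)
      also have "\<dots> \<le> sqrt T * ?a2 + sqrt T * ?a7"
      proof (intro add_mono integral_le_time_L2_norm[OF T] nc L2_norm_nonneg order_refl)
        show "(\<integral>\<^sup>+t. ennreal ((?n (f_t t))\<^sup>2) \<partial>lebesgue_on {0<..<T}) < \<infinity>" using f1L by (simp add: time_L2_def)
        show "(\<integral>\<^sup>+t. ennreal ((?n (u3 t))\<^sup>2) \<partial>lebesgue_on {0<..<T}) < \<infinity>" by (rule bounded_time_L2_finite[OF nb[OF uC(4)] L2_norm_nonneg])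
      qed
      finally show ?thesis by (simp add: distrib_left)
    qed
    let ?L = "L_fu \<Omega> T \<gamma>\<^sub>0 f f_t u u_t u2 u3"
    have bound: "?n (\<lambda>x. u t x - u\<^sub>h t x) \<le> C * h powr (2 * \<gamma>\<^sub>0) * ?L" if t: "t \<in> {0..T}" for t
    proof -
      have uhV: "u\<^sub>h t \<in> V\<^sub>h" by (rule error_estimate(1)[OF pre t])
      have e2: "?n (\<lambda>x. R\<^sub>h (u t) x - u\<^sub>h t x) \<le> T * (2 * (k * (?a1 + ?a5)) + 2 * integral {0..T} (\<lambda>t. ?\<rho> t + k * ?g t))"
        by (rule error_estimate(2)[OF pre t])
      have RL: "R\<^sub>h (u t) \<in> L2_space \<Omega>" by (rule V_L2[OF R_V[OF dom_A_H20[OF dA(1)[OF t]]]])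
      \<comment> \<open>The error is the discrete error minus the projection error; the first is
        bounded through its energy, the second by the Ritz estimate.\<close>
      have "?n (\<lambda>x. u t x - u\<^sub>h t x) = ?n (\<lambda>x. (R\<^sub>h (u t) x - u\<^sub>h t x) - (R\<^sub>h (u t) x - u t x))" by simp
      also have "\<dots> \<le> ?n (\<lambda>x. R\<^sub>h (u t) x - u\<^sub>h t x) + ?n (\<lambda>x. R\<^sub>h (u t) x - u t x)"
        by (intro L2.nm_diff_triangle L2.diff_mem RL L t V_L2 uhV)
      finally have tri: "?n (\<lambda>x. u t x - u\<^sub>h t x) \<le> ?n (\<lambda>x. R\<^sub>h (u t) x - u\<^sub>h t x) + ?n (\<lambda>x. R\<^sub>h (u t) x - u t x)" .
      have e1: "?n (\<lambda>x. R\<^sub>h (u t) x - u t x) \<le> C2 * H * ?a3"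
      proof -
        \<comment> \<open>The Sobolev norm at the single time \<open>t\<close> is not compared with
          its essential supremum directly; the scaled, continuous projection error is.\<close>
        have "?n (\<lambda>x. R\<^sub>h (u t) x - u t x) / (C2 * H) \<le> ?a3"
        proof (rule le_time_Linf_norm[where N = ?S and w = u and q = "\<lambda>t. ?n (\<lambda>x. R\<^sub>h (u t) x - u t x) / (C2 * H)", OF T _ _ _ t])
          show "\<exists>c. \<forall>t\<in>{0..T}. ?S (u t) \<le> c" by (rule Su(2))
          show "continuous_on {0..T} (\<lambda>t. ?n (\<lambda>x. R\<^sub>h (u t) x - u t x) / (C2 * H))" using c2 by (intro continuous_intros uc) auto
          show "?n (\<lambda>x. R\<^sub>h (u s) x - u s x) / (C2 * H) \<le> ?S (u s)" if "s \<in> {0..T}" for s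
            using ritz[OF dA(1)[OF that]] c2 by (simp add: divide_le_eq mult.commute)
        qed
        then show ?thesis using c2 by (simp add: divide_le_eq mult.commute)
      qed
      have "integral {0..T} (\<lambda>t. ?\<rho> t + k * ?g t) = integral {0..T} ?\<rho> + k * integral {0..T} ?g"
        using Henstock_Kurzweil_Integration.integral_add[OF integrable_continuous_real[OF \<rho>c] integrable_continuous_real[OF continuous_on_mult_left[OF gc, of k]]] by simp
      also have "\<dots> \<le> C2 * H * (sqrt T * ?a6) + k * (sqrt T * (?a2 + ?a7))" by (intro add_mono I\<rho> mult_left_mono Ig k)
      also have "\<dots> \<le> C2 * H * (sqrt T * ?a6) + H * \<kappa>' * (sqrt T * (?a2 + ?a7))" using a0 T by (intro add_left_mono mult_right_mono k) auto
      also have "\<dots> \<le> C2 * H * (sqrt T * ?L) + H * \<kappa>' * (sqrt T * ?L)"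
        using a0 T c2 H0 \<kappa>'0 assms(10) by (intro add_mono mult_left_mono mult_nonneg_nonneg) (auto simp: L_fu_def)
      finally have i: "integral {0..T} (\<lambda>t. ?\<rho> t + k * ?g t) \<le> C2 * H * (sqrt T * ?L) + H * \<kappa>' * (sqrt T * ?L)" .
      have "k * (?a1 + ?a5) \<le> H * \<kappa>' * (?a1 + ?a5)" using a0 by (intro mult_right_mono k) auto
      also have "\<dots> \<le> H * \<kappa>' * ?L" using a0 H0 \<kappa>'0 by (intro mult_left_mono) (auto simp: L_fu_def)
      finally have "T * (2 * (k * (?a1 + ?a5)) + 2 * integral {0..T} (\<lambda>t. ?\<rho> t + k * ?g t))
          \<le> T * (2 * (H * \<kappa>' * ?L) + 2 * (C2 * H * (sqrt T * ?L) + H * \<kappa>' * (sqrt T * ?L)))"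
        using i T by (intro mult_left_mono add_mono) auto
      moreover have "C2 * H * ?a3 \<le> C2 * H * ?L" using a0 c2 by (intro mult_left_mono) (auto simp: L_fu_def)
      ultimately have "?n (\<lambda>x. u t x - u\<^sub>h t x) \<le> C2 * H * ?L + T * (2 * (H * \<kappa>' * ?L) + 2 * (C2 * H * (sqrt T * ?L) + H * \<kappa>' * (sqrt T * ?L)))"
        using tri e1 e2 by linarith
      also have "\<dots> = C * H * ?L" unfolding C_def by (simp add: algebra_simps)
      finally show ?thesis unfolding H_def .
    qed
    show "\<exists>u_tt u_ttt u_tttt.
         has_weak_time_deriv \<Omega> T u_t u_tt \<and> has_weak_time_deriv \<Omega> T u_tt u_ttt \<and>
         has_weak_time_deriv \<Omega> T u_ttt u_tttt \<and>
         {u, u_t, u_tt}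
           \<subseteq> time_Linf (sobolev_space \<Omega> (2 + \<gamma>\<^sub>0)) (sobolev_norm \<Omega> (2 + \<gamma>\<^sub>0)) T \<and>
         {u_tt, u_ttt, u_tttt} \<subseteq> time_Linf (L2_space \<Omega>) (L2_norm \<Omega>) T \<and>
         (\<forall>t\<in>{0<..T}.
            L2_norm \<Omega> (\<lambda>x. u t x - u\<^sub>h t x)
              \<le> C * mesh_size \<T> powr (2 * \<gamma>\<^sub>0) * L_fu \<Omega> T \<gamma>\<^sub>0 f f_t u u_t u_tt u_ttt)"
      using bound unfolding h_def by (intro exI[of _ u2] exI[of _ u3] exI[of _ u4] conjI wd inf ballI) auto
  qed
qed

end
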